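(* Let $d\ge1$, let $\nu$ be a probability distribution on the space $\mathcal K$ of compact subsets of $\mathbb{R}^d$, and let $\eta$ be a marked Poisson measure on $\mathbb{R}^d\times\mathcal K$ with control measure $\ell\otimes\nu$, where $\ell$ is Lebesgue measure. For $\lambda>0$ let $X_\lambda=[-\lambda^{1/d},\lambda^{1/d}]^d$, let $\eta^\circ_\lambda$ be the set of points $x\in X_\lambda$ such that $(x,C)\in\eta$ for some $C\in\mathcal K$, and for such $x$ let $C_x$ be the unique grain with $(x,C_x)\in\eta$. Let $\varphi:\mathbb{R}^d\to\mathbb{R}$ be an even measurable function such that $\varphi^2$ is integrable on every compact set, and let $$G_\lambda=\sum_{x\ne y\in\eta^\circ_\lambda}\varphi(x-y)\,\mathbf 1_{\{(x+C_x)\cap(y+C_y)\ne\emptyset\}}.$$ Let $\chi_\nu(x)=P(C_1\cap(x+C_2)\ne\emptyset)$, $x\in\mathbb{R}^d$, where $C_1,C_2$ are i.i.d. with distribution $\nu$, and suppose that $\varphi\,\chi_\nu$ is not a.e. equal to $0$. Assume that there exists a bounded, strictly positive probability density $\kappa$ on $\mathbb{R}^d$ such that $$\int_{\mathbb{R}^d}\varphi(x)^p\,\chi_\nu(x)\,\kappa(x)^{1-p}\,dx<\infty\qquad\text{for }p=2,4.$$ Then there are constants $c,C>0$, not depending on $\lambda$, such that $\mathrm{Var}(G_\lambda)\sim c\lambda$ as $\lambda\to\infty$ and, for every $\lambda>0$ with $\mathrm{Var}(G_\lambda)>0$, $$d_W(\tilde G_\lambda,N)\le C\lambda^{-1/2},$$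 where $\tilde G_\lambda=(G_\lambda-E[G_\lambda])/\sqrt{\mathrm{Var}(G_\lambda)}$ and $N\sim\mathscr N(0,1)$.
   Context: $\mathcal K$ is endowed with the Fell topology and its Borel $\sigma$-algebra. The sum defining $G_\lambda$ is over ordered pairs of distinct points. $a_\lambda\sim b_\lambda$ means $a_\lambda/b_\lambda\to1$. $d_W(F,N)=\sup_g|E[g(F)]-E[g(N)]|$ over functions $g:\mathbb{R}\to\mathbb{R}$ with Lipschitz constant at most $1$. *)

theory Defs
  imports "HOL-Probability.Probability"
begin

definition fell_topology :: "'a::t2_space set topology" where
  "fell_topology = topology_generated_by
     ({{F. closed F \<and> F \<inter> K = {}} | K. compact K} \<union>
      {{F. closed F \<and> F \<inter> U \<noteq> {}} | U. open U})"

text \<open>The Borel space of compact sets; the empty set is one of its points.\<close>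

definition compact_borel :: "'a::t2_space set measure" where
  "compact_borel =
     sigma {C. compact C} {W. openin (subtopology fell_topology {C. compact C}) W}"

text \<open>
  The Poisson probabilities are written out because \<^const>\<open>poisson_pmf\<close> requires a positive
  rate, whereas sets of control measure 0 are allowed here. Finite disjoint families are covered
  by padding with empty sets.
\<close>

definition poisson_measure :: "'w measure \<Rightarrow> 'z measure \<Rightarrow> ('w \<Rightarrow> 'z measure) \<Rightarrow> bool" where
  "poisson_measure P \<mu> \<eta> \<longleftrightarrow>
     prob_space P \<and>
     (\<forall>\<omega>\<in>space P. sets (\<eta> \<omega>) = sets \<mu> \<and>
        (\<forall>A\<in>sets \<mu>. emeasure (\<eta> \<omega>) A \<in> range of_nat \<union> {\<infinity>})) \<and>
     (\<forall>A\<in>sets \<mu>. (\<lambda>\<omega>. emeasure (\<eta> \<omega>) A) \<in> borel_measurable P) \<and>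
     (\<forall>A\<in>sets \<mu>. emeasure \<mu> A < \<infinity> \<longrightarrow>
        (\<forall>k::nat. measure P {\<omega>\<in>space P. emeasure (\<eta> \<omega>) A = of_nat k}
                  = measure \<mu> A ^ k / fact k * exp (- measure \<mu> A))) \<and>
     (\<forall>A::nat \<Rightarrow> 'z set. range A \<subseteq> sets \<mu> \<longrightarrow> disjoint_family A \<longrightarrow>
        prob_space.indep_vars P (\<lambda>_. borel) (\<lambda>i \<omega>. emeasure (\<eta> \<omega>) (A i)) UNIV)"

text \<open>Singletons of \<open>lborel \<Otimes>\<^sub>M \<nu>\<close> are measurable, so \<open>charges\<close> there means having an atom.\<close>

definition charges :: "'z measure \<Rightarrow> 'z \<Rightarrow> bool" where
  "charges m z \<longleftrightarrow> emeasure m {z} > 0"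

definition window :: "real \<Rightarrow> (real ^ 'n) set" where
  "window l = {x. \<forall>i. x $ i \<in> {- (l powr (1 / CARD('n))) .. l powr (1 / CARD('n))}}"

definition germs :: "((real ^ 'n) \<times> (real ^ 'n) set) measure \<Rightarrow> real \<Rightarrow> (real ^ 'n) set" where
  "germs m l = {x \<in> window l. \<exists>C. compact C \<and> charges m (x, C)}"

definition grain :: "((real ^ 'n) \<times> (real ^ 'n) set) measure \<Rightarrow> real ^ 'n \<Rightarrow> (real ^ 'n) set" where
  "grain m x = (THE C. compact C \<and> charges m (x, C))"

text \<open>
  For a Poisson measure on \<open>\<real>\<^sup>d \<times> \<K>\<close> the grain of a germ is unique, and the set of germs in a
  window is finite, only almost surely. So the sum below determines a random variable only up
  to null sets, and a random variable given by it is one that agrees with it almost surely.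
\<close>

definition grain_sum ::
  "(real ^ 'n \<Rightarrow> real) \<Rightarrow> ((real ^ 'n) \<times> (real ^ 'n) set) measure \<Rightarrow> real \<Rightarrow> real" where
  "grain_sum \<phi> m l =
     (\<Sum>(x, y) \<in> {(x, y). x \<in> germs m l \<and> y \<in> germs m l \<and> x \<noteq> y}.
        \<phi> (x - y) * of_bool (((+) x ` grain m x) \<inter> ((+) y ` grain m y) \<noteq> {}))"

definition hit_prob :: "(real ^ 'n) set measure \<Rightarrow> real ^ 'n \<Rightarrow> real" where
  "hit_prob \<nu> x =
     measure (\<nu> \<Otimes>\<^sub>M \<nu>) {(C1, C2) \<in> space (\<nu> \<Otimes>\<^sub>M \<nu>). C1 \<inter> ((+) x ` C2) \<noteq> {}}"

text \<open>The Wasserstein distance of random variables, as a function of their laws.\<close>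

definition wasserstein :: "real measure \<Rightarrow> real measure \<Rightarrow> ennreal" where
  "wasserstein M N =
     (SUP g \<in> {g :: real \<Rightarrow> real. 1-lipschitz_on UNIV g}.
        ennreal \<bar>(\<integral>x. g x \<partial>M) - (\<integral>x. g x \<partial>N)\<bar>)"

end

(* Restricted to the window, the marked Poisson measure has finite intensity, and almost surely
   G is the sum of the symmetric kernel H((x,C),(y,D)) = phi(x - y) 1{(x + C) and (y + D) meet}
   over ordered pairs of distinct points. With rows h = 2 * int H(., y) dy, F = G - E[G] has
   variance int h^2 + 2 int H^2.

   For a kernel that is constant on the blocks of a finite partition, F is a quadratic polynomial
   in finitely many independent Poisson counts. Chen's formula E[(n - r) g(n)] = r E[g(n + 1) - g(n)],
   applied to F f(F) with f the solution of Stein's equation, bounds the Wasserstein distance by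
   the variance of a Stein kernel and a third order remainder. Splitting H = (H / kappa) kappa with
   kappa doubly substochastic, Jensen's inequality bounds both terms by M = int H^4 / kappa^3 and
   the mass of the intensity, with constants depending only on sup kappa. Off-diagonal partition
   kernels are dense in L^2, and block averages increase neither M nor the row sums of kappa, so
   the bound passes to H itself. By translation invariance M and the mass are O(lambda), which
   gives the rate lambda^(-1/2) once the variance is known to be of order lambda.

   After rescaling the window, Var(G) / lambda is an integral over the unit window times the law
   of one grain, and dominated convergence applies because Cauchy-Schwarz against kappa bounds the
   squared row integrals by int phi^2 chi / kappa. The limit is at least a positive multiple of
   int phi^2 chi > 0. *)
theory Submission
  imports Defs
begin

section \<open>Stein's equation for the normal distribution\<close>

text \<open>A cell with n points contributes n (n - 1) ordered pairs, whereas the square of the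
  counting measure yields n^2; kernels with zero diagonal blocks avoid the mismatch, and a diffuse
  intensity makes the deleted blocks negligible. Zero diagonal also means that a point added to cell
  i leaves the factor of its own count unchanged, so Chen's formula gives an exact Stein identity
  without multiple stochastic integrals. Arbitrary L2 approximations would lose control of M. Block
  means keep it, and they are the best off-diagonal approximation on their partition, so the density
  of some such kernels forces the means to converge. The weight is doubly substochastic because
  \<kappa> is a probability density in the difference of two germs and restriction to the window
  only lowers row and column integrals. That the germs are almost surely distinct, with mass one
  each, is not part of the definition of a Poisson measure; it is extracted from second moments of
  counts. The rate is claimed for every \<lambda> with positive variance, so small \<lambda>, where
  the variance has no lower bound of the right order, need the trivial bound 2 between standardised
  laws.\<close>

lemma stein_comparison:
  fixes v r b b' :: "real \<Rightarrow> real"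
  assumes v: "\<And>x. x \<ge> 1 \<Longrightarrow> (v has_real_derivative x * v x + r x) (at x)"
    and b: "\<And>x. x \<ge> 1 \<Longrightarrow> (b has_real_derivative b' x) (at x)"
    and le: "\<And>x. x \<ge> 1 \<Longrightarrow> b' x \<le> x * b x + r x"
    and lim: "((\<lambda>x. (v x - b x) * exp (- x\<^sup>2 / 2)) \<longlongrightarrow> 0) at_top"
    and "x \<ge> 1"
  shows "v x \<le> b x"
proof -
  \<comment> \<open>The Gaussian factor is the integrating factor of the equation for
    \<open>v\<close>. The inequality for \<open>b\<close> makes \<psi> nondecreasing on [1,
    \<infinity>), so its limit 0 at infinity bounds it from above.\<close>
  define \<psi> where "\<psi> = (\<lambda>x. (v x - b x) * exp (- x\<^sup>2 / 2))"
  have deriv: "(\<psi> has_real_derivative (r t - b' t + t * b t) * exp (- t\<^sup>2 / 2)) (at t)" if "t \<ge> 1" for t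
    unfolding \<psi>_def using v[OF that] b[OF that]
    by (auto intro!: derivative_eq_intros simp: algebra_simps)
  have mono: "\<psi> s \<le> \<psi> t" if "1 \<le> s" "s \<le> t" for s t
  proof (rule DERIV_nonneg_imp_nondecreasing[OF that(2)])
    fix u assume "s \<le> u" "u \<le> t"
    then show "\<exists>y. DERIV \<psi> u :> y \<and> 0 \<le> y"
      using deriv[of u] le[of u] that(1) by (intro exI[of _ "(r u - b' u + u * b u) * exp (- u\<^sup>2 / 2)"]) auto
  qed
  have "\<psi> x \<le> 0"
  proof (rule tendsto_lowerbound)
    show "(\<psi> \<longlongrightarrow> 0) at_top" using lim by (simp add: \<psi>_def)
    show "\<forall>\<^sub>F t in at_top. \<psi> x \<le> \<psi> t"
      using eventually_ge_at_top[of x] by eventually_elim (use mono \<open>x \<ge> 1\<close> in auto)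
  qed auto
  then show ?thesis by (simp add: \<psi>_def mult_le_0_iff)
qed

lemma exp_half_le_2: "exp (1 / 2 :: real) \<le> 2"
proof -
  have "exp (1 / 2 :: real) ^ 2 = exp 1"
    by (simp flip: exp_of_nat_mult)
  also have "\<dots> \<le> 2 ^ 2" using exp_le by simp
  finally show ?thesis by (rule power2_le_imp_le) simp
qed

text \<open>On [-1, 1] the integrating factor lies between exp (-1/2) and 1. Moving from 1 to x,
  over a length of at most 2, costs 2 * R, and removing the factor costs at most exp (1/2) \<le> 2.
  The value at 1 is supplied by tail estimates.\<close>

lemma stein_middle:
  fixes v r :: "real \<Rightarrow> real"
  assumes v: "\<And>x. (v has_real_derivative x * v x + r x) (at x)"
    and r: "\<And>x. \<bar>x\<bar> \<le> 1 \<Longrightarrow> \<bar>r x\<bar> \<le> R" and A: "\<bar>v 1\<bar> \<le> A" and x: "\<bar>x\<bar> \<le> 1"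
  shows "\<bar>v x\<bar> \<le> 2 * (A + 2 * R)"
proof -
  have R: "0 \<le> R" using r[of 0] by simp
  define \<psi> where "\<psi> = (\<lambda>x. v x * exp (- x\<^sup>2 / 2))"
  have deriv: "(\<psi> has_real_derivative r t * exp (- t\<^sup>2 / 2)) (at t within {-1..1})" for t
    unfolding \<psi>_def using v[of t, THEN DERIV_subset, of "{-1..1}"]
    by (auto intro!: derivative_eq_intros simp: algebra_simps)
  have "norm (\<psi> x - \<psi> 1) \<le> R * norm (x - 1)"
  proof (rule field_differentiable_bound[where S = "{-1..1}" and f' = "\<lambda>t. r t * exp (- t\<^sup>2 / 2)"])
    show "norm (r t * exp (- t\<^sup>2 / 2)) \<le> R" if "t \<in> {-1..1}" for t
    proof -
      have "\<bar>r t\<bar> * exp (- t\<^sup>2 / 2) \<le> R * 1"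
        using r[of t] that R by (intro mult_mono) auto
      then show ?thesis by (simp add: abs_mult)
    qed
  qed (use deriv x in auto)
  also have "\<dots> \<le> R * 2" using x R by (intro mult_left_mono) auto
  finally have 1: "\<bar>\<psi> x - \<psi> 1\<bar> \<le> 2 * R" by simp
  have "\<bar>\<psi> 1\<bar> \<le> A * 1" unfolding \<psi>_def abs_mult using A by (intro mult_mono) auto
  then have 2: "\<bar>\<psi> x\<bar> \<le> A + 2 * R" using 1 by linarith
  have "\<bar>v x\<bar> = \<bar>\<psi> x\<bar> * exp (x\<^sup>2 / 2)"
    by (simp add: \<psi>_def abs_mult flip: exp_add)
  also have "\<dots> \<le> (A + 2 * R) * 2"
  proof (intro mult_mono 2)
    have "x\<^sup>2 \<le> 1" using x by (simp add: abs_square_le_1)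
    then have "exp (x\<^sup>2 / 2) \<le> exp (1 / 2)" by simp
    then show "exp (x\<^sup>2 / 2) \<le> 2" using exp_half_le_2 by linarith
  qed (use 2 in linarith, simp)
  finally show ?thesis by simp
qed

lemma gauss_decay: "((\<lambda>x::real. exp (- x\<^sup>2 / 2)) \<longlongrightarrow> 0) at_top"
proof -
  have "filterlim (\<lambda>x::real. x ^ 2) at_top at_top"
    by (rule filterlim_pow_at_top) (simp_all add: filterlim_ident)
  from filterlim_tendsto_pos_mult_at_top[OF tendsto_const[of "1/2"] _ this]
  have "filterlim (\<lambda>x::real. x\<^sup>2 / 2) at_top at_top" by simp
  then have "filterlim (\<lambda>x::real. - (x\<^sup>2 / 2)) at_bot at_top"
    by (simp add: filterlim_uminus_at_top)
  from filterlim_compose[OF exp_at_bot this] show ?thesis by simp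
qed

lemma bounded_gauss_decay:
  fixes v :: "real \<Rightarrow> real"
  assumes "\<And>x. x \<ge> 1 \<Longrightarrow> \<bar>v x\<bar> \<le> K"
  shows "((\<lambda>x. v x * exp (- x\<^sup>2 / 2)) \<longlongrightarrow> 0) at_top"
proof (rule Lim_null_comparison)
  show "\<forall>\<^sub>F x in at_top. norm (v x * exp (- x\<^sup>2 / 2)) \<le> K * exp (- x\<^sup>2 / 2)"
    using eventually_ge_at_top[of 1]
    by eventually_elim (auto simp: abs_mult intro!: mult_right_mono assms)
  show "((\<lambda>x. K * exp (- x\<^sup>2 / 2)) \<longlongrightarrow> 0) at_top"
    using tendsto_mult_left[OF gauss_decay, of K] by simp
qed

text \<open>The Stein equation is invariant under \<open>v \<mapsto> -v\<close> and under reflection, so that it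
  suffices to bound \<open>v\<close> from above on \<open>[1, \<infinity>)\<close>.\<close>

lemma stein_bound_tails:
  fixes v r b b' \<rho> :: "real \<Rightarrow> real"
  assumes v: "\<And>x. (v has_real_derivative x * v x + r x) (at x)"
    and b: "\<And>x. x \<ge> 1 \<Longrightarrow> (b has_real_derivative b' x) (at x)"
    and le: "\<And>x. x \<ge> 1 \<Longrightarrow> b' x \<le> x * b x - \<rho> x"
    and r: "\<And>x. \<bar>x\<bar> \<ge> 1 \<Longrightarrow> \<bar>r x\<bar> \<le> \<rho> \<bar>x\<bar>"
    and bK: "\<And>x. x \<ge> 1 \<Longrightarrow> \<bar>b x\<bar> \<le> K"
    and lim: "((\<lambda>x. v x * exp (- x\<^sup>2 / 2)) \<longlongrightarrow> 0) at_top"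
      "((\<lambda>x. v (- x) * exp (- x\<^sup>2 / 2)) \<longlongrightarrow> 0) at_top"
    and x: "\<bar>x\<bar> \<ge> 1"
  shows "\<bar>v x\<bar> \<le> b \<bar>x\<bar>"
proof -
  have limb: "((\<lambda>x. b x * exp (- x\<^sup>2 / 2)) \<longlongrightarrow> 0) at_top"
    by (rule bounded_gauss_decay[of b K]) (use bK in auto)
  have up: "c * w y \<le> b y" if y: "y \<ge> 1" and c: "c = 1 \<or> c = -1"
    and w: "\<And>x. (w has_real_derivative x * w x + q x) (at x)"
    and q: "\<And>x. x \<ge> 1 \<Longrightarrow> \<bar>q x\<bar> \<le> \<rho> x"
    and lw: "((\<lambda>x. w x * exp (- x\<^sup>2 / 2)) \<longlongrightarrow> 0) at_top" for w q :: "real \<Rightarrow> real" and c y :: real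
  proof (rule stein_comparison[where v = "\<lambda>x. c * w x" and r = "\<lambda>x. c * q x" and b = b and b' = b'])
    show "((\<lambda>x. c * w x) has_real_derivative x * (c * w x) + c * q x) (at x)" for x
      using w[of x] by (auto intro!: derivative_eq_intros simp: algebra_simps)
    show "b' x \<le> x * b x + c * q x" if "x \<ge> 1" for x
      using q[OF that] le[OF that] c by auto
    show "((\<lambda>x. (c * w x - b x) * exp (- x\<^sup>2 / 2)) \<longlongrightarrow> 0) at_top"
      using tendsto_diff[OF tendsto_mult_left[OF lw, of c] limb] by (simp add: algebra_simps)
  qed (use b y in auto)
  have w: "((\<lambda>x. v (- x)) has_real_derivative x * v (- x) + (- r (- x))) (at x)" for x
    using DERIV_chain2[OF v[of "- x"] DERIV_minus[OF DERIV_ident]] by simp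
  show ?thesis
  proof (cases "x \<ge> 0")
    case True
    then have "x \<ge> 1" using x by simp
    have q: "\<bar>r t\<bar> \<le> \<rho> t" if "t \<ge> 1" for t
      using r[of t] that by simp
    have "1 * v x \<le> b x"
      by (rule up[where w = v and q = r]) (use \<open>x \<ge> 1\<close> v q lim in auto)
    moreover have "-1 * v x \<le> b x"
      by (rule up[where w = v and q = r]) (use \<open>x \<ge> 1\<close> v q lim in auto)
    ultimately show ?thesis using True by simp
  next
    case False
    then have *: "- x \<ge> 1" using x by simp
    have q: "\<bar>- r (- t)\<bar> \<le> \<rho> t" if "t \<ge> 1" for t
      using r[of "- t"] that by simp
    have "1 * v (- (- x)) \<le> b (- x)"
      by (rule up[where w = "\<lambda>x. v (- x)" and q = "\<lambda>x. - r (- x)"]) (use * w q lim in auto)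
    moreover have "-1 * v (- (- x)) \<le> b (- x)"
      by (rule up[where w = "\<lambda>x. v (- x)" and q = "\<lambda>x. - r (- x)"]) (use * w q lim in auto)
    ultimately show ?thesis using False by simp
  qed
qed

text \<open>The barrier R / x satisfies the comparison inequality on [1, \<infinity>) because x * (R
  / x) - R = 0, and \<open>stein_middle\<close> started from \<open>\<bar>v 1\<bar> \<le> R\<close>
  gives 2 * (R + 2 * R) = 6 * R. The bound K guarantees decay against the Gaussian and does not
  enter the constants.\<close>

lemma stein_bound:
  fixes v r :: "real \<Rightarrow> real"
  assumes v: "\<And>x. (v has_real_derivative x * v x + r x) (at x)"
    and r: "\<And>x. \<bar>r x\<bar> \<le> R" and bdd: "\<And>x. \<bar>v x\<bar> \<le> K"
  shows "\<bar>v x\<bar> \<le> 6 * R" and "\<bar>x * v x\<bar> \<le> 6 * R"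
proof -
  have R: "0 \<le> R" using r[of 0] by linarith
  have tail: "\<bar>v y\<bar> \<le> R / \<bar>y\<bar>" if "\<bar>y\<bar> \<ge> 1" for y
  proof (rule stein_bound_tails[where \<rho> = "\<lambda>_. R" and b' = "\<lambda>x. - R / x\<^sup>2" and K = R, OF v])
    show "((\<lambda>x. R / x) has_real_derivative - R / x\<^sup>2) (at x)" if "x \<ge> 1" for x
      using that by (auto intro!: derivative_eq_intros simp: power2_eq_square)
    show "- R / x\<^sup>2 \<le> x * (R / x) - R" if "x \<ge> 1" for x
      using that R by (auto simp: divide_simps)
    show "\<bar>R / x\<bar> \<le> R" if "x \<ge> 1" for x
      using that R by (auto simp: divide_simps mult_le_cancel_left1 abs_mult)
    show "((\<lambda>x. v x * exp (- x\<^sup>2 / 2)) \<longlongrightarrow> 0) at_top"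
      by (rule bounded_gauss_decay[of v K]) (rule bdd)
    show "((\<lambda>x. v (- x) * exp (- x\<^sup>2 / 2)) \<longlongrightarrow> 0) at_top"
      by (rule bounded_gauss_decay[of "\<lambda>x. v (- x)" K]) (rule bdd)
  qed (use r that in auto)
  have mid: "\<bar>v y\<bar> \<le> 6 * R" if "\<bar>y\<bar> \<le> 1" for y
    using stein_middle[OF v r _ that, of R] tail[of 1] by simp
  show "\<bar>v x\<bar> \<le> 6 * R"
  proof (cases "\<bar>x\<bar> \<le> 1")
    case False
    then have "R / \<bar>x\<bar> \<le> R / 1" using R by (intro divide_left_mono) auto
    then show ?thesis using tail[of x] False R by simp
  qed (use mid in auto)
  show "\<bar>x * v x\<bar> \<le> 6 * R"
  proof (cases "\<bar>x\<bar> \<le> 1")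
    case True
    then have "\<bar>x\<bar> * \<bar>v x\<bar> \<le> 1 * (6 * R)" using mid[OF True] by (intro mult_mono) auto
    then show ?thesis by (simp add: abs_mult)
  next
    case False
    then show ?thesis using tail[of x] R by (simp add: abs_mult field_simps)
  qed
qed

section \<open>The solution of Stein's equation for Lipschitz test functions\<close>

lemma prob_space_std_normal: "prob_space std_normal_distribution"
  using prob_space_normal_density[of 1 0] by simp

lemma measure_std_normal_UNIV [simp]: "measure std_normal_distribution UNIV = 1"
  using prob_space.prob_space[OF prob_space_std_normal] by simp

lemma lipschitz_1_abs:
  fixes g :: "real \<Rightarrow> real"
  assumes "1-lipschitz_on UNIV g"
  shows "\<bar>g x - g y\<bar> \<le> \<bar>x - y\<bar>"
  using lipschitz_onD[OF assms, of x y] by (simp add: dist_real_def)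

lemma lipschitz_1_measurable:
  fixes g :: "real \<Rightarrow> real"
  assumes "1-lipschitz_on UNIV g"
  shows "g \<in> borel_measurable borel"
  using lipschitz_on_continuous_on[OF assms] by (rule borel_measurable_continuous_onI)

lemma integrable_std_normal_id: "integrable std_normal_distribution (\<lambda>x. x)"
  using integrable_std_normal_moment[of 1] by (subst integrable_density) auto

lemma integrable_std_normal_lipschitz:
  fixes g :: "real \<Rightarrow> real"
  assumes g: "1-lipschitz_on UNIV g"
  shows "integrable std_normal_distribution g"
proof (rule Bochner_Integration.integrable_bound[where f = "\<lambda>x. \<bar>g 0\<bar> + \<bar>x\<bar>"])
  interpret prob_space std_normal_distribution by (rule prob_space_std_normal)
  show "integrable std_normal_distribution (\<lambda>x. \<bar>g 0\<bar> + \<bar>x\<bar>)"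
    using integrable_std_normal_id by auto
  show "AE x in std_normal_distribution. norm (g x) \<le> norm (\<bar>g 0\<bar> + \<bar>x\<bar>)"
  proof (rule AE_I2)
    fix x show "norm (g x) \<le> norm (\<bar>g 0\<bar> + \<bar>x\<bar>)"
      using lipschitz_1_abs[OF g, of x 0] by auto
  qed
qed (use lipschitz_1_measurable[OF g] in simp)

lemma std_normal_abs_moment_le_1: "(\<integral>x. \<bar>x\<bar> \<partial>std_normal_distribution) \<le> 1"
proof -
  interpret prob_space std_normal_distribution by (rule prob_space_std_normal)
  have sq: "integrable std_normal_distribution (\<lambda>x. x\<^sup>2)"
    using integrable_std_normal_moment[of 2] by (subst integrable_density) auto
  have "(\<integral>x. x\<^sup>2 \<partial>std_normal_distribution) = 1"
    using integral_std_normal_moment_even[of 1] by (subst integral_density) (auto simp: fact_numeral)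
  moreover have "(\<integral>x. \<bar>x\<bar> \<partial>std_normal_distribution) \<le> (\<integral>x. (1 + x\<^sup>2) / 2 \<partial>std_normal_distribution)"
  proof (rule integral_mono)
    show "\<bar>x\<bar> \<le> (1 + x\<^sup>2) / 2" for x :: real
      using zero_le_power2[of "\<bar>x\<bar> - 1"] by (simp add: power2_diff)
  qed (use sq integrable_std_normal_id in auto)
  ultimately show ?thesis using sq by (simp add: prob_space)
qed

text \<open>Average |g x - g t| \<le> |x| + |t| over a standard normal t, whose first absolute
  moment is at most 1. The right-hand side of Stein's equation therefore grows at most
  linearly.\<close>

lemma std_normal_lipschitz_centre:
  fixes g :: "real \<Rightarrow> real"
  assumes g: "1-lipschitz_on UNIV g"
  shows "\<bar>g x - (\<integral>t. g t \<partial>std_normal_distribution)\<bar> \<le> \<bar>x\<bar> + 1"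
proof -
  interpret prob_space std_normal_distribution by (rule prob_space_std_normal)
  have "g x - (\<integral>t. g t \<partial>std_normal_distribution) = (\<integral>t. g x - g t \<partial>std_normal_distribution)"
    using integrable_std_normal_lipschitz[OF g] by (simp add: prob_space)
  also have "\<bar>\<dots>\<bar> \<le> (\<integral>t. \<bar>x\<bar> + \<bar>t\<bar> \<partial>std_normal_distribution)"
  proof (rule order.trans[OF integral_abs_bound integral_mono])
    show "\<bar>g x - g t\<bar> \<le> \<bar>x\<bar> + \<bar>t\<bar>" for t using lipschitz_1_abs[OF g, of x t] by simp
  qed (use integrable_std_normal_lipschitz[OF g] integrable_std_normal_id in auto)
  also have "\<dots> \<le> \<bar>x\<bar> + 1"
    using std_normal_abs_moment_le_1 integrable_std_normal_id by (simp add: prob_space)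
  finally show ?thesis .
qed

lemma std_normal_density_deriv:
  "(std_normal_density has_real_derivative - x * std_normal_density x) (at x)"
  unfolding std_normal_density_def[abs_def]
  by (auto intro!: derivative_eq_intros simp: field_simps power2_eq_square)

text \<open>Variation of constants started at minus infinity: f x is exp (x^2 / 2) times the
  integral up to x of the centred g against exp (- t^2 / 2). Other solutions differ by a multiple of
  exp (x^2 / 2), so the limits single this one out; the limit at plus infinity vanishes because
  centring makes the total integral zero.\<close>

lemma stein_solution_exists:
  fixes g :: "real \<Rightarrow> real"
  assumes g: "1-lipschitz_on UNIV g"
  obtains f where "\<And>x. (f has_real_derivative x * f x + (g x - (\<integral>t. g t \<partial>std_normal_distribution))) (at x)"
    and "((\<lambda>x. f x * exp (- x\<^sup>2 / 2)) \<longlongrightarrow> 0) at_top"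
    and "((\<lambda>x. f (- x) * exp (- x\<^sup>2 / 2)) \<longlongrightarrow> 0) at_top"
proof -
  interpret prob_space std_normal_distribution by (rule prob_space_std_normal)
  define q where "q = (\<lambda>x. (g x - (\<integral>t. g t \<partial>std_normal_distribution)) * std_normal_density x)"
  have g_meas [measurable]: "g \<in> borel_measurable borel" by (rule lipschitz_1_measurable[OF g])
  have ig: "integrable std_normal_distribution (\<lambda>x. g x - (\<integral>t. g t \<partial>std_normal_distribution))"
    using integrable_std_normal_lipschitz[OF g] by simp
  have iq: "integrable lborel q"
    using ig by (subst (asm) integrable_density) (auto simp: q_def mult.commute)
  have cq: "continuous_on S q" for S
    using continuous_on_subset[OF lipschitz_on_continuous_on[OF g], of S]
      continuous_at_imp_continuous_on[of S std_normal_density] std_normal_density_deriv DERIV_isCont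
    unfolding q_def by (intro continuous_intros) blast+
  have zero: "integral\<^sup>L lborel q = 0"
  proof -
    have "(\<integral>x. g x - (\<integral>t. g t \<partial>std_normal_distribution) \<partial>std_normal_distribution) = 0"
      using integrable_std_normal_lipschitz[OF g] by (simp add: prob_space)
    then show ?thesis
      by (subst (asm) integral_density) (auto simp: q_def mult.commute)
  qed
  define H where "H = (\<lambda>x. \<integral>t. indicator {..x} t * q t \<partial>lborel)"
  have qm [measurable]: "q \<in> borel_measurable borel" using iq by auto
  have H_deriv: "(H has_real_derivative q x) (at x)" for x
  proof -
    \<comment> \<open>The fundamental theorem of calculus is applied to the gauge integral over a
      compact interval; the base point x - 1 leaves room on both sides of x.\<close>
    have int: "integral {x - 1..y} q = H y - H (x - 1)" if "x - 1 \<le> y" for y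
    proof -
      have si: "set_integrable lborel {x - 1<..y} q"
        using iq unfolding set_integrable_def by (intro integrable_mult_indicator) auto
      have "H y - H (x - 1) = (\<integral>t. indicator {..y} t * q t - indicator {..x - 1} t * q t \<partial>lborel)"
        unfolding H_def using integrable_mult_indicator[of "{..y}" lborel q] integrable_mult_indicator[of "{..x - 1}" lborel q] iq
        by (intro Bochner_Integration.integral_diff[symmetric]) auto
      also have "\<dots> = (LINT t:{x - 1<..y}|lborel. q t)"
        unfolding set_lebesgue_integral_def using that
        by (intro Bochner_Integration.integral_cong) (auto simp: indicator_def)
      also have "\<dots> = integral {x - 1<..y} q"
        by (rule set_borel_integral_eq_integral(2)[OF si])
      also have "\<dots> = integral {x - 1..y} q"
        by (rule integral_spike_set; rule negligible_subset[OF negligible_sing[of "x - 1"]]) auto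
      finally show ?thesis by simp
    qed
    have "((\<lambda>y. integral {x - 1..y} q) has_real_derivative q x) (at x within {x - 1..x + 1})"
      by (rule integral_has_real_derivative[OF cq]) simp
    then have "((\<lambda>y. H y - H (x - 1)) has_real_derivative q x) (at x within {x - 1..x + 1})"
      by (rule has_field_derivative_transform_within[where d = 1]) (use int in auto)
    then have "((\<lambda>y. H y - H (x - 1)) has_real_derivative q x) (at x)"
      by (simp add: at_within_Icc_at)
    from DERIV_add[OF this DERIV_const[of "H (x - 1)"]] show ?thesis by simp
  qed
  have lim1: "(H \<longlongrightarrow> integral\<^sup>L lborel q) at_top" unfolding H_def
  proof (rule integral_dominated_convergence_at_top[where w = "\<lambda>x. \<bar>q x\<bar>"])
    show "AE x in lborel. ((\<lambda>y. indicator {..y} x * q x) \<longlongrightarrow> q x) at_top"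
    proof (rule AE_I2)
      fix x
      show "((\<lambda>y. indicator {..y} x * q x) \<longlongrightarrow> q x) at_top"
        by (rule tendsto_eventually)
           (use eventually_ge_at_top[of x] in \<open>eventually_elim, simp\<close>)
    qed
  qed (use iq in \<open>auto simp: indicator_def\<close>)
  have lim2: "((\<lambda>y. H (- y)) \<longlongrightarrow> (\<integral>x. 0 \<partial>(lborel :: real measure))) at_top" unfolding H_def
  proof (rule integral_dominated_convergence_at_top[where w = "\<lambda>x. \<bar>q x\<bar>"
        and s = "\<lambda>y t. indicator {..- y} t * q t" and f = "\<lambda>_. 0"])
    show "AE x in lborel. ((\<lambda>y. indicator {..- y} x * q x) \<longlongrightarrow> 0) at_top"
    proof (rule AE_I2)
      fix x :: real
      show "((\<lambda>y. indicator {..- y} x * q x) \<longlongrightarrow> 0) at_top"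
        by (rule tendsto_eventually)
           (use eventually_gt_at_top[of "- x"] in \<open>eventually_elim, simp add: indicator_def\<close>)
    qed
  qed (use iq in \<open>auto simp: indicator_def\<close>)
  define f where "f = (\<lambda>x. H x / std_normal_density x)"
  have D0: "std_normal_density x > 0" for x by (simp add: std_normal_density_def)
  have fe: "f x * exp (- x\<^sup>2 / 2) = H x * sqrt (2 * pi)" for x
    by (simp add: f_def std_normal_density_def)
  show ?thesis
  proof
    show "(f has_real_derivative x * f x + (g x - (\<integral>t. g t \<partial>std_normal_distribution))) (at x)" for x
    proof -
      have *: "(f has_real_derivative (q x * std_normal_density x - H x * (- x * std_normal_density x)) /
          (std_normal_density x * std_normal_density x)) (at x)"
        unfolding f_def by (rule DERIV_divide[OF H_deriv std_normal_density_deriv]) (use D0[of x] in simp)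
      have "(q x * std_normal_density x - H x * (- x * std_normal_density x)) /
          (std_normal_density x * std_normal_density x) = x * f x + (g x - (\<integral>t. g t \<partial>std_normal_distribution))"
        using D0[of x] by (simp add: f_def q_def field_simps)
      with * show ?thesis by simp
    qed
    show "((\<lambda>x. f x * exp (- x\<^sup>2 / 2)) \<longlongrightarrow> 0) at_top"
      unfolding fe using tendsto_mult_right[OF lim1, of "sqrt (2 * pi)"] zero by simp
    have "((\<lambda>x. f (- x) * exp (- (- x)\<^sup>2 / 2)) \<longlongrightarrow> 0) at_top"
      unfolding fe using tendsto_mult_right[OF lim2, of "sqrt (2 * pi)"] by simp
    then show "((\<lambda>x. f (- x) * exp (- x\<^sup>2 / 2)) \<longlongrightarrow> 0) at_top" by simp
  qed
qed

text \<open>On the tails the constant barrier 2 works because 2 * x \<ge> x + 1, and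
  \<open>stein_middle\<close> turns it into 12 = 2 * (2 + 2 * 2). A difference quotient of f solves
  a Stein equation with right-hand side at most 13 = 12 + 1, so \<open>stein_bound\<close> gives 78
  = 6 * 13, and 91 = 78 + 13 bounds the increments of f'. Quotients avoid differentiating g, which
  is merely Lipschitz.\<close>

theorem stein_solution:
  fixes g :: "real \<Rightarrow> real"
  assumes g: "1-lipschitz_on UNIV g"
  obtains f f' where "\<And>x. (f has_real_derivative f' x) (at x)"
    and "\<And>x. f' x - x * f x = g x - (\<integral>t. g t \<partial>std_normal_distribution)"
    and "\<And>x. \<bar>f x\<bar> \<le> 12" and "\<And>x. \<bar>f' x\<bar> \<le> 78" and "\<And>x y. \<bar>f' x - f' y\<bar> \<le> 91 * \<bar>x - y\<bar>"
proof -
  define c where "c = (\<integral>t. g t \<partial>std_normal_distribution)"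
  obtain f where f: "\<And>x. (f has_real_derivative x * f x + (g x - c)) (at x)"
    and lim: "((\<lambda>x. f x * exp (- x\<^sup>2 / 2)) \<longlongrightarrow> 0) at_top"
      "((\<lambda>x. f (- x) * exp (- x\<^sup>2 / 2)) \<longlongrightarrow> 0) at_top"
    using stein_solution_exists[OF g] unfolding c_def by blast
  have r: "\<bar>g x - c\<bar> \<le> \<bar>x\<bar> + 1" for x
    unfolding c_def by (rule std_normal_lipschitz_centre[OF g])
  have tail: "\<bar>f x\<bar> \<le> 2" if "\<bar>x\<bar> \<ge> 1" for x
    by (rule stein_bound_tails[where b = "\<lambda>_. 2" and b' = "\<lambda>_. 0" and \<rho> = "\<lambda>x. x + 1" and K = 2, OF f])
       (use r that lim in auto)
  have f_bound: "\<bar>f x\<bar> \<le> 12" for x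
  proof (cases "\<bar>x\<bar> \<le> 1")
    case True
    have "\<bar>f x\<bar> \<le> 2 * (2 + 2 * 2)"
    proof (rule stein_middle[OF f])
      show "\<bar>g y - c\<bar> \<le> 2" if "\<bar>y\<bar> \<le> 1" for y using r[of y] that by linarith
    qed (use tail[of 1] True in auto)
    then show ?thesis by simp
  qed (use tail[of x] in force)
  text \<open>The difference quotients of \<open>f\<close> solve a Stein equation with bounded right-hand side.\<close>
  have quot: "\<bar>f (x + d) - f x\<bar> \<le> 78 * d"
    "\<bar>((x + d) * f (x + d) + (g (x + d) - c)) - (x * f x + (g x - c))\<bar> \<le> 91 * d" if d: "d > 0" for x d
  proof -
    define v where "v = (\<lambda>x. (f (x + d) - f x) / d)"
    define s where "s = (\<lambda>x. f (x + d) + (g (x + d) - g x) / d)"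
    have vd: "(v has_real_derivative ((y + d) * f (y + d) + (g (y + d) - c) - (y * f y + (g y - c))) / d) (at y)" for y
    proof -
      have "((\<lambda>y. f (y + d)) has_real_derivative (y + d) * f (y + d) + (g (y + d) - c)) (at y)"
        using f[of "y + d"] by (simp add: DERIV_shift)
      from DERIV_cdivide[OF DERIV_diff[OF this f[of y]]] show ?thesis by (simp add: v_def)
    qed
    have eq: "((y + d) * f (y + d) + (g (y + d) - c) - (y * f y + (g y - c))) / d = y * v y + s y" for y
      using d by (simp add: v_def s_def field_simps)
    have s: "\<bar>s y\<bar> \<le> 13" for y
    proof -
      have "\<bar>(g (y + d) - g y) / d\<bar> \<le> 1"
        using lipschitz_1_abs[OF g, of "y + d" y] d by (simp add: field_simps abs_if split: if_splits)
      then show ?thesis using f_bound[of "y + d"] unfolding s_def by linarith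
    qed
    \<comment> \<open>This bound degenerates as d tends to 0, but \<open>stein_bound\<close> uses it
      only as qualitative boundedness.\<close>
    have vb: "\<bar>v y\<bar> \<le> 24 / d" for y
      unfolding v_def abs_divide using d f_bound[of "y + d"] f_bound[of y]
      by (simp add: divide_right_mono)
    note b = stein_bound[where v = v and r = s, OF vd[unfolded eq] s vb]
    show "\<bar>f (x + d) - f x\<bar> \<le> 78 * d"
      using b(1)[of x] d by (simp add: v_def field_simps)
    have "\<bar>((x + d) * f (x + d) + (g (x + d) - c) - (x * f x + (g x - c))) / d\<bar> \<le> 91"
      unfolding eq using b(2)[of x] s[of x] by linarith
    then show "\<bar>((x + d) * f (x + d) + (g (x + d) - c)) - (x * f x + (g x - c))\<bar> \<le> 91 * d"
      using d by (simp add: field_simps)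
  qed
  show ?thesis
  proof
    show "(f has_real_derivative x * f x + (g x - c)) (at x)" for x by (rule f)
    show "x * f x + (g x - c) - x * f x = g x - (\<integral>t. g t \<partial>std_normal_distribution)" for x by (simp add: c_def)
    show "\<bar>x * f x + (g x - c)\<bar> \<le> 78" for x
    proof (rule tendsto_upperbound)
      show "((\<lambda>d. \<bar>(f (x + d) - f x) / d\<bar>) \<longlongrightarrow> \<bar>x * f x + (g x - c)\<bar>) (at_right 0)"
        using f[of x] unfolding DERIV_def
        by (intro tendsto_rabs) (auto simp: filterlim_at_split)
      show "\<forall>\<^sub>F d in at_right 0. \<bar>(f (x + d) - f x) / d\<bar> \<le> 78"
        using eventually_at_right_less[of "0::real"]
        by eventually_elim (use quot(1)[of _ x] in \<open>auto simp: field_simps\<close>)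
    qed simp
    show "\<bar>x * f x + (g x - c) - (y * f y + (g y - c))\<bar> \<le> 91 * \<bar>x - y\<bar>" for x y
      using quot(2)[of "y - x" x] quot(2)[of "x - y" y]
      by (cases x y rule: linorder_cases) (auto simp: abs_minus_commute)
  qed (rule f_bound)
qed

section \<open>Quadratic polynomials in independent Poisson variables\<close>

lemma power_le_fact_exp:
  fixes x :: real
  assumes "x \<ge> 0"
  shows "x ^ k \<le> fact k * exp x"
proof -
  have "x ^ k /\<^sub>R fact k \<le> exp x"
    unfolding exp_def using sum_le_suminf[OF summable_exp_generic, of "{k}" x] assms by simp
  then show ?thesis by (simp add: field_simps)
qed

lemma integrable_exp_poisson:
  assumes "0 < a"
  shows "integrable (measure_pmf (poisson_pmf a)) (\<lambda>y. exp (real y))"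
proof -
  have "summable (\<lambda>y. (exp 1 * a) ^ y /\<^sub>R fact y * exp (- a))"
    by (intro summable_mult2 summable_exp_generic)
  moreover have "(\<lambda>y. (exp 1 * a) ^ y /\<^sub>R fact y * exp (- a)) = (\<lambda>y. pmf (poisson_pmf a) y * exp (real y))"
  proof
    fix y
    have "(exp 1 :: real) ^ y = exp (real y)" by (simp flip: exp_of_nat_mult)
    then show "(exp 1 * a) ^ y /\<^sub>R fact y * exp (- a) = pmf (poisson_pmf a) y * exp (real y)"
      using assms by (simp add: power_mult_distrib field_simps)
  qed
  ultimately show ?thesis
    by (simp add: measure_pmf_eq_density integrable_density integrable_count_space_nat_iff abs_mult)
qed

text \<open>The Poisson weights satisfy (y + 1) * p (y + 1) = a * p y, and the term y = 0 carries
  the factor 0. In \<open>ennreal\<close> the identity holds without integrability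
  conditions.\<close>

lemma nn_integral_poisson_shift:
  fixes g :: "nat \<Rightarrow> ennreal"
  assumes a: "0 < a"
  shows "(\<integral>\<^sup>+ y. of_nat y * g y \<partial>measure_pmf (poisson_pmf a)) =
    ennreal a * (\<integral>\<^sup>+ y. g (Suc y) \<partial>measure_pmf (poisson_pmf a))"
proof -
  define p where "p = (\<lambda>y. ennreal (pmf (poisson_pmf a) y))"
  have p: "p (Suc y) * of_nat (Suc y) = ennreal a * p y" for y
    unfolding p_def using a
    by (simp add: ennreal_of_nat_eq_real_of_nat ennreal_mult[symmetric] field_simps del: of_nat_Suc)
  have "(\<integral>\<^sup>+ y. of_nat y * g y \<partial>measure_pmf (poisson_pmf a)) = (\<Sum>y. p y * (of_nat y * g y))"
    by (simp add: nn_integral_measure_pmf nn_integral_count_space_nat p_def)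
  also have "\<dots> = (\<Sum>y. p (y + 1) * (of_nat (y + 1) * g (y + 1)))"
    using suminf_offset[of "\<lambda>y. p y * (of_nat y * g y)" 1] by simp
  also have "\<dots> = (\<Sum>y. ennreal a * (p y * g (Suc y)))"
    using p by (simp add: mult.assoc[symmetric] del: of_nat_Suc)
  also have "\<dots> = ennreal a * (\<integral>\<^sup>+ y. g (Suc y) \<partial>measure_pmf (poisson_pmf a))"
    by (simp add: nn_integral_measure_pmf nn_integral_count_space_nat p_def)
  finally show ?thesis .
qed

section \<open>Independent Poisson counts and Chen's formula\<close>

locale finite_poisson =
  fixes I :: "'i set" and r :: "'i \<Rightarrow> real"
  assumes finite_I: "finite I" and r_pos: "\<And>i. i \<in> I \<Longrightarrow> r i > 0"
begin

definition law :: "('i \<Rightarrow> nat) pmf" where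
  "law = Pi_pmf I 0 (\<lambda>i. poisson_pmf (r i))"

abbreviation E :: "(('i \<Rightarrow> nat) \<Rightarrow> real) \<Rightarrow> real" where
  "E \<equiv> measure_pmf.expectation law"

definition size_I :: "('i \<Rightarrow> nat) \<Rightarrow> real" where
  "size_I n = 1 + (\<Sum>i\<in>I. real (n i))"

text \<open>Polynomial growth in the total count. The class is closed under sums, products and
  add-one shifts and consists of integrable functions, so integrability of the polynomials below
  becomes a syntactic matter. The summand 1 in \<open>size_I\<close> makes its powers increase with
  the exponent.\<close>

definition tame :: "(('i \<Rightarrow> nat) \<Rightarrow> real) \<Rightarrow> bool" where
  "tame g \<longleftrightarrow> (\<exists>C k. \<forall>n. \<bar>g n\<bar> \<le> C * size_I n ^ k)"

lemma size_I_ge_1: "size_I n \<ge> 1"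
  by (simp add: size_I_def sum_nonneg)

lemma tameI: "(\<And>n. \<bar>g n\<bar> \<le> C * size_I n ^ k) \<Longrightarrow> tame g"
  unfolding tame_def by blast

lemma tameE:
  assumes "tame g"
  obtains C k where "C \<ge> 0" "\<And>n. \<bar>g n\<bar> \<le> C * size_I n ^ k"
proof -
  obtain C k where *: "\<And>n. \<bar>g n\<bar> \<le> C * size_I n ^ k" using assms unfolding tame_def by blast
  have "\<bar>g n\<bar> \<le> \<bar>C\<bar> * size_I n ^ k" for n
    by (rule order.trans[OF *]) (use size_I_ge_1[of n] in \<open>auto intro!: mult_right_mono\<close>)
  then show ?thesis using that[of "\<bar>C\<bar>"] by auto
qed

lemma tame_bounded: "(\<And>n. \<bar>g n\<bar> \<le> C) \<Longrightarrow> tame g"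
  by (rule tameI[of _ C 0]) simp

lemma tame_mono: "tame g \<Longrightarrow> (\<And>n. \<bar>f n\<bar> \<le> \<bar>g n\<bar>) \<Longrightarrow> tame f"
  unfolding tame_def by (blast intro: order.trans)

lemma tame_const [simp, intro]: "tame (\<lambda>n. c)"
  by (rule tame_bounded[of _ "\<bar>c\<bar>"]) simp

lemma tame_mult [intro]:
  assumes "tame f" "tame g" shows "tame (\<lambda>n. f n * g n)"
proof -
  obtain C k where f: "C \<ge> 0" "\<And>n. \<bar>f n\<bar> \<le> C * size_I n ^ k" by (rule tameE[OF assms(1)]) blast
  obtain D l where g: "D \<ge> 0" "\<And>n. \<bar>g n\<bar> \<le> D * size_I n ^ l" by (rule tameE[OF assms(2)]) blast
  show ?thesis
  proof (rule tameI[of _ "C * D" "k + l"])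
    fix n
    have "\<bar>f n\<bar> * \<bar>g n\<bar> \<le> (C * size_I n ^ k) * (D * size_I n ^ l)"
      using f g size_I_ge_1[of n] by (intro mult_mono) auto
    then show "\<bar>f n * g n\<bar> \<le> C * D * size_I n ^ (k + l)"
      by (simp add: abs_mult power_add mult_ac)
  qed
qed

lemma tame_add [intro]:
  assumes "tame f" "tame g" shows "tame (\<lambda>n. f n + g n)"
proof -
  obtain C k where f: "C \<ge> 0" "\<And>n. \<bar>f n\<bar> \<le> C * size_I n ^ k" by (rule tameE[OF assms(1)]) blast
  obtain D l where g: "D \<ge> 0" "\<And>n. \<bar>g n\<bar> \<le> D * size_I n ^ l" by (rule tameE[OF assms(2)]) blast
  show ?thesis
  proof (rule tameI[of _ "C + D" "k + l"])
    fix n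
    have 1: "size_I n \<ge> 1" by (rule size_I_ge_1)
    have "\<bar>f n\<bar> \<le> C * size_I n ^ (k + l)"
      by (rule order.trans[OF f(2)]) (use f(1) 1 in \<open>auto intro!: mult_left_mono power_increasing\<close>)
    moreover have "\<bar>g n\<bar> \<le> D * size_I n ^ (k + l)"
      by (rule order.trans[OF g(2)]) (use g(1) 1 in \<open>auto intro!: mult_left_mono power_increasing\<close>)
    ultimately show "\<bar>f n + g n\<bar> \<le> (C + D) * size_I n ^ (k + l)"
      by (simp add: algebra_simps abs_triangle_ineq[THEN order.trans])
  qed
qed

lemma tame_minus [intro]: "tame f \<Longrightarrow> tame (\<lambda>n. - f n)"
  by (rule tame_mono[of f]) auto

lemma tame_diff [intro]: "tame f \<Longrightarrow> tame g \<Longrightarrow> tame (\<lambda>n. f n - g n)"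
  using tame_add[OF _ tame_minus, of f g] by simp

lemma tame_abs [intro]: "tame f \<Longrightarrow> tame (\<lambda>n. \<bar>f n\<bar>)"
  by (rule tame_mono[of f]) auto

lemma tame_power [intro]: "tame f \<Longrightarrow> tame (\<lambda>n. f n ^ k)"
  by (induction k) auto

lemma tame_sum [intro]: "(\<And>i. i \<in> A \<Longrightarrow> tame (f i)) \<Longrightarrow> tame (\<lambda>n. \<Sum>i\<in>A. f i n)"
  by (induction A rule: infinite_finite_induct) auto

lemma tame_coord: "i \<in> I \<Longrightarrow> tame (\<lambda>n. real (n i))"
proof (rule tameI[of _ 1 1])
  fix n assume "i \<in> I"
  then have "real (n i) \<le> (\<Sum>i\<in>I. real (n i))"
    using finite_I by (intro member_le_sum) auto
  then show "\<bar>real (n i)\<bar> \<le> 1 * size_I n ^ 1" by (simp add: size_I_def)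
qed

lemma size_I_Suc: "i \<in> I \<Longrightarrow> size_I (n(i := Suc (n i))) = size_I n + 1"
proof -
  assume i: "i \<in> I"
  have "(\<Sum>j\<in>I. real ((n(i := Suc (n i))) j)) = (\<Sum>j\<in>I. real (n j) + (if j = i then 1 else 0))"
    by (rule sum.cong) auto
  then show ?thesis using i finite_I by (simp add: size_I_def sum.distrib)
qed

lemma tame_Suc:
  assumes "tame g" "i \<in> I" shows "tame (\<lambda>n. g (n(i := Suc (n i))))"
proof -
  obtain C k where g: "C \<ge> 0" "\<And>n. \<bar>g n\<bar> \<le> C * size_I n ^ k" by (rule tameE[OF assms(1)]) blast
  show ?thesis
  proof (rule tameI[of _ "C * 2 ^ k" k])
    fix n
    have "\<bar>g (n(i := Suc (n i)))\<bar> \<le> C * (size_I n + 1) ^ k"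
      using g(2)[of "n(i := Suc (n i))"] assms(2) by (simp add: size_I_Suc)
    also have "\<dots> \<le> C * (2 * size_I n) ^ k"
      using g(1) size_I_ge_1[of n] by (intro mult_left_mono power_mono) auto
    finally show "\<bar>g (n(i := Suc (n i)))\<bar> \<le> C * 2 ^ k * size_I n ^ k"
      by (simp add: power_mult_distrib)
  qed
qed

text \<open>A k-th power is at most k! times the exponential, and the exponential of the total count
  is a product over independent coordinates, each with a finite exponential moment.\<close>

lemma integrable_tame:
  assumes "tame g" shows "integrable law g"
proof -
  obtain C k where g: "C \<ge> 0" "\<And>n. \<bar>g n\<bar> \<le> C * size_I n ^ k" by (rule tameE[OF assms]) blast
  have "integrable law (\<lambda>n. \<Prod>i\<in>I. exp (real (n i)))"
    unfolding law_def
    by (rule integrable_prod_Pi_pmf[OF finite_I]) (use r_pos integrable_exp_poisson in auto)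
  then have int: "integrable law (\<lambda>n. C * fact k * exp 1 * (\<Prod>i\<in>I. exp (real (n i))))" by simp
  show ?thesis
  proof (rule Bochner_Integration.integrable_bound[OF int])
    show "AE n in law. norm (g n) \<le> norm (C * fact k * exp 1 * (\<Prod>i\<in>I. exp (real (n i))))"
    proof (rule AE_I2)
      fix n
      have "size_I n ^ k \<le> fact k * exp (size_I n)"
        using size_I_ge_1[of n] by (intro power_le_fact_exp) auto
      also have "exp (size_I n) = exp 1 * (\<Prod>i\<in>I. exp (real (n i)))"
        using finite_I by (simp add: size_I_def exp_add exp_sum)
      finally have "C * size_I n ^ k \<le> C * (fact k * (exp 1 * (\<Prod>i\<in>I. exp (real (n i)))))"
        using g(1) by (rule mult_left_mono)
      with g(2)[of n] show "norm (g n) \<le> norm (C * fact k * exp 1 * (\<Prod>i\<in>I. exp (real (n i))))"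
        by (simp add: mult.assoc)
    qed
  qed simp
qed

text \<open>Coordinate i is split off as an independent factor, and the one-dimensional shift is
  applied with the other coordinates integrated out.\<close>

lemma nn_integral_shift:
  assumes i: "i \<in> I"
  shows "(\<integral>\<^sup>+ n. of_nat (n i) * g n \<partial>law) = ennreal (r i) * (\<integral>\<^sup>+ n. g (n(i := Suc (n i))) \<partial>law)"
proof -
  have law: "law = map_pmf (\<lambda>(y, f). f(i := y))
      (pair_pmf (poisson_pmf (r i)) (Pi_pmf (I - {i}) 0 (\<lambda>i. poisson_pmf (r i))))"
    unfolding law_def using i finite_I
    by (subst Pi_pmf_insert[symmetric]) (auto simp: insert_absorb)
  define p where "p = Pi_pmf (I - {i}) 0 (\<lambda>i. poisson_pmf (r i))"
  have law': "(\<integral>\<^sup>+ n. f n \<partial>law) = (\<integral>\<^sup>+ a. \<integral>\<^sup>+ b. f (b(i := a)) \<partial>p \<partial>poisson_pmf (r i))" for f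
    unfolding law p_def by (simp add: nn_integral_pair_pmf' case_prod_beta)
  show ?thesis
    unfolding law' using nn_integral_poisson_shift[OF r_pos[OF i], of "\<lambda>a. \<integral>\<^sup>+ b. g (b(i := a)) \<partial>p"]
    by (simp add: nn_integral_cmult)
qed

lemma expectation_shift_nonneg:
  assumes g: "tame g" "\<And>n. g n \<ge> 0" and i: "i \<in> I"
  shows "E (\<lambda>n. real (n i) * g n) = r i * E (\<lambda>n. g (n(i := Suc (n i))))"
proof -
  have "E (\<lambda>n. real (n i) * g n) = enn2real (\<integral>\<^sup>+ n. of_nat (n i) * ennreal (g n) \<partial>law)"
    using g by (subst integral_eq_nn_integral)
      (auto simp: ennreal_mult ennreal_of_nat_eq_real_of_nat)
  also have "\<dots> = r i * E (\<lambda>n. g (n(i := Suc (n i))))"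
    unfolding nn_integral_shift[OF i] using g r_pos[OF i]
    by (subst integral_eq_nn_integral) (auto simp: enn2real_mult)
  finally show ?thesis .
qed

lemma expectation_shift:
  assumes g: "tame g" and i: "i \<in> I"
  shows "E (\<lambda>n. real (n i) * g n) = r i * E (\<lambda>n. g (n(i := Suc (n i))))"
proof -
  define gp where "gp = (\<lambda>n. (\<bar>g n\<bar> + g n) * (1 / 2))"
  define gm where "gm = (\<lambda>n. (\<bar>g n\<bar> - g n) * (1 / 2))"
  have t: "tame gp" "tame gm"
    unfolding gp_def gm_def by (intro tame_mult tame_add tame_diff tame_abs tame_const g)+
  have nn: "gp n \<ge> 0" "gm n \<ge> 0" for n unfolding gp_def gm_def by auto
  have eq: "g = (\<lambda>n. gp n - gm n)" by (simp add: gp_def gm_def field_simps)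
  have "E (\<lambda>n. real (n i) * g n) = E (\<lambda>n. real (n i) * gp n) - E (\<lambda>n. real (n i) * gm n)"
    unfolding eq right_diff_distrib
    by (rule Bochner_Integration.integral_diff; (rule integrable_tame tame_mult tame_coord[OF i] t)+)
  also have "\<dots> = r i * (E (\<lambda>n. gp (n(i := Suc (n i)))) - E (\<lambda>n. gm (n(i := Suc (n i)))))"
    using expectation_shift_nonneg[OF t(1) nn(1) i] expectation_shift_nonneg[OF t(2) nn(2) i]
    by (simp add: right_diff_distrib)
  also have "E (\<lambda>n. gp (n(i := Suc (n i)))) - E (\<lambda>n. gm (n(i := Suc (n i)))) = E (\<lambda>n. g (n(i := Suc (n i))))"
    unfolding eq
    by (rule Bochner_Integration.integral_diff[symmetric]; (rule integrable_tame tame_Suc[OF _ i] t)+)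
  finally show ?thesis .
qed

text \<open>The first-order Wiener-Ito integral of b against the compensated counts.\<close>

definition lin :: "('i \<Rightarrow> real) \<Rightarrow> ('i \<Rightarrow> nat) \<Rightarrow> real" where
  "lin b n = (\<Sum>i\<in>I. b i * (real (n i) - r i))"

lemma tame_lin [intro]: "tame (lin b)"
  unfolding lin_def[abs_def] by (intro tame_sum tame_mult tame_diff tame_const tame_coord)

lemma lin_Suc:
  assumes "i \<in> I" shows "lin b (n(i := Suc (n i))) = lin b n + b i"
proof -
  have "lin b (n(i := Suc (n i))) = (\<Sum>j\<in>I. b j * (real (n j) - r j) + (if j = i then b i else 0))"
    unfolding lin_def by (rule sum.cong) (auto simp: algebra_simps)
  then show ?thesis using assms finite_I by (simp add: lin_def sum.distrib)
qed

lemma E_add: "tame f \<Longrightarrow> tame g \<Longrightarrow> E (\<lambda>n. f n + g n) = E f + E g"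
  by (intro Bochner_Integration.integral_add integrable_tame)

lemma E_diff: "tame f \<Longrightarrow> tame g \<Longrightarrow> E (\<lambda>n. f n - g n) = E f - E g"
  by (intro Bochner_Integration.integral_diff integrable_tame)

lemma E_sum: "(\<And>i. i \<in> A \<Longrightarrow> tame (f i)) \<Longrightarrow> E (\<lambda>n. \<Sum>i\<in>A. f i n) = (\<Sum>i\<in>A. E (f i))"
  by (intro Bochner_Integration.integral_sum integrable_tame)

lemma E_mono: "tame f \<Longrightarrow> tame g \<Longrightarrow> (\<And>n. f n \<le> g n) \<Longrightarrow> E f \<le> E g"
  by (intro integral_mono integrable_tame)
lemma chen:
  assumes g: "tame g" and i: "i \<in> I"
  shows "E (\<lambda>n. (real (n i) - r i) * g n) = r i * E (\<lambda>n. g (n(i := Suc (n i))) - g n)"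
proof -
  have "E (\<lambda>n. (real (n i) - r i) * g n) = E (\<lambda>n. real (n i) * g n - r i * g n)"
    by (simp add: algebra_simps)
  also have "\<dots> = E (\<lambda>n. real (n i) * g n) - E (\<lambda>n. r i * g n)"
    by (rule E_diff) (use g i in \<open>auto intro!: tame_coord\<close>)
  also have "E (\<lambda>n. real (n i) * g n) = r i * E (\<lambda>n. g (n(i := Suc (n i))))"
    by (rule expectation_shift[OF g i])
  also have "r i * E (\<lambda>n. g (n(i := Suc (n i)))) - E (\<lambda>n. r i * g n) =
      r i * E (\<lambda>n. g (n(i := Suc (n i))) - g n)"
    using E_diff[OF tame_Suc[OF g i] g] by (simp add: right_diff_distrib)
  finally show ?thesis .
qed

text \<open>Every coordinate may carry its own function; for a quadratic form it is the linear form
  given by the corresponding row of the kernel.\<close>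

lemma chen_sum:
  assumes g: "\<And>i. i \<in> I \<Longrightarrow> tame (g i)"
  shows "E (\<lambda>n. \<Sum>i\<in>I. (real (n i) - r i) * g i n) =
    (\<Sum>i\<in>I. r i * E (\<lambda>n. g i (n(i := Suc (n i))) - g i n))"
proof -
  have "E (\<lambda>n. \<Sum>i\<in>I. (real (n i) - r i) * g i n) = (\<Sum>i\<in>I. E (\<lambda>n. (real (n i) - r i) * g i n))"
    by (rule E_sum) (intro tame_mult tame_diff tame_coord tame_const g)
  then show ?thesis using chen[OF g] by simp
qed

lemma chen_lin:
  assumes g: "tame g"
  shows "E (\<lambda>n. lin b n * g n) = (\<Sum>i\<in>I. r i * b i * E (\<lambda>n. g (n(i := Suc (n i))) - g n))"
proof -
  have "E (\<lambda>n. lin b n * g n) = E (\<lambda>n. \<Sum>i\<in>I. (real (n i) - r i) * (b i * g n))"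
    by (rule arg_cong[of _ _ E]) (auto simp: fun_eq_iff lin_def sum_distrib_right intro!: sum.cong)
  also have "\<dots> = (\<Sum>i\<in>I. r i * E (\<lambda>n. b i * g (n(i := Suc (n i))) - b i * g n))"
    by (rule chen_sum) (use g in auto)
  also have "\<dots> = (\<Sum>i\<in>I. r i * b i * E (\<lambda>n. g (n(i := Suc (n i))) - g n))"
    by (simp add: right_diff_distrib[symmetric] mult.assoc)
  finally show ?thesis .
qed

lemma E_lin: "E (lin b) = 0"
  using chen_lin[of "\<lambda>_. 1" b] by simp

lemma E_lin_lin: "E (\<lambda>n. lin b n * lin c n) = (\<Sum>i\<in>I. r i * b i * c i)"
  by (simp add: chen_lin[OF tame_lin] lin_Suc)

lemma E_lin_sq: "E (\<lambda>n. (lin b n)\<^sup>2) = (\<Sum>i\<in>I. r i * (b i)\<^sup>2)"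
  using E_lin_lin[of b b] by (simp add: power2_eq_square mult.assoc)

text \<open>Chen's formula applied to the cube of the linear form L leaves the increment 3 b L^2 + 3
  b^2 L + b^3, whose middle term has mean zero. The result is the Gaussian value, three times the
  squared variance, plus the fourth cumulant.\<close>

lemma E_lin_4: "E (\<lambda>n. lin b n ^ 4) = 3 * (\<Sum>i\<in>I. r i * (b i)\<^sup>2)\<^sup>2 + (\<Sum>i\<in>I. r i * b i ^ 4)"
proof -
  have "E (\<lambda>n. lin b n ^ 4) = E (\<lambda>n. lin b n * lin b n ^ 3)"
    by (simp add: power_numeral_reduce)
  also have "\<dots> = (\<Sum>i\<in>I. r i * b i * E (\<lambda>n. lin b (n(i := Suc (n i))) ^ 3 - lin b n ^ 3))"
    by (rule chen_lin) auto
  also have "\<dots> = (\<Sum>i\<in>I. r i * b i * (3 * b i * (\<Sum>i\<in>I. r i * (b i)\<^sup>2) + (b i) ^ 3))"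
  proof (rule sum.cong, rule refl)
    fix i assume i: "i \<in> I"
    have "(\<lambda>n. lin b (n(i := Suc (n i))) ^ 3 - lin b n ^ 3) =
        (\<lambda>n. (3 * b i * (lin b n)\<^sup>2 + 3 * (b i)\<^sup>2 * lin b n) + (b i) ^ 3)"
      using i by (auto simp: lin_Suc algebra_simps power_numeral_reduce)
    then have "E (\<lambda>n. lin b (n(i := Suc (n i))) ^ 3 - lin b n ^ 3) =
        3 * b i * E (\<lambda>n. (lin b n)\<^sup>2) + 3 * (b i)\<^sup>2 * E (lin b) + (b i) ^ 3"
      by (simp add: E_add tame_add tame_mult tame_power tame_lin)
    then show "r i * b i * E (\<lambda>n. lin b (n(i := Suc (n i))) ^ 3 - lin b n ^ 3) =
        r i * b i * (3 * b i * (\<Sum>i\<in>I. r i * (b i)\<^sup>2) + (b i) ^ 3)"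
      by (simp add: E_lin E_lin_sq)
  qed
  also have "\<dots> = (\<Sum>i\<in>I. 3 * (\<Sum>i\<in>I. r i * (b i)\<^sup>2) * (r i * (b i)\<^sup>2) + r i * b i ^ 4)"
    by (rule sum.cong) (auto simp: algebra_simps power_numeral_reduce)
  also have "\<dots> = 3 * (\<Sum>i\<in>I. r i * (b i)\<^sup>2)\<^sup>2 + (\<Sum>i\<in>I. r i * b i ^ 4)"
    by (simp add: sum.distrib sum_distrib_left[symmetric] power2_eq_square[of "sum _ _"])
  finally show ?thesis .
qed

end

section \<open>Centred quadratic forms\<close>

context finite_poisson
begin

text \<open>The subtracted constant is the mean. A nonzero diagonal has to be allowed because
  contractions of the kernel have one; a squared centred count contributes, besides its second-order
  part, a linear part, visible as the last sum in \<open>E_quad_sq\<close>.\<close>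

definition quad :: "('i \<Rightarrow> 'i \<Rightarrow> real) \<Rightarrow> ('i \<Rightarrow> nat) \<Rightarrow> real" where
  "quad b n = (\<Sum>i\<in>I. (real (n i) - r i) * lin (b i) n) - (\<Sum>i\<in>I. r i * b i i)"

lemma tame_centred: "i \<in> I \<Longrightarrow> tame (\<lambda>n. real (n i) - r i)"
  by (intro tame_diff tame_coord tame_const)

lemma tame_quad: "tame (quad b)"
  unfolding quad_def[abs_def]
  by (rule tame_diff, rule tame_sum, rule tame_mult, erule tame_centred, rule tame_lin, rule tame_const)

lemma sum_lin_Suc:
  assumes i: "i \<in> I" and b: "\<And>k. k \<in> I \<Longrightarrow> b k i = b i k"
  shows "(\<Sum>k\<in>I. (real ((n(i := Suc (n i))) k) - r k) * lin (b k) (n(i := Suc (n i)))) =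
    (\<Sum>k\<in>I. (real (n k) - r k) * lin (b k) n) + (2 * lin (b i) n + b i i)"
proof -
  have "(\<Sum>k\<in>I. (real ((n(i := Suc (n i))) k) - r k) * lin (b k) (n(i := Suc (n i)))) =
    (\<Sum>k\<in>I. (real (n k) - r k) * lin (b k) n + b i k * (real (n k) - r k)
       + (if k = i then lin (b i) n + b i i else 0))"
  proof (rule sum.cong, rule refl)
    fix k assume k: "k \<in> I"
    show "(real ((n(i := Suc (n i))) k) - r k) * lin (b k) (n(i := Suc (n i))) =
        (real (n k) - r k) * lin (b k) n + b i k * (real (n k) - r k)
          + (if k = i then lin (b i) n + b i i else 0)"
      unfolding lin_Suc[OF i] b[OF k] by (simp add: algebra_simps)
  qed
  also have "\<dots> = (\<Sum>k\<in>I. (real (n k) - r k) * lin (b k) n) + lin (b i) n + (lin (b i) n + b i i)"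
    using i finite_I by (simp add: sum.distrib lin_def)
  finally show ?thesis by simp
qed

lemma quad_Suc:
  assumes i: "i \<in> I" and b: "\<And>k. k \<in> I \<Longrightarrow> b k i = b i k"
  shows "quad b (n(i := Suc (n i))) = quad b n + (2 * lin (b i) n + b i i)"
  unfolding quad_def by (subst sum_lin_Suc[where b = b, OF i b]) simp_all

lemma E_quad: "E (quad b) = 0"
proof -
  have "E (quad b) = E (\<lambda>n. \<Sum>i\<in>I. (real (n i) - r i) * lin (b i) n) - E (\<lambda>n. \<Sum>i\<in>I. r i * b i i)"
    unfolding quad_def[abs_def]
    by (rule E_diff; (rule tame_const | intro tame_sum tame_mult tame_centred tame_lin))
  also have "E (\<lambda>n. \<Sum>i\<in>I. (real (n i) - r i) * lin (b i) n) = (\<Sum>i\<in>I. r i * b i i)"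
    by (subst chen_sum) (auto simp: lin_Suc)
  finally show ?thesis by simp
qed

text \<open>Chen's formula is applied to the product of a row form L with the quadratic form Q. With
  d the diagonal entry, an added point changes L Q by 2 L^2 + 3 d L + d Q + d^2, and L and Q are
  centred.\<close>

lemma E_quad_sq:
  assumes b: "\<And>i j. i \<in> I \<Longrightarrow> j \<in> I \<Longrightarrow> b i j = b j i"
  shows "E (\<lambda>n. (quad b n)\<^sup>2) =
    2 * (\<Sum>i\<in>I. \<Sum>j\<in>I. r i * r j * (b i j)\<^sup>2) + (\<Sum>i\<in>I. r i * (b i i)\<^sup>2)"
proof -
  define c where "c = (\<Sum>i\<in>I. r i * b i i)"
  have "E (\<lambda>n. (quad b n)\<^sup>2) =
      E (\<lambda>n. (\<Sum>i\<in>I. (real (n i) - r i) * (lin (b i) n * quad b n)) - c * quad b n)"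
  proof (rule arg_cong[of _ _ E], rule ext)
    fix n
    have "(quad b n)\<^sup>2 = ((\<Sum>i\<in>I. (real (n i) - r i) * lin (b i) n) - c) * quad b n"
      by (simp add: power2_eq_square quad_def c_def)
    then show "(quad b n)\<^sup>2 = (\<Sum>i\<in>I. (real (n i) - r i) * (lin (b i) n * quad b n)) - c * quad b n"
      by (simp add: left_diff_distrib sum_distrib_right mult.assoc)
  qed
  also have "\<dots> = E (\<lambda>n. \<Sum>i\<in>I. (real (n i) - r i) * (lin (b i) n * quad b n)) - E (\<lambda>n. c * quad b n)"
    by (rule E_diff; intro tame_sum tame_mult tame_centred tame_lin tame_quad tame_const)
  also have "E (\<lambda>n. c * quad b n) = 0"
    by (simp add: E_quad)
  also have "E (\<lambda>n. \<Sum>i\<in>I. (real (n i) - r i) * (lin (b i) n * quad b n)) =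
    (\<Sum>i\<in>I. r i * E (\<lambda>n. lin (b i) (n(i := Suc (n i))) * quad b (n(i := Suc (n i))) - lin (b i) n * quad b n))"
    by (rule chen_sum) (intro tame_mult tame_lin tame_quad)
  also have "\<dots> = (\<Sum>i\<in>I. r i * (2 * (\<Sum>j\<in>I. r j * (b i j)\<^sup>2) + (b i i)\<^sup>2))"
  proof (rule sum.cong, rule refl)
    fix i assume i: "i \<in> I"
    have "(\<lambda>n. lin (b i) (n(i := Suc (n i))) * quad b (n(i := Suc (n i))) - lin (b i) n * quad b n) =
        (\<lambda>n. (2 * (lin (b i) n)\<^sup>2 + (3 * b i i) * lin (b i) n) + (b i i * quad b n + (b i i)\<^sup>2))"
      using i b by (auto simp: fun_eq_iff lin_Suc quad_Suc algebra_simps power2_eq_square)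
    then have "E (\<lambda>n. lin (b i) (n(i := Suc (n i))) * quad b (n(i := Suc (n i))) - lin (b i) n * quad b n) =
       (2 * E (\<lambda>n. (lin (b i) n)\<^sup>2) + (3 * b i i) * E (lin (b i))) + (b i i * E (quad b) + (b i i)\<^sup>2)"
      by (simp add: E_add tame_add tame_mult tame_power tame_lin tame_quad)
    then show "r i * E (\<lambda>n. lin (b i) (n(i := Suc (n i))) * quad b (n(i := Suc (n i))) - lin (b i) n * quad b n)
      = r i * (2 * (\<Sum>j\<in>I. r j * (b i j)\<^sup>2) + (b i i)\<^sup>2)"
      by (simp add: E_lin_sq E_lin E_quad)
  qed
  also have "\<dots> = 2 * (\<Sum>i\<in>I. \<Sum>j\<in>I. r i * r j * (b i j)\<^sup>2) + (\<Sum>i\<in>I. r i * (b i i)\<^sup>2)"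
    by (simp add: distrib_left sum.distrib sum_distrib_left mult_ac)
  finally show ?thesis by simp
qed

lemma E_abs_le_sqrt:
  assumes "tame g" shows "E (\<lambda>n. \<bar>g n\<bar>) \<le> sqrt (E (\<lambda>n. (g n)\<^sup>2))"
proof -
  have "(E (\<lambda>n. \<bar>g n\<bar>))\<^sup>2 \<le> E (\<lambda>n. \<bar>g n\<bar>\<^sup>2)"
  proof -
    have "0 \<le> E (\<lambda>n. (\<bar>g n\<bar> - E (\<lambda>n. \<bar>g n\<bar>))\<^sup>2)" by simp
    also have "\<dots> = E (\<lambda>n. (\<bar>g n\<bar>\<^sup>2 + (- 2 * E (\<lambda>n. \<bar>g n\<bar>)) * \<bar>g n\<bar>) + (E (\<lambda>n. \<bar>g n\<bar>))\<^sup>2)"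
      by (rule arg_cong[of _ _ E]) (auto simp: fun_eq_iff power2_diff)
    also have "\<dots> = E (\<lambda>n. \<bar>g n\<bar>\<^sup>2) + (- 2 * E (\<lambda>n. \<bar>g n\<bar>)) * E (\<lambda>n. \<bar>g n\<bar>) + (E (\<lambda>n. \<bar>g n\<bar>))\<^sup>2"
      using assms by (simp add: E_add E_diff tame_add tame_diff tame_mult tame_power tame_abs)
    finally show ?thesis by (simp add: power2_eq_square)
  qed
  then show ?thesis by (intro real_le_rsqrt) simp
qed

end

section \<open>Stein's method for a quadratic polynomial of Poisson counts\<close>

locale finite_kernel = finite_poisson I r for I :: "'i set" and r +
  fixes a :: "'i \<Rightarrow> 'i \<Rightarrow> real"
  assumes a_sym: "\<And>i j. i \<in> I \<Longrightarrow> j \<in> I \<Longrightarrow> a i j = a j i" and a_diag: "\<And>i. i \<in> I \<Longrightarrow> a i i = 0"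
begin

definition h :: "'i \<Rightarrow> real" where "h i = 2 * (\<Sum>j\<in>I. r j * a i j)"

definition F :: "('i \<Rightarrow> nat) \<Rightarrow> real" where
  "F n = (\<Sum>i\<in>I. (real (n i) - r i) * (h i + lin (a i) n))"

definition D :: "'i \<Rightarrow> ('i \<Rightarrow> nat) \<Rightarrow> real" where "D i n = h i + 2 * lin (a i) n"

definition s2 :: real where
  "s2 = (\<Sum>i\<in>I. r i * (h i)\<^sup>2) + 2 * (\<Sum>i\<in>I. \<Sum>j\<in>I. r i * r j * (a i j)\<^sup>2)"

text \<open>With \<open>F = I\<^sub>1(h) + I\<^sub>2(a)\<close>, the factors of \<open>T\<close> are the add-one cost \<open>D\<close> of \<open>F\<close> and that of
  \<open>-L\<^sup>-\<^sup>1F = I\<^sub>1(h) + I\<^sub>2(a) / 2\<close>, where \<open>L\<close> is the Ornstein--Uhlenbeck generator.\<close>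

definition T :: "('i \<Rightarrow> nat) \<Rightarrow> real" where
  "T n = (\<Sum>i\<in>I. r i * ((h i + lin (a i) n) * D i n))"

text \<open>Write n = (n - r) + r in both factors: the constant part is the mean, and by symmetry
  the two mixed parts agree and add up to the row term h.\<close>

lemma double_sum_eq_F:
  "(\<Sum>i\<in>I. \<Sum>j\<in>I. a i j * (real (n i) * real (n j))) = F n + (\<Sum>i\<in>I. \<Sum>j\<in>I. a i j * (r i * r j))"
proof -
  have 1: "(\<Sum>i\<in>I. \<Sum>j\<in>I. a i j * ((real (n i) - r i) * r j)) = (\<Sum>i\<in>I. (real (n i) - r i) * (h i / 2))"
    by (simp add: h_def sum_distrib_left sum_divide_distrib mult_ac)
  have "(\<Sum>i\<in>I. \<Sum>j\<in>I. a i j * (r i * (real (n j) - r j))) = (\<Sum>j\<in>I. \<Sum>i\<in>I. a j i * ((real (n j) - r j) * r i))"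
    by (subst sum.swap) (auto intro!: sum.cong simp: a_sym)
  with 1 have 2: "(\<Sum>i\<in>I. \<Sum>j\<in>I. a i j * (r i * (real (n j) - r j))) = (\<Sum>i\<in>I. (real (n i) - r i) * (h i / 2))"
    by simp
  have "(\<Sum>i\<in>I. \<Sum>j\<in>I. a i j * (real (n i) * real (n j))) =
      (\<Sum>i\<in>I. \<Sum>j\<in>I. (real (n i) - r i) * (a i j * (real (n j) - r j))
        + a i j * ((real (n i) - r i) * r j) + a i j * (r i * (real (n j) - r j)) + a i j * (r i * r j))"
    by (simp add: algebra_simps)
  also have "\<dots> = (\<Sum>i\<in>I. (real (n i) - r i) * lin (a i) n) + (\<Sum>i\<in>I. (real (n i) - r i) * (h i / 2))
      + (\<Sum>i\<in>I. (real (n i) - r i) * (h i / 2)) + (\<Sum>i\<in>I. \<Sum>j\<in>I. a i j * (r i * r j))"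
    by (simp only: sum.distrib 1 2 lin_def sum_distrib_left)
  also have "\<dots> = F n + (\<Sum>i\<in>I. \<Sum>j\<in>I. a i j * (r i * r j))"
    by (simp add: F_def sum.distrib[symmetric] algebra_simps)
  finally show ?thesis .
qed

lemma tame_F: "tame F"
  unfolding F_def[abs_def] by (intro tame_sum tame_mult tame_centred tame_add tame_const tame_lin)

lemma tame_D: "tame (D i)"
  unfolding D_def[abs_def] by (intro tame_mult tame_add tame_const tame_lin)

lemma tame_T: "tame T"
  unfolding T_def[abs_def] by (intro tame_sum tame_mult tame_add tame_const tame_lin tame_D)

lemma F_eq: "F n = lin h n + (\<Sum>i\<in>I. (real (n i) - r i) * lin (a i) n)"
  by (simp add: F_def lin_def distrib_left sum.distrib mult_ac)

lemma F_Suc: "i \<in> I \<Longrightarrow> F (n(i := Suc (n i))) = F n + D i n"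
  unfolding F_eq by (subst sum_lin_Suc) (auto simp: lin_Suc D_def a_sym a_diag)

text \<open>Here the zero diagonal acts: the factor of a centred count in F is unaffected by a point
  added to that cell, so Chen's formula differences only f (F).\<close>

lemma lin_a_Suc: "i \<in> I \<Longrightarrow> lin (a i) (n(i := Suc (n i))) = lin (a i) n"
  by (simp add: lin_Suc a_diag)

lemma stein_identity:
  assumes "tame (\<lambda>n. f (F n))"
  shows "E (\<lambda>n. F n * f (F n)) =
    (\<Sum>i\<in>I. r i * E (\<lambda>n. (h i + lin (a i) n) * (f (F n + D i n) - f (F n))))"
proof -
  have "E (\<lambda>n. F n * f (F n)) = E (\<lambda>n. \<Sum>i\<in>I. (real (n i) - r i) * ((h i + lin (a i) n) * f (F n)))"
    by (simp add: F_def sum_distrib_right mult.assoc)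
  also have "\<dots> = (\<Sum>i\<in>I. r i * E (\<lambda>n. (h i + lin (a i) (n(i := Suc (n i)))) * f (F (n(i := Suc (n i))))
      - (h i + lin (a i) n) * f (F n)))"
    by (rule chen_sum) (intro tame_mult tame_add tame_const tame_lin assms)
  also have "\<dots> = (\<Sum>i\<in>I. r i * E (\<lambda>n. (h i + lin (a i) n) * (f (F n + D i n) - f (F n))))"
    by (intro sum.cong refl) (simp add: F_Suc lin_a_Suc right_diff_distrib)
  finally show ?thesis .
qed

lemma E_F: "E F = 0"
  unfolding F_def[abs_def]
  by (subst chen_sum) (auto simp: lin_a_Suc intro!: tame_add tame_lin)

text \<open>The chaos expansion of the Stein kernel, from (h + L) (h + 2 L) = h^2 + 3 h L + 2 L^2
  for each row form L. The quadratic part is the form of the kernel contracted with itself.\<close>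

lemma T_eq: "T n = s2 + (3 * lin (\<lambda>j. \<Sum>i\<in>I. r i * h i * a i j) n
    + 2 * quad (\<lambda>j k. \<Sum>i\<in>I. r i * a i j * a i k) n)"
proof -
  have lin: "lin (\<lambda>k. \<Sum>i\<in>I. c i * a i k) n = (\<Sum>i\<in>I. c i * lin (a i) n)" for c
    unfolding lin_def sum_distrib_left sum_distrib_right
    by (subst sum.swap) (simp add: mult_ac)
  have "(\<Sum>j\<in>I. (real (n j) - r j) * lin (\<lambda>k. \<Sum>i\<in>I. r i * a i j * a i k) n)
      = (\<Sum>j\<in>I. (real (n j) - r j) * (\<Sum>i\<in>I. r i * a i j * lin (a i) n))"
    by (simp only: lin)
  also have "\<dots> = (\<Sum>i\<in>I. \<Sum>j\<in>I. r i * lin (a i) n * (a i j * (real (n j) - r j)))"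
    unfolding sum_distrib_left by (subst sum.swap) (simp add: mult_ac)
  also have "\<dots> = (\<Sum>i\<in>I. r i * (lin (a i) n)\<^sup>2)"
    unfolding sum_distrib_left[symmetric] lin_def[symmetric] by (simp add: power2_eq_square mult.assoc)
  finally have 1: "(\<Sum>j\<in>I. (real (n j) - r j) * lin (\<lambda>k. \<Sum>i\<in>I. r i * a i j * a i k) n)
      = (\<Sum>i\<in>I. r i * (lin (a i) n)\<^sup>2)" .
  have 2: "(\<Sum>j\<in>I. r j * (\<Sum>i\<in>I. r i * a i j * a i j)) = (\<Sum>i\<in>I. \<Sum>j\<in>I. r i * r j * (a i j)\<^sup>2)"
    unfolding sum_distrib_left by (subst sum.swap) (simp add: power2_eq_square mult_ac)
  have 3: "quad (\<lambda>j k. \<Sum>i\<in>I. r i * a i j * a i k) n =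
      (\<Sum>i\<in>I. r i * (lin (a i) n)\<^sup>2) - (\<Sum>i\<in>I. \<Sum>j\<in>I. r i * r j * (a i j)\<^sup>2)"
    unfolding quad_def 1 2 ..
  show ?thesis
    unfolding 3 lin s2_def T_def D_def
    by (simp add: sum_distrib_left sum.distrib[symmetric] algebra_simps power2_eq_square)
qed

lemma E_T: "E T = s2"
  unfolding T_eq[abs_def]
  by (subst E_add; (intro tame_add tame_mult tame_const tame_lin tame_quad)?)+ (simp add: E_lin E_quad)

text \<open>The Stein identity with f the identity, for which the increment of f is exactly
  D.\<close>

lemma E_F_sq: "E (\<lambda>n. (F n)\<^sup>2) = s2"
proof -
  have "E (\<lambda>n. (F n)\<^sup>2) = (\<Sum>i\<in>I. r i * E (\<lambda>n. (h i + lin (a i) n) * D i n))"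
    using stein_identity[of "\<lambda>x. x"] tame_F by (simp add: power2_eq_square)
  also have "\<dots> = E T"
    unfolding T_def[abs_def]
    by (subst E_sum) (auto intro!: tame_mult tame_add tame_const tame_lin tame_D)
  finally show ?thesis by (simp add: E_T)
qed

text \<open>From (3 x + 2 y)^2 \<le> 18 x^2 + 8 y^2 with x the linear and y the quadratic form in T
  - s2. The bracket after 8 is the second moment of the contraction form, including its
  diagonal.\<close>

definition V :: real where
  "V = 18 * (\<Sum>j\<in>I. r j * (\<Sum>i\<in>I. r i * h i * a i j)\<^sup>2)
    + 8 * (2 * (\<Sum>j\<in>I. \<Sum>k\<in>I. r j * r k * (\<Sum>i\<in>I. r i * a i j * a i k)\<^sup>2)
      + (\<Sum>j\<in>I. r j * (\<Sum>i\<in>I. r i * a i j * a i j)\<^sup>2))"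

lemma E_T_sq: "E (\<lambda>n. (T n - s2)\<^sup>2) \<le> V"
proof -
  let ?c = "\<lambda>j. \<Sum>i\<in>I. r i * h i * a i j" and ?b = "\<lambda>j k. \<Sum>i\<in>I. r i * a i j * a i k"
  have "E (\<lambda>n. (T n - s2)\<^sup>2) \<le> E (\<lambda>n. 18 * (lin ?c n)\<^sup>2 + 8 * (quad ?b n)\<^sup>2)"
  proof (rule E_mono)
    fix n
    have "18 * (lin ?c n)\<^sup>2 + 8 * (quad ?b n)\<^sup>2 - (T n - s2)\<^sup>2 = (3 * lin ?c n - 2 * quad ?b n)\<^sup>2"
      unfolding T_eq by (simp add: power2_eq_square algebra_simps)
    moreover have "(3 * lin ?c n - 2 * quad ?b n)\<^sup>2 \<ge> 0" by simp
    ultimately show "(T n - s2)\<^sup>2 \<le> 18 * (lin ?c n)\<^sup>2 + 8 * (quad ?b n)\<^sup>2" by linarith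
  qed (intro tame_power tame_diff tame_T tame_const tame_add tame_mult tame_lin tame_quad)+
  also have "\<dots> = 18 * E (\<lambda>n. (lin ?c n)\<^sup>2) + 8 * E (\<lambda>n. (quad ?b n)\<^sup>2)"
    by (subst E_add) (auto intro!: tame_mult tame_const tame_power tame_lin tame_quad)
  also have "\<dots> = V"
    unfolding V_def E_lin_sq by (subst E_quad_sq) (auto simp: mult_ac)
  finally show ?thesis .
qed

text \<open>Cell by cell, the second and fourth moments left by \<open>cubic_bound\<close>: those of
  h, which is deterministic, and those of the row form, from \<open>E_lin_sq\<close> and
  \<open>E_lin_4\<close>.\<close>

definition W :: real where
  "W = (\<Sum>i\<in>I. r i * ((h i)\<^sup>2 + h i ^ 4 + (\<Sum>j\<in>I. r j * (a i j)\<^sup>2)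
     + (3 * (\<Sum>j\<in>I. r j * (a i j)\<^sup>2)\<^sup>2 + (\<Sum>j\<in>I. r j * a i j ^ 4))))"

text \<open>Third-order terms are traded for second and fourth powers, whose expectations have
  closed formulas for linear forms. The means is p q^2 \<le> (p^2 + q^4) / 2.\<close>

lemma cubic_bound:
  fixes x y :: real
  shows "\<bar>x + y\<bar> * (x + 2 * y)\<^sup>2 \<le> 8 * (x\<^sup>2 + x ^ 4 + y\<^sup>2 + y ^ 4)"
proof -
  have cube: "p * q\<^sup>2 \<le> (p\<^sup>2 + q ^ 4) / 2" for p q :: real
  proof -
    have "0 \<le> (p - q\<^sup>2)\<^sup>2" by simp
    then show ?thesis by (simp add: power2_diff field_simps power_mult[symmetric])
  qed
  define p where "p = \<bar>x\<bar>"
  define q where "q = \<bar>y\<bar>"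
  have pq: "p \<ge> 0" "q \<ge> 0" by (auto simp: p_def q_def)
  have "(x + 2 * y)\<^sup>2 \<le> 2 * x\<^sup>2 + 8 * y\<^sup>2"
    using zero_le_power2[of "x - 2 * y"] by (simp add: power2_eq_square algebra_simps)
  then have "\<bar>x + y\<bar> * (x + 2 * y)\<^sup>2 \<le> (p + q) * (2 * p\<^sup>2 + 8 * q\<^sup>2)"
    unfolding p_def q_def by (intro mult_mono) auto
  also have "\<dots> = 2 * (p * p\<^sup>2) + 8 * (q * q\<^sup>2) + 8 * (p * q\<^sup>2) + 2 * (q * p\<^sup>2)"
    by (simp add: algebra_simps)
  also have "\<dots> \<le> 8 * (p\<^sup>2 + p ^ 4 + q\<^sup>2 + q ^ 4)"
    using cube[of p p] cube[of q q] cube[of p q] cube[of q p]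
      zero_le_power2[of p] zero_le_power2[of q] zero_le_power[OF pq(1), of 4] zero_le_power[OF pq(2), of 4]
    by argo
  also have "p\<^sup>2 + p ^ 4 + q\<^sup>2 + q ^ 4 = x\<^sup>2 + x ^ 4 + y\<^sup>2 + y ^ 4"
    by (simp add: p_def q_def)
  finally show ?thesis .
qed

text \<open>Two errors add up: replacing the increment of f by D f' (F) in the Stein identity costs
  8 * L * W, and replacing T by its mean costs A times their L1 distance, which is at most sqrt
  V.\<close>

lemma stein_discrepancy:
  assumes deriv: "\<And>x. (f has_real_derivative f' x) (at x)"
    and f: "\<And>x. \<bar>f x\<bar> \<le> B" and f': "\<And>x. \<bar>f' x\<bar> \<le> A" and lip: "\<And>x y. \<bar>f' x - f' y\<bar> \<le> L * \<bar>x - y\<bar>"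
  shows "\<bar>s2 * E (\<lambda>n. f' (F n)) - E (\<lambda>n. F n * f (F n))\<bar> \<le> A * sqrt V + 8 * L * W"
proof -
  have A: "A \<ge> 0" using f'[of 0] by linarith
  have L: "L \<ge> 0" using lip[of 1 0] by simp
  have tf: "tame (\<lambda>n. f (G n))" for G by (rule tame_bounded[OF f])
  have tf': "tame (\<lambda>n. f' (G n))" for G by (rule tame_bounded[OF f'])
  \<comment> \<open>The derivative is Lipschitz but need not be differentiable, hence the mean value
    theorem, with constant L in place of L / 2.\<close>
  have taylor: "\<bar>f (y + d) - f y - f' y * d\<bar> \<le> L * d\<^sup>2" for y d
  proof -
    have "\<exists>z. \<bar>z - y\<bar> \<le> \<bar>d\<bar> \<and> f (y + d) - f y = d * f' z"
    proof (cases d "0 :: real" rule: linorder_cases)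
      case less
      from MVT2[of "y + d" y f f'] deriv less
      obtain z where "y + d < z" "z < y" "f y - f (y + d) = (y - (y + d)) * f' z" by auto
      then show ?thesis using less by (intro exI[of _ z]) auto
    next
      case greater
      from MVT2[of y "y + d" f f'] deriv greater
      obtain z where "y < z" "z < y + d" "f (y + d) - f y = (y + d - y) * f' z" by auto
      then show ?thesis using greater by (intro exI[of _ z]) auto
    qed auto
    then obtain z where z: "\<bar>z - y\<bar> \<le> \<bar>d\<bar>" "f (y + d) - f y = d * f' z" by blast
    have "\<bar>f (y + d) - f y - f' y * d\<bar> = \<bar>d\<bar> * \<bar>f' z - f' y\<bar>"
      unfolding z(2) abs_mult[symmetric] by (simp add: algebra_simps)
    also have "\<dots> \<le> \<bar>d\<bar> * (L * \<bar>d\<bar>)"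
      using lip[of z y] z(1) L by (intro mult_left_mono) (auto intro: order.trans mult_left_mono)
    finally show ?thesis by (simp add: power2_eq_square mult_ac)
  qed
  have rem: "\<bar>E (\<lambda>n. (h i + lin (a i) n) * (f (F n + D i n) - f (F n)))
      - E (\<lambda>n. (h i + lin (a i) n) * D i n * f' (F n))\<bar> \<le>
      8 * L * ((h i)\<^sup>2 + h i ^ 4 + (\<Sum>j\<in>I. r j * (a i j)\<^sup>2)
       + (3 * (\<Sum>j\<in>I. r j * (a i j)\<^sup>2)\<^sup>2 + (\<Sum>j\<in>I. r j * a i j ^ 4)))" for i
  proof -
    let ?J = "lin (a i)"
    note tame = tame_power tame_mult tame_abs tame_add tame_diff tame_const tame_lin tame_D tf tf'
    have "\<bar>E (\<lambda>n. (h i + ?J n) * (f (F n + D i n) - f (F n))) - E (\<lambda>n. (h i + ?J n) * D i n * f' (F n))\<bar>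
      = \<bar>E (\<lambda>n. (h i + ?J n) * (f (F n + D i n) - f (F n)) - (h i + ?J n) * D i n * f' (F n))\<bar>"
      by (subst E_diff) (intro tame | simp)+
    also have "\<dots> \<le> E (\<lambda>n. \<bar>(h i + ?J n) * (f (F n + D i n) - f (F n)) - (h i + ?J n) * D i n * f' (F n)\<bar>)"
      by (rule integral_abs_bound)
    also have "\<dots> \<le> E (\<lambda>n. (8 * L) * (((h i)\<^sup>2 + h i ^ 4) + ((?J n)\<^sup>2 + (?J n) ^ 4)))"
    proof (rule E_mono)
      fix n
      have "\<bar>(h i + ?J n) * (f (F n + D i n) - f (F n)) - (h i + ?J n) * D i n * f' (F n)\<bar>
        = \<bar>h i + ?J n\<bar> * \<bar>f (F n + D i n) - f (F n) - f' (F n) * D i n\<bar>"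
        unfolding abs_mult[symmetric] by (simp add: algebra_simps)
      also have "\<dots> \<le> \<bar>h i + ?J n\<bar> * (L * (D i n)\<^sup>2)"
        by (intro mult_left_mono taylor) simp
      also have "\<dots> = L * (\<bar>h i + ?J n\<bar> * (h i + 2 * ?J n)\<^sup>2)" by (simp add: D_def)
      also have "\<dots> \<le> L * (8 * ((h i)\<^sup>2 + h i ^ 4 + (?J n)\<^sup>2 + (?J n) ^ 4))"
        by (intro mult_left_mono cubic_bound L)
      finally show "\<bar>(h i + ?J n) * (f (F n + D i n) - f (F n)) - (h i + ?J n) * D i n * f' (F n)\<bar>
          \<le> (8 * L) * (((h i)\<^sup>2 + h i ^ 4) + ((?J n)\<^sup>2 + (?J n) ^ 4))"
        by (simp add: mult_ac add_ac)
    qed (intro tame)+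
    also have "\<dots> = (8 * L) * (((h i)\<^sup>2 + h i ^ 4) + (E (\<lambda>n. (?J n)\<^sup>2) + E (\<lambda>n. (?J n) ^ 4)))"
      by (simp add: E_add tame_add tame_power tame_lin)
    finally show ?thesis by (simp add: E_lin_sq E_lin_4 add_ac)
  qed
  have "E (\<lambda>n. F n * f (F n)) = (\<Sum>i\<in>I. r i * E (\<lambda>n. (h i + lin (a i) n) * (f (F n + D i n) - f (F n))))"
    by (rule stein_identity[OF tf])
  moreover have "E (\<lambda>n. T n * f' (F n)) = (\<Sum>i\<in>I. r i * E (\<lambda>n. (h i + lin (a i) n) * D i n * f' (F n)))"
  proof -
    have "E (\<lambda>n. T n * f' (F n)) = E (\<lambda>n. \<Sum>i\<in>I. r i * ((h i + lin (a i) n) * D i n * f' (F n)))"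
      by (rule arg_cong[of _ _ E]) (simp add: fun_eq_iff T_def sum_distrib_right mult.assoc)
    also have "\<dots> = (\<Sum>i\<in>I. E (\<lambda>n. r i * ((h i + lin (a i) n) * D i n * f' (F n))))"
      by (rule E_sum) (intro tame_mult tame_add tame_const tame_lin tame_D tf')
    finally show ?thesis by simp
  qed
  ultimately have "\<bar>E (\<lambda>n. F n * f (F n)) - E (\<lambda>n. T n * f' (F n))\<bar> \<le>
      (\<Sum>i\<in>I. \<bar>r i * E (\<lambda>n. (h i + lin (a i) n) * (f (F n + D i n) - f (F n)))
        - r i * E (\<lambda>n. (h i + lin (a i) n) * D i n * f' (F n))\<bar>)"
    by (simp add: sum_subtractf[symmetric] sum_abs)
  also have "\<dots> \<le> (\<Sum>i\<in>I. r i * (8 * L * ((h i)\<^sup>2 + h i ^ 4 + (\<Sum>j\<in>I. r j * (a i j)\<^sup>2)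
       + (3 * (\<Sum>j\<in>I. r j * (a i j)\<^sup>2)\<^sup>2 + (\<Sum>j\<in>I. r j * a i j ^ 4)))))"
  proof (rule sum_mono)
    fix i assume "i \<in> I"
    then show "\<bar>r i * E (\<lambda>n. (h i + lin (a i) n) * (f (F n + D i n) - f (F n)))
        - r i * E (\<lambda>n. (h i + lin (a i) n) * D i n * f' (F n))\<bar> \<le>
        r i * (8 * L * ((h i)\<^sup>2 + h i ^ 4 + (\<Sum>j\<in>I. r j * (a i j)\<^sup>2)
       + (3 * (\<Sum>j\<in>I. r j * (a i j)\<^sup>2)\<^sup>2 + (\<Sum>j\<in>I. r j * a i j ^ 4))))"
      using rem[of i] r_pos[of i] by (simp add: abs_mult right_diff_distrib[symmetric])
  qed
  also have "\<dots> = 8 * L * W" by (simp add: W_def sum_distrib_left mult_ac)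
  finally have 1: "\<bar>E (\<lambda>n. F n * f (F n)) - E (\<lambda>n. T n * f' (F n))\<bar> \<le> 8 * L * W" .
  have "\<bar>s2 * E (\<lambda>n. f' (F n)) - E (\<lambda>n. T n * f' (F n))\<bar> = \<bar>E (\<lambda>n. (T n - s2) * f' (F n))\<bar>"
    using E_diff[OF tame_mult[OF tame_T tf'] tame_mult[OF tame_const tf'], of F s2 F]
    by (simp add: left_diff_distrib abs_minus_commute)
  also have "\<dots> \<le> E (\<lambda>n. \<bar>(T n - s2) * f' (F n)\<bar>)" by (rule integral_abs_bound)
  also have "\<dots> \<le> E (\<lambda>n. A * \<bar>T n - s2\<bar>)"
  proof (rule E_mono)
    show "\<bar>(T n - s2) * f' (F n)\<bar> \<le> A * \<bar>T n - s2\<bar>" for n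
      using f'[of "F n"] by (simp add: abs_mult mult.commute mult_right_mono)
  qed (intro tame_mult tame_abs tame_diff tame_T tame_const tf')+
  also have "\<dots> = A * E (\<lambda>n. \<bar>T n - s2\<bar>)" by simp
  also have "\<dots> \<le> A * sqrt V"
  proof (rule mult_left_mono[OF _ A])
    have "E (\<lambda>n. \<bar>T n - s2\<bar>) \<le> sqrt (E (\<lambda>n. (T n - s2)\<^sup>2))"
      by (rule E_abs_le_sqrt) (intro tame_diff tame_T tame_const)
    also have "\<dots> \<le> sqrt V" using E_T_sq by simp
    finally show "E (\<lambda>n. \<bar>T n - s2\<bar>) \<le> sqrt V" .
  qed
  finally show ?thesis using 1 by linarith
qed

end

section \<open>Bounds by the weighted fourth moment\<close>

text \<open>Jensen's inequality for the square under the sub-probability weights r K, obtained by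
  expanding a nonnegative weighted sum of squares of a / K - m.\<close>

lemma weighted_sum_sq_le:
  fixes r a K :: "'j \<Rightarrow> real"
  assumes "finite J" and r: "\<And>j. j \<in> J \<Longrightarrow> r j \<ge> 0" and K: "\<And>j. j \<in> J \<Longrightarrow> K j > 0"
    and le: "(\<Sum>j\<in>J. r j * K j) \<le> 1"
  shows "(\<Sum>j\<in>J. r j * a j)\<^sup>2 \<le> (\<Sum>j\<in>J. r j * ((a j)\<^sup>2 / K j))"
proof -
  define m where "m = (\<Sum>j\<in>J. r j * a j)"
  have "0 \<le> (\<Sum>j\<in>J. r j * K j * (a j / K j - m)\<^sup>2)"
    by (rule sum_nonneg) (use r K in \<open>auto simp: less_imp_le\<close>)
  also have "\<dots> = (\<Sum>j\<in>J. r j * ((a j)\<^sup>2 / K j) - 2 * m * (r j * a j) + m\<^sup>2 * (r j * K j))"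
  proof (rule sum.cong, rule refl)
    fix j assume "j \<in> J"
    then have "K j > 0" by (rule K)
    then show "r j * K j * (a j / K j - m)\<^sup>2 = r j * ((a j)\<^sup>2 / K j) - 2 * m * (r j * a j) + m\<^sup>2 * (r j * K j)"
      by (simp add: field_simps power2_eq_square)
  qed
  also have "\<dots> = (\<Sum>j\<in>J. r j * ((a j)\<^sup>2 / K j)) - 2 * m * m + m\<^sup>2 * (\<Sum>j\<in>J. r j * K j)"
    by (simp add: sum.distrib sum_subtractf sum_distrib_left[symmetric] m_def)
  also have "\<dots> \<le> (\<Sum>j\<in>J. r j * ((a j)\<^sup>2 / K j)) - 2 * m * m + m\<^sup>2 * 1"
    using le by (intro add_left_mono mult_left_mono) auto
  finally show ?thesis by (simp add: m_def power2_eq_square)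
qed

text \<open>The arithmetic-geometric mean inequality, balanced so that y = a^2 reproduces the
  summand a^4 / K^3 of the fourth moment while x^2 * K can be summed through the row or column sums
  of K.\<close>

lemma mult_div_le_half:
  fixes x y K :: real
  assumes "K > 0"
  shows "x * y / K \<le> (x\<^sup>2 * K + y\<^sup>2 / K ^ 3) / 2"
proof -
  have "0 \<le> K * (x - y / K\<^sup>2)\<^sup>2" using assms by simp
  also have "\<dots> = x\<^sup>2 * K + y\<^sup>2 / K ^ 3 - 2 * (x * y / K)"
    using assms by (simp add: power2_eq_square power3_eq_cube field_simps)
  finally show ?thesis by (simp add: mult_ac)
qed

locale weighted_kernel = finite_kernel I r a for I :: "'i set" and r a +
  fixes K :: "'i \<Rightarrow> 'i \<Rightarrow> real" and k :: real
  assumes K_pos: "\<And>i j. i \<in> I \<Longrightarrow> j \<in> I \<Longrightarrow> K i j > 0"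
    and K_le: "\<And>i j. i \<in> I \<Longrightarrow> j \<in> I \<Longrightarrow> K i j \<le> k"
    and row: "\<And>i. i \<in> I \<Longrightarrow> (\<Sum>j\<in>I. r j * K i j) \<le> 1"
    and col: "\<And>j. j \<in> I \<Longrightarrow> (\<Sum>i\<in>I. r i * K i j) \<le> 1"
    and k_nonneg: "k \<ge> 0"
begin

definition m :: "'i \<Rightarrow> real" where "m i = (\<Sum>j\<in>I. r j * (a i j ^ 4 / K i j ^ 3))"
definition M :: real where "M = (\<Sum>i\<in>I. r i * m i)"
text \<open>An intermediate scale between rows and fourth moments: Jensen's inequality gives h^2
  \<le> 4 q and q^2 \<le> m, and K \<le> k gives \<beta> \<le> k q.\<close>

definition q :: "'i \<Rightarrow> real" where "q i = (\<Sum>j\<in>I. r j * ((a i j)\<^sup>2 / K i j))"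
definition \<beta> :: "'i \<Rightarrow> real" where "\<beta> i = (\<Sum>j\<in>I. r j * (a i j)\<^sup>2)"

lemma r_nonneg: "i \<in> I \<Longrightarrow> r i \<ge> 0"
  using r_pos by (simp add: less_imp_le)
lemma m_nonneg: "i \<in> I \<Longrightarrow> m i \<ge> 0"
  unfolding m_def by (intro sum_nonneg mult_nonneg_nonneg r_nonneg divide_nonneg_pos zero_less_power K_pos) auto
lemma \<beta>_nonneg: "i \<in> I \<Longrightarrow> \<beta> i \<ge> 0"
  unfolding \<beta>_def by (intro sum_nonneg mult_nonneg_nonneg r_nonneg) auto

lemma M_alt: "M = (\<Sum>i\<in>I. \<Sum>j\<in>I. r i * r j * (a i j ^ 4 / K i j ^ 3))"
  by (simp add: M_def m_def sum_distrib_left mult_ac)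

lemma q_sq_le: assumes i: "i \<in> I" shows "(q i)\<^sup>2 \<le> m i"
proof -
  have "(q i)\<^sup>2 \<le> (\<Sum>j\<in>I. r j * (((a i j)\<^sup>2 / K i j)\<^sup>2 / K i j))"
    unfolding q_def by (rule weighted_sum_sq_le) (use finite_I r_nonneg K_pos row i in auto)
  also have "\<dots> = m i"
    unfolding m_def by (intro sum.cong refl) (simp add: power2_eq_square power_numeral_reduce)
  finally show ?thesis .
qed

lemma h_sq_le: assumes i: "i \<in> I" shows "(h i)\<^sup>2 \<le> 4 * q i"
proof -
  have "(\<Sum>j\<in>I. r j * a i j)\<^sup>2 \<le> q i"
    unfolding q_def by (rule weighted_sum_sq_le) (use finite_I r_nonneg K_pos row i in auto)
  then show ?thesis unfolding h_def power_mult_distrib by simp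
qed

lemma h_4_le: assumes i: "i \<in> I" shows "h i ^ 4 \<le> 16 * m i"
proof -
  have "h i ^ 4 = ((h i)\<^sup>2)\<^sup>2" by simp
  also have "\<dots> \<le> (4 * q i)\<^sup>2" using h_sq_le[OF i] by (intro power_mono) auto
  also have "\<dots> \<le> 16 * m i" using q_sq_le[OF i] by (simp add: power_mult_distrib)
  finally show ?thesis .
qed

lemma q_le: assumes i: "i \<in> I" shows "q i \<le> (1 + m i) / 2"
  using q_sq_le[OF i] zero_le_power2[of "q i - 1"] by (simp add: power2_diff)

lemma \<beta>_le: assumes i: "i \<in> I" shows "\<beta> i \<le> k * q i"
  unfolding \<beta>_def q_def sum_distrib_left
proof (rule sum_mono)
  fix j assume j: "j \<in> I"
  have "(a i j)\<^sup>2 * K i j \<le> (a i j)\<^sup>2 * k" using K_le[OF i j] by (intro mult_left_mono) auto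
  then have "(a i j)\<^sup>2 \<le> k * ((a i j)\<^sup>2 / K i j)" using K_pos[OF i j] by (simp add: field_simps)
  then have "r j * (a i j)\<^sup>2 \<le> r j * (k * ((a i j)\<^sup>2 / K i j))"
    using r_nonneg[OF j] by (rule mult_left_mono)
  then show "r j * (a i j)\<^sup>2 \<le> k * (r j * ((a i j)\<^sup>2 / K i j))" by (simp add: mult_ac)
qed

lemma \<beta>_sq_le: assumes i: "i \<in> I" shows "(\<beta> i)\<^sup>2 \<le> k\<^sup>2 * m i"
proof -
  have "(\<beta> i)\<^sup>2 \<le> (k * q i)\<^sup>2" using \<beta>_le[OF i] \<beta>_nonneg[OF i] by (rule power_mono)
  also have "\<dots> \<le> k\<^sup>2 * m i"
    unfolding power_mult_distrib using q_sq_le[OF i] by (intro mult_left_mono) auto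
  finally show ?thesis .
qed

lemma a_4_le: assumes i: "i \<in> I" shows "(\<Sum>j\<in>I. r j * a i j ^ 4) \<le> k ^ 3 * m i"
  unfolding m_def sum_distrib_left
proof (rule sum_mono)
  fix j assume j: "j \<in> I"
  have "K i j ^ 3 \<le> k ^ 3" using K_le[OF i j] K_pos[OF i j] by (intro power_mono) auto
  then have "a i j ^ 4 * K i j ^ 3 \<le> a i j ^ 4 * k ^ 3" by (intro mult_left_mono) auto
  then have "a i j ^ 4 \<le> k ^ 3 * (a i j ^ 4 / K i j ^ 3)" using K_pos[OF i j] by (simp add: field_simps)
  then have "r j * a i j ^ 4 \<le> r j * (k ^ 3 * (a i j ^ 4 / K i j ^ 3))"
    using r_nonneg[OF j] by (rule mult_left_mono)
  then show "r j * a i j ^ 4 \<le> k ^ 3 * (r j * (a i j ^ 4 / K i j ^ 3))" by (simp add: mult_ac)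
qed

text \<open>Terms linear in q are turned into (1 + m) / 2, and this 1 is where the total mass of the
  intensity comes in. The 18 collects 2 from h^2 and 16 from h^4; the powers of k come from \<beta>,
  \<beta>^2 and the fourth powers of the kernel.\<close>

lemma W_le: "W \<le> (18 + k + 3 * k\<^sup>2 + k ^ 3) * (M + (\<Sum>i\<in>I. r i))"
proof -
  have "W \<le> (\<Sum>i\<in>I. r i * ((18 + k + 3 * k\<^sup>2 + k ^ 3) * (m i + 1)))"
    unfolding W_def
  proof (intro sum_mono mult_left_mono r_nonneg)
    fix i assume i: "i \<in> I"
    have m: "0 \<le> m i" by (rule m_nonneg[OF i])
    have "(h i)\<^sup>2 + h i ^ 4 + \<beta> i + (3 * (\<beta> i)\<^sup>2 + (\<Sum>j\<in>I. r j * a i j ^ 4))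
      \<le> 4 * ((1 + m i) / 2) + 16 * m i + k * ((1 + m i) / 2) + (3 * (k\<^sup>2 * m i) + k ^ 3 * m i)"
      using h_sq_le[OF i] h_4_le[OF i] \<beta>_sq_le[OF i] a_4_le[OF i] q_le[OF i]
        order.trans[OF \<beta>_le[OF i] mult_left_mono[OF q_le[OF i] k_nonneg]] by linarith
    also have "\<dots> \<le> (18 + k + 3 * k\<^sup>2 + k ^ 3) * (m i + 1)"
    proof -
      have "0 \<le> k * m i" "0 \<le> k\<^sup>2" "0 \<le> k ^ 3" using m k_nonneg by auto
      moreover have "(18 + k + 3 * k\<^sup>2 + k ^ 3) * (m i + 1)
          - (4 * ((1 + m i) / 2) + 16 * m i + k * ((1 + m i) / 2) + (3 * (k\<^sup>2 * m i) + k ^ 3 * m i))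
          = 16 + k / 2 + k * m i / 2 + 3 * k\<^sup>2 + k ^ 3"
        by (simp add: field_simps)
      ultimately show ?thesis using k_nonneg by linarith
    qed
    finally show "(h i)\<^sup>2 + h i ^ 4 + (\<Sum>j\<in>I. r j * (a i j)\<^sup>2) + (3 * (\<Sum>j\<in>I. r j * (a i j)\<^sup>2)\<^sup>2
        + (\<Sum>j\<in>I. r j * a i j ^ 4)) \<le> (18 + k + 3 * k\<^sup>2 + k ^ 3) * (m i + 1)"
      by (simp add: \<beta>_def)
  qed
  also have "\<dots> = (18 + k + 3 * k\<^sup>2 + k ^ 3) * (M + (\<Sum>i\<in>I. r i))"
    by (simp add: M_def sum_distrib_left sum.distrib[symmetric] algebra_simps)
  finally show ?thesis .
qed

text \<open>Jensen's inequality over i uses the column sums of K. After splitting with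
  \<open>mult_div_le_half\<close>, the part with h^4 is summed over j through the row sums. The
  constant is (16 + 1) / 2, with 16 from \<open>h_4_le\<close>.\<close>

lemma linear_part_le: "(\<Sum>j\<in>I. r j * (\<Sum>i\<in>I. r i * h i * a i j)\<^sup>2) \<le> 17 / 2 * M"
proof -
  have "(\<Sum>j\<in>I. r j * (\<Sum>i\<in>I. r i * h i * a i j)\<^sup>2) \<le>
      (\<Sum>j\<in>I. r j * (\<Sum>i\<in>I. r i * ((h i ^ 4 * K i j + a i j ^ 4 / K i j ^ 3) / 2)))"
  proof (intro sum_mono mult_left_mono r_nonneg)
    fix j assume j: "j \<in> I"
    have "(\<Sum>i\<in>I. r i * h i * a i j)\<^sup>2 = (\<Sum>i\<in>I. r i * (h i * a i j))\<^sup>2" by (simp add: mult_ac)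
    also have "\<dots> \<le> (\<Sum>i\<in>I. r i * ((h i * a i j)\<^sup>2 / K i j))"
      by (rule weighted_sum_sq_le) (use finite_I r_nonneg K_pos col j in auto)
    also have "\<dots> \<le> (\<Sum>i\<in>I. r i * ((h i ^ 4 * K i j + a i j ^ 4 / K i j ^ 3) / 2))"
    proof (intro sum_mono mult_left_mono r_nonneg)
      fix i assume i: "i \<in> I"
      show "(h i * a i j)\<^sup>2 / K i j \<le> (h i ^ 4 * K i j + a i j ^ 4 / K i j ^ 3) / 2"
        using mult_div_le_half[OF K_pos[OF i j], of "(h i)\<^sup>2" "(a i j)\<^sup>2"] by (simp add: power_mult_distrib)
    qed
    finally show "(\<Sum>i\<in>I. r i * h i * a i j)\<^sup>2 \<le> (\<Sum>i\<in>I. r i * ((h i ^ 4 * K i j + a i j ^ 4 / K i j ^ 3) / 2))" .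
  qed
  also have "\<dots> = (\<Sum>j\<in>I. \<Sum>i\<in>I. (r i * h i ^ 4 * (r j * K i j) + r i * r j * (a i j ^ 4 / K i j ^ 3)) / 2)"
    unfolding sum_distrib_left by (simp add: algebra_simps)
  also have "\<dots> = ((\<Sum>i\<in>I. r i * h i ^ 4 * (\<Sum>j\<in>I. r j * K i j)) + M) / 2"
    unfolding M_alt by (subst sum.swap) (simp add: sum_divide_distrib[symmetric] sum.distrib sum_distrib_left)
  also have "\<dots> \<le> ((\<Sum>i\<in>I. r i * (16 * m i)) + M) / 2"
  proof -
    have "(\<Sum>i\<in>I. r i * h i ^ 4 * (\<Sum>j\<in>I. r j * K i j)) \<le> (\<Sum>i\<in>I. r i * (16 * m i))"
    proof (rule sum_mono)
      fix i assume i: "i \<in> I"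
      have "r i * h i ^ 4 * (\<Sum>j\<in>I. r j * K i j) \<le> r i * h i ^ 4 * 1"
        using row[OF i] r_nonneg[OF i] by (intro mult_left_mono) auto
      also have "\<dots> \<le> r i * (16 * m i)"
        using h_4_le[OF i] r_nonneg[OF i] by (simp add: mult_left_mono)
      finally show "r i * h i ^ 4 * (\<Sum>j\<in>I. r j * K i j) \<le> r i * (16 * m i)" .
    qed
    then show ?thesis by simp
  qed
  also have "(\<Sum>i\<in>I. r i * (16 * m i)) = 16 * M"
    by (simp add: M_def sum_distrib_left mult.left_commute)
  also have "(16 * M + M) / 2 = 17 / 2 * M" by simp
  finally show ?thesis .
qed

lemma \<beta>_sum_le: "(\<Sum>j\<in>I. r j * (\<beta> j)\<^sup>2) \<le> k\<^sup>2 * M"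
proof -
  have "(\<Sum>j\<in>I. r j * (\<beta> j)\<^sup>2) \<le> (\<Sum>j\<in>I. r j * (k\<^sup>2 * m j))"
    by (intro sum_mono mult_left_mono \<beta>_sq_le r_nonneg)
  also have "\<dots> = k\<^sup>2 * M" by (simp add: M_def sum_distrib_left mult_ac)
  finally show ?thesis .
qed

lemma \<beta>_eq: "j \<in> I \<Longrightarrow> (\<Sum>i\<in>I. r i * a i j * a i j) = \<beta> j"
  unfolding \<beta>_def by (intro sum.cong refl) (simp add: a_sym power2_eq_square)

lemma diagonal_part_le: "(\<Sum>j\<in>I. r j * (\<Sum>i\<in>I. r i * a i j * a i j)\<^sup>2) \<le> k\<^sup>2 * M"
  using \<beta>_sum_le by (simp add: \<beta>_eq)

text \<open>The contraction norm: one of the two kernels in each entry of the contraction is absorbed by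
  the Cauchy--Schwarz bound \<open>\<bar>b\<^sub>j\<^sub>k\<bar> \<le> \<surd>(\<beta>\<^sub>j \<beta>\<^sub>k)\<close>, after which the sums over \<open>j\<close> and \<open>k\<close> decouple.\<close>

lemma contraction_le:
  "(\<Sum>j\<in>I. \<Sum>l\<in>I. r j * r l * (\<Sum>i\<in>I. r i * a i j * a i l)\<^sup>2) \<le> (1 + k\<^sup>2) / 2 * M"
proof -
  let ?b = "\<lambda>j l. \<Sum>i\<in>I. r i * a i j * a i l"
  define s where "s = (\<lambda>j. sqrt (\<beta> j))"
  have s: "s j \<ge> 0" "(s j)\<^sup>2 = \<beta> j" if "j \<in> I" for j
    using \<beta>_nonneg[OF that] by (auto simp: s_def)
  have b1: "\<bar>?b j l\<bar> \<le> s j * s l" if j: "j \<in> I" and l: "l \<in> I" for j l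
  proof -
    have "(?b j l)\<^sup>2 = (\<Sum>i\<in>I. (sqrt (r i) * a i j) * (sqrt (r i) * a i l))\<^sup>2"
    proof (intro arg_cong[of _ _ "\<lambda>x. x\<^sup>2"] sum.cong refl)
      fix i assume i: "i \<in> I"
      have "(sqrt (r i) * a i j) * (sqrt (r i) * a i l) = (sqrt (r i) * sqrt (r i)) * (a i j * a i l)"
        by (simp only: mult_ac)
      then show "r i * a i j * a i l = (sqrt (r i) * a i j) * (sqrt (r i) * a i l)"
        using r_nonneg[OF i] by simp
    qed
    also have "\<dots> \<le> (\<Sum>i\<in>I. (sqrt (r i) * a i j)\<^sup>2) * (\<Sum>i\<in>I. (sqrt (r i) * a i l)\<^sup>2)"
      by (rule Cauchy_Schwarz_ineq_sum)
    also have "\<dots> = (s j * s l)\<^sup>2"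
      unfolding power_mult_distrib s(2)[OF j] s(2)[OF l] \<beta>_eq[OF j, symmetric] \<beta>_eq[OF l, symmetric]
      by (simp add: r_nonneg power2_eq_square mult_ac)
    finally show ?thesis
      using s(1)[OF j] s(1)[OF l] by (simp add: abs_le_square_iff[symmetric] abs_mult)
  qed
  have b2: "\<bar>?b j l\<bar> \<le> (\<Sum>i\<in>I. r i * (\<bar>a i j\<bar> * \<bar>a i l\<bar>))" for j l
    by (rule order.trans[OF sum_abs]) (auto simp: abs_mult r_nonneg mult.assoc intro!: sum_mono)
  have "(\<Sum>j\<in>I. \<Sum>l\<in>I. r j * r l * (?b j l)\<^sup>2) \<le>
      (\<Sum>j\<in>I. \<Sum>l\<in>I. r j * r l * ((s j * s l) * (\<Sum>i\<in>I. r i * (\<bar>a i j\<bar> * \<bar>a i l\<bar>))))"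
  proof (intro sum_mono mult_left_mono)
    fix j l assume jl: "j \<in> I" "l \<in> I"
    have "\<bar>?b j l\<bar> * \<bar>?b j l\<bar> \<le> (s j * s l) * (\<Sum>i\<in>I. r i * (\<bar>a i j\<bar> * \<bar>a i l\<bar>))"
      using b1[OF jl] b2[of j l] s(1) jl by (intro mult_mono) auto
    then show "(?b j l)\<^sup>2 \<le> (s j * s l) * (\<Sum>i\<in>I. r i * (\<bar>a i j\<bar> * \<bar>a i l\<bar>))"
      by (simp add: power2_eq_square)
  qed (simp add: r_nonneg)
  also have "\<dots> = (\<Sum>i\<in>I. r i * (\<Sum>j\<in>I. r j * (\<bar>a i j\<bar> * s j))\<^sup>2)"
  proof -
    have "(\<Sum>j\<in>I. \<Sum>l\<in>I. r j * r l * ((s j * s l) * (\<Sum>i\<in>I. r i * (\<bar>a i j\<bar> * \<bar>a i l\<bar>)))) =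
       (\<Sum>j\<in>I. \<Sum>l\<in>I. \<Sum>i\<in>I. r i * ((r j * (\<bar>a i j\<bar> * s j)) * (r l * (\<bar>a i l\<bar> * s l))))"
      by (simp add: sum_distrib_left mult_ac)
    also have "\<dots> = (\<Sum>j\<in>I. \<Sum>i\<in>I. \<Sum>l\<in>I. r i * ((r j * (\<bar>a i j\<bar> * s j)) * (r l * (\<bar>a i l\<bar> * s l))))"
      by (rule sum.cong, rule refl, rule sum.swap)
    also have "\<dots> = (\<Sum>i\<in>I. \<Sum>j\<in>I. \<Sum>l\<in>I. r i * ((r j * (\<bar>a i j\<bar> * s j)) * (r l * (\<bar>a i l\<bar> * s l))))"
      by (rule sum.swap)
    also have "\<dots> = (\<Sum>i\<in>I. r i * (\<Sum>j\<in>I. r j * (\<bar>a i j\<bar> * s j))\<^sup>2)"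
      by (simp only: power2_eq_square sum_product, simp only: sum_distrib_left)
    finally show ?thesis .
  qed
  also have "\<dots> \<le> (\<Sum>i\<in>I. r i * (\<Sum>j\<in>I. r j * (((\<beta> j)\<^sup>2 * K i j + a i j ^ 4 / K i j ^ 3) / 2)))"
  proof (intro sum_mono mult_left_mono r_nonneg)
    fix i assume i: "i \<in> I"
    have "(\<Sum>j\<in>I. r j * (\<bar>a i j\<bar> * s j))\<^sup>2 \<le> (\<Sum>j\<in>I. r j * ((\<bar>a i j\<bar> * s j)\<^sup>2 / K i j))"
      by (rule weighted_sum_sq_le) (use finite_I r_nonneg K_pos row i in auto)
    also have "\<dots> \<le> (\<Sum>j\<in>I. r j * (((\<beta> j)\<^sup>2 * K i j + a i j ^ 4 / K i j ^ 3) / 2))"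
    proof (intro sum_mono mult_left_mono r_nonneg)
      fix j assume j: "j \<in> I"
      show "(\<bar>a i j\<bar> * s j)\<^sup>2 / K i j \<le> ((\<beta> j)\<^sup>2 * K i j + a i j ^ 4 / K i j ^ 3) / 2"
        using mult_div_le_half[OF K_pos[OF i j], of "\<beta> j" "(a i j)\<^sup>2"] s(2)[OF j]
        by (simp add: power_mult_distrib mult.commute)
    qed
    finally show "(\<Sum>j\<in>I. r j * (\<bar>a i j\<bar> * s j))\<^sup>2 \<le>
      (\<Sum>j\<in>I. r j * (((\<beta> j)\<^sup>2 * K i j + a i j ^ 4 / K i j ^ 3) / 2))" .
  qed
  also have "\<dots> = (\<Sum>i\<in>I. \<Sum>j\<in>I. (r j * (\<beta> j)\<^sup>2 * (r i * K i j) + r i * r j * (a i j ^ 4 / K i j ^ 3)) / 2)"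
    unfolding sum_distrib_left by (simp add: algebra_simps)
  also have "\<dots> = ((\<Sum>i\<in>I. \<Sum>j\<in>I. r j * (\<beta> j)\<^sup>2 * (r i * K i j)) + M) / 2"
    unfolding M_alt by (simp add: sum_divide_distrib[symmetric] sum.distrib)
  also have "(\<Sum>i\<in>I. \<Sum>j\<in>I. r j * (\<beta> j)\<^sup>2 * (r i * K i j)) = (\<Sum>j\<in>I. r j * (\<beta> j)\<^sup>2 * (\<Sum>i\<in>I. r i * K i j))"
    by (subst sum.swap) (simp add: sum_distrib_left)
  also have "(\<Sum>j\<in>I. r j * (\<beta> j)\<^sup>2 * (\<Sum>i\<in>I. r i * K i j)) \<le> (\<Sum>j\<in>I. r j * (\<beta> j)\<^sup>2 * 1)"
    by (intro sum_mono mult_left_mono col mult_nonneg_nonneg r_nonneg) auto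
  also have "\<dots> \<le> k\<^sup>2 * M" using \<beta>_sum_le by simp
  finally show ?thesis by (simp add: field_simps)
qed

text \<open>The constants are 161 = 18 * 17 / 2 + 8 and 16 = 8 + 8, from the linear part, the
  contraction norm and the diagonal.\<close>

lemma V_le: "V \<le> (161 + 16 * k\<^sup>2) * M"
  unfolding V_def using linear_part_le diagonal_part_le contraction_le by (simp add: algebra_simps)

end

section \<open>Poisson processes of finite intensity\<close>

text \<open>Independence is encoded in the joint law of the counts of finitely many disjoint sets,
  which is what the counts of cells require. Counts are finite for every \<omega>, so that
  \<open>\<xi> \<omega>\<close> and its square are finite measures without an exceptional
  set.\<close>

locale poisson_process =
  fixes P :: "'w measure" and \<mu> :: "'z measure" and \<xi> :: "'w \<Rightarrow> 'z measure"
  assumes prob_P: "prob_space P" and finite_\<mu>: "finite_measure \<mu>"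
    and sets_\<xi>: "\<And>\<omega>. \<omega> \<in> space P \<Longrightarrow> sets (\<xi> \<omega>) = sets \<mu>"
    and count_\<xi>: "\<And>\<omega> A. \<omega> \<in> space P \<Longrightarrow> A \<in> sets \<mu> \<Longrightarrow> \<exists>k::nat. emeasure (\<xi> \<omega>) A = of_nat k"
    and meas_\<xi>: "\<And>A. A \<in> sets \<mu> \<Longrightarrow> (\<lambda>\<omega>. emeasure (\<xi> \<omega>) A) \<in> borel_measurable P"
    and law_\<xi>: "\<And>(J :: nat set) A k. finite J \<Longrightarrow> (\<And>j. j \<in> J \<Longrightarrow> A j \<in> sets \<mu>) \<Longrightarrow> disjoint_family_on A J \<Longrightarrow>
      measure P {\<omega> \<in> space P. \<forall>j\<in>J. emeasure (\<xi> \<omega>) (A j) = of_nat (k j)} =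
      (\<Prod>j\<in>J. measure \<mu> (A j) ^ k j / fact (k j) * exp (- measure \<mu> (A j)))"
begin

sublocale P: prob_space P by (rule prob_P)
sublocale \<mu>: finite_measure \<mu> by (rule finite_\<mu>)
sublocale \<mu>\<mu>: pair_sigma_finite \<mu> \<mu> ..

lemma space_\<xi>: "\<omega> \<in> space P \<Longrightarrow> space (\<xi> \<omega>) = space \<mu>"
  using sets_\<xi> sets_eq_imp_space_eq by blast

lemma finite_\<xi>:
  assumes "\<omega> \<in> space P" shows "finite_measure (\<xi> \<omega>)"
proof
  obtain k :: nat where "emeasure (\<xi> \<omega>) (space \<mu>) = of_nat k"
    using count_\<xi>[OF assms, of "space \<mu>"] by auto
  then show "emeasure (\<xi> \<omega>) (space (\<xi> \<omega>)) \<noteq> \<infinity>"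
    using space_\<xi>[OF assms] by simp
qed

definition num :: "'z set \<Rightarrow> 'w \<Rightarrow> nat" where
  "num A \<omega> = (THE k. emeasure (\<xi> \<omega>) A = of_nat k)"

lemma emeasure_\<xi>: "\<omega> \<in> space P \<Longrightarrow> A \<in> sets \<mu> \<Longrightarrow> emeasure (\<xi> \<omega>) A = of_nat (num A \<omega>)"
  using count_\<xi>[of \<omega> A] unfolding num_def by auto

lemma measure_\<xi>: "\<omega> \<in> space P \<Longrightarrow> A \<in> sets \<mu> \<Longrightarrow> measure (\<xi> \<omega>) A = real (num A \<omega>)"
  by (simp add: measure_def emeasure_\<xi>)

lemma emeasure_\<xi>_eq_iff: "\<omega> \<in> space P \<Longrightarrow> A \<in> sets \<mu> \<Longrightarrow> emeasure (\<xi> \<omega>) A = of_nat k \<longleftrightarrow> num A \<omega> = k"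
  by (simp add: emeasure_\<xi>)

lemma measurable_num [measurable]:
  assumes "A \<in> sets \<mu>" shows "num A \<in> measurable P (count_space UNIV)"
proof (rule measurable_count_space_eq_countable[THEN iffD2])
  show "num A \<in> space P \<rightarrow> UNIV \<and> (\<forall>a\<in>UNIV. num A -` {a} \<inter> space P \<in> sets P)"
  proof (intro conjI ballI)
    fix k
    have "num A -` {k} \<inter> space P = (\<lambda>\<omega>. emeasure (\<xi> \<omega>) A) -` {of_nat k} \<inter> space P"
      using emeasure_\<xi>_eq_iff[OF _ assms] by auto
    also have "\<dots> \<in> sets P" using meas_\<xi>[OF assms] by (rule measurable_sets) simp
    finally show "num A -` {k} \<inter> space P \<in> sets P" .
  qed simp
qed simp

lemma prob_num_zero:
  assumes A: "A \<in> sets \<mu>" and "measure \<mu> A = 0"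
  shows "AE \<omega> in P. num A \<omega> = 0"
proof -
  have "P.prob {\<omega> \<in> space P. \<forall>j\<in>{0::nat}. emeasure (\<xi> \<omega>) A = of_nat ((\<lambda>_. 0) j)} = 1"
    by (subst law_\<xi>) (use assms in \<open>auto simp: disjoint_family_on_def\<close>)
  then have "P.prob {\<omega> \<in> space P. num A \<omega> = 0} = 1"
    using emeasure_\<xi>_eq_iff[OF _ A, of _ 0] by (simp cong: conj_cong)
  then show ?thesis
    by (subst (asm) P.prob_Collect_eq_1) (use A in auto)
qed

text \<open>The value 0 outside J is the default value of the \<open>Pi_pmf\<close> behind
  \<open>law\<close>, so that the two laws can be equal.\<close>

definition counts :: "nat set \<Rightarrow> (nat \<Rightarrow> 'z set) \<Rightarrow> 'w \<Rightarrow> nat \<Rightarrow> nat" where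
  "counts J A \<omega> = (\<lambda>j. if j \<in> J then num (A j) \<omega> else 0)"

lemma countable_finite_support:
  assumes "finite (J :: nat set)" shows "countable {f :: nat \<Rightarrow> nat. \<forall>j. j \<notin> J \<longrightarrow> f j = 0}"
proof (rule countable_subset)
  show "{f :: nat \<Rightarrow> nat. \<forall>j. j \<notin> J \<longrightarrow> f j = 0} \<subseteq> (\<lambda>h j. if j \<in> J then h j else 0) ` (PiE J (\<lambda>_. UNIV))"
  proof
    fix f :: "nat \<Rightarrow> nat" assume "f \<in> {f. \<forall>j. j \<notin> J \<longrightarrow> f j = 0}"
    then have "f = (\<lambda>h j. if j \<in> J then h j else 0) (restrict f J)" by (auto simp: fun_eq_iff)
    moreover have "restrict f J \<in> PiE J (\<lambda>_. UNIV)" by simp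
    ultimately show "f \<in> (\<lambda>h j. if j \<in> J then h j else 0) ` (PiE J (\<lambda>_. UNIV))" by (rule image_eqI)
  qed
  show "countable ((\<lambda>h j. if j \<in> J then h j else (0::nat)) ` (PiE J (\<lambda>_. UNIV)))"
    by (intro countable_image countable_PiE assms) auto
qed

text \<open>The target carries the discrete \<sigma>-algebra of an uncountable function space, but
  only countably many functions vanish outside the finite set J.\<close>

lemma measurable_counts:
  assumes J: "finite J" and A: "\<And>j. j \<in> J \<Longrightarrow> A j \<in> sets \<mu>"
  shows "counts J A \<in> measurable P (count_space UNIV)"
proof (rule measurableI)
  fix X :: "(nat \<Rightarrow> nat) set"
  let ?R = "{f :: nat \<Rightarrow> nat. \<forall>j. j \<notin> J \<longrightarrow> f j = 0}"
  have "counts J A -` X \<inter> space P = (\<Union>v\<in>?R \<inter> X. {\<omega> \<in> space P. counts J A \<omega> = v})"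
    by (auto simp: counts_def)
  also have "\<dots> \<in> sets P"
  proof (rule sets.countable_UN'')
    show "countable (?R \<inter> X)" using countable_finite_support[OF J] by auto
    fix v assume v: "v \<in> ?R \<inter> X"
    have "{\<omega> \<in> space P. counts J A \<omega> = v} = {\<omega> \<in> space P. \<forall>j\<in>J. num (A j) \<omega> = v j}"
      using v by (auto simp: counts_def fun_eq_iff)
    also have "\<dots> \<in> sets P"
      by (rule sets.sets_Collect_finite_All[OF _ J]) (use measurable_num[OF A] in measurable)
    finally show "{\<omega> \<in> space P. counts J A \<omega> = v} \<in> sets P" .
  qed
  finally show "counts J A -` X \<inter> space P \<in> sets P" .
qed simp

lemma distr_counts:
  assumes J: "finite J" and A: "\<And>j. j \<in> J \<Longrightarrow> A j \<in> sets \<mu>" and disj: "disjoint_family_on A J"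
    and pos: "\<And>j. j \<in> J \<Longrightarrow> measure \<mu> (A j) > 0"
  shows "distr P (count_space UNIV) (counts J A) =
    measure_pmf (finite_poisson.law J (\<lambda>j. measure \<mu> (A j)))"
proof -
  interpret fp: finite_poisson J "\<lambda>j. measure \<mu> (A j)"
    by unfold_locales (use J pos in auto)
  let ?R = "{f :: nat \<Rightarrow> nat. \<forall>j. j \<notin> J \<longrightarrow> f j = 0}"
  note [measurable] = measurable_counts[OF J A]
  show ?thesis
  proof (rule measure_eqI_countable_AE[of _ _ ?R])
    show "countable ?R" by (rule countable_finite_support[OF J])
    show "AE x in distr P (count_space UNIV) (counts J A). x \<in> ?R"
      by (subst AE_distr_iff) (auto simp: counts_def)
    show "AE x in fp.law. x \<in> ?R"
      using set_Pi_pmf_subset[OF J, of 0 "\<lambda>i. poisson_pmf (measure \<mu> (A i))"]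
      by (auto simp: AE_measure_pmf_iff fp.law_def)
    fix v assume v: "v \<in> ?R"
    have "counts J A -` {v} \<inter> space P = {\<omega> \<in> space P. \<forall>j\<in>J. emeasure (\<xi> \<omega>) (A j) = of_nat (v j)}"
      using v emeasure_\<xi>_eq_iff A by (auto simp: counts_def fun_eq_iff)
    then have "measure (distr P (count_space UNIV) (counts J A)) {v} =
      (\<Prod>j\<in>J. measure \<mu> (A j) ^ v j / fact (v j) * exp (- measure \<mu> (A j)))"
      by (subst measure_distr) (use law_\<xi>[OF J A disj] in auto)
    also have "\<dots> = pmf fp.law v"
      unfolding fp.law_def using v pos by (subst pmf_Pi'[OF J]) (auto intro!: prod.cong)
    finally show "emeasure (distr P (count_space UNIV) (counts J A)) {v} = emeasure fp.law {v}"
      using finite_measure.emeasure_eq_measure[OF P.finite_measure_distr, of "counts J A" "count_space UNIV" "{v}"]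
      by (simp add: emeasure_pmf_single)
  qed auto
qed

lemma nn_integral_num:
  assumes A: "A \<in> sets \<mu>"
  shows "(\<integral>\<^sup>+ \<omega>. emeasure (\<xi> \<omega>) A \<partial>P) = emeasure \<mu> A"
proof (cases "measure \<mu> A = 0")
  case True
  have "(\<integral>\<^sup>+ \<omega>. emeasure (\<xi> \<omega>) A \<partial>P) = (\<integral>\<^sup>+ \<omega>. 0 \<partial>P)"
    by (rule nn_integral_cong_AE) (use prob_num_zero[OF A True] emeasure_\<xi>[OF _ A] in auto)
  then show ?thesis using True by (simp add: \<mu>.emeasure_eq_measure)
next
  case False
  then have pos: "measure \<mu> A > 0" by (simp add: zero_less_measure_iff)
  interpret fp: finite_poisson "{0::nat}" "\<lambda>j. measure \<mu> A"
    by unfold_locales (use pos in auto)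
  have d: "distr P (count_space UNIV) (counts {0} (\<lambda>_. A)) = measure_pmf fp.law"
    by (rule distr_counts) (use A pos in \<open>auto simp: disjoint_family_on_def\<close>)
  have "(\<integral>\<^sup>+ \<omega>. emeasure (\<xi> \<omega>) A \<partial>P) = (\<integral>\<^sup>+ \<omega>. of_nat (counts {0} (\<lambda>_. A) \<omega> 0) \<partial>P)"
    by (rule nn_integral_cong) (simp add: emeasure_\<xi>[OF _ A] counts_def)
  also have "\<dots> = (\<integral>\<^sup>+ v. of_nat (v 0) * 1 \<partial>fp.law)"
    unfolding d[symmetric] by (subst nn_integral_distr) (use A in \<open>auto intro!: measurable_counts\<close>)
  also have "\<dots> = emeasure \<mu> A"
    by (subst fp.nn_integral_shift) (auto simp: \<mu>.emeasure_eq_measure)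
  finally show ?thesis .
qed

lemma nn_integral_num_sq:
  assumes A: "A \<in> sets \<mu>"
  shows "(\<integral>\<^sup>+ \<omega>. emeasure (\<xi> \<omega>) A * emeasure (\<xi> \<omega>) A \<partial>P) = emeasure \<mu> A * emeasure \<mu> A + emeasure \<mu> A"
proof (cases "measure \<mu> A = 0")
  case True
  have "(\<integral>\<^sup>+ \<omega>. emeasure (\<xi> \<omega>) A * emeasure (\<xi> \<omega>) A \<partial>P) = (\<integral>\<^sup>+ \<omega>. 0 \<partial>P)"
    by (rule nn_integral_cong_AE) (use prob_num_zero[OF A True] emeasure_\<xi>[OF _ A] in auto)
  then show ?thesis using True by (simp add: \<mu>.emeasure_eq_measure)
next
  case False
  then have pos: "measure \<mu> A > 0" by (simp add: zero_less_measure_iff)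
  interpret fp: finite_poisson "{0::nat}" "\<lambda>j. measure \<mu> A"
    by unfold_locales (use pos in auto)
  have d: "distr P (count_space UNIV) (counts {0} (\<lambda>_. A)) = measure_pmf fp.law"
    by (rule distr_counts) (use A pos in \<open>auto simp: disjoint_family_on_def\<close>)
  have "(\<integral>\<^sup>+ \<omega>. emeasure (\<xi> \<omega>) A * emeasure (\<xi> \<omega>) A \<partial>P) =
      (\<integral>\<^sup>+ \<omega>. of_nat (counts {0} (\<lambda>_. A) \<omega> 0) * of_nat (counts {0} (\<lambda>_. A) \<omega> 0) \<partial>P)"
    by (rule nn_integral_cong) (simp add: emeasure_\<xi>[OF _ A] counts_def)
  also have "\<dots> = (\<integral>\<^sup>+ v. of_nat (v 0) * of_nat (v 0) \<partial>fp.law)"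
    unfolding d[symmetric] by (subst nn_integral_distr) (use A in \<open>auto intro!: measurable_counts\<close>)
  also have "\<dots> = ennreal (measure \<mu> A) * (\<integral>\<^sup>+ v. 1 + of_nat (v 0) * 1 \<partial>fp.law)"
    by (subst fp.nn_integral_shift) (auto simp: add.commute)
  also have "(\<integral>\<^sup>+ v. 1 + of_nat (v 0) * 1 \<partial>fp.law) = 1 + (\<integral>\<^sup>+ v. of_nat (v 0) * 1 \<partial>fp.law)"
    by (subst nn_integral_add) auto
  also have "(\<integral>\<^sup>+ v. of_nat (v 0) * 1 \<partial>fp.law) = ennreal (measure \<mu> A)"
    by (subst fp.nn_integral_shift) auto
  finally show ?thesis by (simp add: \<mu>.emeasure_eq_measure distrib_left add.commute)
qed

lemma nn_integral_num_mult:
  assumes A: "A \<in> sets \<mu>" and B: "B \<in> sets \<mu>" and AB: "A \<inter> B = {}"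
  shows "(\<integral>\<^sup>+ \<omega>. emeasure (\<xi> \<omega>) A * emeasure (\<xi> \<omega>) B \<partial>P) = emeasure \<mu> A * emeasure \<mu> B"
proof (cases "measure \<mu> A = 0 \<or> measure \<mu> B = 0")
  case True
  then have "AE \<omega> in P. emeasure (\<xi> \<omega>) A * emeasure (\<xi> \<omega>) B = 0"
    using prob_num_zero[OF A] prob_num_zero[OF B] emeasure_\<xi>[OF _ A] emeasure_\<xi>[OF _ B] by auto
  then have "(\<integral>\<^sup>+ \<omega>. emeasure (\<xi> \<omega>) A * emeasure (\<xi> \<omega>) B \<partial>P) = (\<integral>\<^sup>+ \<omega>. 0 \<partial>P)"
    by (intro nn_integral_cong_AE)
  then show ?thesis using True by (auto simp: \<mu>.emeasure_eq_measure)
next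
  case False
  then have pos: "measure \<mu> A > 0" "measure \<mu> B > 0" by (auto simp: zero_less_measure_iff)
  define C where "C = (\<lambda>j::nat. if j = 0 then A else B)"
  have C: "\<And>j. j \<in> {0,1} \<Longrightarrow> C j \<in> sets \<mu>" "\<And>j. j \<in> {0,1} \<Longrightarrow> measure \<mu> (C j) > 0"
    using A B pos by (auto simp: C_def)
  interpret fp: finite_poisson "{0::nat,1}" "\<lambda>j. measure \<mu> (C j)"
    by unfold_locales (use C in auto)
  have d: "distr P (count_space UNIV) (counts {0,1} C) = measure_pmf fp.law"
    by (rule distr_counts) (use C AB in \<open>auto simp: disjoint_family_on_def C_def\<close>)
  have "(\<integral>\<^sup>+ \<omega>. emeasure (\<xi> \<omega>) A * emeasure (\<xi> \<omega>) B \<partial>P) =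
      (\<integral>\<^sup>+ \<omega>. of_nat (counts {0,1} C \<omega> 0) * of_nat (counts {0,1} C \<omega> 1) \<partial>P)"
    by (rule nn_integral_cong) (simp add: emeasure_\<xi>[OF _ A] emeasure_\<xi>[OF _ B] counts_def C_def)
  also have "\<dots> = (\<integral>\<^sup>+ v. of_nat (v 0) * of_nat (v 1) \<partial>fp.law)"
    unfolding d[symmetric] by (subst nn_integral_distr) (use C in \<open>auto intro!: measurable_counts\<close>)
  also have "\<dots> = ennreal (measure \<mu> (C 0)) * (\<integral>\<^sup>+ v. of_nat (v 1) * 1 \<partial>fp.law)"
    by (subst fp.nn_integral_shift) auto
  also have "(\<integral>\<^sup>+ v. of_nat (v 1) * 1 \<partial>fp.law) = ennreal (measure \<mu> (C 1))"
    by (subst fp.nn_integral_shift) auto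
  finally show ?thesis by (simp add: \<mu>.emeasure_eq_measure C_def)
qed

section \<open>The second moment measure of a Poisson process\<close>

abbreviation \<mu>2 :: "('z \<times> 'z) measure" where "\<mu>2 \<equiv> \<mu> \<Otimes>\<^sub>M \<mu>"
abbreviation \<xi>2 :: "'w \<Rightarrow> ('z \<times> 'z) measure" where "\<xi>2 \<omega> \<equiv> \<xi> \<omega> \<Otimes>\<^sub>M \<xi> \<omega>"

lemma sets_\<xi>2: "\<omega> \<in> space P \<Longrightarrow> sets (\<xi>2 \<omega>) = sets \<mu>2"
  by (intro sets_pair_measure_cong sets_\<xi>)

lemma space_\<xi>2: "\<omega> \<in> space P \<Longrightarrow> space (\<xi>2 \<omega>) = space \<mu>2"
  using sets_\<xi>2 sets_eq_imp_space_eq by blast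

lemma finite_\<xi>2:
  assumes "\<omega> \<in> space P" shows "finite_measure (\<xi>2 \<omega>)"
  by (intro finite_measure_pair_measure finite_\<xi> assms)

lemma emeasure_\<xi>2_Times:
  assumes "\<omega> \<in> space P" "A \<in> sets \<mu>" "B \<in> sets \<mu>"
  shows "emeasure (\<xi>2 \<omega>) (A \<times> B) = emeasure (\<xi> \<omega>) A * emeasure (\<xi> \<omega>) B"
proof -
  interpret finite_measure "\<xi> \<omega>" by (rule finite_\<xi>[OF assms(1)])
  show ?thesis using assms by (intro emeasure_pair_measure_Times) (auto simp: sets_\<xi>)
qed
text \<open>The counts of A - B, B - A and A \<inter> B are independent, so products of different
  pieces factorise. Only the square of the common piece carries an extra Poisson variance, which
  becomes the diagonal term.\<close>

lemma second_moment_Times: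
  assumes A: "A \<in> sets \<mu>" and B: "B \<in> sets \<mu>"
  shows "(\<integral>\<^sup>+ \<omega>. emeasure (\<xi> \<omega>) A * emeasure (\<xi> \<omega>) B \<partial>P) = emeasure \<mu> A * emeasure \<mu> B + emeasure \<mu> (A \<inter> B)"
proof -
  note [measurable] = meas_\<xi>
  have S: "A - B \<in> sets \<mu>" "B - A \<in> sets \<mu>" "A \<inter> B \<in> sets \<mu>" using A B by auto
  have disj: "(A - B) \<inter> (B - A) = {}" "(A - B) \<inter> (A \<inter> B) = {}" "(A \<inter> B) \<inter> (B - A) = {}" by auto
  have split: "emeasure M A = emeasure M (A - B) + emeasure M (A \<inter> B)"
    "emeasure M B = emeasure M (B - A) + emeasure M (A \<inter> B)" if "sets M = sets \<mu>" for M
  proof -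
    have "emeasure M (A - B) + emeasure M (A \<inter> B) = emeasure M ((A - B) \<union> (A \<inter> B))"
      using S that by (intro plus_emeasure) auto
    also have "(A - B) \<union> (A \<inter> B) = A" by auto
    finally show "emeasure M A = emeasure M (A - B) + emeasure M (A \<inter> B)" ..
    have "emeasure M (B - A) + emeasure M (A \<inter> B) = emeasure M ((B - A) \<union> (A \<inter> B))"
      using S that by (intro plus_emeasure) auto
    also have "(B - A) \<union> (A \<inter> B) = B" by auto
    finally show "emeasure M B = emeasure M (B - A) + emeasure M (A \<inter> B)" ..
  qed
  have "(\<integral>\<^sup>+ \<omega>. emeasure (\<xi> \<omega>) A * emeasure (\<xi> \<omega>) B \<partial>P) =
    (\<integral>\<^sup>+ \<omega>. (emeasure (\<xi> \<omega>) (A - B) * emeasure (\<xi> \<omega>) (B - A)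
       + emeasure (\<xi> \<omega>) (A - B) * emeasure (\<xi> \<omega>) (A \<inter> B))
     + (emeasure (\<xi> \<omega>) (A \<inter> B) * emeasure (\<xi> \<omega>) (B - A)
       + emeasure (\<xi> \<omega>) (A \<inter> B) * emeasure (\<xi> \<omega>) (A \<inter> B)) \<partial>P)"
    by (rule nn_integral_cong) (simp add: split[OF sets_\<xi>] algebra_simps)
  also have "\<dots> = (emeasure \<mu> (A - B) * emeasure \<mu> (B - A) + emeasure \<mu> (A - B) * emeasure \<mu> (A \<inter> B))
      + (emeasure \<mu> (A \<inter> B) * emeasure \<mu> (B - A) + (emeasure \<mu> (A \<inter> B) * emeasure \<mu> (A \<inter> B) + emeasure \<mu> (A \<inter> B)))"
    using S nn_integral_num_mult[of "A - B" "B - A"] nn_integral_num_mult[of "A - B" "A \<inter> B"]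
      nn_integral_num_mult[of "A \<inter> B" "B - A"] nn_integral_num_sq[of "A \<inter> B"] disj
    using meas_\<xi>[OF S(1)] meas_\<xi>[OF S(2)] meas_\<xi>[OF S(3)] by (auto simp: nn_integral_add)
  also have "\<dots> = emeasure \<mu> A * emeasure \<mu> B + emeasure \<mu> (A \<inter> B)"
    by (simp add: split[OF refl] algebra_simps)
  finally show ?thesis .
qed

text \<open>The second moment measure is the product plus \<mu> carried by the diagonal. Writing the
  latter as an integral of \<open>indicator E (z, z)\<close> does not ask for a measurable diagonal.
  The identity spreads from rectangles through disjoint unions and complements; complements can be
  subtracted because all quantities are finite.\<close>

lemma second_moment_sets:
  assumes "E \<in> sets \<mu>2"
  shows "(\<lambda>\<omega>. emeasure (\<xi>2 \<omega>) E) \<in> borel_measurable P \<and>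
    (\<integral>\<^sup>+ \<omega>. emeasure (\<xi>2 \<omega>) E \<partial>P) = emeasure \<mu>2 E + (\<integral>\<^sup>+ z. indicator E (z, z) \<partial>\<mu>)"
proof -
  let ?\<Omega> = "space \<mu> \<times> space \<mu>"
  let ?G = "{a \<times> b | a b. a \<in> sets \<mu> \<and> b \<in> sets \<mu>}"
  have E: "E \<in> sigma_sets ?\<Omega> ?G" using assms by (simp add: sets_pair_measure)
  have sets: "X \<in> sets \<mu>2" if "X \<in> sigma_sets ?\<Omega> ?G" for X using that by (simp add: sets_pair_measure)
  have full: "emeasure (\<xi>2 \<omega>) ?\<Omega> = emeasure (\<xi> \<omega>) (space \<mu>) * emeasure (\<xi> \<omega>) (space \<mu>)" if "\<omega> \<in> space P" for \<omega>
    using emeasure_\<xi>2_Times[OF that, of "space \<mu>" "space \<mu>"] by simp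
  note [measurable] = meas_\<xi>
  have m_full [measurable]: "(\<lambda>\<omega>. emeasure (\<xi>2 \<omega>) ?\<Omega>) \<in> borel_measurable P"
    by (subst measurable_cong[OF full]) auto
  have i_full: "(\<integral>\<^sup>+ \<omega>. emeasure (\<xi>2 \<omega>) ?\<Omega> \<partial>P) = emeasure \<mu>2 ?\<Omega> + emeasure \<mu> (space \<mu>)"
    using second_moment_Times[of "space \<mu>" "space \<mu>"]
    by (subst nn_integral_cong[OF full]) (auto simp: \<mu>.emeasure_pair_measure_Times)
  have fin_\<mu>2: "emeasure \<mu>2 X \<noteq> \<infinity>" for X
    using finite_measure.emeasure_finite[OF finite_measure_pair_measure[OF finite_\<mu> finite_\<mu>]] by simp
  show ?thesis using Int_stable_pair_measure_generator[of \<mu> \<mu>] pair_measure_closed[of \<mu> \<mu>] E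
  proof (induction rule: sigma_sets_induct_disjoint)
    case (basic X)
    then obtain a b where X: "X = a \<times> b" "a \<in> sets \<mu>" "b \<in> sets \<mu>" by auto
    have eq: "emeasure (\<xi>2 \<omega>) X = emeasure (\<xi> \<omega>) a * emeasure (\<xi> \<omega>) b" if "\<omega> \<in> space P" for \<omega>
      unfolding X(1) using that X by (intro emeasure_\<xi>2_Times)
    have "(\<integral>\<^sup>+ z. indicator X (z, z) \<partial>\<mu>) = (\<integral>\<^sup>+ z. indicator (a \<inter> b) z \<partial>\<mu>)"
      by (rule nn_integral_cong) (auto simp: X indicator_def)
    then show ?case
      using second_moment_Times[OF X(2,3)] X(2,3)
      by (auto simp: X(1) \<mu>.emeasure_pair_measure_Times measurable_cong[OF eq, unfolded X(1)]
          nn_integral_cong[OF eq, unfolded X(1)])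
  next
    case empty
    then show ?case by simp
  next
    case (compl X)
    note [measurable] = compl.IH[THEN conjunct1] sets[OF compl.hyps]
    have X: "X \<in> sets \<mu>2" "?\<Omega> - X \<in> sets \<mu>2"
      using sets[OF compl.hyps] by (auto simp: space_pair_measure[symmetric])
    have sub: "X \<subseteq> ?\<Omega>" using sets.sets_into_space[OF X(1)] by (simp add: space_pair_measure)
    have eq: "emeasure (\<xi>2 \<omega>) (?\<Omega> - X) = emeasure (\<xi>2 \<omega>) ?\<Omega> - emeasure (\<xi>2 \<omega>) X" if "\<omega> \<in> space P" for \<omega>
    proof (rule emeasure_Diff)
      show "emeasure (\<xi>2 \<omega>) X \<noteq> \<infinity>"
        using finite_measure.emeasure_finite[OF finite_\<xi>2[OF that]] by simp
    qed (use X sub sets_\<xi>2[OF that] space_pair_measure in \<open>auto simp: space_pair_measure[symmetric]\<close>)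
    have m: "(\<lambda>\<omega>. emeasure (\<xi>2 \<omega>) (?\<Omega> - X)) \<in> borel_measurable P"
      by (subst measurable_cong[OF eq]) auto
    have add: "emeasure (\<xi>2 \<omega>) X + emeasure (\<xi>2 \<omega>) (?\<Omega> - X) = emeasure (\<xi>2 \<omega>) ?\<Omega>" if "\<omega> \<in> space P" for \<omega>
      using X sub sets_\<xi>2[OF that] by (subst plus_emeasure) (auto intro!: arg_cong[of _ _ "emeasure _"])
    have addm: "emeasure \<mu>2 X + emeasure \<mu>2 (?\<Omega> - X) = emeasure \<mu>2 ?\<Omega>"
      using X sub by (subst plus_emeasure) (auto intro!: arg_cong[of _ _ "emeasure _"])
    have addd: "(\<integral>\<^sup>+ z. indicator X (z, z) \<partial>\<mu>) + (\<integral>\<^sup>+ z. indicator (?\<Omega> - X) (z, z) \<partial>\<mu>) = emeasure \<mu> (space \<mu>)"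
    proof -
      have "(\<integral>\<^sup>+ z. indicator X (z, z) \<partial>\<mu>) + (\<integral>\<^sup>+ z. indicator (?\<Omega> - X) (z, z) \<partial>\<mu>)
        = (\<integral>\<^sup>+ z. indicator X (z, z) + indicator (?\<Omega> - X) (z, z) \<partial>\<mu>)"
        using X by (intro nn_integral_add[symmetric]) measurable
      also have "\<dots> = (\<integral>\<^sup>+ z. 1 \<partial>\<mu>)"
        by (rule nn_integral_cong) (auto simp: indicator_def)
      finally show ?thesis by simp
    qed
    have "(\<integral>\<^sup>+ \<omega>. emeasure (\<xi>2 \<omega>) X \<partial>P) + (\<integral>\<^sup>+ \<omega>. emeasure (\<xi>2 \<omega>) (?\<Omega> - X) \<partial>P)
        = (\<integral>\<^sup>+ \<omega>. emeasure (\<xi>2 \<omega>) X + emeasure (\<xi>2 \<omega>) (?\<Omega> - X) \<partial>P)"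
      using m by (intro nn_integral_add[symmetric]) auto
    also have "\<dots> = emeasure \<mu>2 ?\<Omega> + emeasure \<mu> (space \<mu>)"
      by (subst nn_integral_cong[OF add]) (auto simp: i_full)
    also have "\<dots> = (emeasure \<mu>2 X + (\<integral>\<^sup>+ z. indicator X (z, z) \<partial>\<mu>)) +
        (emeasure \<mu>2 (?\<Omega> - X) + (\<integral>\<^sup>+ z. indicator (?\<Omega> - X) (z, z) \<partial>\<mu>))"
      by (simp add: addm[symmetric] addd[symmetric] add_ac)
    finally have "(emeasure \<mu>2 X + (\<integral>\<^sup>+ z. indicator X (z, z) \<partial>\<mu>)) + (\<integral>\<^sup>+ \<omega>. emeasure (\<xi>2 \<omega>) (?\<Omega> - X) \<partial>P)
       = (emeasure \<mu>2 X + (\<integral>\<^sup>+ z. indicator X (z, z) \<partial>\<mu>)) +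
        (emeasure \<mu>2 (?\<Omega> - X) + (\<integral>\<^sup>+ z. indicator (?\<Omega> - X) (z, z) \<partial>\<mu>))"
      using compl.IH by simp
    moreover have "emeasure \<mu>2 X + (\<integral>\<^sup>+ z. indicator X (z, z) \<partial>\<mu>) \<noteq> \<infinity>"
    proof -
      have "(\<integral>\<^sup>+ z. indicator X (z, z) \<partial>\<mu>) \<le> emeasure \<mu> (space \<mu>)"
        unfolding addd[symmetric] by simp
      then show ?thesis using fin_\<mu>2[of X] \<mu>.emeasure_finite[of "space \<mu>"] by (auto simp: top_unique)
    qed
    ultimately have "(\<integral>\<^sup>+ \<omega>. emeasure (\<xi>2 \<omega>) (?\<Omega> - X) \<partial>P)
       = emeasure \<mu>2 (?\<Omega> - X) + (\<integral>\<^sup>+ z. indicator (?\<Omega> - X) (z, z) \<partial>\<mu>)"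
      unfolding ennreal_add_left_cancel by auto
    with m show ?case by blast
  next
    case (union X)
    have X: "X i \<in> sets \<mu>2" for i using union.hyps sets by blast
    note [measurable] = union.IH[THEN conjunct1] X
    have eq: "emeasure (\<xi>2 \<omega>) (\<Union>i. X i) = (\<Sum>i. emeasure (\<xi>2 \<omega>) (X i))" if "\<omega> \<in> space P" for \<omega>
      using X union.hyps sets_\<xi>2[OF that] by (intro suminf_emeasure[symmetric]) auto
    have "(\<integral>\<^sup>+ \<omega>. emeasure (\<xi>2 \<omega>) (\<Union>i. X i) \<partial>P) = (\<Sum>i. \<integral>\<^sup>+ \<omega>. emeasure (\<xi>2 \<omega>) (X i) \<partial>P)"
      by (subst nn_integral_cong[OF eq]) (auto intro!: nn_integral_suminf)
    also have "\<dots> = (\<Sum>i. emeasure \<mu>2 (X i)) + (\<Sum>i. \<integral>\<^sup>+ z. indicator (X i) (z, z) \<partial>\<mu>)"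
      using union.IH by (subst suminf_add) auto
    also have "(\<Sum>i. emeasure \<mu>2 (X i)) = emeasure \<mu>2 (\<Union>i. X i)"
      using X union.hyps by (intro suminf_emeasure) auto
    also have "(\<Sum>i. \<integral>\<^sup>+ z. indicator (X i) (z, z) \<partial>\<mu>) = (\<integral>\<^sup>+ z. (\<Sum>i. indicator (X i) (z, z)) \<partial>\<mu>)"
      by (intro nn_integral_suminf[symmetric]) measurable
    also have "\<dots> = (\<integral>\<^sup>+ z. indicator (\<Union>i. X i) (z, z) \<partial>\<mu>)"
      using union.hyps by (simp add: suminf_indicator)
    finally have "(\<integral>\<^sup>+ \<omega>. emeasure (\<xi>2 \<omega>) (\<Union>i. X i) \<partial>P) =
      emeasure \<mu>2 (\<Union>i. X i) + (\<integral>\<^sup>+ z. indicator (\<Union>i. X i) (z, z) \<partial>\<mu>)" .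
    moreover have "(\<lambda>\<omega>. emeasure (\<xi>2 \<omega>) (\<Union>i. X i)) \<in> borel_measurable P"
      by (subst measurable_cong[OF eq]) auto
    ultimately show ?case by blast
  qed
qed

lemma measurable_\<xi>2: "\<omega> \<in> space P \<Longrightarrow> H \<in> measurable \<mu>2 N \<Longrightarrow> H \<in> measurable (\<xi>2 \<omega>) N"
  using measurable_cong_sets[OF sets_\<xi>2 refl] by blast

lemma second_moment:
  fixes H :: "'z \<times> 'z \<Rightarrow> ennreal"
  assumes "H \<in> borel_measurable \<mu>2"
  shows "(\<lambda>\<omega>. \<integral>\<^sup>+ z. H z \<partial>\<xi>2 \<omega>) \<in> borel_measurable P \<and>
    (\<integral>\<^sup>+ \<omega>. \<integral>\<^sup>+ z. H z \<partial>\<xi>2 \<omega> \<partial>P) = (\<integral>\<^sup>+ z. H z \<partial>\<mu>2) + (\<integral>\<^sup>+ z. H (z, z) \<partial>\<mu>)"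
  using assms
proof (induction rule: borel_measurable_induct)
  case (cong f g)
  have "(\<integral>\<^sup>+ z. f z \<partial>\<xi>2 \<omega>) = (\<integral>\<^sup>+ z. g z \<partial>\<xi>2 \<omega>)" if "\<omega> \<in> space P" for \<omega>
    using cong.hyps(3) space_\<xi>2[OF that] by (intro nn_integral_cong) auto
  moreover have "(\<integral>\<^sup>+ z. f z \<partial>\<mu>2) = (\<integral>\<^sup>+ z. g z \<partial>\<mu>2)"
    using cong.hyps(3) by (intro nn_integral_cong) auto
  moreover have "(\<integral>\<^sup>+ z. f (z, z) \<partial>\<mu>) = (\<integral>\<^sup>+ z. g (z, z) \<partial>\<mu>)"
    using cong.hyps(3) by (intro nn_integral_cong) (auto simp: space_pair_measure)
  ultimately show ?case
    using cong.IH by (simp cong: measurable_cong nn_integral_cong)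
next
  case (set A)
  have "(\<integral>\<^sup>+ z. indicator A z \<partial>\<xi>2 \<omega>) = emeasure (\<xi>2 \<omega>) A" if "\<omega> \<in> space P" for \<omega>
    using set sets_\<xi>2[OF that] by simp
  then show ?case
    using second_moment_sets[OF set] set by (simp cong: measurable_cong nn_integral_cong)
next
  case (mult u c)
  have eq: "(\<integral>\<^sup>+ z. c * u z \<partial>\<xi>2 \<omega>) = c * (\<integral>\<^sup>+ z. u z \<partial>\<xi>2 \<omega>)" if "\<omega> \<in> space P" for \<omega>
    using measurable_\<xi>2[OF that mult.hyps(2)] by (rule nn_integral_cmult)
  note [measurable] = mult.hyps(2) mult.IH[THEN conjunct1]
  show ?case
    using mult.IH
    by (simp add: measurable_cong[OF eq] nn_integral_cong[OF eq] nn_integral_cmult distrib_left)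
next
  case (add u v)
  have eq: "(\<integral>\<^sup>+ z. v z + u z \<partial>\<xi>2 \<omega>) = (\<integral>\<^sup>+ z. v z \<partial>\<xi>2 \<omega>) + (\<integral>\<^sup>+ z. u z \<partial>\<xi>2 \<omega>)" if "\<omega> \<in> space P" for \<omega>
    using measurable_\<xi>2[OF that add.hyps(1)] measurable_\<xi>2[OF that add.hyps(3)] by (intro nn_integral_add)
  note [measurable] = add.hyps(1,3) add.IH(1)[THEN conjunct1] add.IH(2)[THEN conjunct1]
  have m: "(\<lambda>\<omega>. \<integral>\<^sup>+ z. v z + u z \<partial>\<xi>2 \<omega>) \<in> borel_measurable P"
    by (subst measurable_cong[OF eq]) measurable
  have "(\<integral>\<^sup>+ \<omega>. \<integral>\<^sup>+ z. v z + u z \<partial>\<xi>2 \<omega> \<partial>P) =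
      (\<integral>\<^sup>+ \<omega>. (\<integral>\<^sup>+ z. v z \<partial>\<xi>2 \<omega>) + (\<integral>\<^sup>+ z. u z \<partial>\<xi>2 \<omega>) \<partial>P)"
    by (rule nn_integral_cong[OF eq])
  also have "\<dots> = ((\<integral>\<^sup>+ z. v z \<partial>\<mu>2) + (\<integral>\<^sup>+ z. v (z, z) \<partial>\<mu>)) +
      ((\<integral>\<^sup>+ z. u z \<partial>\<mu>2) + (\<integral>\<^sup>+ z. u (z, z) \<partial>\<mu>))"
    using add.IH by (simp add: nn_integral_add)
  also have "\<dots> = (\<integral>\<^sup>+ z. v z + u z \<partial>\<mu>2) + (\<integral>\<^sup>+ z. v (z, z) + u (z, z) \<partial>\<mu>)"
    by (simp add: nn_integral_add add_ac)
  finally show ?case using m by blast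
next
  case (seq U)
  have eq: "(\<integral>\<^sup>+ z. (SUP i. U i z) \<partial>\<xi>2 \<omega>) = (SUP i. \<integral>\<^sup>+ z. U i z \<partial>\<xi>2 \<omega>)" if "\<omega> \<in> space P" for \<omega>
    using measurable_\<xi>2[OF that seq.hyps(1)] seq.hyps(3) by (intro nn_integral_monotone_convergence_SUP)
  note [measurable] = seq.hyps(1) seq.IH[THEN conjunct1]
  have inc: "incseq (\<lambda>i \<omega>. \<integral>\<^sup>+ z. U i z \<partial>\<xi>2 \<omega>)"
    using seq.hyps(3) by (auto simp: incseq_def le_fun_def intro!: nn_integral_mono)
  have "(\<integral>\<^sup>+ \<omega>. (SUP i. \<integral>\<^sup>+ z. U i z \<partial>\<xi>2 \<omega>) \<partial>P) = (SUP i. \<integral>\<^sup>+ \<omega>. (\<integral>\<^sup>+ z. U i z \<partial>\<xi>2 \<omega>) \<partial>P)"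
    by (intro nn_integral_monotone_convergence_SUP inc) measurable
  also have "\<dots> = (SUP i. (\<integral>\<^sup>+ z. U i z \<partial>\<mu>2) + (\<integral>\<^sup>+ z. U i (z, z) \<partial>\<mu>))"
    using seq.IH by simp
  also have "\<dots> = (SUP i. \<integral>\<^sup>+ z. U i z \<partial>\<mu>2) + (SUP i. \<integral>\<^sup>+ z. U i (z, z) \<partial>\<mu>)"
    using seq.hyps(3)
    by (intro ennreal_SUP_add) (auto simp: incseq_def le_fun_def intro!: nn_integral_mono)
  also have "(SUP i. \<integral>\<^sup>+ z. U i z \<partial>\<mu>2) = (\<integral>\<^sup>+ z. (SUP i. U i z) \<partial>\<mu>2)"
    using seq.hyps(3) by (intro nn_integral_monotone_convergence_SUP[symmetric]) auto
  also have "(SUP i. \<integral>\<^sup>+ z. U i (z, z) \<partial>\<mu>) = (\<integral>\<^sup>+ z. (SUP i. U i (z, z)) \<partial>\<mu>)"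
    using seq.hyps(3)
    by (intro nn_integral_monotone_convergence_SUP[symmetric]) (auto simp: incseq_def le_fun_def)
  finally show ?case
    by (simp add: measurable_cong[OF eq] nn_integral_cong[OF eq] image_comp SUP_apply)
qed

text \<open>For a kernel vanishing on the diagonal the extra term drops out, so the L1 norm is
  preserved in mean. This links a general H to its approximations before any second moment of its
  double sum is known.\<close>

lemma
  fixes H :: "'z \<times> 'z \<Rightarrow> real"
  assumes H [measurable]: "integrable \<mu>2 H" and diag: "\<And>z. z \<in> space \<mu> \<Longrightarrow> H (z, z) = 0"
  shows AE_integrable_\<xi>2: "AE \<omega> in P. integrable (\<xi>2 \<omega>) H"
    and nn_integral_abs_\<xi>2: "(\<integral>\<^sup>+ \<omega>. \<integral>\<^sup>+ z. ennreal \<bar>H z\<bar> \<partial>\<xi>2 \<omega> \<partial>P) = (\<integral>\<^sup>+ z. ennreal \<bar>H z\<bar> \<partial>\<mu>2)"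
    and measurable_nn_abs_\<xi>2: "(\<lambda>\<omega>. \<integral>\<^sup>+ z. ennreal \<bar>H z\<bar> \<partial>\<xi>2 \<omega>) \<in> borel_measurable P"
proof -
  have d: "(\<integral>\<^sup>+ z. ennreal \<bar>H (z, z)\<bar> \<partial>\<mu>) = 0"
    using diag by (subst nn_integral_cong[of _ _ "\<lambda>_. 0"]) auto
  have Hm: "H \<in> borel_measurable \<mu>2" using H by auto
  then have "(\<lambda>z. ennreal \<bar>H z\<bar>) \<in> borel_measurable \<mu>2" by measurable
  from second_moment[OF this] d
  show m: "(\<lambda>\<omega>. \<integral>\<^sup>+ z. ennreal \<bar>H z\<bar> \<partial>\<xi>2 \<omega>) \<in> borel_measurable P"
    and i: "(\<integral>\<^sup>+ \<omega>. \<integral>\<^sup>+ z. ennreal \<bar>H z\<bar> \<partial>\<xi>2 \<omega> \<partial>P) = (\<integral>\<^sup>+ z. ennreal \<bar>H z\<bar> \<partial>\<mu>2)"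
    by auto
  have "(\<integral>\<^sup>+ z. ennreal \<bar>H z\<bar> \<partial>\<mu>2) < \<infinity>" using H by (simp add: integrable_iff_bounded)
  then have "AE \<omega> in P. (\<integral>\<^sup>+ z. ennreal \<bar>H z\<bar> \<partial>\<xi>2 \<omega>) \<noteq> \<infinity>"
    unfolding i[symmetric] by (intro nn_integral_PInf_AE m) auto
  then show "AE \<omega> in P. integrable (\<xi>2 \<omega>) H"
    using measurable_\<xi>2[OF _ Hm] by (auto simp: integrable_iff_bounded top.not_eq_extremum)
qed

end

section \<open>Approximation by partition kernels\<close>

text \<open>A finite measurable partition is given by its labelling with natural numbers. Cells may
  be null, and the common refinement of two partitions is the pair of labels under
  \<open>prod_encode\<close>.\<close>

definition partition_map :: "'z measure \<Rightarrow> ('z \<Rightarrow> nat) \<Rightarrow> bool" where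
  "partition_map \<mu> p \<longleftrightarrow> p \<in> measurable \<mu> (count_space UNIV) \<and> finite (p ` space \<mu>)"

definition offdiag :: "'z measure \<Rightarrow> ('z \<times> 'z \<Rightarrow> real) \<Rightarrow> bool" where
  "offdiag \<mu> g \<longleftrightarrow> (\<exists>p a. partition_map \<mu> p \<and> (\<forall>i. a i i = 0) \<and>
     (\<forall>z\<in>space (\<mu> \<Otimes>\<^sub>M \<mu>). g z = a (p (fst z)) (p (snd z))))"

text \<open>The L2 closure of the off-diagonal partition kernels, with distances in
  \<open>ennreal\<close> so that integrability need not be carried along.\<close>

definition approximable :: "'z measure \<Rightarrow> ('z \<times> 'z \<Rightarrow> real) \<Rightarrow> bool" where
  "approximable \<mu> H \<longleftrightarrow> H \<in> borel_measurable (\<mu> \<Otimes>\<^sub>M \<mu>) \<and>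
     (\<forall>e>0. \<exists>g. offdiag \<mu> g \<and> (\<integral>\<^sup>+ z. ennreal ((H z - g z)\<^sup>2) \<partial>(\<mu> \<Otimes>\<^sub>M \<mu>)) < ennreal e)"

lemma partition_map_pair:
  assumes "partition_map \<mu> p" "partition_map \<mu> q"
  shows "partition_map \<mu> (\<lambda>z. prod_encode (p z, q z))"
proof -
  have [measurable]: "p \<in> measurable \<mu> (count_space UNIV)" "q \<in> measurable \<mu> (count_space UNIV)"
    and fin: "finite (p ` space \<mu>)" "finite (q ` space \<mu>)"
    using assms by (auto simp: partition_map_def)
  have "(\<lambda>z. prod_encode (p z, q z)) ` space \<mu> \<subseteq> prod_encode ` ((p ` space \<mu>) \<times> (q ` space \<mu>))"
    by auto
  then have "finite ((\<lambda>z. prod_encode (p z, q z)) ` space \<mu>)"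
    using fin finite_subset by blast
  then show ?thesis by (simp add: partition_map_def)
qed

lemma measurable_partition_kernel:
  assumes "partition_map \<mu> p"
  shows "(\<lambda>z. a (p (fst z)) (p (snd z)) :: real) \<in> borel_measurable (\<mu> \<Otimes>\<^sub>M \<mu>)"
proof -
  have [measurable]: "p \<in> measurable \<mu> (count_space UNIV)" using assms by (auto simp: partition_map_def)
  show ?thesis by measurable
qed

lemma offdiag_measurable:
  assumes "offdiag \<mu> g" shows "g \<in> borel_measurable (\<mu> \<Otimes>\<^sub>M \<mu>)"
proof -
  obtain p a where p: "partition_map \<mu> p" "\<And>z. z \<in> space (\<mu> \<Otimes>\<^sub>M \<mu>) \<Longrightarrow> g z = a (p (fst z)) (p (snd z))"
    using assms unfolding offdiag_def by blast
  show ?thesis using measurable_partition_kernel[OF p(1), of a] by (simp add: measurable_cong[OF p(2)])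
qed

lemma offdiag_add:
  assumes "offdiag \<mu> f" "offdiag \<mu> g" shows "offdiag \<mu> (\<lambda>z. f z + g z)"
proof -
  obtain p a where p: "partition_map \<mu> p" "\<And>i. a i i = 0"
    "\<And>z. z \<in> space (\<mu> \<Otimes>\<^sub>M \<mu>) \<Longrightarrow> f z = a (p (fst z)) (p (snd z))"
    using assms(1) unfolding offdiag_def by blast
  obtain q b where q: "partition_map \<mu> q" "\<And>i. b i i = 0"
    "\<And>z. z \<in> space (\<mu> \<Otimes>\<^sub>M \<mu>) \<Longrightarrow> g z = b (q (fst z)) (q (snd z))"
    using assms(2) unfolding offdiag_def by blast
  show ?thesis unfolding offdiag_def
    by (rule exI[of _ "\<lambda>z. prod_encode (p z, q z)"],
        rule exI[of _ "\<lambda>i j. a (fst (prod_decode i)) (fst (prod_decode j)) + b (snd (prod_decode i)) (snd (prod_decode j))"])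
       (simp add: partition_map_pair p q)
qed

lemma offdiag_cmult:
  assumes "offdiag \<mu> f" shows "offdiag \<mu> (\<lambda>z. c * f z)"
proof -
  obtain p a where p: "partition_map \<mu> p" "\<And>i. a i i = 0"
    "\<And>z. z \<in> space (\<mu> \<Otimes>\<^sub>M \<mu>) \<Longrightarrow> f z = a (p (fst z)) (p (snd z))"
    using assms(1) unfolding offdiag_def by blast
  show ?thesis unfolding offdiag_def
    by (rule exI[of _ p], rule exI[of _ "\<lambda>i j. c * a i j"]) (simp add: p)
qed

lemma offdiag_approximable: "offdiag \<mu> g \<Longrightarrow> approximable \<mu> g"
  unfolding approximable_def using offdiag_measurable by (auto intro!: exI[of _ g])

lemma sq_add_le: "(x + y :: real)\<^sup>2 \<le> 2 * x\<^sup>2 + 2 * y\<^sup>2"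
  using zero_le_power2[of "x - y"] by (simp add: power2_eq_square algebra_simps)

text \<open>A quarter for each term suffices because (x + y)^2 \<le> 2 x^2 + 2 y^2.\<close>

lemma nn_integral_sq_add_less:
  fixes f g :: "'x \<Rightarrow> real"
  assumes [measurable]: "f \<in> borel_measurable M" "g \<in> borel_measurable M" and "e > 0"
    and "(\<integral>\<^sup>+ z. ennreal ((f z)\<^sup>2) \<partial>M) < ennreal (e / 4)" "(\<integral>\<^sup>+ z. ennreal ((g z)\<^sup>2) \<partial>M) < ennreal (e / 4)"
  shows "(\<integral>\<^sup>+ z. ennreal ((f z + g z)\<^sup>2) \<partial>M) < ennreal e"
proof -
  have "(\<integral>\<^sup>+ z. ennreal ((f z + g z)\<^sup>2) \<partial>M) \<le> (\<integral>\<^sup>+ z. 2 * ennreal ((f z)\<^sup>2) + 2 * ennreal ((g z)\<^sup>2) \<partial>M)"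
  proof (rule nn_integral_mono)
    fix z
    have "ennreal ((f z + g z)\<^sup>2) \<le> ennreal (2 * (f z)\<^sup>2 + 2 * (g z)\<^sup>2)"
      by (intro ennreal_leI sq_add_le)
    then show "ennreal ((f z + g z)\<^sup>2) \<le> 2 * ennreal ((f z)\<^sup>2) + 2 * ennreal ((g z)\<^sup>2)"
      by (simp add: ennreal_plus ennreal_mult)
  qed
  also have "\<dots> = 2 * (\<integral>\<^sup>+ z. ennreal ((f z)\<^sup>2) \<partial>M) + 2 * (\<integral>\<^sup>+ z. ennreal ((g z)\<^sup>2) \<partial>M)"
    by (simp add: nn_integral_add nn_integral_cmult)
  also have "\<dots> < 2 * ennreal (e / 4) + 2 * ennreal (e / 4)"
    using assms(4,5) by (intro add_strict_mono ennreal_mult_strict_left_mono) auto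
  also have "\<dots> = ennreal (2 * (e / 4) + 2 * (e / 4))"
    using \<open>e > 0\<close> by (simp only: ennreal_plus ennreal_mult ennreal_numeral)
  finally show ?thesis by simp
qed

lemma approximable_add:
  assumes f: "approximable \<mu> f" and g: "approximable \<mu> g" shows "approximable \<mu> (\<lambda>z. f z + g z)"
  unfolding approximable_def
proof (intro conjI allI impI)
  have fm [measurable]: "f \<in> borel_measurable (\<mu> \<Otimes>\<^sub>M \<mu>)" "g \<in> borel_measurable (\<mu> \<Otimes>\<^sub>M \<mu>)"
    using f g by (auto simp: approximable_def)
  show "(\<lambda>z. f z + g z) \<in> borel_measurable (\<mu> \<Otimes>\<^sub>M \<mu>)" by measurable
  fix e :: real assume e: "e > 0"
  obtain f' where f': "offdiag \<mu> f'" "(\<integral>\<^sup>+ z. ennreal ((f z - f' z)\<^sup>2) \<partial>(\<mu> \<Otimes>\<^sub>M \<mu>)) < ennreal (e / 4)"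
    using f e unfolding approximable_def by (meson divide_pos_pos zero_less_numeral)
  obtain g' where g': "offdiag \<mu> g'" "(\<integral>\<^sup>+ z. ennreal ((g z - g' z)\<^sup>2) \<partial>(\<mu> \<Otimes>\<^sub>M \<mu>)) < ennreal (e / 4)"
    using g e unfolding approximable_def by (meson divide_pos_pos zero_less_numeral)
  have [measurable]: "f' \<in> borel_measurable (\<mu> \<Otimes>\<^sub>M \<mu>)" "g' \<in> borel_measurable (\<mu> \<Otimes>\<^sub>M \<mu>)"
    using f' g' offdiag_measurable by auto
  have "(\<integral>\<^sup>+ z. ennreal (((f z - f' z) + (g z - g' z))\<^sup>2) \<partial>(\<mu> \<Otimes>\<^sub>M \<mu>)) < ennreal e"
    by (rule nn_integral_sq_add_less) (use e f' g' in auto)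
  then show "\<exists>h. offdiag \<mu> h \<and> (\<integral>\<^sup>+ z. ennreal ((f z + g z - h z)\<^sup>2) \<partial>(\<mu> \<Otimes>\<^sub>M \<mu>)) < ennreal e"
    by (intro exI[of _ "\<lambda>z. f' z + g' z"]) (use f' g' offdiag_add in \<open>auto simp: algebra_simps\<close>)
qed

lemma approximable_cmult:
  assumes f: "approximable \<mu> f" shows "approximable \<mu> (\<lambda>z. c * f z)"
  unfolding approximable_def
proof (intro conjI allI impI)
  have fm [measurable]: "f \<in> borel_measurable (\<mu> \<Otimes>\<^sub>M \<mu>)"
    using f by (auto simp: approximable_def)
  show "(\<lambda>z. c * f z) \<in> borel_measurable (\<mu> \<Otimes>\<^sub>M \<mu>)" by measurable
  fix e :: real assume e: "e > 0"
  \<comment> \<open>The summand 1 keeps the tolerance e / (c^2 + 1) positive and meaningful for c =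
    0.\<close>
  have c: "c\<^sup>2 + 1 > 0" by (simp add: add_nonneg_pos)
  obtain f' where f': "offdiag \<mu> f'" "(\<integral>\<^sup>+ z. ennreal ((f z - f' z)\<^sup>2) \<partial>(\<mu> \<Otimes>\<^sub>M \<mu>)) < ennreal (e / (c\<^sup>2 + 1))"
    using f e c unfolding approximable_def by (meson divide_pos_pos)
  have [measurable]: "f' \<in> borel_measurable (\<mu> \<Otimes>\<^sub>M \<mu>)"
    using f' offdiag_measurable by auto
  have "(\<integral>\<^sup>+ z. ennreal ((c * f z - c * f' z)\<^sup>2) \<partial>(\<mu> \<Otimes>\<^sub>M \<mu>)) =
      (\<integral>\<^sup>+ z. ennreal (c\<^sup>2) * ennreal ((f z - f' z)\<^sup>2) \<partial>(\<mu> \<Otimes>\<^sub>M \<mu>))"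
    by (simp add: ennreal_mult'[symmetric] power_mult_distrib[symmetric] right_diff_distrib)
  also have "\<dots> = ennreal (c\<^sup>2) * (\<integral>\<^sup>+ z. ennreal ((f z - f' z)\<^sup>2) \<partial>(\<mu> \<Otimes>\<^sub>M \<mu>))"
    by (rule nn_integral_cmult) measurable
  also have "\<dots> \<le> ennreal (c\<^sup>2) * ennreal (e / (c\<^sup>2 + 1))"
    using f' by (intro mult_left_mono) auto
  also have "\<dots> = ennreal (c\<^sup>2 * (e / (c\<^sup>2 + 1)))" by (subst ennreal_mult') auto
  also have "\<dots> < ennreal e"
    using e c by (intro ennreal_lessI) (auto simp: field_simps)
  finally show "\<exists>h. offdiag \<mu> h \<and> (\<integral>\<^sup>+ z. ennreal ((c * f z - h z)\<^sup>2) \<partial>(\<mu> \<Otimes>\<^sub>M \<mu>)) < ennreal e"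
    using offdiag_cmult[OF f'(1), of c] by blast
qed

lemma approximable_zero: "approximable \<mu> (\<lambda>z. 0)"
  by (rule offdiag_approximable)
     (auto simp: offdiag_def partition_map_def intro!: exI[of _ "\<lambda>z. 0"] exI[of _ "\<lambda>i j. 0"] intro: finite_subset[of _ "{0}"])

lemma approximable_sum:
  "finite A \<Longrightarrow> (\<And>i. i \<in> A \<Longrightarrow> approximable \<mu> (f i)) \<Longrightarrow> approximable \<mu> (\<lambda>z. \<Sum>i\<in>A. f i z)"
  by (induction A rule: finite_induct) (auto intro: approximable_zero approximable_add)

lemma approximable_cong:
  assumes "approximable \<mu> f" "\<And>z. z \<in> space (\<mu> \<Otimes>\<^sub>M \<mu>) \<Longrightarrow> f z = g z"
  shows "approximable \<mu> g"
proof -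
  have "(\<integral>\<^sup>+ z. ennreal ((f z - h z)\<^sup>2) \<partial>(\<mu> \<Otimes>\<^sub>M \<mu>)) = (\<integral>\<^sup>+ z. ennreal ((g z - h z)\<^sup>2) \<partial>(\<mu> \<Otimes>\<^sub>M \<mu>))" for h
    using assms(2) by (intro nn_integral_cong) auto
  moreover have "g \<in> borel_measurable (\<mu> \<Otimes>\<^sub>M \<mu>)"
    using assms by (auto simp: approximable_def measurable_cong[OF assms(2)])
  ultimately show ?thesis using assms(1) unfolding approximable_def by simp
qed

text \<open>Closure under dominated convergence, as a monotone class argument requires it. The
  function w dominates the squared errors rather than the functions themselves.\<close>

lemma approximable_limit:
  assumes s: "\<And>n. approximable \<mu> (s n)" and H [measurable]: "H \<in> borel_measurable (\<mu> \<Otimes>\<^sub>M \<mu>)"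
    and lim: "AE z in \<mu> \<Otimes>\<^sub>M \<mu>. (\<lambda>n. s n z) \<longlonglongrightarrow> H z"
    and w [measurable]: "w \<in> borel_measurable (\<mu> \<Otimes>\<^sub>M \<mu>)" "(\<integral>\<^sup>+ z. ennreal (w z) \<partial>(\<mu> \<Otimes>\<^sub>M \<mu>)) < \<infinity>"
    and bound: "\<And>n z. z \<in> space (\<mu> \<Otimes>\<^sub>M \<mu>) \<Longrightarrow> (H z - s n z)\<^sup>2 \<le> w z"
  shows "approximable \<mu> H"
  unfolding approximable_def
proof (intro conjI allI impI)
  show "H \<in> borel_measurable (\<mu> \<Otimes>\<^sub>M \<mu>)" by (rule H)
  have sm [measurable]: "s n \<in> borel_measurable (\<mu> \<Otimes>\<^sub>M \<mu>)" for n
    using s[of n] by (simp add: approximable_def)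
  fix e :: real assume e: "e > 0"
  have "(\<lambda>n. \<integral>\<^sup>+ z. ennreal ((H z - s n z)\<^sup>2) \<partial>(\<mu> \<Otimes>\<^sub>M \<mu>)) \<longlonglongrightarrow> (\<integral>\<^sup>+ z. 0 \<partial>(\<mu> \<Otimes>\<^sub>M \<mu>))"
  proof (rule nn_integral_dominated_convergence[where w = "\<lambda>z. ennreal (w z)"])
    show "AE z in \<mu> \<Otimes>\<^sub>M \<mu>. (\<lambda>n. ennreal ((H z - s n z)\<^sup>2)) \<longlonglongrightarrow> 0"
      using lim
    proof eventually_elim
      case (elim z)
      have "(\<lambda>n. (H z - s n z)\<^sup>2) \<longlonglongrightarrow> (H z - H z)\<^sup>2" by (intro tendsto_intros elim)
      then show ?case using tendsto_ennrealI by fastforce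
    qed
    show "AE z in \<mu> \<Otimes>\<^sub>M \<mu>. ennreal ((H z - s n z)\<^sup>2) \<le> ennreal (w z)" for n
      using bound by (intro AE_I2 ennreal_leI) auto
  qed (use w in auto)
  then have "(\<lambda>n. \<integral>\<^sup>+ z. ennreal ((H z - s n z)\<^sup>2) \<partial>(\<mu> \<Otimes>\<^sub>M \<mu>)) \<longlonglongrightarrow> 0" by simp
  then have "\<forall>\<^sub>F n in sequentially. (\<integral>\<^sup>+ z. ennreal ((H z - s n z)\<^sup>2) \<partial>(\<mu> \<Otimes>\<^sub>M \<mu>)) < ennreal (e / 4)"
    by (rule order_tendstoD) (use e in auto)
  then obtain n where n: "(\<integral>\<^sup>+ z. ennreal ((H z - s n z)\<^sup>2) \<partial>(\<mu> \<Otimes>\<^sub>M \<mu>)) < ennreal (e / 4)"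
    by (auto simp: eventually_sequentially)
  obtain g where g: "offdiag \<mu> g" "(\<integral>\<^sup>+ z. ennreal ((s n z - g z)\<^sup>2) \<partial>(\<mu> \<Otimes>\<^sub>M \<mu>)) < ennreal (e / 4)"
    using s[of n] e unfolding approximable_def by (meson divide_pos_pos zero_less_numeral)
  have [measurable]: "g \<in> borel_measurable (\<mu> \<Otimes>\<^sub>M \<mu>)" using g offdiag_measurable by auto
  have "(\<integral>\<^sup>+ z. ennreal (((H z - s n z) + (s n z - g z))\<^sup>2) \<partial>(\<mu> \<Otimes>\<^sub>M \<mu>)) < ennreal e"
    by (rule nn_integral_sq_add_less) (use e n g in auto)
  then show "\<exists>g. offdiag \<mu> g \<and> (\<integral>\<^sup>+ z. ennreal ((H z - g z)\<^sup>2) \<partial>(\<mu> \<Otimes>\<^sub>M \<mu>)) < ennreal e"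
    using g by auto
qed

text \<open>Diffuseness in a form that does not require the diagonal to be measurable: countably many sets
  separate the two coordinates of almost every pair.\<close>

locale diffuse_measure = finite_measure \<mu> for \<mu> :: "'z measure" +
  fixes B :: "nat \<Rightarrow> 'z set"
  assumes B_sets [measurable]: "\<And>n. B n \<in> sets \<mu>"
    and diag_null: "AE z in \<mu> \<Otimes>\<^sub>M \<mu>. \<exists>n. (fst z \<in> B n) \<noteq> (snd z \<in> B n)"
begin

lemma finite_\<mu>2: "finite_measure (\<mu> \<Otimes>\<^sub>M \<mu>)"
  by (intro finite_measure_pair_measure finite_measure_axioms)

text \<open>Membership in the first n separating sets, read as binary digits; the cells are the
  atoms of the algebra generated by these sets.\<close>

definition code :: "nat \<Rightarrow> 'z \<Rightarrow> nat" where
  "code n z = (\<Sum>k<n. if z \<in> B k then 2 ^ k else 0)"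

lemma code_eq: "code n z = set_encode {k \<in> {..<n}. z \<in> B k}"
  unfolding code_def set_encode_def by (rule sum.inter_filter[symmetric]) simp

lemma code_inj: "code n z = code n z' \<longleftrightarrow> (\<forall>k<n. (z \<in> B k) = (z' \<in> B k))"
  unfolding code_eq by (subst inj_on_eq_iff[OF inj_on_set_encode]) auto

lemma partition_code: "partition_map \<mu> (code n)"
proof -
  have "code n ` space \<mu> \<subseteq> {..(\<Sum>k<n. 2 ^ k)}"
    by (auto simp: code_def intro!: sum_mono)
  then have "finite (code n ` space \<mu>)" using finite_subset by blast
  moreover have "code n \<in> measurable \<mu> (count_space UNIV)"
    unfolding code_def by measurable
  ultimately show ?thesis by (simp add: partition_map_def)
qed

lemma partition_indicator:
  assumes [measurable]: "A \<in> sets \<mu>"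
  shows "partition_map \<mu> (\<lambda>z. if z \<in> A then 1 else 0)"
proof -
  have "finite ((\<lambda>z. if z \<in> A then 1 else 0 :: nat) ` space \<mu>)"
    by (rule finite_subset[of _ "{0, 1}"]) auto
  then show ?thesis by (simp add: partition_map_def)
qed

text \<open>Delete from the rectangle all pairs with equal n-th code. What remains is a kernel with
  zero diagonal on the partition generated by the code, A and C, and almost every pair is eventually
  separated, so nothing is lost in the limit.\<close>

lemma approximable_Times:
  assumes A: "A \<in> sets \<mu>" and C: "C \<in> sets \<mu>"
  shows "approximable \<mu> (indicator (A \<times> C))"
proof (rule approximable_limit)
  let ?s = "\<lambda>n z. indicator (A \<times> C) z * of_bool (code n (fst z) \<noteq> code n (snd z)) :: real"
  show "approximable \<mu> (?s n)" for n
  proof (rule offdiag_approximable)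
    let ?p = "\<lambda>z. prod_encode (code n z, prod_encode (if z \<in> A then 1 else 0, if z \<in> C then 1 else 0))"
    have "partition_map \<mu> ?p"
      by (intro partition_map_pair partition_code partition_indicator A C)
    then show "offdiag \<mu> (?s n)"
      unfolding offdiag_def
      by (intro exI[of _ ?p] exI[of _ "\<lambda>i j. of_bool (fst (prod_decode i) \<noteq> fst (prod_decode j)) *
        (real (fst (prod_decode (snd (prod_decode i)))) * real (snd (prod_decode (snd (prod_decode j)))))"])
        (auto simp: indicator_def)
  qed
  show "indicator (A \<times> C) \<in> borel_measurable (\<mu> \<Otimes>\<^sub>M \<mu>)"
    using A C by measurable
  show "AE z in \<mu> \<Otimes>\<^sub>M \<mu>. (\<lambda>n. ?s n z) \<longlonglongrightarrow> indicator (A \<times> C) z"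
    using diag_null
  proof eventually_elim
    case (elim z)
    then obtain k where k: "(fst z \<in> B k) \<noteq> (snd z \<in> B k)" by blast
    have ne: "code n (fst z) \<noteq> code n (snd z)" if "n > k" for n
      using that k by (auto simp: code_inj)
    have "\<forall>\<^sub>F n in sequentially. ?s n z = indicator (A \<times> C) z"
      by (rule eventually_mono[OF eventually_gt_at_top[of k]]) (simp add: ne)
    then show ?case by (rule tendsto_eventually)
  qed
  show "(\<integral>\<^sup>+ z. ennreal 1 \<partial>(\<mu> \<Otimes>\<^sub>M \<mu>)) < \<infinity>"
    using finite_measure.emeasure_finite[OF finite_\<mu>2] by (simp add: top.not_eq_extremum)
  show "(indicator (A \<times> C) z - ?s n z)\<^sup>2 \<le> 1" for n z
    by (auto simp: indicator_def)
qed simp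

lemma approximable_indicator:
  assumes "E \<in> sets (\<mu> \<Otimes>\<^sub>M \<mu>)"
  shows "approximable \<mu> (indicator E)"
proof -
  let ?\<Omega> = "space \<mu> \<times> space \<mu>"
  let ?G = "{a \<times> b | a b. a \<in> sets \<mu> \<and> b \<in> sets \<mu>}"
  have E: "E \<in> sigma_sets ?\<Omega> ?G" using assms by (simp add: sets_pair_measure)
  have sets: "X \<in> sets (\<mu> \<Otimes>\<^sub>M \<mu>)" if "X \<in> sigma_sets ?\<Omega> ?G" for X using that by (simp add: sets_pair_measure)
  show ?thesis using Int_stable_pair_measure_generator[of \<mu> \<mu>] pair_measure_closed[of \<mu> \<mu>] E
  proof (induction rule: sigma_sets_induct_disjoint)
    case (basic X)
    then show ?case using approximable_Times by auto
  next
    case empty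
    then show ?case using approximable_zero by (simp add: indicator_def[abs_def])
  next
    case (compl X)
    have "approximable \<mu> (\<lambda>z. indicator ?\<Omega> z + (-1) * indicator X z)"
      by (intro approximable_add approximable_cmult approximable_Times compl) auto
    then show ?case
      by (rule approximable_cong) (auto simp: indicator_def space_pair_measure)
  next
    case (union X)
    have X [measurable]: "X i \<in> sets (\<mu> \<Otimes>\<^sub>M \<mu>)" for i using union.hyps sets by blast
    show ?case
    proof (rule approximable_limit)
      show "approximable \<mu> (\<lambda>z. \<Sum>i<n. indicator (X i) z)" for n
        by (intro approximable_sum union.IH) auto
      have part: "(\<Sum>i<n. indicator (X i) z) = (indicator (\<Union>i<n. X i) z :: real)" for n z
        using union.hyps(1) by (intro indicator_UN_disjoint[symmetric]) (auto simp: disjoint_family_on_def)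
      show "AE z in \<mu> \<Otimes>\<^sub>M \<mu>. (\<lambda>n. \<Sum>i<n. indicator (X i) z) \<longlonglongrightarrow> (indicator (\<Union>i. X i) z :: real)"
        unfolding part by (intro AE_I2 LIMSEQ_indicator_UN)
      show "(\<integral>\<^sup>+ z. ennreal 1 \<partial>(\<mu> \<Otimes>\<^sub>M \<mu>)) < \<infinity>"
        using finite_measure.emeasure_finite[OF finite_\<mu>2] by (simp add: top.not_eq_extremum)
      show "(indicator (\<Union>i. X i) z - (\<Sum>i<n. indicator (X i) z))\<^sup>2 \<le> (1::real)" for n z
        unfolding part by (auto simp: indicator_def)
    qed auto
  qed
qed

theorem approximable_L2:
  assumes H [measurable]: "H \<in> borel_measurable (\<mu> \<Otimes>\<^sub>M \<mu>)"
    and sq: "(\<integral>\<^sup>+ z. ennreal ((H z)\<^sup>2) \<partial>(\<mu> \<Otimes>\<^sub>M \<mu>)) < \<infinity>"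
  shows "approximable \<mu> H"
proof -
  obtain F where F: "\<And>i. simple_function (\<mu> \<Otimes>\<^sub>M \<mu>) (F i)"
    "\<And>z. z \<in> space (\<mu> \<Otimes>\<^sub>M \<mu>) \<Longrightarrow> (\<lambda>i. F i z) \<longlonglongrightarrow> H z"
    "\<And>i z. z \<in> space (\<mu> \<Otimes>\<^sub>M \<mu>) \<Longrightarrow> dist (F i z) 0 \<le> 2 * dist (H z) 0"
    using borel_measurable_implies_sequence_metric[OF H, of 0] by blast
  show ?thesis
  proof (rule approximable_limit[OF _ H])
    show "approximable \<mu> (F i)" for i
    proof -
      let ?M = "\<mu> \<Otimes>\<^sub>M \<mu>"
      have fin: "finite (F i ` space ?M)" using F(1)[of i] by (simp add: simple_function_def)
      have "approximable \<mu> (\<lambda>z. \<Sum>y\<in>F i ` space ?M. y * indicator (F i -` {y} \<inter> space ?M) z)"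
        by (intro approximable_sum fin approximable_cmult approximable_indicator simple_functionD(2)[OF F(1)])
      then show ?thesis
      proof (rule approximable_cong)
        fix z assume z: "z \<in> space ?M"
        have "(\<Sum>y\<in>F i ` space ?M. y * indicator (F i -` {y} \<inter> space ?M) z) =
            (\<Sum>y\<in>F i ` space ?M. if y = F i z then y else 0)"
          using z by (intro sum.cong) (auto simp: indicator_def)
        then show "(\<Sum>y\<in>F i ` space ?M. y * indicator (F i -` {y} \<inter> space ?M) z) = F i z"
          using fin z by simp
      qed
    qed
    show "AE z in \<mu> \<Otimes>\<^sub>M \<mu>. (\<lambda>n. F n z) \<longlonglongrightarrow> H z" using F(2) by (intro AE_I2)
    show "(\<integral>\<^sup>+ z. ennreal (9 * (H z)\<^sup>2) \<partial>(\<mu> \<Otimes>\<^sub>M \<mu>)) < \<infinity>"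
      using sq by (simp add: ennreal_mult nn_integral_cmult ennreal_mult_less_top)
    \<comment> \<open>The simple functions satisfy |F| \<le> 2 |H|, hence |H - F| \<le> 3 |H|, which
      explains the factor 9 of the dominating function.\<close>
    show "(H z - F n z)\<^sup>2 \<le> 9 * (H z)\<^sup>2" if "z \<in> space (\<mu> \<Otimes>\<^sub>M \<mu>)" for n z
    proof -
      have "\<bar>H z - F n z\<bar> \<le> 3 * \<bar>H z\<bar>" using F(3)[OF that, of n] by (auto simp: dist_real_def)
      then have "\<bar>H z - F n z\<bar>\<^sup>2 \<le> (3 * \<bar>H z\<bar>)\<^sup>2" by (intro power_mono) auto
      then show ?thesis by (simp add: power_mult_distrib)
    qed
  qed simp
qed

end

section \<open>Block averages over a partition\<close>

context finite_measure
begin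

definition cell :: "('a \<Rightarrow> nat) \<Rightarrow> nat \<Rightarrow> 'a set" where
  "cell p i = p -` {i} \<inter> space M"

definition block :: "('a \<Rightarrow> nat) \<Rightarrow> nat \<Rightarrow> nat \<Rightarrow> ('a \<times> 'a) set" where
  "block p i j = cell p i \<times> cell p j"

definition block_integral :: "('a \<Rightarrow> nat) \<Rightarrow> ('a \<times> 'a \<Rightarrow> real) \<Rightarrow> nat \<Rightarrow> nat \<Rightarrow> real" where
  "block_integral p f i j = (\<integral>z. indicator (block p i j) z * f z \<partial>(M \<Otimes>\<^sub>M M))"

text \<open>On a null block the integral and the denominator both vanish, and division by zero gives
  the value 0.\<close>

definition block_mean :: "('a \<Rightarrow> nat) \<Rightarrow> ('a \<times> 'a \<Rightarrow> real) \<Rightarrow> nat \<Rightarrow> nat \<Rightarrow> real" where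
  "block_mean p f i j = block_integral p f i j / (measure M (cell p i) * measure M (cell p j))"

text \<open>The L2 projection of f onto the kernels that are constant on blocks and zero on diagonal
  blocks.\<close>

definition offdiag_mean :: "('a \<Rightarrow> nat) \<Rightarrow> ('a \<times> 'a \<Rightarrow> real) \<Rightarrow> nat \<Rightarrow> nat \<Rightarrow> real" where
  "offdiag_mean p f i j = (if i = j then 0 else block_mean p f i j)"

lemma finite_pair: "finite_measure (M \<Otimes>\<^sub>M M)"
  by (intro finite_measure_pair_measure finite_measure_axioms)

lemma cell_sets: "partition_map M p \<Longrightarrow> cell p i \<in> sets M"
  unfolding cell_def partition_map_def by (auto intro: measurable_sets)

lemma block_sets: "partition_map M p \<Longrightarrow> block p i j \<in> sets (M \<Otimes>\<^sub>M M)"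
  unfolding block_def by (intro pair_measureI cell_sets)

lemma measure_block: "partition_map M p \<Longrightarrow> measure (M \<Otimes>\<^sub>M M) (block p i j) = measure M (cell p i) * measure M (cell p j)"
  unfolding block_def measure_def
  by (subst emeasure_pair_measure_Times) (auto simp: cell_sets enn2real_mult)

lemma integrable_block: "partition_map M p \<Longrightarrow> integrable (M \<Otimes>\<^sub>M M) f \<Longrightarrow>
    integrable (M \<Otimes>\<^sub>M M) (\<lambda>z. indicator (block p i j) z * f z :: real)"
  using integrable_mult_indicator[OF block_sets, of p f i j] by simp

lemma sum_block_indicator:
  assumes "partition_map M p" and z: "z \<in> space (M \<Otimes>\<^sub>M M)"
  shows "(\<Sum>i\<in>p ` space M. \<Sum>j\<in>p ` space M. indicator (block p i j) z * f z :: real) = f z"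
proof -
  have fin: "finite (p ` space M)" using assms by (simp add: partition_map_def)
  have zs: "fst z \<in> space M" "snd z \<in> space M" using z by (auto simp: space_pair_measure)
  have "(\<Sum>i\<in>p ` space M. \<Sum>j\<in>p ` space M. indicator (block p i j) z * f z) =
    (\<Sum>i\<in>p ` space M. \<Sum>j\<in>p ` space M. if j = p (snd z) then (if i = p (fst z) then f z else 0) else 0)"
    using zs by (intro sum.cong refl) (auto simp: block_def cell_def indicator_def mem_Times_iff)
  also have "\<dots> = f z" using fin zs by simp
  finally show ?thesis .
qed

lemma integral_eq_sum_blocks:
  assumes p: "partition_map M p" and f: "integrable (M \<Otimes>\<^sub>M M) f"
  shows "(\<integral>z. f z \<partial>(M \<Otimes>\<^sub>M M)) = (\<Sum>i\<in>p ` space M. \<Sum>j\<in>p ` space M. block_integral p f i j)"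
proof -
  have "(\<integral>z. f z \<partial>(M \<Otimes>\<^sub>M M)) = (\<integral>z. (\<Sum>i\<in>p ` space M. \<Sum>j\<in>p ` space M. indicator (block p i j) z * f z) \<partial>(M \<Otimes>\<^sub>M M))"
    using sum_block_indicator[OF p] by (intro Bochner_Integration.integral_cong) auto
  also have "\<dots> = (\<Sum>i\<in>p ` space M. \<Sum>j\<in>p ` space M. block_integral p f i j)"
    unfolding block_integral_def
    by (subst Bochner_Integration.integral_sum, intro Bochner_Integration.integrable_sum integrable_block p f)
       (intro sum.cong refl Bochner_Integration.integral_sum integrable_block p f)
  finally show ?thesis .
qed

lemma partition_kernel_bounded:
  assumes p: "partition_map M p"
  obtains C where "\<And>z. z \<in> space (M \<Otimes>\<^sub>M M) \<Longrightarrow> \<bar>a (p (fst z)) (p (snd z)) :: real\<bar> \<le> C"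
proof -
  have fin: "finite ((\<lambda>(i, j). \<bar>a i j\<bar>) ` (p ` space M \<times> p ` space M))"
    using p by (simp add: partition_map_def)
  show ?thesis
  proof (rule that)
    fix z assume "z \<in> space (M \<Otimes>\<^sub>M M)"
    then have "\<bar>a (p (fst z)) (p (snd z))\<bar> \<in> (\<lambda>(i, j). \<bar>a i j\<bar>) ` (p ` space M \<times> p ` space M)"
      by (auto simp: space_pair_measure intro!: image_eqI[of _ _ "(p (fst z), p (snd z))"])
    then show "\<bar>a (p (fst z)) (p (snd z))\<bar> \<le> Max ((\<lambda>(i, j). \<bar>a i j\<bar>) ` (p ` space M \<times> p ` space M))"
      using fin by (intro Max_ge)
  qed
qed

lemma integrable_partition_kernel:
  assumes p: "partition_map M p"
  shows "integrable (M \<Otimes>\<^sub>M M) (\<lambda>z. a (p (fst z)) (p (snd z)) :: real)"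
proof -
  interpret pair: finite_measure "M \<Otimes>\<^sub>M M" by (rule finite_pair)
  obtain C where "\<And>z. z \<in> space (M \<Otimes>\<^sub>M M) \<Longrightarrow> \<bar>a (p (fst z)) (p (snd z)) :: real\<bar> \<le> C"
    using partition_kernel_bounded[OF p] by blast
  then show ?thesis
    by (intro pair.integrable_const_bound[of _ C] measurable_partition_kernel[OF p] AE_I2) simp
qed

lemma integrable_sq_diff_partition_kernel:
  fixes H :: "'a \<times> 'a \<Rightarrow> real"
  assumes p: "partition_map M p" and H [measurable]: "H \<in> borel_measurable (M \<Otimes>\<^sub>M M)"
    and sq: "integrable (M \<Otimes>\<^sub>M M) (\<lambda>z. (H z)\<^sup>2)"
  shows "integrable (M \<Otimes>\<^sub>M M) (\<lambda>z. (H z - a (p (fst z)) (p (snd z)))\<^sup>2)"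
proof (rule Bochner_Integration.integrable_bound)
  show "integrable (M \<Otimes>\<^sub>M M) (\<lambda>z. 2 * (H z)\<^sup>2 + 2 * (a (p (fst z)) (p (snd z)))\<^sup>2)"
    using integrable_partition_kernel[OF p, of "\<lambda>i j. (a i j)\<^sup>2"] sq by simp
  have [measurable]: "(\<lambda>z. a (p (fst z)) (p (snd z))) \<in> borel_measurable (M \<Otimes>\<^sub>M M)"
    by (rule measurable_partition_kernel[OF p])
  show "(\<lambda>z. (H z - a (p (fst z)) (p (snd z)))\<^sup>2) \<in> borel_measurable (M \<Otimes>\<^sub>M M)" by measurable
  show "AE z in M \<Otimes>\<^sub>M M. norm ((H z - a (p (fst z)) (p (snd z)))\<^sup>2) \<le>
      norm (2 * (H z)\<^sup>2 + 2 * (a (p (fst z)) (p (snd z)))\<^sup>2)"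
  proof (rule AE_I2)
    fix z
    show "norm ((H z - a (p (fst z)) (p (snd z)))\<^sup>2) \<le> norm (2 * (H z)\<^sup>2 + 2 * (a (p (fst z)) (p (snd z)))\<^sup>2)"
      using sq_add_le[of "H z" "- a (p (fst z)) (p (snd z))"] by simp
  qed
qed

lemma integrable_of_sq:
  fixes f :: "'b \<Rightarrow> real"
  assumes "finite_measure N" and [measurable]: "f \<in> borel_measurable N" and "integrable N (\<lambda>z. (f z)\<^sup>2)"
  shows "integrable N f"
  using finite_measure.square_integrable_imp_integrable[OF assms(1,2)] assms(3) by simp

lemma block_integral_kernel:
  assumes p: "partition_map M p"
  shows "block_integral p (\<lambda>z. a (p (fst z)) (p (snd z))) i j = a i j * (measure M (cell p i) * measure M (cell p j))"
proof -
  have "block_integral p (\<lambda>z. a (p (fst z)) (p (snd z))) i j = (\<integral>z. a i j * indicator (block p i j) z \<partial>(M \<Otimes>\<^sub>M M))"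
    unfolding block_integral_def
    by (intro Bochner_Integration.integral_cong) (auto simp: indicator_def block_def cell_def)
  also have "\<dots> = a i j * measure (M \<Otimes>\<^sub>M M) (block p i j)"
    using block_sets[OF p] by simp
  finally show ?thesis by (simp add: measure_block[OF p])
qed

lemma block_integral_sq_diff:
  assumes p: "partition_map M p" and H [measurable]: "H \<in> borel_measurable (M \<Otimes>\<^sub>M M)"
    and sq: "integrable (M \<Otimes>\<^sub>M M) (\<lambda>z. (H z)\<^sup>2)"
  shows "block_integral p (\<lambda>z. (H z - a (p (fst z)) (p (snd z)))\<^sup>2) i j =
    block_integral p (\<lambda>z. (H z)\<^sup>2) i j - 2 * a i j * block_integral p H i j
      + (a i j)\<^sup>2 * (measure M (cell p i) * measure M (cell p j))"
proof -
  have Hi: "integrable (M \<Otimes>\<^sub>M M) H" by (rule integrable_of_sq[OF finite_pair H sq])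
  have "block_integral p (\<lambda>z. (H z - a (p (fst z)) (p (snd z)))\<^sup>2) i j =
    (\<integral>z. indicator (block p i j) z * (H z)\<^sup>2 - 2 * a i j * (indicator (block p i j) z * H z)
      + (a i j)\<^sup>2 * indicator (block p i j) z \<partial>(M \<Otimes>\<^sub>M M))"
    unfolding block_integral_def
    by (intro Bochner_Integration.integral_cong)
       (auto simp: indicator_def block_def cell_def power2_eq_square algebra_simps)
  also have "\<dots> = block_integral p (\<lambda>z. (H z)\<^sup>2) i j - 2 * a i j * block_integral p H i j
      + (a i j)\<^sup>2 * measure (M \<Otimes>\<^sub>M M) (block p i j)"
    using integrable_block[OF p sq] integrable_block[OF p Hi] block_sets[OF p] finite_measure.emeasure_finite[OF finite_pair]
    by (simp add: block_integral_def top.not_eq_extremum)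
  finally show ?thesis by (simp add: measure_block[OF p])
qed

text \<open>On each block the squared error is a quadratic polynomial in the constant, minimised by
  the mean. So the existence of some good off-diagonal kernel already makes the means good, and it
  is for means that Jensen's inequality controls the weighted fourth moment.\<close>

lemma offdiag_mean_best:
  assumes p: "partition_map M p" and H [measurable]: "H \<in> borel_measurable (M \<Otimes>\<^sub>M M)"
    and sq: "integrable (M \<Otimes>\<^sub>M M) (\<lambda>z. (H z)\<^sup>2)" and a: "\<And>i. a i i = 0"
  shows "(\<integral>z. (H z - offdiag_mean p H (p (fst z)) (p (snd z)))\<^sup>2 \<partial>(M \<Otimes>\<^sub>M M))
    \<le> (\<integral>z. (H z - a (p (fst z)) (p (snd z)))\<^sup>2 \<partial>(M \<Otimes>\<^sub>M M))"
  unfolding integral_eq_sum_blocks[OF p integrable_sq_diff_partition_kernel[OF p H sq]]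
proof (intro sum_mono)
  fix i j
  let ?q = "measure M (cell p i) * measure M (cell p j)" and ?I = "block_integral p H i j"
  have I0: "?I = 0" if "?q = 0"
  proof -
    have "block p i j \<in> null_sets (M \<Otimes>\<^sub>M M)"
      using that measure_block[OF p, of i j] block_sets[OF p, of i j]
        finite_measure.emeasure_eq_measure[OF finite_pair, of "block p i j"]
      by (intro null_setsI) auto
    then have "AE z in M \<Otimes>\<^sub>M M. z \<notin> block p i j" by (rule AE_not_in)
    then have "AE z in M \<Otimes>\<^sub>M M. indicator (block p i j) z * H z = 0" by auto
    then show ?thesis unfolding block_integral_def by (rule integral_eq_zero_AE)
  qed
  have "2 * offdiag_mean p H i j * ?I - (offdiag_mean p H i j)\<^sup>2 * ?q \<ge> 2 * a i j * ?I - (a i j)\<^sup>2 * ?q"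
  proof (cases "i = j \<or> ?q = 0")
    case True
    then show ?thesis using I0 a by (auto simp: offdiag_mean_def)
  next
    case False
    then have q: "?q > 0" by (auto simp: zero_less_measure_iff)
    have m: "offdiag_mean p H i j = ?I / ?q" using False by (simp add: offdiag_mean_def block_mean_def)
    have "0 \<le> (a i j - ?I / ?q)\<^sup>2 * ?q" using q by simp
    also have "\<dots> = (2 * (?I / ?q) * ?I - (?I / ?q)\<^sup>2 * ?q) - (2 * a i j * ?I - (a i j)\<^sup>2 * ?q)"
    proof -
      have "(c - I / Q)\<^sup>2 * Q = (2 * (I / Q) * I - (I / Q)\<^sup>2 * Q) - (2 * c * I - c\<^sup>2 * Q)" if "Q > 0" for c I Q :: real
        using that by (simp add: power2_eq_square field_simps)
      from this[OF q] show ?thesis .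
    qed
    finally show ?thesis unfolding m by simp
  qed
  then show "block_integral p (\<lambda>z. (H z - offdiag_mean p H (p (fst z)) (p (snd z)))\<^sup>2) i j
      \<le> block_integral p (\<lambda>z. (H z - a (p (fst z)) (p (snd z)))\<^sup>2) i j"
    unfolding block_integral_sq_diff[OF p H sq] by simp
qed

text \<open>Jensen's inequality for the perspective \<open>(x, y) \<mapsto> x\<^sup>4 / y\<^sup>3\<close>, from its tangent planes.\<close>

lemma block_jensen:
  assumes p: "partition_map M p" and H: "integrable (M \<Otimes>\<^sub>M M) H"
    and \<kappa>: "integrable (M \<Otimes>\<^sub>M M) \<kappa>" "\<And>z. z \<in> space (M \<Otimes>\<^sub>M M) \<Longrightarrow> \<kappa> z > 0"
    and H4: "integrable (M \<Otimes>\<^sub>M M) (\<lambda>z. H z ^ 4 / \<kappa> z ^ 3)"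
    and pos: "measure M (cell p i) > 0" "measure M (cell p j) > 0"
  shows "block_mean p \<kappa> i j > 0"
    and "measure M (cell p i) * measure M (cell p j) * (block_mean p H i j ^ 4 / block_mean p \<kappa> i j ^ 3)
      \<le> block_integral p (\<lambda>z. H z ^ 4 / \<kappa> z ^ 3) i j"
proof -
  let ?q = "measure M (cell p i) * measure M (cell p j)"
  let ?I = "block_integral p H i j" and ?K = "block_integral p \<kappa> i j"
  have q: "?q > 0" using pos by simp
  have nn: "indicator (block p i j) z * \<kappa> z \<ge> 0" if "z \<in> space (M \<Otimes>\<^sub>M M)" for z
    using \<kappa>(2)[OF that] by simp
  have K: "?K > 0"
  proof (rule ccontr)
    assume "\<not> ?K > 0"
    moreover have "?K \<ge> 0" unfolding block_integral_def using nn by (intro integral_nonneg_AE AE_I2)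
    ultimately have "?K = 0" by simp
    then have "AE z in M \<Otimes>\<^sub>M M. indicator (block p i j) z * \<kappa> z = 0"
      unfolding block_integral_def
      by (subst (asm) integral_nonneg_eq_0_iff_AE[OF integrable_block[OF p \<kappa>(1)]]) (use nn in auto)
    then have "AE z in M \<Otimes>\<^sub>M M. z \<notin> block p i j"
      using AE_space
    proof eventually_elim
      case (elim z)
      then show ?case using \<kappa>(2)[of z] by (auto simp: indicator_def)
    qed
    from emeasure_eq_0_AE[OF this] have "emeasure (M \<Otimes>\<^sub>M M) {z \<in> space (M \<Otimes>\<^sub>M M). z \<in> block p i j} = 0" .
    moreover have "{z \<in> space (M \<Otimes>\<^sub>M M). z \<in> block p i j} = block p i j"
      using sets.sets_into_space[OF block_sets[OF p, of i j]] by auto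
    ultimately have "measure (M \<Otimes>\<^sub>M M) (block p i j) = 0" by (simp add: measure_def)
    then show False using pos by (simp add: measure_block[OF p])
  qed
  then show "block_mean p \<kappa> i j > 0" using q by (simp add: block_mean_def)
  \<comment> \<open>The ratio at which the tangent plane touches the perspective in the pair of
    block integrals, so that the linear lower bound equals \<open>?I ^ 4 / ?K ^ 3\<close>
    exactly.\<close>
  define l where "l = ?I / ?K"
  have tangent: "4 * l ^ 3 * x - 3 * l ^ 4 * k \<le> x ^ 4 / k ^ 3" if "k > 0" for x k :: real
  proof -
    \<comment> \<open>With u = x / k, the product (u - l)^2 ((u + l)^2 + 2 l^2) equals u^4 - 4 l^3 u
      + 3 l^4.\<close>
    have "0 \<le> (x / k - l)\<^sup>2 * ((x / k + l)\<^sup>2 + 2 * l\<^sup>2) * k" using that by simp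
    also have "\<dots> = x ^ 4 / k ^ 3 - (4 * l ^ 3 * x - 3 * l ^ 4 * k)"
      using that by (simp add: field_simps power_numeral_reduce)
    finally show ?thesis by simp
  qed
  have "4 * l ^ 3 * ?I - 3 * l ^ 4 * ?K =
    (\<integral>z. 4 * l ^ 3 * (indicator (block p i j) z * H z) - 3 * l ^ 4 * (indicator (block p i j) z * \<kappa> z) \<partial>(M \<Otimes>\<^sub>M M))"
    unfolding block_integral_def using integrable_block[OF p H] integrable_block[OF p \<kappa>(1)] by simp
  also have "\<dots> \<le> block_integral p (\<lambda>z. H z ^ 4 / \<kappa> z ^ 3) i j"
    unfolding block_integral_def
  proof (rule integral_mono)
    show "4 * l ^ 3 * (indicator (block p i j) z * H z) - 3 * l ^ 4 * (indicator (block p i j) z * \<kappa> z)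
      \<le> indicator (block p i j) z * (H z ^ 4 / \<kappa> z ^ 3)" if "z \<in> space (M \<Otimes>\<^sub>M M)" for z
      using tangent[OF \<kappa>(2)[OF that], of "H z"] by (simp add: indicator_def)
  qed (use integrable_block[OF p H] integrable_block[OF p \<kappa>(1)] integrable_block[OF p H4] in auto)
  also have "4 * l ^ 3 * ?I - 3 * l ^ 4 * ?K = ?I ^ 4 / ?K ^ 3"
    using K by (simp add: l_def field_simps power_numeral_reduce)
  also have "?I ^ 4 / ?K ^ 3 = ?q * (block_mean p H i j ^ 4 / block_mean p \<kappa> i j ^ 3)"
  proof -
    have "I ^ 4 / L ^ 3 = Q * ((I / Q) ^ 4 / (L / Q) ^ 3)" if "Q > 0" "L > 0" for I L Q :: real
      using that by (simp add: field_simps power_numeral_reduce)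
    from this[OF q K] show ?thesis unfolding block_mean_def .
  qed
  finally show "?q * (block_mean p H i j ^ 4 / block_mean p \<kappa> i j ^ 3) \<le> block_integral p (\<lambda>z. H z ^ 4 / \<kappa> z ^ 3) i j" .
qed

lemma block_integral_swap:
  assumes p: "partition_map M p" and H: "integrable (M \<Otimes>\<^sub>M M) H"
    and sym: "\<And>x y. x \<in> space M \<Longrightarrow> y \<in> space M \<Longrightarrow> H (x, y) = H (y, x)"
  shows "block_integral p H i j = block_integral p H j i"
proof -
  interpret pair_sigma_finite M M ..
  have "block_integral p H j i = (\<integral>(x, y). (indicator (block p j i) (y, x) * H (y, x)) \<partial>(M \<Otimes>\<^sub>M M))"
    unfolding block_integral_def
    by (rule integral_product_swap[symmetric]) (use integrable_block[OF p H] in auto)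
  also have "\<dots> = block_integral p H i j"
    unfolding block_integral_def
    by (intro Bochner_Integration.integral_cong)
       (auto simp: indicator_def block_def space_pair_measure sym)
  finally show ?thesis ..
qed

end

text \<open>For each n, density provides a kernel with error below 1 / (n + 1), and passing to the
  means on its partition does not increase the error. The partitions are chosen separately and need
  not be nested.\<close>

theorem (in diffuse_measure) offdiag_means_converge:
  assumes H [measurable]: "H \<in> borel_measurable (\<mu> \<Otimes>\<^sub>M \<mu>)"
    and sq: "integrable (\<mu> \<Otimes>\<^sub>M \<mu>) (\<lambda>z. (H z)\<^sup>2)"
  obtains p where "\<And>n. partition_map \<mu> (p n)"
    and "(\<lambda>n. \<integral>z. (H z - offdiag_mean (p n) H (p n (fst z)) (p n (snd z)))\<^sup>2 \<partial>(\<mu> \<Otimes>\<^sub>M \<mu>)) \<longlonglongrightarrow> 0"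
proof -
  have "(\<integral>\<^sup>+ z. ennreal ((H z)\<^sup>2) \<partial>(\<mu> \<Otimes>\<^sub>M \<mu>)) < \<infinity>"
    using sq by (simp add: integrable_iff_bounded)
  then have appr: "approximable \<mu> H" by (rule approximable_L2[OF H])
  have ex: "\<forall>n. \<exists>p. partition_map \<mu> p \<and>
      (\<integral>z. (H z - offdiag_mean p H (p (fst z)) (p (snd z)))\<^sup>2 \<partial>(\<mu> \<Otimes>\<^sub>M \<mu>)) \<le> 1 / real (Suc n)"
  proof
    fix n :: nat
    obtain g where g: "offdiag \<mu> g" "(\<integral>\<^sup>+ z. ennreal ((H z - g z)\<^sup>2) \<partial>(\<mu> \<Otimes>\<^sub>M \<mu>)) < ennreal (1 / real (Suc n))"
      using appr unfolding approximable_def by (metis of_nat_0_less_iff zero_less_Suc zero_less_divide_1_iff)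
    obtain p a where p: "partition_map \<mu> p" "\<And>i. a i i = 0"
      "\<And>z. z \<in> space (\<mu> \<Otimes>\<^sub>M \<mu>) \<Longrightarrow> g z = a (p (fst z)) (p (snd z))"
      using g(1) unfolding offdiag_def by blast
    have int: "integrable (\<mu> \<Otimes>\<^sub>M \<mu>) (\<lambda>z. (H z - a (p (fst z)) (p (snd z)))\<^sup>2)"
      by (rule integrable_sq_diff_partition_kernel[OF p(1) H sq])
    have "ennreal (\<integral>z. (H z - a (p (fst z)) (p (snd z)))\<^sup>2 \<partial>(\<mu> \<Otimes>\<^sub>M \<mu>)) =
        (\<integral>\<^sup>+ z. ennreal ((H z - a (p (fst z)) (p (snd z)))\<^sup>2) \<partial>(\<mu> \<Otimes>\<^sub>M \<mu>))"
      by (rule nn_integral_eq_integral[symmetric, OF int]) simp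
    also have "\<dots> = (\<integral>\<^sup>+ z. ennreal ((H z - g z)\<^sup>2) \<partial>(\<mu> \<Otimes>\<^sub>M \<mu>))"
      using p(3) by (intro nn_integral_cong) auto
    also have "\<dots> < ennreal (1 / real (Suc n))" by (rule g(2))
    finally have "(\<integral>z. (H z - a (p (fst z)) (p (snd z)))\<^sup>2 \<partial>(\<mu> \<Otimes>\<^sub>M \<mu>)) < 1 / real (Suc n)"
      by (subst (asm) ennreal_less_iff) auto
    with offdiag_mean_best[where a = a, OF p(1) H sq p(2)] p(1)
    show "\<exists>p. partition_map \<mu> p \<and>
      (\<integral>z. (H z - offdiag_mean p H (p (fst z)) (p (snd z)))\<^sup>2 \<partial>(\<mu> \<Otimes>\<^sub>M \<mu>)) \<le> 1 / real (Suc n)"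
      by (intro exI[of _ p]) linarith
  qed
  from choice[OF ex] obtain p where ps: "\<forall>n. partition_map \<mu> (p n) \<and>
      (\<integral>z. (H z - offdiag_mean (p n) H (p n (fst z)) (p n (snd z)))\<^sup>2 \<partial>(\<mu> \<Otimes>\<^sub>M \<mu>)) \<le> 1 / real (Suc n)"
    by (rule exE)
  note p = ps[rule_format, THEN conjunct1] ps[rule_format, THEN conjunct2]
  have "(\<lambda>n. \<integral>z. (H z - offdiag_mean (p n) H (p n (fst z)) (p n (snd z)))\<^sup>2 \<partial>(\<mu> \<Otimes>\<^sub>M \<mu>)) \<longlonglongrightarrow> 0"
  proof (rule tendsto_sandwich[OF _ _ tendsto_const])
    show "(\<lambda>n. 1 / real (Suc n)) \<longlonglongrightarrow> 0" by (rule LIMSEQ_inverse_real_of_nat[unfolded inverse_eq_divide])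
    show "\<forall>\<^sub>F n in sequentially. 0 \<le> (\<integral>z. (H z - offdiag_mean (p n) H (p n (fst z)) (p n (snd z)))\<^sup>2 \<partial>(\<mu> \<Otimes>\<^sub>M \<mu>))"
      by (intro always_eventually allI integral_nonneg_AE AE_I2) simp
    show "\<forall>\<^sub>F n in sequentially. (\<integral>z. (H z - offdiag_mean (p n) H (p n (fst z)) (p n (snd z)))\<^sup>2 \<partial>(\<mu> \<Otimes>\<^sub>M \<mu>)) \<le> 1 / real (Suc n)"
      by (intro always_eventually allI p(2))
  qed
  with p(1) show ?thesis by (rule that)
qed

section \<open>Square integrable functions and convergence in L2\<close>

definition sq_integrable :: "'x measure \<Rightarrow> ('x \<Rightarrow> real) \<Rightarrow> bool" where
  "sq_integrable M f \<longleftrightarrow> f \<in> borel_measurable M \<and> integrable M (\<lambda>x. (f x)\<^sup>2)"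

lemma sq_integrable_mult:
  assumes "sq_integrable M f" "sq_integrable M g" shows "integrable M (\<lambda>x. f x * g x)"
proof (rule Bochner_Integration.integrable_bound[where f = "\<lambda>x. (f x)\<^sup>2 + (g x)\<^sup>2"])
  show "AE x in M. norm (f x * g x) \<le> norm ((f x)\<^sup>2 + (g x)\<^sup>2)"
  proof (rule AE_I2)
    fix x
    have "0 \<le> (\<bar>f x\<bar> - \<bar>g x\<bar>)\<^sup>2" by simp
    then have "2 * \<bar>f x * g x\<bar> \<le> (f x)\<^sup>2 + (g x)\<^sup>2"
      by (simp add: power2_diff abs_mult)
    then show "norm (f x * g x) \<le> norm ((f x)\<^sup>2 + (g x)\<^sup>2)" by simp
  qed
qed (use assms in \<open>auto simp: sq_integrable_def\<close>)

lemma sq_integrable_add: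
  assumes f: "sq_integrable M f" and g: "sq_integrable M g" shows "sq_integrable M (\<lambda>x. f x + g x)"
proof -
  have "integrable M (\<lambda>x. (f x)\<^sup>2 + 2 * (f x * g x) + (g x)\<^sup>2)"
    using assms sq_integrable_mult[OF f g] by (auto simp: sq_integrable_def)
  moreover have "(\<lambda>x. (f x)\<^sup>2 + 2 * (f x * g x) + (g x)\<^sup>2) = (\<lambda>x. (f x + g x)\<^sup>2)"
    by (simp add: power2_sum mult.assoc add_ac)
  ultimately show ?thesis using assms by (auto simp: sq_integrable_def)
qed

lemma sq_integrable_cmult: "sq_integrable M f \<Longrightarrow> sq_integrable M (\<lambda>x. c * f x)"
  by (auto simp: sq_integrable_def power_mult_distrib)

lemma sq_integrable_diff:
  "sq_integrable M f \<Longrightarrow> sq_integrable M g \<Longrightarrow> sq_integrable M (\<lambda>x. f x - g x)"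
  using sq_integrable_add[OF _ sq_integrable_cmult, of M f g "-1"] by simp

lemma sq_integrable_const: "finite_measure M \<Longrightarrow> sq_integrable M (\<lambda>x. c)"
  by (simp add: sq_integrable_def finite_measure.integrable_const)

lemma sq_integrable_bounded:
  assumes "finite_measure M" "f \<in> borel_measurable M" "\<And>x. \<bar>f x\<bar> \<le> C" shows "sq_integrable M f"
proof -
  have "norm ((f x)\<^sup>2) \<le> C\<^sup>2" for x
    using assms(3)[of x] abs_ge_zero[of "f x"] by (simp add: power2_le_iff_abs_le)
  then show ?thesis
    using assms by (auto simp: sq_integrable_def intro!: finite_measure.integrable_const_bound[of _ _ "C\<^sup>2"])
qed

lemma sq_integrable_imp_integrable: "finite_measure M \<Longrightarrow> sq_integrable M f \<Longrightarrow> integrable M f"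
  using sq_integrable_mult[OF _ sq_integrable_const, of M f 1] by simp

lemma integral_cauchy_schwarz:
  assumes f: "sq_integrable M f" and g: "sq_integrable M g"
  shows "(\<integral>x. f x * g x \<partial>M)\<^sup>2 \<le> (\<integral>x. (f x)\<^sup>2 \<partial>M) * (\<integral>x. (g x)\<^sup>2 \<partial>M)"
proof -
  let ?a = "\<integral>x. (f x)\<^sup>2 \<partial>M" and ?b = "\<integral>x. (g x)\<^sup>2 \<partial>M" and ?c = "\<integral>x. f x * g x \<partial>M"
  have i: "integrable M (\<lambda>x. (f x)\<^sup>2)" "integrable M (\<lambda>x. (g x)\<^sup>2)" "integrable M (\<lambda>x. f x * g x)"
    using assms sq_integrable_mult[OF f g] by (auto simp: sq_integrable_def)
  have quad: "0 \<le> s\<^sup>2 * ?a + 2 * s * t * ?c + t\<^sup>2 * ?b" for s t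
  proof -
    have "0 \<le> (\<integral>x. (s * f x + t * g x)\<^sup>2 \<partial>M)" by simp
    also have "\<dots> = (\<integral>x. s\<^sup>2 * (f x)\<^sup>2 + 2 * s * t * (f x * g x) + t\<^sup>2 * (g x)\<^sup>2 \<partial>M)"
      by (simp add: power2_eq_square algebra_simps)
    finally show ?thesis using i by simp
  qed
  have ab: "?a \<ge> 0" "?b \<ge> 0" by simp_all
  show ?thesis
  proof (cases "?b = 0")
    case True
    have "?c = 0"
    proof (rule ccontr)
      assume c: "?c \<noteq> 0"
      \<comment> \<open>For \<open>?b = 0\<close> and s = 1 the quadratic form is affine in t; this
        t gives it the value -1.\<close>
      have "0 \<le> 1\<^sup>2 * ?a + 2 * 1 * (- (?a + 1) / (2 * ?c)) * ?c + (- (?a + 1) / (2 * ?c))\<^sup>2 * ?b" by (rule quad)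
      also have "\<dots> = -1" using True c by (simp add: field_simps)
      finally show False by simp
    qed
    then show ?thesis using True by simp
  next
    case False
    have "0 \<le> ?b\<^sup>2 * ?a + 2 * ?b * (- ?c) * ?c + (- ?c)\<^sup>2 * ?b" by (rule quad)
    also have "\<dots> = ?b * (?a * ?b - ?c\<^sup>2)" by (simp add: power2_eq_square algebra_simps)
    finally show ?thesis using False ab by (simp add: zero_le_mult_iff)
  qed
qed

definition L2_tendsto :: "'x measure \<Rightarrow> (nat \<Rightarrow> 'x \<Rightarrow> real) \<Rightarrow> ('x \<Rightarrow> real) \<Rightarrow> bool" where
  "L2_tendsto M f l \<longleftrightarrow> (\<forall>n. sq_integrable M (f n)) \<and> sq_integrable M l \<and>
     (\<lambda>n. \<integral>x. (f n x - l x)\<^sup>2 \<partial>M) \<longlonglongrightarrow> 0"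

lemma L2_tendsto_const: "sq_integrable M l \<Longrightarrow> L2_tendsto M (\<lambda>n. l) l"
  by (simp add: L2_tendsto_def)

lemma L2_tendsto_integral_mult:
  assumes f: "L2_tendsto M f l" and g: "L2_tendsto M g k"
  shows "(\<lambda>n. \<integral>x. f n x * g n x \<partial>M) \<longlonglongrightarrow> (\<integral>x. l x * k x \<partial>M)"
proof -
  note L = f[unfolded L2_tendsto_def] g[unfolded L2_tendsto_def]
  define df where "df = (\<lambda>n x. f n x - l x)"
  define dg where "dg = (\<lambda>n x. g n x - k x)"
  have sq: "sq_integrable M (df n)" "sq_integrable M (dg n)" "sq_integrable M l" "sq_integrable M k" for n
    using L unfolding df_def dg_def by (auto intro: sq_integrable_diff)
  have lim: "(\<lambda>n. \<integral>x. (df n x)\<^sup>2 \<partial>M) \<longlonglongrightarrow> 0" "(\<lambda>n. \<integral>x. (dg n x)\<^sup>2 \<partial>M) \<longlonglongrightarrow> 0"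
    using L by (auto simp: df_def dg_def)
  have small: "(\<lambda>n. \<integral>x. u n x * v n x \<partial>M) \<longlonglongrightarrow> 0"
    if "\<And>n. sq_integrable M (u n)" "\<And>n. sq_integrable M (v n)"
      "(\<lambda>n. (\<integral>x. (u n x)\<^sup>2 \<partial>M) * (\<integral>x. (v n x)\<^sup>2 \<partial>M)) \<longlonglongrightarrow> 0" for u v
  proof -
    have "(\<lambda>n. (\<integral>x. u n x * v n x \<partial>M)\<^sup>2) \<longlonglongrightarrow> 0"
    proof (rule tendsto_sandwich[OF _ _ tendsto_const that(3)])
      show "\<forall>\<^sub>F n in sequentially. (\<integral>x. u n x * v n x \<partial>M)\<^sup>2 \<le> (\<integral>x. (u n x)\<^sup>2 \<partial>M) * (\<integral>x. (v n x)\<^sup>2 \<partial>M)"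
        using integral_cauchy_schwarz[OF that(1,2)] by (intro always_eventually allI)
    qed simp
    from tendsto_real_sqrt[OF this] have "(\<lambda>n. \<bar>\<integral>x. u n x * v n x \<partial>M\<bar>) \<longlonglongrightarrow> 0" by simp
    then show ?thesis by (simp add: tendsto_rabs_zero_iff)
  qed
  have "(\<lambda>n. (\<integral>x. df n x * dg n x \<partial>M) + (\<integral>x. df n x * k x \<partial>M) + (\<integral>x. l x * dg n x \<partial>M) + (\<integral>x. l x * k x \<partial>M))
     \<longlonglongrightarrow> 0 + 0 + 0 + (\<integral>x. l x * k x \<partial>M)"
  proof (intro tendsto_add small sq tendsto_const)
    show "(\<lambda>n. (\<integral>x. (df n x)\<^sup>2 \<partial>M) * (\<integral>x. (dg n x)\<^sup>2 \<partial>M)) \<longlonglongrightarrow> 0"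
      using tendsto_mult[OF lim] by simp
    show "(\<lambda>n. (\<integral>x. (df n x)\<^sup>2 \<partial>M) * (\<integral>x. (k x)\<^sup>2 \<partial>M)) \<longlonglongrightarrow> 0"
      using tendsto_mult_right[OF lim(1), of "\<integral>x. (k x)\<^sup>2 \<partial>M"] by simp
    show "(\<lambda>n. (\<integral>x. (l x)\<^sup>2 \<partial>M) * (\<integral>x. (dg n x)\<^sup>2 \<partial>M)) \<longlonglongrightarrow> 0"
      using tendsto_mult_left[OF lim(2), of "\<integral>x. (l x)\<^sup>2 \<partial>M"] by simp
  qed
  moreover have "(\<integral>x. f n x * g n x \<partial>M) =
    (\<integral>x. df n x * dg n x \<partial>M) + (\<integral>x. df n x * k x \<partial>M) + (\<integral>x. l x * dg n x \<partial>M) + (\<integral>x. l x * k x \<partial>M)" for n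
  proof -
    have "(\<integral>x. f n x * g n x \<partial>M) = (\<integral>x. df n x * dg n x + df n x * k x + l x * dg n x + l x * k x \<partial>M)"
      by (simp add: df_def dg_def algebra_simps)
    then show ?thesis
      using sq_integrable_mult[OF sq(1,2)] sq_integrable_mult[OF sq(1,4)] sq_integrable_mult[OF sq(3,2)]
        sq_integrable_mult[OF sq(3,4)] by simp
  qed
  ultimately show ?thesis by simp
qed

lemma L2_tendsto_integral:
  assumes "finite_measure M" "L2_tendsto M f l"
  shows "(\<lambda>n. \<integral>x. f n x \<partial>M) \<longlonglongrightarrow> (\<integral>x. l x \<partial>M)"
  using L2_tendsto_integral_mult[OF assms(2) L2_tendsto_const[OF sq_integrable_const[OF assms(1), of 1]]] by simp

lemma L2_tendsto_sq:
  assumes "L2_tendsto M f l"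
  shows "(\<lambda>n. \<integral>x. (f n x)\<^sup>2 \<partial>M) \<longlonglongrightarrow> (\<integral>x. (l x)\<^sup>2 \<partial>M)"
  using L2_tendsto_integral_mult[OF assms assms] by (simp add: power2_eq_square)

text \<open>Boundedness keeps the composition square integrable, and the Lipschitz bound transfers
  the convergence. It is meant for the Stein solution and its derivative.\<close>

lemma L2_tendsto_compose:
  assumes M: "finite_measure M" and f: "L2_tendsto M f l" and F [measurable]: "F \<in> borel_measurable borel"
    and bound: "\<And>x. \<bar>F x\<bar> \<le> C" and lip: "\<And>x y. \<bar>F x - F y\<bar> \<le> D * \<bar>x - y\<bar>"
  shows "L2_tendsto M (\<lambda>n x. F (f n x)) (\<lambda>x. F (l x))"
  unfolding L2_tendsto_def
proof (intro conjI allI)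
  have sq: "sq_integrable M (f n)" "sq_integrable M l" for n using f by (auto simp: L2_tendsto_def)
  then have [measurable]: "f n \<in> borel_measurable M" "l \<in> borel_measurable M" for n
    by (auto simp: sq_integrable_def)
  show s: "sq_integrable M (\<lambda>x. F (f n x))" "sq_integrable M (\<lambda>x. F (l x))" for n
    by (rule sq_integrable_bounded[OF M _ bound]; measurable)+
  have le: "(\<integral>x. (F (f n x) - F (l x))\<^sup>2 \<partial>M) \<le> D\<^sup>2 * (\<integral>x. (f n x - l x)\<^sup>2 \<partial>M)" for n
  proof -
    have "(\<integral>x. (F (f n x) - F (l x))\<^sup>2 \<partial>M) \<le> (\<integral>x. D\<^sup>2 * (f n x - l x)\<^sup>2 \<partial>M)"
    proof (rule integral_mono)
      show "(F (f n x) - F (l x))\<^sup>2 \<le> D\<^sup>2 * (f n x - l x)\<^sup>2" for x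
      proof -
        have "\<bar>F (f n x) - F (l x)\<bar>\<^sup>2 \<le> (D * \<bar>f n x - l x\<bar>)\<^sup>2" by (intro power_mono lip) simp
        then show ?thesis by (simp add: power_mult_distrib)
      qed
    qed (use sq_integrable_diff[OF s(1,2)] sq_integrable_diff[OF sq(1,2)] in \<open>auto simp: sq_integrable_def\<close>)
    then show ?thesis by simp
  qed
  show "(\<lambda>n. \<integral>x. (F (f n x) - F (l x))\<^sup>2 \<partial>M) \<longlonglongrightarrow> 0"
  proof (rule tendsto_sandwich[OF _ _ tendsto_const])
    show "(\<lambda>n. D\<^sup>2 * (\<integral>x. (f n x - l x)\<^sup>2 \<partial>M)) \<longlonglongrightarrow> 0"
      using f tendsto_mult_left[of _ 0 sequentially "D\<^sup>2"] by (auto simp: L2_tendsto_def)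
  qed (use le in \<open>auto intro!: always_eventually\<close>)
qed

section \<open>The variance functional of a kernel\<close>

context finite_measure
begin

definition row_integral :: "('a \<times> 'a \<Rightarrow> real) \<Rightarrow> 'a \<Rightarrow> real" where
  "row_integral g x = (\<integral>y. g (x, y) \<partial>M)"

text \<open>The factor 4 comes from squaring \<open>h = 2 * row_integral\<close>; the two terms are
  the variances of the first- and second-order parts of a pair sum.\<close>

definition pair_variance :: "('a \<times> 'a \<Rightarrow> real) \<Rightarrow> real" where
  "pair_variance g = 4 * (\<integral>x. (row_integral g x)\<^sup>2 \<partial>M) + 2 * (\<integral>z. (g z)\<^sup>2 \<partial>(M \<Otimes>\<^sub>M M))"

lemma row_integral_sq:
  assumes g: "sq_integrable (M \<Otimes>\<^sub>M M) g"
  shows "sq_integrable M (row_integral g)"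
    and "(\<integral>x. (row_integral g x)\<^sup>2 \<partial>M) \<le> measure M (space M) * (\<integral>z. (g z)\<^sup>2 \<partial>(M \<Otimes>\<^sub>M M))"
proof -
  interpret pair_sigma_finite M M ..
  have gm [measurable]: "g \<in> borel_measurable (M \<Otimes>\<^sub>M M)" and g2: "integrable (M \<Otimes>\<^sub>M M) (\<lambda>z. (g z)\<^sup>2)"
    using g by (auto simp: sq_integrable_def)
  have rm [measurable]: "row_integral g \<in> borel_measurable M"
    unfolding row_integral_def by measurable
  have "AE x in M. integrable M (\<lambda>y. (g (x, y))\<^sup>2)"
    using AE_integrable_fst'[OF g2] by simp
  then have le: "AE x in M. (row_integral g x)\<^sup>2 \<le> measure M (space M) * (\<integral>y. (g (x, y))\<^sup>2 \<partial>M)"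
    using AE_space
  proof eventually_elim
    case (elim x)
    then have "sq_integrable M (\<lambda>y. g (x, y))" by (simp add: sq_integrable_def)
    from integral_cauchy_schwarz[OF this sq_integrable_const[OF finite_measure_axioms, of 1]]
    show ?case by (simp add: row_integral_def mult.commute)
  qed
  have int: "integrable M (\<lambda>x. measure M (space M) * (\<integral>y. (g (x, y))\<^sup>2 \<partial>M))"
    using integrable_fst'[OF g2] by simp
  have i: "integrable M (\<lambda>x. (row_integral g x)\<^sup>2)"
  proof (rule Bochner_Integration.integrable_bound[OF int])
    show "AE x in M. norm ((row_integral g x)\<^sup>2) \<le> norm (measure M (space M) * (\<integral>y. (g (x, y))\<^sup>2 \<partial>M))"
      using le by eventually_elim auto
  qed measurable
  then show "sq_integrable M (row_integral g)" by (simp add: sq_integrable_def)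
  have "(\<integral>x. (row_integral g x)\<^sup>2 \<partial>M) \<le> (\<integral>x. measure M (space M) * (\<integral>y. (g (x, y))\<^sup>2 \<partial>M) \<partial>M)"
    by (rule integral_mono_AE[OF i int le])
  also have "\<dots> = measure M (space M) * (\<integral>z. (g z)\<^sup>2 \<partial>(M \<Otimes>\<^sub>M M))"
    using integral_fst'[OF g2] by simp
  finally show "(\<integral>x. (row_integral g x)\<^sup>2 \<partial>M) \<le> measure M (space M) * (\<integral>z. (g z)\<^sup>2 \<partial>(M \<Otimes>\<^sub>M M))" .
qed

lemma pair_variance_le:
  assumes "sq_integrable (M \<Otimes>\<^sub>M M) g"
  shows "pair_variance g \<le> (4 * measure M (space M) + 2) * (\<integral>z. (g z)\<^sup>2 \<partial>(M \<Otimes>\<^sub>M M))"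
  unfolding pair_variance_def using row_integral_sq(2)[OF assms] by (simp add: distrib_right)

text \<open>Integrating out one coordinate is bounded from L2 of the pairs to L2 because the total
  mass is finite, so both terms are continuous in the kernel.\<close>

lemma pair_variance_tendsto:
  assumes g: "L2_tendsto (M \<Otimes>\<^sub>M M) g H"
  shows "(\<lambda>n. pair_variance (g n)) \<longlonglongrightarrow> pair_variance H"
proof -
  interpret pair_sigma_finite M M ..
  have sq: "sq_integrable (M \<Otimes>\<^sub>M M) (g n)" "sq_integrable (M \<Otimes>\<^sub>M M) H" for n
    using g by (auto simp: L2_tendsto_def)
  have lim: "(\<lambda>n. \<integral>z. (g n z - H z)\<^sup>2 \<partial>(M \<Otimes>\<^sub>M M)) \<longlonglongrightarrow> 0"
    using g by (auto simp: L2_tendsto_def)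
  have int: "integrable (M \<Otimes>\<^sub>M M) (g n)" "integrable (M \<Otimes>\<^sub>M M) H" for n
    using sq finite_pair by (auto intro: sq_integrable_imp_integrable)
  have row_diff: "(\<integral>x. (row_integral (g n) x - row_integral H x)\<^sup>2 \<partial>M) =
      (\<integral>x. (row_integral (\<lambda>z. g n z - H z) x)\<^sup>2 \<partial>M)" for n
  proof (rule integral_cong_AE)
    show "AE x in M. (row_integral (g n) x - row_integral H x)\<^sup>2 = (row_integral (\<lambda>z. g n z - H z) x)\<^sup>2"
      using AE_integrable_fst'[OF int(1)[of n]] AE_integrable_fst'[OF int(2)]
      by eventually_elim (simp add: row_integral_def)
  qed (use row_integral_sq(1)[OF sq(1)[of n]] row_integral_sq(1)[OF sq(2)]
      row_integral_sq(1)[OF sq_integrable_diff[OF sq(1)[of n] sq(2)]] in \<open>auto simp: sq_integrable_def\<close>)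
  have "L2_tendsto M (\<lambda>n. row_integral (g n)) (row_integral H)"
    unfolding L2_tendsto_def
  proof (intro conjI allI row_integral_sq sq)
    show "(\<lambda>n. \<integral>x. (row_integral (g n) x - row_integral H x)\<^sup>2 \<partial>M) \<longlonglongrightarrow> 0"
      unfolding row_diff
    proof (rule tendsto_sandwich[OF _ _ tendsto_const])
      show "\<forall>\<^sub>F n in sequentially. (\<integral>x. (row_integral (\<lambda>z. g n z - H z) x)\<^sup>2 \<partial>M)
          \<le> measure M (space M) * (\<integral>z. (g n z - H z)\<^sup>2 \<partial>(M \<Otimes>\<^sub>M M))"
        by (intro always_eventually allI row_integral_sq(2) sq_integrable_diff sq)
      show "(\<lambda>n. measure M (space M) * (\<integral>z. (g n z - H z)\<^sup>2 \<partial>(M \<Otimes>\<^sub>M M))) \<longlonglongrightarrow> 0"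
        using tendsto_mult_left[OF lim, of "measure M (space M)"] by simp
    qed simp
  qed
  from L2_tendsto_sq[OF this] L2_tendsto_sq[OF g] show ?thesis
    unfolding pair_variance_def by (intro tendsto_intros)
qed

end

section \<open>Partition kernels summed over the points of the process\<close>

context finite_measure
begin

lemma integral_partition:
  assumes p: "partition_map M p"
  shows "(\<integral>z. f (p z) \<partial>M) = (\<Sum>i\<in>p ` space M. f i * measure M (cell p i) :: real)"
proof -
  have fin: "finite (p ` space M)" using p by (simp add: partition_map_def)
  have "(\<integral>z. f (p z) \<partial>M) = (\<integral>z. (\<Sum>i\<in>p ` space M. f i * indicator (cell p i) z) \<partial>M)"
  proof (rule Bochner_Integration.integral_cong)
    fix z assume z: "z \<in> space M"
    have "(\<Sum>i\<in>p ` space M. f i * indicator (cell p i) z) = (\<Sum>i\<in>p ` space M. if i = p z then f i else 0)"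
      using z by (intro sum.cong) (auto simp: cell_def indicator_def)
    then show "f (p z) = (\<Sum>i\<in>p ` space M. f i * indicator (cell p i) z)"
      using z fin by simp
  qed simp
  also have "\<dots> = (\<Sum>i\<in>p ` space M. f i * measure M (cell p i))"
    by (subst Bochner_Integration.integral_sum)
       (auto simp: cell_sets[OF p] emeasure_finite less_top[symmetric] intro!: integrable_mult_right)
  finally show ?thesis .
qed

lemma integral_partition_pair:
  assumes p: "partition_map M p"
  shows "(\<integral>z. a (p (fst z)) (p (snd z)) \<partial>(M \<Otimes>\<^sub>M M)) =
    (\<Sum>i\<in>p ` space M. \<Sum>j\<in>p ` space M. a i j * (measure M (cell p i) * measure M (cell p j)))"
  using integral_eq_sum_blocks[OF p integrable_partition_kernel[OF p, of a]]
  by (simp add: block_integral_kernel[OF p])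

end

context poisson_process
begin

lemma partition_\<xi>: "\<omega> \<in> space P \<Longrightarrow> partition_map \<mu> p \<Longrightarrow> partition_map (\<xi> \<omega>) p"
  using sets_\<xi>[of \<omega>] space_\<xi>[of \<omega>] measurable_cong_sets[of "\<xi> \<omega>" \<mu> "count_space (UNIV :: nat set)" "count_space UNIV"]
  by (simp add: partition_map_def)

lemma integral_kernel_\<xi>2:
  assumes \<omega>: "\<omega> \<in> space P" and p: "partition_map \<mu> p"
  shows "(\<integral>z. a (p (fst z)) (p (snd z)) \<partial>\<xi>2 \<omega>) = (\<Sum>i\<in>p ` space \<mu>. \<Sum>j\<in>p ` space \<mu>.
    a i j * (real (num (\<mu>.cell p i) \<omega>) * real (num (\<mu>.cell p j) \<omega>)))"
proof -
  interpret X: finite_measure "\<xi> \<omega>" by (rule finite_\<xi>[OF \<omega>])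
  have c: "X.cell p i = \<mu>.cell p i" for i
    by (simp add: X.cell_def \<mu>.cell_def space_\<xi>[OF \<omega>])
  show ?thesis
    using X.integral_partition_pair[OF partition_\<xi>[OF \<omega> p], of a]
    by (simp add: c space_\<xi>[OF \<omega>] measure_\<xi>[OF \<omega> \<mu>.cell_sets[OF p]])
qed

text \<open>The square of the point measure also charges coinciding points, but the kernels
  considered vanish there; the subtracted integral is then the mean.\<close>

definition pair_sum :: "('z \<times> 'z \<Rightarrow> real) \<Rightarrow> 'w \<Rightarrow> real" where
  "pair_sum g \<omega> = (\<integral>z. g z \<partial>\<xi>2 \<omega>) - (\<integral>z. g z \<partial>\<mu>2)"

text \<open>Null cells are discarded because \<open>finite_poisson\<close> asks for positive rates;
  they are almost surely empty.\<close>

definition pos_cells :: "('z \<Rightarrow> nat) \<Rightarrow> nat set" where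
  "pos_cells p = {i \<in> p ` space \<mu>. measure \<mu> (\<mu>.cell p i) > 0}"

abbreviation cell_mass :: "('z \<Rightarrow> nat) \<Rightarrow> nat \<Rightarrow> real" where
  "cell_mass p i \<equiv> measure \<mu> (\<mu>.cell p i)"

lemma finite_pos_cells: "partition_map \<mu> p \<Longrightarrow> finite (pos_cells p)"
  by (rule finite_subset[of _ "p ` space \<mu>"]) (auto simp: pos_cells_def partition_map_def)

lemma sum_pos_cells:
  assumes "partition_map \<mu> p" and "\<And>i. measure \<mu> (\<mu>.cell p i) = 0 \<Longrightarrow> f i = (0 :: real)"
  shows "(\<Sum>i\<in>p ` space \<mu>. f i) = (\<Sum>i\<in>pos_cells p. f i)"
  using assms by (intro sum.mono_neutral_right) (auto simp: partition_map_def pos_cells_def zero_less_measure_iff)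

lemma disjoint_cells: "disjoint_family_on (\<mu>.cell p) J"
  by (auto simp: disjoint_family_on_def \<mu>.cell_def)

lemma finite_poisson_cells: "partition_map \<mu> p \<Longrightarrow> finite_poisson (pos_cells p) (cell_mass p)"
  by unfold_locales (simp add: finite_pos_cells, simp add: pos_cells_def)

lemma finite_kernel_cells:
  assumes "partition_map \<mu> p" "\<And>i j. a i j = a j i" "\<And>i. a i i = 0"
  shows "finite_kernel (pos_cells p) (cell_mass p) a"
proof -
  interpret finite_poisson "pos_cells p" "cell_mass p" by (rule finite_poisson_cells[OF assms(1)])
  show ?thesis by unfold_locales (use assms in auto)
qed

lemma measurable_pair_sum_kernel:
  assumes p: "partition_map \<mu> p"
  shows "pair_sum (\<lambda>z. a (p (fst z)) (p (snd z))) \<in> borel_measurable P"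
proof -
  have [measurable]: "num (\<mu>.cell p i) \<in> measurable P (count_space UNIV)" for i
    by (rule measurable_num[OF \<mu>.cell_sets[OF p]])
  show ?thesis
    unfolding pair_sum_def
    by (subst measurable_cong, subst integral_kernel_\<xi>2[OF _ p], assumption, rule refl) measurable
qed

lemma pair_sum_kernel:
  assumes p: "partition_map \<mu> p" and sym: "\<And>i j. a i j = a j i" and diag: "\<And>i. a i i = 0"
  shows "AE \<omega> in P. pair_sum (\<lambda>z. a (p (fst z)) (p (snd z))) \<omega> =
    finite_kernel.F (pos_cells p) (cell_mass p) a (counts (pos_cells p) (\<mu>.cell p) \<omega>)"
proof -
  interpret fk: finite_kernel "pos_cells p" "cell_mass p" a by (rule finite_kernel_cells[OF p sym diag])
  let ?R = "p ` space \<mu>" and ?J = "pos_cells p"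
  have finR: "finite ?R" using p by (simp add: partition_map_def)
  have JR: "?J \<subseteq> ?R" by (auto simp: pos_cells_def)
  have "AE \<omega> in P. \<forall>i\<in>?R - ?J. num (\<mu>.cell p i) \<omega> = 0"
    using finR by (intro AE_finite_allI)
      (auto intro!: prob_num_zero \<mu>.cell_sets[OF p] simp: pos_cells_def zero_less_measure_iff)
  then show ?thesis using AE_space
  proof eventually_elim
    case (elim \<omega>)
    have red: "(\<Sum>i\<in>?R. \<Sum>j\<in>?R. a i j * (x i * x j)) = (\<Sum>i\<in>?J. \<Sum>j\<in>?J. a i j * (x i * x j))"
      if "\<And>i. i \<in> ?R - ?J \<Longrightarrow> x i = 0" for x :: "nat \<Rightarrow> real"
    proof -
      have "(\<Sum>i\<in>?R. \<Sum>j\<in>?R. a i j * (x i * x j)) = (\<Sum>i\<in>?R. \<Sum>j\<in>?J. a i j * (x i * x j))"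
        using that finR JR by (intro sum.cong refl sum.mono_neutral_right) auto
      also have "\<dots> = (\<Sum>i\<in>?J. \<Sum>j\<in>?J. a i j * (x i * x j))"
        using that finR JR by (intro sum.mono_neutral_right) auto
      finally show ?thesis .
    qed
    have "(\<integral>z. a (p (fst z)) (p (snd z)) \<partial>\<xi>2 \<omega>) =
        (\<Sum>i\<in>?J. \<Sum>j\<in>?J. a i j * (real (num (\<mu>.cell p i) \<omega>) * real (num (\<mu>.cell p j) \<omega>)))"
      unfolding integral_kernel_\<xi>2[OF elim(2) p] by (rule red) (use elim in auto)
    also have "\<dots> = (\<Sum>i\<in>?J. \<Sum>j\<in>?J. a i j *
        (real (counts ?J (\<mu>.cell p) \<omega> i) * real (counts ?J (\<mu>.cell p) \<omega> j)))"
      by (intro sum.cong refl) (simp add: counts_def)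
    also have "\<dots> = fk.F (counts ?J (\<mu>.cell p) \<omega>) + (\<Sum>i\<in>?J. \<Sum>j\<in>?J. a i j * (cell_mass p i * cell_mass p j))"
      by (rule fk.double_sum_eq_F)
    also have "(\<Sum>i\<in>?J. \<Sum>j\<in>?J. a i j * (cell_mass p i * cell_mass p j)) = (\<integral>z. a (p (fst z)) (p (snd z)) \<partial>\<mu>2)"
      unfolding \<mu>.integral_partition_pair[OF p]
      by (rule red[symmetric]) (auto simp: pos_cells_def zero_less_measure_iff)
    finally show ?case by (simp add: pair_sum_def)
  qed
qed

lemma expectation_pair_sum_kernel:
  fixes f :: "real \<Rightarrow> real"
  assumes p: "partition_map \<mu> p" and sym: "\<And>i j. a i j = a j i" and diag: "\<And>i. a i i = 0"
    and f [measurable]: "f \<in> borel_measurable borel"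
  shows "P.expectation (\<lambda>\<omega>. f (pair_sum (\<lambda>z. a (p (fst z)) (p (snd z))) \<omega>)) =
      measure_pmf.expectation (finite_poisson.law (pos_cells p) (cell_mass p))
        (\<lambda>n. f (finite_kernel.F (pos_cells p) (cell_mass p) a n))" (is ?eq)
    and "integrable (finite_poisson.law (pos_cells p) (cell_mass p))
        (\<lambda>n. f (finite_kernel.F (pos_cells p) (cell_mass p) a n)) \<Longrightarrow>
      integrable P (\<lambda>\<omega>. f (pair_sum (\<lambda>z. a (p (fst z)) (p (snd z))) \<omega>))" (is "_ \<Longrightarrow> ?int")
proof -
  interpret fk: finite_kernel "pos_cells p" "cell_mass p" a by (rule finite_kernel_cells[OF p sym diag])
  let ?J = "pos_cells p"
  have [measurable]: "counts ?J (\<mu>.cell p) \<in> measurable P (count_space UNIV)"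
    by (rule measurable_counts[OF finite_pos_cells[OF p] \<mu>.cell_sets[OF p]])
  have [measurable]: "fk.F \<in> measurable (count_space UNIV) borel" by simp
  note [measurable] = measurable_pair_sum_kernel[OF p, of a]
  have d: "distr P (count_space UNIV) (counts ?J (\<mu>.cell p)) = measure_pmf fk.law"
    by (rule distr_counts) (simp_all add: finite_pos_cells[OF p] \<mu>.cell_sets[OF p] disjoint_cells, simp add: pos_cells_def)
  have ae: "AE \<omega> in P. f (pair_sum (\<lambda>z. a (p (fst z)) (p (snd z))) \<omega>) = f (fk.F (counts ?J (\<mu>.cell p) \<omega>))"
    using pair_sum_kernel[where a = a, OF p sym diag] by eventually_elim simp
  have "P.expectation (\<lambda>\<omega>. f (pair_sum (\<lambda>z. a (p (fst z)) (p (snd z))) \<omega>)) =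
      P.expectation (\<lambda>\<omega>. f (fk.F (counts ?J (\<mu>.cell p) \<omega>)))"
    by (rule integral_cong_AE[OF _ _ ae]) measurable
  also have "\<dots> = fk.E (\<lambda>n. f (fk.F n))"
    unfolding d[symmetric] by (subst integral_distr) auto
  finally show ?eq .
  assume "integrable fk.law (\<lambda>n. f (fk.F n))"
  then have "integrable P (\<lambda>\<omega>. f (fk.F (counts ?J (\<mu>.cell p) \<omega>)))"
    unfolding d[symmetric] by (subst (asm) integrable_distr_eq) auto
  then show ?int
    by (subst integrable_cong_AE[OF _ _ ae]) measurable
qed

lemma s2_eq_pair_variance:
  assumes p: "partition_map \<mu> p" and sym: "\<And>i j. a i j = a j i" and diag: "\<And>i. a i i = 0"
  shows "finite_kernel.s2 (pos_cells p) (cell_mass p) a = \<mu>.pair_variance (\<lambda>z. a (p (fst z)) (p (snd z)))"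
proof -
  interpret fk: finite_kernel "pos_cells p" "cell_mass p" a by (rule finite_kernel_cells[OF p sym diag])
  have row: "\<mu>.row_integral (\<lambda>z. a (p (fst z)) (p (snd z))) x = fk.h (p x) / 2" for x
    unfolding \<mu>.row_integral_def fk.h_def using \<mu>.integral_partition[OF p, of "a (p x)"]
    by (simp add: sum_pos_cells[OF p] mult.commute)
  have 1: "4 * (\<integral>x. (\<mu>.row_integral (\<lambda>z. a (p (fst z)) (p (snd z))) x)\<^sup>2 \<partial>\<mu>) = (\<Sum>i\<in>pos_cells p. cell_mass p i * (fk.h i)\<^sup>2)"
  proof -
    have "4 * (\<integral>x. (\<mu>.row_integral (\<lambda>z. a (p (fst z)) (p (snd z))) x)\<^sup>2 \<partial>\<mu>) = (\<integral>x. (fk.h (p x))\<^sup>2 \<partial>\<mu>)"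
      unfolding row by (simp add: power_divide)
    also have "\<dots> = (\<Sum>i\<in>pos_cells p. cell_mass p i * (fk.h i)\<^sup>2)"
      using \<mu>.integral_partition[OF p, of "\<lambda>i. (fk.h i)\<^sup>2"]
      by (simp add: sum_pos_cells[OF p] mult.commute)
    finally show ?thesis .
  qed
  have 2: "(\<integral>z. (a (p (fst z)) (p (snd z)))\<^sup>2 \<partial>\<mu>2) =
      (\<Sum>i\<in>pos_cells p. \<Sum>j\<in>pos_cells p. cell_mass p i * cell_mass p j * (a i j)\<^sup>2)"
    using \<mu>.integral_partition_pair[OF p, of "\<lambda>i j. (a i j)\<^sup>2"]
    by (simp add: sum_pos_cells[OF p] mult_ac)
  show ?thesis unfolding fk.s2_def \<mu>.pair_variance_def 1 2 ..
qed

lemma pair_sum_kernel_moments: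
  assumes p: "partition_map \<mu> p" and sym: "\<And>i j. a i j = a j i" and diag: "\<And>i. a i i = 0"
  shows "sq_integrable P (pair_sum (\<lambda>z. a (p (fst z)) (p (snd z))))"
    and "P.expectation (pair_sum (\<lambda>z. a (p (fst z)) (p (snd z)))) = 0"
    and "P.expectation (\<lambda>\<omega>. (pair_sum (\<lambda>z. a (p (fst z)) (p (snd z))) \<omega>)\<^sup>2) =
      \<mu>.pair_variance (\<lambda>z. a (p (fst z)) (p (snd z)))"
proof -
  interpret fk: finite_kernel "pos_cells p" "cell_mass p" a by (rule finite_kernel_cells[OF p sym diag])
  note e = expectation_pair_sum_kernel[where a = a, OF p sym diag]
  show "sq_integrable P (pair_sum (\<lambda>z. a (p (fst z)) (p (snd z))))"
    unfolding sq_integrable_def using measurable_pair_sum_kernel[OF p, of a] e(2)[of "\<lambda>x. x\<^sup>2"]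
      fk.integrable_tame[OF fk.tame_power[OF fk.tame_F, of 2]] by simp
  show "P.expectation (pair_sum (\<lambda>z. a (p (fst z)) (p (snd z)))) = 0"
    using e(1)[of "\<lambda>x. x"] fk.E_F by simp
  show "P.expectation (\<lambda>\<omega>. (pair_sum (\<lambda>z. a (p (fst z)) (p (snd z))) \<omega>)\<^sup>2) =
      \<mu>.pair_variance (\<lambda>z. a (p (fst z)) (p (snd z)))"
    using e(1)[of "\<lambda>x. x\<^sup>2"] fk.E_F_sq s2_eq_pair_variance[OF p sym diag] by simp
qed

lemma pair_sum_diff_kernel:
  assumes p: "partition_map \<mu> p" and q: "partition_map \<mu> q" and \<omega>: "\<omega> \<in> space P"
  shows "pair_sum (\<lambda>z. a (p (fst z)) (p (snd z))) \<omega> - pair_sum (\<lambda>z. b (q (fst z)) (q (snd z))) \<omega> =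
    pair_sum (\<lambda>z. a (p (fst z)) (p (snd z)) - b (q (fst z)) (q (snd z))) \<omega>"
proof -
  interpret X: finite_measure "\<xi> \<omega>" by (rule finite_\<xi>[OF \<omega>])
  show ?thesis
    unfolding pair_sum_def
    using X.integrable_partition_kernel[OF partition_\<xi>[OF \<omega> p], of a] X.integrable_partition_kernel[OF partition_\<xi>[OF \<omega> q], of b]
      \<mu>.integrable_partition_kernel[OF p, of a] \<mu>.integrable_partition_kernel[OF q, of b]
    by simp
qed

text \<open>Both kernels live on the common refinement, where their difference is again symmetric
  with zero diagonal, since equal pairs of labels have equal components. The variance formula for
  partition kernels then turns the L2 distance into the pair variance of the difference.\<close>

lemma pair_sum_diff_sq_le:
  assumes p: "partition_map \<mu> p" "\<And>i j. a i j = a j i" "\<And>i. a i i = 0"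
    and q: "partition_map \<mu> q" "\<And>i j. b i j = b j i" "\<And>i. b i i = 0"
  shows "P.expectation (\<lambda>\<omega>. (pair_sum (\<lambda>z. a (p (fst z)) (p (snd z))) \<omega> - pair_sum (\<lambda>z. b (q (fst z)) (q (snd z))) \<omega>)\<^sup>2)
    \<le> (4 * measure \<mu> (space \<mu>) + 2) * (\<integral>z. (a (p (fst z)) (p (snd z)) - b (q (fst z)) (q (snd z)))\<^sup>2 \<partial>\<mu>2)"
proof -
  define c where "c = (\<lambda>i j. a (fst (prod_decode i)) (fst (prod_decode j)) - b (snd (prod_decode i)) (snd (prod_decode j)))"
  let ?pq = "\<lambda>z. prod_encode (p z, q z)"
  have c: "c (?pq x) (?pq y) = a (p x) (p y) - b (q x) (q y)" for x y by (simp add: c_def)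
  have cs: "c i j = c j i" "c i i = 0" for i j
    using p(2)[of "fst (prod_decode i)" "fst (prod_decode j)"] q(2)[of "snd (prod_decode i)" "snd (prod_decode j)"] p(3) q(3)
    by (auto simp: c_def)
  have "P.expectation (\<lambda>\<omega>. (pair_sum (\<lambda>z. a (p (fst z)) (p (snd z))) \<omega> - pair_sum (\<lambda>z. b (q (fst z)) (q (snd z))) \<omega>)\<^sup>2)
      = P.expectation (\<lambda>\<omega>. (pair_sum (\<lambda>z. c (?pq (fst z)) (?pq (snd z))) \<omega>)\<^sup>2)"
    unfolding c by (intro Bochner_Integration.integral_cong refl) (simp add: pair_sum_diff_kernel[OF p(1) q(1)])
  also have "\<dots> = \<mu>.pair_variance (\<lambda>z. c (?pq (fst z)) (?pq (snd z)))"
    by (rule pair_sum_kernel_moments(3)[where a = c, OF partition_map_pair[OF p(1) q(1)] cs])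
  also have "\<dots> \<le> (4 * measure \<mu> (space \<mu>) + 2) * (\<integral>z. (c (?pq (fst z)) (?pq (snd z)))\<^sup>2 \<partial>\<mu>2)"
    by (rule \<mu>.pair_variance_le)
       (use \<mu>.integrable_partition_kernel[OF partition_map_pair[OF p(1) q(1)], of "\<lambda>i j. (c i j)\<^sup>2"]
         measurable_partition_kernel[OF partition_map_pair[OF p(1) q(1)], of c]
        in \<open>auto simp: sq_integrable_def\<close>)
  finally show ?thesis unfolding c .
qed

end

section \<open>Normal approximation of pair statistics\<close>

context finite_measure
begin

lemma block_integral_transpose:
  assumes p: "partition_map M p" and H: "integrable (M \<Otimes>\<^sub>M M) H"
  shows "block_integral p (\<lambda>z. H (snd z, fst z)) j i = block_integral p H i j"
proof -
  interpret pair_sigma_finite M M ..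
  have "block_integral p H i j = (\<integral>(x, y). (indicator (block p i j) (y, x) * H (y, x)) \<partial>(M \<Otimes>\<^sub>M M))"
    unfolding block_integral_def
    by (rule integral_product_swap[symmetric]) (use integrable_block[OF p H] in auto)
  also have "\<dots> = block_integral p (\<lambda>z. H (snd z, fst z)) j i"
    unfolding block_integral_def
    by (intro Bochner_Integration.integral_cong) (auto simp: indicator_def block_def)
  finally show ?thesis ..
qed

lemma integrable_transpose:
  assumes "integrable (M \<Otimes>\<^sub>M M) H"
  shows "integrable (M \<Otimes>\<^sub>M M) (\<lambda>z. H (snd z, fst z) :: real)"
proof -
  interpret pair_sigma_finite M M ..
  show ?thesis using integrable_product_swap[OF assms] by (simp add: case_prod_unfold)
qed

text \<open>Summing over j removes the partition in the second coordinate, and the row bound is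
  integrated over the cell. Applied to the transposed kernel it serves for columns.\<close>

lemma block_row_sum_le:
  assumes p: "partition_map M p" and \<kappa>: "integrable (M \<Otimes>\<^sub>M M) \<kappa>"
    and row: "\<And>x. x \<in> space M \<Longrightarrow> (\<integral>y. \<kappa> (x, y) \<partial>M) \<le> 1"
  shows "(\<Sum>j\<in>p ` space M. block_integral p \<kappa> i j) \<le> measure M (cell p i)"
proof -
  interpret pair_sigma_finite M M ..
  have fin: "finite (p ` space M)" using p by (simp add: partition_map_def)
  have c [measurable]: "cell p i \<in> sets M" by (rule cell_sets[OF p])
  have int: "integrable (M \<Otimes>\<^sub>M M) (\<lambda>z. indicator (cell p i \<times> space M) z * \<kappa> z)"
    using integrable_mult_indicator[OF _ \<kappa>, of "cell p i \<times> space M"] by simp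
  have "(\<Sum>j\<in>p ` space M. block_integral p \<kappa> i j) =
      (\<integral>z. (\<Sum>j\<in>p ` space M. indicator (block p i j) z * \<kappa> z) \<partial>(M \<Otimes>\<^sub>M M))"
    unfolding block_integral_def
    by (rule Bochner_Integration.integral_sum[symmetric]) (rule integrable_block[OF p \<kappa>])
  also have "\<dots> = (\<integral>z. indicator (cell p i \<times> space M) z * \<kappa> z \<partial>(M \<Otimes>\<^sub>M M))"
  proof (rule Bochner_Integration.integral_cong)
    fix z assume z: "z \<in> space (M \<Otimes>\<^sub>M M)"
    have "(\<Sum>j\<in>p ` space M. indicator (block p i j) z * \<kappa> z) =
        (\<Sum>j\<in>p ` space M. if j = p (snd z) then indicator (cell p i \<times> space M) z * \<kappa> z else 0)"
      using z by (intro sum.cong) (auto simp: block_def cell_def indicator_def space_pair_measure)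
    then show "(\<Sum>j\<in>p ` space M. indicator (block p i j) z * \<kappa> z) = indicator (cell p i \<times> space M) z * \<kappa> z"
      using z fin by (auto simp: space_pair_measure)
  qed simp
  also have "\<dots> = (\<integral>x. (\<integral>y. indicator (cell p i \<times> space M) (x, y) * \<kappa> (x, y) \<partial>M) \<partial>M)"
    using integral_fst'[OF int] by simp
  also have "\<dots> \<le> (\<integral>x. indicator (cell p i) x \<partial>M)"
  proof (rule integral_mono)
    show "integrable M (\<lambda>x. \<integral>y. indicator (cell p i \<times> space M) (x, y) * \<kappa> (x, y) \<partial>M)"
      using integrable_fst'[OF int] by simp
    show "integrable M (indicator (cell p i) :: 'a \<Rightarrow> real)"
      using c by (simp add: emeasure_finite less_top[symmetric])
    fix x assume x: "x \<in> space M"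
    have "(\<integral>y. indicator (cell p i \<times> space M) (x, y) * \<kappa> (x, y) \<partial>M) = indicator (cell p i) x * (\<integral>y. \<kappa> (x, y) \<partial>M)"
      by (subst Bochner_Integration.integral_mult_right_zero[symmetric])
         (intro Bochner_Integration.integral_cong, auto simp: indicator_def)
    also have "\<dots> \<le> indicator (cell p i) x" using row[OF x] by (auto simp: indicator_def)
    finally show "(\<integral>y. indicator (cell p i \<times> space M) (x, y) * \<kappa> (x, y) \<partial>M) \<le> indicator (cell p i) x" .
  qed
  also have "\<dots> = measure M (cell p i)" using c by simp
  finally show ?thesis .
qed

end

text \<open>G is tied to the double integral of H only almost surely, and the zero diagonal of H
  makes this integral a sum over pairs of distinct points. The weight has row and column bounds
  separately because it need not be symmetric.\<close>

locale pair_statistic = poisson_process P \<mu> \<xi> + diffuse: diffuse_measure \<mu> B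
  for P :: "'w measure" and \<mu> :: "'z measure" and \<xi> B +
  fixes H \<kappa> :: "'z \<times> 'z \<Rightarrow> real" and k :: real and G :: "'w \<Rightarrow> real"
  assumes H_meas [measurable]: "H \<in> borel_measurable (\<mu> \<Otimes>\<^sub>M \<mu>)"
    and H_sym: "\<And>x y. x \<in> space \<mu> \<Longrightarrow> y \<in> space \<mu> \<Longrightarrow> H (x, y) = H (y, x)"
    and H_diag: "\<And>x. x \<in> space \<mu> \<Longrightarrow> H (x, x) = 0"
    and \<kappa>_meas [measurable]: "\<kappa> \<in> borel_measurable (\<mu> \<Otimes>\<^sub>M \<mu>)"
    and \<kappa>_pos: "\<And>z. \<kappa> z > 0" and \<kappa>_le: "\<And>z. \<kappa> z \<le> k"
    and \<kappa>_row: "\<And>x. x \<in> space \<mu> \<Longrightarrow> (\<integral>y. \<kappa> (x, y) \<partial>\<mu>) \<le> 1"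
    and \<kappa>_col: "\<And>y. y \<in> space \<mu> \<Longrightarrow> (\<integral>x. \<kappa> (x, y) \<partial>\<mu>) \<le> 1"
    and H4: "integrable (\<mu> \<Otimes>\<^sub>M \<mu>) (\<lambda>z. H z ^ 4 / \<kappa> z ^ 3)"
    and G_meas [measurable]: "G \<in> borel_measurable P"
    and G_eq: "AE \<omega> in P. G \<omega> = (\<integral>z. H z \<partial>(\<xi> \<omega> \<Otimes>\<^sub>M \<xi> \<omega>))"
begin

definition M4 :: real where "M4 = (\<integral>z. H z ^ 4 / \<kappa> z ^ 3 \<partial>\<mu>2)"
definition Y :: "'w \<Rightarrow> real" where "Y \<omega> = G \<omega> - (\<integral>z. H z \<partial>\<mu>2)"
abbreviation mass :: real where "mass \<equiv> measure \<mu> (space \<mu>)"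

lemma k_pos: "k > 0"
  using \<kappa>_pos[of undefined] \<kappa>_le[of undefined] by linarith

sublocale \<mu>2: finite_measure "\<mu> \<Otimes>\<^sub>M \<mu>"
  by (rule \<mu>.finite_pair)

lemma integrable_\<kappa>: "integrable \<mu>2 \<kappa>"
  using \<kappa>_pos \<kappa>_le by (intro \<mu>2.integrable_const_bound[of _ k]) (auto simp: abs_of_pos)

lemma sq_integrable_H: "sq_integrable \<mu>2 H"
proof -
  have "integrable \<mu>2 (\<lambda>z. (H z)\<^sup>2)"
  proof (rule Bochner_Integration.integrable_bound)
    show "integrable \<mu>2 (\<lambda>z. H z ^ 4 / \<kappa> z ^ 3 + k ^ 3)" using H4 by simp
    show "AE z in \<mu>2. norm ((H z)\<^sup>2) \<le> norm (H z ^ 4 / \<kappa> z ^ 3 + k ^ 3)"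
    proof (rule AE_I2)
      fix z
      \<comment> \<open>Used with x = H^2 and c = \<kappa>^3, which gives 2 H^2 \<le> H^4 /
        \<kappa>^3 + \<kappa>^3.\<close>
      have amgm: "2 * x \<le> x\<^sup>2 / c + c" if "c > 0" for x c :: real
      proof -
        have "0 \<le> (x - c)\<^sup>2 / c" using that by simp
        also have "\<dots> = x\<^sup>2 / c + c - 2 * x" using that by (simp add: power2_eq_square field_simps)
        finally show ?thesis by simp
      qed
      have "2 * (H z)\<^sup>2 \<le> H z ^ 4 / \<kappa> z ^ 3 + \<kappa> z ^ 3"
        using amgm[of "\<kappa> z ^ 3" "(H z)\<^sup>2"] \<kappa>_pos[of z] by simp
      moreover have "\<kappa> z ^ 3 \<le> k ^ 3" using \<kappa>_pos[of z] \<kappa>_le[of z] by (intro power_mono) auto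
      moreover have "(H z)\<^sup>2 \<ge> 0" by simp
      ultimately have "(H z)\<^sup>2 \<le> H z ^ 4 / \<kappa> z ^ 3 + k ^ 3" by linarith
      then show "norm ((H z)\<^sup>2) \<le> norm (H z ^ 4 / \<kappa> z ^ 3 + k ^ 3)" by simp
    qed
  qed measurable
  then show ?thesis by (simp add: sq_integrable_def)
qed

lemma integrable_H: "integrable \<mu>2 H"
  by (rule sq_integrable_imp_integrable[OF \<mu>.finite_pair sq_integrable_H])

lemma M4_nonneg: "M4 \<ge> 0"
  unfolding M4_def using \<kappa>_pos by (intro integral_nonneg_AE AE_I2) (auto simp: less_imp_le)

definition kern :: "('z \<Rightarrow> nat) \<Rightarrow> 'z \<times> 'z \<Rightarrow> real" where
  "kern p z = \<mu>.offdiag_mean p H (p (fst z)) (p (snd z))"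

lemma offdiag_mean_sym:
  assumes p: "partition_map \<mu> p" shows "\<mu>.offdiag_mean p H i j = \<mu>.offdiag_mean p H j i"
  unfolding \<mu>.offdiag_mean_def \<mu>.block_mean_def
  using \<mu>.block_integral_swap[OF p integrable_H H_sym, of i j] by (simp add: mult.commute)

lemma offdiag_mean_diag: "\<mu>.offdiag_mean p H i i = 0"
  by (simp add: \<mu>.offdiag_mean_def)

lemma kern_eq: "kern p = (\<lambda>z. \<mu>.offdiag_mean p H (p (fst z)) (p (snd z)))"
  by (rule ext) (rule kern_def)

lemma sq_integrable_kern: "partition_map \<mu> p \<Longrightarrow> sq_integrable \<mu>2 (kern p)"
  unfolding sq_integrable_def kern_eq
  using measurable_partition_kernel[of \<mu> p "\<mu>.offdiag_mean p H"]
    \<mu>.integrable_partition_kernel[of p "\<lambda>i j. (\<mu>.offdiag_mean p H i j)\<^sup>2"] by simp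

lemma kern_diag: "kern p (x, x) = 0"
  by (simp add: kern_def offdiag_mean_diag)

text \<open>Of the factor 2, one unit comes from the sum over points, whose absolute value is
  controlled in mean by the second moment formula, and one from the compensating integral.\<close>

lemma L1_bound:
  assumes p: "partition_map \<mu> p"
  shows "integrable P (\<lambda>\<omega>. pair_sum (kern p) \<omega> - Y \<omega>)"
    and "P.expectation (\<lambda>\<omega>. \<bar>pair_sum (kern p) \<omega> - Y \<omega>\<bar>) \<le> 2 * (\<integral>z. \<bar>kern p z - H z\<bar> \<partial>\<mu>2)"
proof -
  let ?d = "\<integral>z. \<bar>kern p z - H z\<bar> \<partial>\<mu>2"
  have ik: "integrable \<mu>2 (kern p)" by (rule sq_integrable_imp_integrable[OF \<mu>.finite_pair sq_integrable_kern[OF p]])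
  have i: "integrable \<mu>2 (\<lambda>z. kern p z - H z)" using ik integrable_H by simp
  have diag: "kern p (x, x) - H (x, x) = 0" if "x \<in> space \<mu>" for x using H_diag[OF that] by (simp add: kern_diag)
  have m [measurable]: "pair_sum (kern p) \<in> borel_measurable P"
    unfolding kern_eq by (rule measurable_pair_sum_kernel[OF p])
  have aeH: "AE \<omega> in P. integrable (\<xi>2 \<omega>) H"
    by (rule AE_integrable_\<xi>2[OF integrable_H]) (rule H_diag)
  have ae: "AE \<omega> in P. ennreal \<bar>pair_sum (kern p) \<omega> - Y \<omega>\<bar> \<le> (\<integral>\<^sup>+ z. ennreal \<bar>kern p z - H z\<bar> \<partial>\<xi>2 \<omega>) + ennreal ?d"
    using G_eq AE_integrable_\<xi>2[OF ik kern_diag] aeH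
  proof eventually_elim
    case (elim \<omega>)
    have "pair_sum (kern p) \<omega> - Y \<omega> = (\<integral>z. kern p z - H z \<partial>\<xi>2 \<omega>) - (\<integral>z. kern p z - H z \<partial>\<mu>2)"
      using elim ik integrable_H by (simp add: pair_sum_def Y_def)
    then have "\<bar>pair_sum (kern p) \<omega> - Y \<omega>\<bar> \<le> (\<integral>z. \<bar>kern p z - H z\<bar> \<partial>\<xi>2 \<omega>) + ?d"
      using integral_abs_bound[of "\<xi>2 \<omega>" "\<lambda>z. kern p z - H z"] integral_abs_bound[of \<mu>2 "\<lambda>z. kern p z - H z"]
      by linarith
    then have "ennreal \<bar>pair_sum (kern p) \<omega> - Y \<omega>\<bar> \<le> ennreal ((\<integral>z. \<bar>kern p z - H z\<bar> \<partial>\<xi>2 \<omega>) + ?d)"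
      by (rule ennreal_leI)
    also have "\<dots> = (\<integral>\<^sup>+ z. ennreal \<bar>kern p z - H z\<bar> \<partial>\<xi>2 \<omega>) + ennreal ?d"
      using elim by (subst ennreal_plus) (auto simp: nn_integral_eq_integral)
    finally show ?case .
  qed
  have "(\<integral>\<^sup>+ \<omega>. ennreal \<bar>pair_sum (kern p) \<omega> - Y \<omega>\<bar> \<partial>P) \<le>
      (\<integral>\<^sup>+ \<omega>. (\<integral>\<^sup>+ z. ennreal \<bar>kern p z - H z\<bar> \<partial>\<xi>2 \<omega>) + ennreal ?d \<partial>P)"
    by (rule nn_integral_mono_AE[OF ae])
  also have "\<dots> = (\<integral>\<^sup>+ \<omega>. (\<integral>\<^sup>+ z. ennreal \<bar>kern p z - H z\<bar> \<partial>\<xi>2 \<omega>) \<partial>P) + ennreal ?d"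
    using measurable_nn_abs_\<xi>2[OF i diag] by (subst nn_integral_add) (auto simp: P.emeasure_space_1)
  also have "\<dots> = ennreal ?d + ennreal ?d"
    using i by (subst nn_integral_abs_\<xi>2[OF i diag]) (auto simp: nn_integral_eq_integral)
  also have "\<dots> = ennreal (2 * ?d)"
    by (subst ennreal_plus[symmetric]) auto
  finally have le: "(\<integral>\<^sup>+ \<omega>. ennreal \<bar>pair_sum (kern p) \<omega> - Y \<omega>\<bar> \<partial>P) \<le> ennreal (2 * ?d)" .
  have Ym [measurable]: "Y \<in> borel_measurable P" unfolding Y_def[abs_def] by measurable
  show int: "integrable P (\<lambda>\<omega>. pair_sum (kern p) \<omega> - Y \<omega>)"
    using le by (auto simp: integrable_iff_bounded intro: le_less_trans)
  have "ennreal (P.expectation (\<lambda>\<omega>. \<bar>pair_sum (kern p) \<omega> - Y \<omega>\<bar>)) \<le> ennreal (2 * ?d)"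
    using le int by (subst nn_integral_eq_integral[symmetric]) auto
  then show "P.expectation (\<lambda>\<omega>. \<bar>pair_sum (kern p) \<omega> - Y \<omega>\<bar>) \<le> 2 * ?d"
    by (subst (asm) ennreal_le_iff) auto
qed

text \<open>The approximating sums converge in \<open>L\<^sup>1\<close> by the first moment formula. They are Cauchy in \<open>L\<^sup>2\<close>
  by the isometry for partition kernels, and Fatou's lemma upgrades the convergence.\<close>

lemma L2_approximation:
  obtains p where "\<And>n. partition_map \<mu> (p n)" and "L2_tendsto \<mu>2 (\<lambda>n. kern (p n)) H"
    and "L2_tendsto P (\<lambda>n. pair_sum (kern (p n))) Y"
proof -
  obtain p where p: "\<And>n. partition_map \<mu> (p n)"
    and lim: "(\<lambda>n. \<integral>z. (H z - \<mu>.offdiag_mean (p n) H (p n (fst z)) (p n (snd z)))\<^sup>2 \<partial>\<mu>2) \<longlonglongrightarrow> 0"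
    using diffuse.offdiag_means_converge[OF H_meas] sq_integrable_H by (auto simp: sq_integrable_def)
  define d where "d = (\<lambda>n. \<integral>z. (kern (p n) z - H z)\<^sup>2 \<partial>\<mu>2)"
  have dlim: "d \<longlonglongrightarrow> 0"
    using lim unfolding d_def kern_def by (simp add: power2_commute)
  have sqd: "sq_integrable \<mu>2 (\<lambda>z. kern (p n) z - H z)" for n
    by (intro sq_integrable_diff sq_integrable_kern p sq_integrable_H)
  have L2\<mu>: "L2_tendsto \<mu>2 (\<lambda>n. kern (p n)) H"
    unfolding L2_tendsto_def using dlim by (auto simp: d_def sq_integrable_kern p sq_integrable_H)
  let ?X = "\<lambda>n. pair_sum (kern (p n))"
  have X: "sq_integrable P (?X n)" for n
    unfolding kern_eq
    by (rule pair_sum_kernel_moments(1)[where a = "\<mu>.offdiag_mean (p n) H", OF p offdiag_mean_sym[OF p] offdiag_mean_diag])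
  have [measurable]: "?X n \<in> borel_measurable P" for n using X[of n] by (simp add: sq_integrable_def)
  have Ym [measurable]: "Y \<in> borel_measurable P" unfolding Y_def[abs_def] by measurable
  have L1: "(\<lambda>n. P.expectation (\<lambda>\<omega>. \<bar>?X n \<omega> - Y \<omega>\<bar>)) \<longlonglongrightarrow> 0"
  proof (rule tendsto_sandwich[OF _ _ tendsto_const])
    show "\<forall>\<^sub>F n in sequentially. P.expectation (\<lambda>\<omega>. \<bar>?X n \<omega> - Y \<omega>\<bar>) \<le> 2 * sqrt (d n * measure \<mu>2 (space \<mu>2))"
    proof (intro always_eventually allI)
      fix n
      have "sq_integrable \<mu>2 (\<lambda>z. \<bar>kern (p n) z - H z\<bar>)" using sqd[of n] by (auto simp: sq_integrable_def)
      from integral_cauchy_schwarz[OF this sq_integrable_const[OF \<mu>.finite_pair, of 1]]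
      have "(\<integral>z. \<bar>kern (p n) z - H z\<bar> \<partial>\<mu>2)\<^sup>2 \<le> d n * measure \<mu>2 (space \<mu>2)" by (simp add: d_def)
      then have "(\<integral>z. \<bar>kern (p n) z - H z\<bar> \<partial>\<mu>2) \<le> sqrt (d n * measure \<mu>2 (space \<mu>2))"
        by (rule real_le_rsqrt)
      then show "P.expectation (\<lambda>\<omega>. \<bar>?X n \<omega> - Y \<omega>\<bar>) \<le> 2 * sqrt (d n * measure \<mu>2 (space \<mu>2))"
        using L1_bound(2)[OF p, of n] by linarith
    qed
    have "(\<lambda>n. 2 * sqrt (d n * measure \<mu>2 (space \<mu>2))) \<longlonglongrightarrow> 2 * sqrt (0 * measure \<mu>2 (space \<mu>2))"
      by (intro tendsto_intros dlim)
    then show "(\<lambda>n. 2 * sqrt (d n * measure \<mu>2 (space \<mu>2))) \<longlonglongrightarrow> 0" by simp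
  qed (auto intro!: always_eventually)
  obtain r :: "nat \<Rightarrow> nat" where r: "strict_mono r" "AE \<omega> in P. (\<lambda>n. ?X (r n) \<omega> - Y \<omega>) \<longlonglongrightarrow> 0"
    using tendsto_L1_AE_subseq[of P "\<lambda>n \<omega>. ?X n \<omega> - Y \<omega>"] L1_bound(1)[OF p] L1 by auto
  let ?C = "4 * mass + 2"
  have cauchy: "P.expectation (\<lambda>\<omega>. (?X n \<omega> - ?X m \<omega>)\<^sup>2) \<le> ?C * (2 * d n + 2 * d m)" for n m
  proof -
    have "P.expectation (\<lambda>\<omega>. (?X n \<omega> - ?X m \<omega>)\<^sup>2) \<le> ?C * (\<integral>z. (kern (p n) z - kern (p m) z)\<^sup>2 \<partial>\<mu>2)"
      unfolding kern_eq
      by (rule pair_sum_diff_sq_le[where a = "\<mu>.offdiag_mean (p n) H" and b = "\<mu>.offdiag_mean (p m) H",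
          OF p offdiag_mean_sym[OF p] offdiag_mean_diag p offdiag_mean_sym[OF p] offdiag_mean_diag])
    also have "\<dots> \<le> ?C * (\<integral>z. 2 * (kern (p n) z - H z)\<^sup>2 + 2 * (kern (p m) z - H z)\<^sup>2 \<partial>\<mu>2)"
    proof (intro mult_left_mono integral_mono)
      show "(kern (p n) z - kern (p m) z)\<^sup>2 \<le> 2 * (kern (p n) z - H z)\<^sup>2 + 2 * (kern (p m) z - H z)\<^sup>2" for z
        using sq_add_le[of "kern (p n) z - H z" "H z - kern (p m) z"] by (simp add: power2_commute)
      show "integrable \<mu>2 (\<lambda>z. (kern (p n) z - kern (p m) z)\<^sup>2)"
        using sq_integrable_diff[OF sq_integrable_kern[OF p, of n] sq_integrable_kern[OF p, of m]] by (simp add: sq_integrable_def)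
    qed (use sqd[of n] sqd[of m] in \<open>auto simp: sq_integrable_def\<close>)
    also have "\<dots> = ?C * (2 * d n + 2 * d m)"
      using sqd[of n] sqd[of m] by (simp add: d_def sq_integrable_def)
    finally show ?thesis .
  qed
  \<comment> \<open>The index n stays fixed while m runs through the almost surely convergent
    subsequence; \<open>d (r m)\<close> tends to 0 and the term with \<open>d n\<close>
    remains.\<close>
  have fatou: "(\<integral>\<^sup>+ \<omega>. ennreal ((?X n \<omega> - Y \<omega>)\<^sup>2) \<partial>P) \<le> ennreal (?C * (2 * d n))" for n
  proof -
    have "(\<integral>\<^sup>+ \<omega>. ennreal ((?X n \<omega> - Y \<omega>)\<^sup>2) \<partial>P) =
        (\<integral>\<^sup>+ \<omega>. liminf (\<lambda>m. ennreal ((?X n \<omega> - ?X (r m) \<omega>)\<^sup>2)) \<partial>P)"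
    proof (rule nn_integral_cong_AE)
      show "AE \<omega> in P. ennreal ((?X n \<omega> - Y \<omega>)\<^sup>2) = liminf (\<lambda>m. ennreal ((?X n \<omega> - ?X (r m) \<omega>)\<^sup>2))"
        using r(2)
      proof eventually_elim
        case (elim \<omega>)
        have "(\<lambda>m. ?X (r m) \<omega>) \<longlonglongrightarrow> Y \<omega>" using elim by (simp add: LIM_zero_iff)
        then have "(\<lambda>m. ennreal ((?X n \<omega> - ?X (r m) \<omega>)\<^sup>2)) \<longlonglongrightarrow> ennreal ((?X n \<omega> - Y \<omega>)\<^sup>2)"
          by (intro tendsto_ennrealI tendsto_intros)
        then show ?case by (intro lim_imp_Liminf[symmetric]) auto
      qed
    qed
    also have "\<dots> \<le> liminf (\<lambda>m. \<integral>\<^sup>+ \<omega>. ennreal ((?X n \<omega> - ?X (r m) \<omega>)\<^sup>2) \<partial>P)"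
      by (intro nn_integral_liminf) measurable
    also have "\<dots> \<le> liminf (\<lambda>m. ennreal (?C * (2 * d n + 2 * d (r m))))"
    proof (intro Liminf_mono always_eventually allI)
      fix m
      have "(\<integral>\<^sup>+ \<omega>. ennreal ((?X n \<omega> - ?X (r m) \<omega>)\<^sup>2) \<partial>P) = ennreal (P.expectation (\<lambda>\<omega>. (?X n \<omega> - ?X (r m) \<omega>)\<^sup>2))"
        using sq_integrable_diff[OF X[of n] X[of "r m"]] by (intro nn_integral_eq_integral) (auto simp: sq_integrable_def)
      also have "\<dots> \<le> ennreal (?C * (2 * d n + 2 * d (r m)))" by (intro ennreal_leI cauchy)
      finally show "(\<integral>\<^sup>+ \<omega>. ennreal ((?X n \<omega> - ?X (r m) \<omega>)\<^sup>2) \<partial>P) \<le> ennreal (?C * (2 * d n + 2 * d (r m)))" .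
    qed
    also have "\<dots> = ennreal (?C * (2 * d n + 2 * 0))"
    proof (rule lim_imp_Liminf)
      have "(\<lambda>m. d (r m)) \<longlonglongrightarrow> 0" using LIMSEQ_subseq_LIMSEQ[OF dlim r(1)] by (simp add: o_def)
      then show "(\<lambda>m. ennreal (?C * (2 * d n + 2 * d (r m)))) \<longlonglongrightarrow> ennreal (?C * (2 * d n + 2 * 0))"
        by (intro tendsto_ennrealI tendsto_intros)
    qed simp
    finally show ?thesis by simp
  qed
  have XY: "sq_integrable P (\<lambda>\<omega>. ?X n \<omega> - Y \<omega>)" for n
    unfolding sq_integrable_def using fatou[of n] by (auto simp: integrable_iff_bounded intro: le_less_trans)
  have Ysq: "sq_integrable P Y"
    using sq_integrable_diff[OF X[of 0] XY[of 0]] by simp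
  have "(\<lambda>n. P.expectation (\<lambda>\<omega>. (?X n \<omega> - Y \<omega>)\<^sup>2)) \<longlonglongrightarrow> 0"
  proof (rule tendsto_sandwich[OF _ _ tendsto_const])
    show "\<forall>\<^sub>F n in sequentially. P.expectation (\<lambda>\<omega>. (?X n \<omega> - Y \<omega>)\<^sup>2) \<le> ?C * (2 * d n)"
    proof (intro always_eventually allI)
      fix n
      have "ennreal (P.expectation (\<lambda>\<omega>. (?X n \<omega> - Y \<omega>)\<^sup>2)) \<le> ennreal (?C * (2 * d n))"
        using fatou[of n] XY[of n] by (subst nn_integral_eq_integral[symmetric]) (auto simp: sq_integrable_def)
      moreover have "?C * (2 * d n) \<ge> 0" by (simp add: d_def)
      ultimately show "P.expectation (\<lambda>\<omega>. (?X n \<omega> - Y \<omega>)\<^sup>2) \<le> ?C * (2 * d n)"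
        by (simp only: ennreal_le_iff)
    qed
    have "(\<lambda>n. ?C * (2 * d n)) \<longlonglongrightarrow> ?C * (2 * 0)" by (intro tendsto_intros dlim)
    then show "(\<lambda>n. ?C * (2 * d n)) \<longlonglongrightarrow> 0" by simp
  qed (auto intro!: always_eventually)
  then have "L2_tendsto P ?X Y" using X Ysq by (simp add: L2_tendsto_def)
  with p L2\<mu> show ?thesis by (rule that)
qed

end

section \<open>Moments of the statistic and the normal approximation bound\<close>

context pair_statistic
begin

lemma sq_integrable_Y: "sq_integrable P Y"
  using L2_approximation by (metis L2_tendsto_def)

text \<open>Expectation, second moment and pair variance are all continuous under the L2
  convergences of \<open>L2_approximation\<close>, so the identities for partition kernels pass to
  the limit.\<close>

lemma Y_moments: "P.expectation Y = 0" "P.expectation (\<lambda>\<omega>. (Y \<omega>)\<^sup>2) = \<mu>.pair_variance H"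
proof -
  obtain p where p: "\<And>n. partition_map \<mu> (p n)" and H: "L2_tendsto \<mu>2 (\<lambda>n. kern (p n)) H"
    and Y: "L2_tendsto P (\<lambda>n. pair_sum (kern (p n))) Y"
    by (rule L2_approximation) (rule that)
  note mom = pair_sum_kernel_moments[where a = "\<mu>.offdiag_mean (p n) H" and p = "p n" for n,
      OF p offdiag_mean_sym[OF p] offdiag_mean_diag, folded kern_eq]
  have "(\<lambda>n. 0) \<longlonglongrightarrow> P.expectation Y"
    using L2_tendsto_integral[OF P.finite_measure_axioms Y] unfolding mom(2) .
  then show "P.expectation Y = 0" by (simp add: LIMSEQ_const_iff)
  have lim: "(\<lambda>n. \<mu>.pair_variance (kern (p n))) \<longlonglongrightarrow> P.expectation (\<lambda>\<omega>. (Y \<omega>)\<^sup>2)"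
    using L2_tendsto_sq[OF Y] unfolding mom(3) .
  show "P.expectation (\<lambda>\<omega>. (Y \<omega>)\<^sup>2) = \<mu>.pair_variance H"
    by (rule LIMSEQ_unique[OF lim \<mu>.pair_variance_tendsto[OF H]])
qed

lemma Y_plus_mean: "(\<lambda>\<omega>. Y \<omega> + (\<integral>z. H z \<partial>\<mu>2)) = G"
  by (simp add: Y_def)

theorem sq_integrable_G: "sq_integrable P G"
  using sq_integrable_add[OF sq_integrable_Y sq_integrable_const[OF P.finite_measure_axioms, of "\<integral>z. H z \<partial>\<mu>2"]]
  unfolding Y_plus_mean .

theorem expectation_G: "P.expectation G = (\<integral>z. H z \<partial>\<mu>2)"
proof -
  have "P.expectation (\<lambda>\<omega>. Y \<omega> + (\<integral>z. H z \<partial>\<mu>2)) = (\<integral>z. H z \<partial>\<mu>2)"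
    using Y_moments(1) sq_integrable_imp_integrable[OF P.finite_measure_axioms sq_integrable_Y]
    by (simp add: P.prob_space)
  then show ?thesis unfolding Y_plus_mean .
qed

theorem variance_G: "P.variance G = \<mu>.pair_variance H"
  using Y_moments(2) by (simp add: expectation_G Y_def)

text \<open>Averaging over blocks preserves positivity, the upper bound k and the row and column
  bounds, so the means of \<kappa> are an admissible weight on the cells.\<close>

lemma weighted_kernel_cells:
  assumes p: "partition_map \<mu> p"
  shows "weighted_kernel (pos_cells p) (cell_mass p) (\<mu>.offdiag_mean p H) (\<mu>.block_mean p \<kappa>) k"
proof -
  interpret fk: finite_kernel "pos_cells p" "cell_mass p" "\<mu>.offdiag_mean p H"
    by (rule finite_kernel_cells[OF p offdiag_mean_sym[OF p] offdiag_mean_diag])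
  have nn: "\<mu>.block_integral p \<kappa> i j \<ge> 0" for i j
    unfolding \<mu>.block_integral_def using \<kappa>_pos by (intro integral_nonneg_AE AE_I2) (simp add: less_imp_le)
  \<comment> \<open>Stated for an arbitrary kernel, so that the transposed weight yields the column
    sums.\<close>
  have row': "(\<Sum>j\<in>pos_cells p. cell_mass p j * \<mu>.block_mean p K i j) \<le> 1"
    if i: "i \<in> pos_cells p" and K: "integrable \<mu>2 K" "\<And>i j. \<mu>.block_integral p K i j \<ge> 0"
      "\<And>x. x \<in> space \<mu> \<Longrightarrow> (\<integral>y. K (x, y) \<partial>\<mu>) \<le> 1" for i K
  proof -
    have "(\<Sum>j\<in>pos_cells p. cell_mass p j * \<mu>.block_mean p K i j) = (\<Sum>j\<in>pos_cells p. \<mu>.block_integral p K i j) / cell_mass p i"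
      unfolding sum_divide_distrib \<mu>.block_mean_def by (intro sum.cong) (auto simp: pos_cells_def)
    also have "\<dots> \<le> (\<Sum>j\<in>p ` space \<mu>. \<mu>.block_integral p K i j) / cell_mass p i"
      using p K(2) by (intro divide_right_mono sum_mono2) (auto simp: partition_map_def pos_cells_def)
    also have "\<dots> \<le> cell_mass p i / cell_mass p i"
      by (intro divide_right_mono \<mu>.block_row_sum_le p K) auto
    finally show ?thesis using i by (simp add: pos_cells_def)
  qed
  show ?thesis
  proof unfold_locales
    show "k \<ge> 0" using k_pos by simp
    fix i assume i: "i \<in> pos_cells p"
    show "(\<Sum>j\<in>pos_cells p. cell_mass p j * \<mu>.block_mean p \<kappa> i j) \<le> 1"
      by (rule row'[OF i integrable_\<kappa> nn \<kappa>_row])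
    have t: "\<mu>.block_integral p (\<lambda>z. \<kappa> (snd z, fst z)) i j = \<mu>.block_integral p \<kappa> j i" for i j
      by (rule \<mu>.block_integral_transpose[OF p integrable_\<kappa>])
    have "(\<Sum>j\<in>pos_cells p. cell_mass p j * \<mu>.block_mean p (\<lambda>z. \<kappa> (snd z, fst z)) i j) \<le> 1"
      by (rule row'[OF i \<mu>.integrable_transpose[OF integrable_\<kappa>]]) (auto simp: t nn \<kappa>_col)
    then show "(\<Sum>j\<in>pos_cells p. cell_mass p j * \<mu>.block_mean p \<kappa> j i) \<le> 1"
      by (simp add: \<mu>.block_mean_def t mult.commute)
  next
    fix i j assume ij: "i \<in> pos_cells p" "j \<in> pos_cells p"
    then have pos: "cell_mass p i > 0" "cell_mass p j > 0" by (auto simp: pos_cells_def)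
    show "0 < \<mu>.block_mean p \<kappa> i j"
      by (rule \<mu>.block_jensen(1)[OF p integrable_H integrable_\<kappa> \<kappa>_pos H4 pos])
    have "\<mu>.block_integral p \<kappa> i j \<le> (\<integral>z. k * indicator (\<mu>.block p i j) z \<partial>\<mu>2)"
      unfolding \<mu>.block_integral_def
    proof (rule integral_mono)
      show "integrable \<mu>2 (\<lambda>z. k * indicator (\<mu>.block p i j) z)"
        using \<mu>.block_sets[OF p] by (intro integrable_mult_right) (auto simp: \<mu>2.emeasure_finite less_top[symmetric])
    qed (use \<mu>.integrable_block[OF p integrable_\<kappa>] \<kappa>_le in \<open>auto simp: indicator_def\<close>)
    also have "\<dots> = k * (cell_mass p i * cell_mass p j)"
      using \<mu>.block_sets[OF p] by (simp add: \<mu>.measure_block[OF p])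
    finally show "\<mu>.block_mean p \<kappa> i j \<le> k"
      using pos by (simp add: \<mu>.block_mean_def divide_le_eq)
  qed
qed

text \<open>Jensen's inequality on each off-diagonal block. On diagonal blocks the left side is 0
  and the right side nonnegative, and blocks over null cells are added at the end at no
  cost.\<close>

lemma M_cells_le:
  assumes p: "partition_map \<mu> p"
  shows "weighted_kernel.M (pos_cells p) (cell_mass p) (\<mu>.offdiag_mean p H) (\<mu>.block_mean p \<kappa>) \<le> M4"
proof -
  interpret wk: weighted_kernel "pos_cells p" "cell_mass p" "\<mu>.offdiag_mean p H" "\<mu>.block_mean p \<kappa>" k
    by (rule weighted_kernel_cells[OF p])
  have nn: "\<mu>.block_integral p (\<lambda>z. H z ^ 4 / \<kappa> z ^ 3) i j \<ge> 0" for i j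
    unfolding \<mu>.block_integral_def using \<kappa>_pos by (intro integral_nonneg_AE AE_I2) (simp add: less_imp_le)
  have "wk.M \<le> (\<Sum>i\<in>pos_cells p. \<Sum>j\<in>pos_cells p. \<mu>.block_integral p (\<lambda>z. H z ^ 4 / \<kappa> z ^ 3) i j)"
    unfolding wk.M_alt
  proof (intro sum_mono)
    fix i j assume "i \<in> pos_cells p" "j \<in> pos_cells p"
    then have "cell_mass p i > 0" "cell_mass p j > 0" by (auto simp: pos_cells_def)
    from \<mu>.block_jensen(2)[OF p integrable_H integrable_\<kappa> \<kappa>_pos H4 this] nn[of i j]
    show "cell_mass p i * cell_mass p j * (\<mu>.offdiag_mean p H i j ^ 4 / \<mu>.block_mean p \<kappa> i j ^ 3)
      \<le> \<mu>.block_integral p (\<lambda>z. H z ^ 4 / \<kappa> z ^ 3) i j"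
      by (cases "i = j") (auto simp: \<mu>.offdiag_mean_def)
  qed
  also have "\<dots> \<le> (\<Sum>i\<in>p ` space \<mu>. \<Sum>j\<in>p ` space \<mu>. \<mu>.block_integral p (\<lambda>z. H z ^ 4 / \<kappa> z ^ 3) i j)"
  proof -
    have fin: "finite (p ` space \<mu>)" and sub: "pos_cells p \<subseteq> p ` space \<mu>"
      using p by (auto simp: partition_map_def pos_cells_def)
    have "(\<Sum>i\<in>pos_cells p. \<Sum>j\<in>pos_cells p. \<mu>.block_integral p (\<lambda>z. H z ^ 4 / \<kappa> z ^ 3) i j)
        \<le> (\<Sum>i\<in>pos_cells p. \<Sum>j\<in>p ` space \<mu>. \<mu>.block_integral p (\<lambda>z. H z ^ 4 / \<kappa> z ^ 3) i j)"
      by (intro sum_mono sum_mono2 fin sub nn)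
    also have "\<dots> \<le> (\<Sum>i\<in>p ` space \<mu>. \<Sum>j\<in>p ` space \<mu>. \<mu>.block_integral p (\<lambda>z. H z ^ 4 / \<kappa> z ^ 3) i j)"
      by (intro sum_mono2 fin sub sum_nonneg nn)
    finally show ?thesis .
  qed
  also have "\<dots> = M4"
    unfolding M4_def by (rule \<mu>.integral_eq_sum_blocks[OF p H4, symmetric])
  finally show ?thesis .
qed

lemma cell_mass_sum_le: "partition_map \<mu> p \<Longrightarrow> (\<Sum>i\<in>pos_cells p. cell_mass p i) \<le> mass"
  using \<mu>.integral_partition[of p "\<lambda>_. 1"] sum_pos_cells[of p "cell_mass p"] by simp

definition stein_const1 :: real where "stein_const1 = 161 + 16 * k\<^sup>2"
definition stein_const2 :: real where "stein_const2 = 18 + k + 3 * k\<^sup>2 + k ^ 3"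

text \<open>The discrepancy bound is applied to f (x / s), whose derivative is bounded by A / s and
  has Lipschitz constant L / s^2, and divided by s. In the application s is the standard deviation
  of G rather than of the approximating sum, hence the ratio of variances in front of f'.\<close>

lemma stein_partition:
  assumes p: "partition_map \<mu> p" and s: "s > 0"
    and deriv: "\<And>x. (f has_real_derivative f' x) (at x)"
    and f: "\<And>x. \<bar>f x\<bar> \<le> B1" and f': "\<And>x. \<bar>f' x\<bar> \<le> A" and lip: "\<And>x y. \<bar>f' x - f' y\<bar> \<le> L * \<bar>x - y\<bar>"
  shows "\<bar>\<mu>.pair_variance (kern p) / s\<^sup>2 * P.expectation (\<lambda>\<omega>. f' (pair_sum (kern p) \<omega> / s))
      - P.expectation (\<lambda>\<omega>. pair_sum (kern p) \<omega> / s * f (pair_sum (kern p) \<omega> / s))\<bar>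
    \<le> A * sqrt (stein_const1 * M4) / s\<^sup>2 + 8 * L * (stein_const2 * (M4 + mass)) / s ^ 3"
proof -
  interpret wk: weighted_kernel "pos_cells p" "cell_mass p" "\<mu>.offdiag_mean p H" "\<mu>.block_mean p \<kappa>" k
    by (rule weighted_kernel_cells[OF p])
  have A: "A \<ge> 0" using f'[of 0] by linarith
  have L: "L \<ge> 0" using lip[of 1 0] by simp
  have cf: "continuous_on UNIV f" using deriv by (intro DERIV_continuous_on) auto
  have cf': "continuous_on UNIV f'"
  proof (rule lipschitz_on_continuous_on)
    show "L-lipschitz_on UNIV f'" using lip L by (intro lipschitz_onI) (auto simp: dist_real_def)
  qed
  have [measurable]: "f \<in> borel_measurable borel" "f' \<in> borel_measurable borel"
    using cf cf' by (auto intro: borel_measurable_continuous_onI)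
  define fs where "fs = (\<lambda>x. f (x / s))"
  define fs' where "fs' = (\<lambda>x. f' (x / s) / s)"
  have [measurable]: "fs \<in> borel_measurable borel" "fs' \<in> borel_measurable borel"
    unfolding fs_def fs'_def by measurable
  have disc: "\<bar>wk.s2 * wk.E (\<lambda>n. fs' (wk.F n)) - wk.E (\<lambda>n. wk.F n * fs (wk.F n))\<bar>
      \<le> (A / s) * sqrt wk.V + 8 * (L / s\<^sup>2) * wk.W"
  proof (rule wk.stein_discrepancy)
    show "(fs has_real_derivative fs' x) (at x)" for x
      unfolding fs_def fs'_def using DERIV_chain2[OF deriv DERIV_cdivide[OF DERIV_ident]] by simp
    show "\<bar>fs x\<bar> \<le> B1" for x unfolding fs_def by (rule f)
    show "\<bar>fs' x\<bar> \<le> A / s" for x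
      unfolding fs'_def abs_divide using f'[of "x / s"] s by (simp add: divide_right_mono)
    show "\<bar>fs' x - fs' y\<bar> \<le> L / s\<^sup>2 * \<bar>x - y\<bar>" for x y
    proof -
      have "\<bar>fs' x - fs' y\<bar> = \<bar>f' (x / s) - f' (y / s)\<bar> / s"
        unfolding fs'_def using s by (simp add: diff_divide_distrib[symmetric])
      also have "\<dots> \<le> L * \<bar>x / s - y / s\<bar> / s"
        using s lip[of "x / s" "y / s"] by (simp add: divide_right_mono)
      also have "\<dots> = L / s\<^sup>2 * \<bar>x - y\<bar>"
        using s by (simp add: diff_divide_distrib[symmetric] power2_eq_square)
      finally show ?thesis .
    qed
  qed
  have V: "wk.V \<le> stein_const1 * M4"
  proof -
    have "wk.V \<le> (161 + 16 * k\<^sup>2) * wk.M" by (rule wk.V_le)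
    also have "\<dots> \<le> stein_const1 * M4"
      unfolding stein_const1_def using M_cells_le[OF p] by (intro mult_left_mono) auto
    finally show ?thesis .
  qed
  have W: "wk.W \<le> stein_const2 * (M4 + mass)"
  proof -
    have "wk.W \<le> (18 + k + 3 * k\<^sup>2 + k ^ 3) * (wk.M + (\<Sum>i\<in>pos_cells p. cell_mass p i))" by (rule wk.W_le)
    also have "\<dots> \<le> stein_const2 * (M4 + mass)"
      unfolding stein_const2_def using M_cells_le[OF p] cell_mass_sum_le[OF p] k_pos
      by (intro mult_left_mono add_mono) auto
    finally show ?thesis .
  qed
  note e = expectation_pair_sum_kernel(1)[where a = "\<mu>.offdiag_mean p H", OF p offdiag_mean_sym[OF p] offdiag_mean_diag, folded kern_eq]
  note s2 = s2_eq_pair_variance[where a = "\<mu>.offdiag_mean p H", OF p offdiag_mean_sym[OF p] offdiag_mean_diag, folded kern_eq]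
  have "\<bar>\<mu>.pair_variance (kern p) * P.expectation (\<lambda>\<omega>. fs' (pair_sum (kern p) \<omega>))
      - P.expectation (\<lambda>\<omega>. pair_sum (kern p) \<omega> * fs (pair_sum (kern p) \<omega>))\<bar>
      \<le> (A / s) * sqrt (stein_const1 * M4) + 8 * (L / s\<^sup>2) * (stein_const2 * (M4 + mass))"
    using disc e[of fs'] e[of "\<lambda>x. x * fs x"] s2
      mult_left_mono[OF real_sqrt_le_mono[OF V], of "A / s"] mult_left_mono[OF W, of "8 * (L / s\<^sup>2)"] A L s
    by simp
  then have "\<bar>\<mu>.pair_variance (kern p) * P.expectation (\<lambda>\<omega>. fs' (pair_sum (kern p) \<omega>))
      - P.expectation (\<lambda>\<omega>. pair_sum (kern p) \<omega> * fs (pair_sum (kern p) \<omega>))\<bar> / s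
      \<le> ((A / s) * sqrt (stein_const1 * M4) + 8 * (L / s\<^sup>2) * (stein_const2 * (M4 + mass))) / s"
    using s by (intro divide_right_mono) auto
  also have "\<dots> = A * sqrt (stein_const1 * M4) / s\<^sup>2 + 8 * L * (stein_const2 * (M4 + mass)) / s ^ 3"
    using s by (simp add: add_divide_distrib power2_eq_square power3_eq_cube mult_ac)
  also have "\<bar>\<mu>.pair_variance (kern p) * P.expectation (\<lambda>\<omega>. fs' (pair_sum (kern p) \<omega>))
      - P.expectation (\<lambda>\<omega>. pair_sum (kern p) \<omega> * fs (pair_sum (kern p) \<omega>))\<bar> / s =
      \<bar>(\<mu>.pair_variance (kern p) * P.expectation (\<lambda>\<omega>. fs' (pair_sum (kern p) \<omega>))
      - P.expectation (\<lambda>\<omega>. pair_sum (kern p) \<omega> * fs (pair_sum (kern p) \<omega>))) / s\<bar>"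
    using s by simp
  also have "(\<mu>.pair_variance (kern p) * P.expectation (\<lambda>\<omega>. fs' (pair_sum (kern p) \<omega>))
      - P.expectation (\<lambda>\<omega>. pair_sum (kern p) \<omega> * fs (pair_sum (kern p) \<omega>))) / s =
    \<mu>.pair_variance (kern p) / s\<^sup>2 * P.expectation (\<lambda>\<omega>. f' (pair_sum (kern p) \<omega> / s))
      - P.expectation (\<lambda>\<omega>. pair_sum (kern p) \<omega> / s * f (pair_sum (kern p) \<omega> / s))"
    unfolding fs_def fs'_def by (simp add: diff_divide_distrib power2_eq_square)
  finally show ?thesis .
qed

text \<open>The bound of \<open>stein_partition\<close> is uniform in the partition. In the limit f
  and f' of the rescaled sums converge in L2, the product with the unbounded factor is a limit of L2
  inner products, and the ratio of variances tends to 1.\<close>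

theorem stein_limit:
  assumes s: "s\<^sup>2 = P.variance G" "s > 0"
    and deriv: "\<And>x. (f has_real_derivative f' x) (at x)"
    and f: "\<And>x. \<bar>f x\<bar> \<le> B1" and f': "\<And>x. \<bar>f' x\<bar> \<le> A" and lip: "\<And>x y. \<bar>f' x - f' y\<bar> \<le> L * \<bar>x - y\<bar>"
  shows "\<bar>P.expectation (\<lambda>\<omega>. f' (Y \<omega> / s)) - P.expectation (\<lambda>\<omega>. Y \<omega> / s * f (Y \<omega> / s))\<bar>
    \<le> A * sqrt (stein_const1 * M4) / s\<^sup>2 + 8 * L * (stein_const2 * (M4 + mass)) / s ^ 3"
proof -
  obtain p where p: "\<And>n. partition_map \<mu> (p n)" and H: "L2_tendsto \<mu>2 (\<lambda>n. kern (p n)) H"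
    and Y: "L2_tendsto P (\<lambda>n. pair_sum (kern (p n))) Y"
    by (rule L2_approximation) (rule that)
  have L: "L \<ge> 0" using lip[of 1 0] by simp
  have cf: "continuous_on UNIV f" using deriv by (intro DERIV_continuous_on) auto
  have cf': "continuous_on UNIV f'"
  proof (rule lipschitz_on_continuous_on)
    show "L-lipschitz_on UNIV f'" using lip L by (intro lipschitz_onI) (auto simp: dist_real_def)
  qed
  have [measurable]: "f \<in> borel_measurable borel" "f' \<in> borel_measurable borel"
    using cf cf' by (auto intro: borel_measurable_continuous_onI)
  have lipf: "\<bar>f x - f y\<bar> \<le> A * \<bar>x - y\<bar>" for x y
    using field_differentiable_bound[of UNIV f f' A x y] deriv f' by auto
  let ?X = "\<lambda>n. pair_sum (kern (p n))"
  have scale: "\<bar>h (x / s) - h (y / s)\<bar> \<le> D / s * \<bar>x - y\<bar>" if "\<And>x y. \<bar>h x - h y\<bar> \<le> D * \<bar>x - y\<bar>" for h D and x y :: real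
    using that[of "x / s" "y / s"] s(2) by (simp add: diff_divide_distrib[symmetric])
  have 1: "L2_tendsto P (\<lambda>n \<omega>. f (?X n \<omega> / s)) (\<lambda>\<omega>. f (Y \<omega> / s))"
    by (rule L2_tendsto_compose[OF P.finite_measure_axioms Y, where F = "\<lambda>x. f (x / s)"])
       (measurable, rule f, rule scale[OF lipf])
  have 2: "L2_tendsto P (\<lambda>n \<omega>. f' (?X n \<omega> / s)) (\<lambda>\<omega>. f' (Y \<omega> / s))"
    by (rule L2_tendsto_compose[OF P.finite_measure_axioms Y, where F = "\<lambda>x. f' (x / s)"])
       (measurable, rule f', rule scale[OF lip])
  have lim1: "(\<lambda>n. P.expectation (\<lambda>\<omega>. ?X n \<omega> / s * f (?X n \<omega> / s))) \<longlonglongrightarrow> P.expectation (\<lambda>\<omega>. Y \<omega> / s * f (Y \<omega> / s))"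
    using tendsto_divide[OF L2_tendsto_integral_mult[OF Y 1] tendsto_const[of s]] s(2) by simp
  have lim2: "(\<lambda>n. P.expectation (\<lambda>\<omega>. f' (?X n \<omega> / s))) \<longlonglongrightarrow> P.expectation (\<lambda>\<omega>. f' (Y \<omega> / s))"
    by (rule L2_tendsto_integral[OF P.finite_measure_axioms 2])
  have lim3: "(\<lambda>n. \<mu>.pair_variance (kern (p n)) / s\<^sup>2) \<longlonglongrightarrow> 1"
  proof -
    have "s\<^sup>2 \<noteq> 0" "\<mu>.pair_variance H / s\<^sup>2 = 1" using s by (auto simp flip: variance_G)
    with tendsto_divide[OF \<mu>.pair_variance_tendsto[OF H] tendsto_const[of "s\<^sup>2"]] show ?thesis by simp
  qed
  have "(\<lambda>n. \<bar>\<mu>.pair_variance (kern (p n)) / s\<^sup>2 * P.expectation (\<lambda>\<omega>. f' (?X n \<omega> / s))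
      - P.expectation (\<lambda>\<omega>. ?X n \<omega> / s * f (?X n \<omega> / s))\<bar>)
    \<longlonglongrightarrow> \<bar>1 * P.expectation (\<lambda>\<omega>. f' (Y \<omega> / s)) - P.expectation (\<lambda>\<omega>. Y \<omega> / s * f (Y \<omega> / s))\<bar>"
    by (intro tendsto_intros lim1 lim2 lim3)
  then have "\<bar>1 * P.expectation (\<lambda>\<omega>. f' (Y \<omega> / s)) - P.expectation (\<lambda>\<omega>. Y \<omega> / s * f (Y \<omega> / s))\<bar>
    \<le> A * sqrt (stein_const1 * M4) / s\<^sup>2 + 8 * L * (stein_const2 * (M4 + mass)) / s ^ 3"
    by (rule tendsto_upperbound, intro always_eventually allI stein_partition[OF p s(2) deriv f f' lip], simp)
  then show ?thesis by simp
qed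

text \<open>The constants are those of \<open>stein_solution\<close>: 78 bounds f', and 728 = 8 * 91
  with 91 the Lipschitz constant of f'. They do not depend on the test function, so the supremum
  obeys the same bound.\<close>

theorem wasserstein_pair_statistic:
  assumes pos: "P.variance G > 0"
  shows "wasserstein (distr P borel (\<lambda>\<omega>. (G \<omega> - P.expectation G) / sqrt (P.variance G))) std_normal_distribution
    \<le> ennreal (78 * sqrt (stein_const1 * M4) / P.variance G
        + 728 * (stein_const2 * (M4 + mass)) / sqrt (P.variance G) ^ 3)"
  unfolding wasserstein_def
proof (rule SUP_least)
  fix g :: "real \<Rightarrow> real" assume "g \<in> {g. 1-lipschitz_on UNIV g}"
  then have g: "1-lipschitz_on UNIV g" by simp
  define s where "s = sqrt (P.variance G)"
  have s: "s\<^sup>2 = P.variance G" "s > 0" using pos by (auto simp: s_def)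
  have gm [measurable]: "g \<in> borel_measurable borel" by (rule lipschitz_1_measurable[OF g])
  obtain f f' where f: "\<And>x. (f has_real_derivative f' x) (at x)"
    "\<And>x. f' x - x * f x = g x - (\<integral>t. g t \<partial>std_normal_distribution)"
    "\<And>x. \<bar>f x\<bar> \<le> 12" "\<And>x. \<bar>f' x\<bar> \<le> 78" "\<And>x y. \<bar>f' x - f' y\<bar> \<le> 91 * \<bar>x - y\<bar>"
    by (rule stein_solution[OF g]) (rule that)
  have [measurable]: "f \<in> borel_measurable borel"
    using f(1) by (intro borel_measurable_continuous_onI DERIV_continuous_on) auto
  have f'_eq: "f' = (\<lambda>x. x * f x + (g x - (\<integral>t. g t \<partial>std_normal_distribution)))" using f(2) by (auto simp: algebra_simps)
  have [measurable]: "f' \<in> borel_measurable borel" unfolding f'_eq by measurable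
  have [measurable]: "Y \<in> borel_measurable P" using sq_integrable_Y by (simp add: sq_integrable_def)
  have Yint: "integrable P Y" by (rule sq_integrable_imp_integrable[OF P.finite_measure_axioms sq_integrable_Y])
  have i1: "integrable P (\<lambda>\<omega>. f' (Y \<omega> / s))"
    by (intro P.integrable_const_bound[of _ 78]) (use f(4) in auto)
  have i2: "integrable P (\<lambda>\<omega>. Y \<omega> / s * f (Y \<omega> / s))"
  proof (rule Bochner_Integration.integrable_bound[where f = "\<lambda>\<omega>. 12 / s * Y \<omega>"])
    show "AE \<omega> in P. norm (Y \<omega> / s * f (Y \<omega> / s)) \<le> norm (12 / s * Y \<omega>)"
    proof (rule AE_I2)
      fix \<omega>
      have "\<bar>Y \<omega> / s\<bar> * \<bar>f (Y \<omega> / s)\<bar> \<le> \<bar>Y \<omega> / s\<bar> * 12" by (intro mult_left_mono f(3)) simp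
      then show "norm (Y \<omega> / s * f (Y \<omega> / s)) \<le> norm (12 / s * Y \<omega>)"
        by (simp add: abs_mult mult.commute)
    qed
  qed (use Yint in auto)
  have eq: "(\<integral>x. g x \<partial>distr P borel (\<lambda>\<omega>. (G \<omega> - P.expectation G) / sqrt (P.variance G))) = P.expectation (\<lambda>\<omega>. g (Y \<omega> / s))"
    by (subst integral_distr) (auto simp: s_def expectation_G Y_def)
  have "P.expectation (\<lambda>\<omega>. f' (Y \<omega> / s)) - P.expectation (\<lambda>\<omega>. Y \<omega> / s * f (Y \<omega> / s)) =
      P.expectation (\<lambda>\<omega>. f' (Y \<omega> / s) - Y \<omega> / s * f (Y \<omega> / s))"
    using i1 i2 by simp
  also have "\<dots> = P.expectation (\<lambda>\<omega>. g (Y \<omega> / s) - (\<integral>t. g t \<partial>std_normal_distribution))"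
    unfolding f(2) ..
  also have "\<dots> = P.expectation (\<lambda>\<omega>. g (Y \<omega> / s)) - (\<integral>t. g t \<partial>std_normal_distribution)"
  proof -
    have "integrable P (\<lambda>\<omega>. (f' (Y \<omega> / s) - Y \<omega> / s * f (Y \<omega> / s)) + (\<integral>t. g t \<partial>std_normal_distribution))"
      using i1 i2 by simp
    then have "integrable P (\<lambda>\<omega>. g (Y \<omega> / s))" unfolding f(2) by simp
    then show ?thesis by (simp add: P.prob_space)
  qed
  finally have "\<bar>P.expectation (\<lambda>\<omega>. g (Y \<omega> / s)) - (\<integral>t. g t \<partial>std_normal_distribution)\<bar>
      \<le> 78 * sqrt (stein_const1 * M4) / s\<^sup>2 + 8 * 91 * (stein_const2 * (M4 + mass)) / s ^ 3"
    using stein_limit[OF s f(1,3,4,5)] by simp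
  then show "ennreal \<bar>(\<integral>x. g x \<partial>distr P borel (\<lambda>\<omega>. (G \<omega> - P.expectation G) / sqrt (P.variance G))) - (\<integral>x. g x \<partial>std_normal_distribution)\<bar>
    \<le> ennreal (78 * sqrt (stein_const1 * M4) / P.variance G
        + 728 * (stein_const2 * (M4 + mass)) / sqrt (P.variance G) ^ 3)"
    unfolding eq unfolding s_def[symmetric] unfolding s(1)[symmetric] by (intro ennreal_leI) simp
qed

end

text \<open>Both expectations of g lie within 1 of g 0, since standardised variables have first
  absolute moment at most 1. This covers windows for which no lower bound of the variance is
  available.\<close>

lemma wasserstein_std_normal_le_2:
  assumes "prob_space P" and X: "sq_integrable P X" and pos: "prob_space.variance P X > 0"
  shows "wasserstein (distr P borel (\<lambda>\<omega>. (X \<omega> - prob_space.expectation P X) / sqrt (prob_space.variance P X))) std_normal_distribution \<le> 2"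
  unfolding wasserstein_def
proof (rule SUP_least)
  interpret P: prob_space P by fact
  interpret N: prob_space std_normal_distribution by (rule prob_space_std_normal)
  fix g :: "real \<Rightarrow> real" assume "g \<in> {g. 1-lipschitz_on UNIV g}"
  then have g: "1-lipschitz_on UNIV g" by simp
  have gm [measurable]: "g \<in> borel_measurable borel" by (rule lipschitz_1_measurable[OF g])
  have [measurable]: "X \<in> borel_measurable P" using X by (simp add: sq_integrable_def)
  define Z where "Z = (\<lambda>\<omega>. (X \<omega> - P.expectation X) / sqrt (P.variance X))"
  have Zm [measurable]: "Z \<in> borel_measurable P" unfolding Z_def by measurable
  have c: "sq_integrable P (\<lambda>\<omega>. X \<omega> - P.expectation X)"
    by (intro sq_integrable_diff X sq_integrable_const P.finite_measure_axioms)
  have Z: "sq_integrable P Z"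
    unfolding Z_def using sq_integrable_cmult[OF c, of "1 / sqrt (P.variance X)"] by simp
  have Z2: "P.expectation (\<lambda>\<omega>. (Z \<omega>)\<^sup>2) = 1"
    unfolding Z_def using pos by (simp add: power_divide)
  have Zi: "integrable P Z" by (rule sq_integrable_imp_integrable[OF P.finite_measure_axioms Z])
  have Z1: "P.expectation (\<lambda>\<omega>. \<bar>Z \<omega>\<bar>) \<le> 1"
  proof -
    have "P.expectation (\<lambda>\<omega>. \<bar>Z \<omega>\<bar>) \<le> P.expectation (\<lambda>\<omega>. (1 + (Z \<omega>)\<^sup>2) / 2)"
    proof (rule integral_mono)
      show "\<bar>Z \<omega>\<bar> \<le> (1 + (Z \<omega>)\<^sup>2) / 2" for \<omega>
        using zero_le_power2[of "\<bar>Z \<omega>\<bar> - 1"] by (simp add: power2_diff)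
    qed (use Z Zi in \<open>auto simp: sq_integrable_def\<close>)
    also have "\<dots> = 1" using Z Z2 by (simp add: sq_integrable_def P.prob_space)
    finally show ?thesis .
  qed
  have gi: "integrable P (\<lambda>\<omega>. g (Z \<omega>))"
  proof (rule Bochner_Integration.integrable_bound[where f = "\<lambda>\<omega>. \<bar>g 0\<bar> + \<bar>Z \<omega>\<bar>"])
    show "AE \<omega> in P. norm (g (Z \<omega>)) \<le> norm (\<bar>g 0\<bar> + \<bar>Z \<omega>\<bar>)"
    proof (rule AE_I2)
      fix \<omega> show "norm (g (Z \<omega>)) \<le> norm (\<bar>g 0\<bar> + \<bar>Z \<omega>\<bar>)"
        using lipschitz_1_abs[OF g, of "Z \<omega>" 0] by auto
    qed
  qed (use Zi in auto)
  have "\<bar>P.expectation (\<lambda>\<omega>. g (Z \<omega>)) - g 0\<bar> = \<bar>P.expectation (\<lambda>\<omega>. g (Z \<omega>) - g 0)\<bar>"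
    using gi by (simp add: P.prob_space)
  also have "\<dots> \<le> P.expectation (\<lambda>\<omega>. \<bar>Z \<omega>\<bar>)"
  proof (rule order.trans[OF integral_abs_bound integral_mono])
    show "\<bar>g (Z \<omega>) - g 0\<bar> \<le> \<bar>Z \<omega>\<bar>" for \<omega> using lipschitz_1_abs[OF g, of "Z \<omega>" 0] by simp
  qed (use gi Zi in auto)
  finally have 1: "\<bar>P.expectation (\<lambda>\<omega>. g (Z \<omega>)) - g 0\<bar> \<le> 1" using Z1 by linarith
  have 2: "\<bar>g 0 - (\<integral>x. g x \<partial>std_normal_distribution)\<bar> \<le> 1" using std_normal_lipschitz_centre[OF g, of 0] by simp
  have "(\<integral>x. g x \<partial>distr P borel (\<lambda>\<omega>. (X \<omega> - P.expectation X) / sqrt (P.variance X))) = P.expectation (\<lambda>\<omega>. g (Z \<omega>))"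
    by (subst integral_distr) (auto simp: Z_def)
  then have "\<bar>(\<integral>x. g x \<partial>distr P borel (\<lambda>\<omega>. (X \<omega> - P.expectation X) / sqrt (P.variance X))) - (\<integral>x. g x \<partial>std_normal_distribution)\<bar> \<le> 2"
    using 1 2 by linarith
  then show "ennreal \<bar>(\<integral>x. g x \<partial>distr P borel (\<lambda>\<omega>. (X \<omega> - P.expectation X) / sqrt (P.variance X))) - (\<integral>x. g x \<partial>std_normal_distribution)\<bar> \<le> 2"
    using ennreal_leI by fastforce
qed

section \<open>The Boolean model\<close>

lemma space_compact_borel: "space (compact_borel :: 'a::t2_space set measure) = {C. compact C}"
proof -
  have "{W. openin (subtopology fell_topology {C. compact C}) W} \<subseteq> Pow {C :: 'a set. compact C}"
    by (auto simp: openin_subtopology)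
  then show ?thesis unfolding compact_borel_def by (simp add: space_measure_of)
qed

lemma compact_borel_hit:
  fixes U :: "'a::t2_space set"
  assumes "open U" shows "{C. compact C \<and> C \<inter> U \<noteq> {}} \<in> sets compact_borel"
proof -
  have sub: "{W. openin (subtopology fell_topology {C. compact C}) W} \<subseteq> Pow {C :: 'a set. compact C}"
    by (auto simp: openin_subtopology)
  have "openin fell_topology {F. closed F \<and> F \<inter> U \<noteq> {}}"
    unfolding fell_topology_def by (rule topology_generated_by_Basis) (use assms in auto)
  then have "openin (subtopology fell_topology {C. compact C}) ({F. closed F \<and> F \<inter> U \<noteq> {}} \<inter> {C. compact C})"
    by (auto simp: openin_subtopology)
  also have "{F. closed F \<and> F \<inter> U \<noteq> {}} \<inter> {C. compact C} = {C. compact C \<and> C \<inter> U \<noteq> {}}"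
    by (auto dest: compact_imp_closed)
  finally show ?thesis
    unfolding compact_borel_def using sub by (simp add: sets_measure_of sigma_sets.Basic)
qed

lemma basis_sequence:
  obtains U :: "nat \<Rightarrow> 'a::euclidean_space set" where "\<And>n. open (U n)"
    and "\<And>S x. open S \<Longrightarrow> x \<in> S \<Longrightarrow> \<exists>n. x \<in> U n \<and> U n \<subseteq> S"
proof -
  obtain B :: "nat \<Rightarrow> 'a set" where B: "\<And>n. open (B n)" "\<And>S. open S \<Longrightarrow> \<exists>k. S = \<Union> {B n |n. n \<in> k}"
    by (rule univ_second_countable_sequence) (rule that)
  have "\<exists>n. x \<in> B n \<and> B n \<subseteq> S" if "open S" "x \<in> S" for S x
    using B(2)[OF that(1)] that(2) by blast
  with B(1) show ?thesis by (rule that)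
qed

locale grain_law = prob_space \<nu> for \<nu> :: "(real ^ 'n) set measure" +
  assumes sets_\<nu>: "sets \<nu> = sets compact_borel"
begin

lemma space_\<nu>: "space \<nu> = {C. compact C}"
  using sets_eq_imp_space_eq[OF sets_\<nu>] by (simp add: space_compact_borel)

definition \<Lambda> :: "((real ^ 'n) \<times> (real ^ 'n) set) measure" where "\<Lambda> = lborel \<Otimes>\<^sub>M \<nu>"

lemma space_\<Lambda>: "space \<Lambda> = UNIV \<times> {C. compact C}"
  by (simp add: \<Lambda>_def space_pair_measure space_\<nu>)

definition Hit :: "(real ^ 'n) \<times> (real ^ 'n) set \<Rightarrow> (real ^ 'n) \<times> (real ^ 'n) set \<Rightarrow> bool" where
  "Hit z z' \<longleftrightarrow> ((+) (fst z) ` snd z) \<inter> ((+) (fst z') ` snd z') \<noteq> {}"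

text \<open>By continuity of addition, if x + c lies in S then some product of basic open sets
  around (x, c) is carried into S. So the event is a countable union of rectangles whose second
  sides consist of the compact sets hitting a basic open set.\<close>

lemma hit_open_sets:
  assumes S: "open S"
  shows "{z \<in> space \<Lambda>. ((+) (fst z) ` snd z) \<inter> S \<noteq> {}} \<in> sets \<Lambda>"
proof -
  obtain U :: "nat \<Rightarrow> (real ^ 'n) set" where U: "\<And>n. open (U n)"
    "\<And>S x. open S \<Longrightarrow> x \<in> S \<Longrightarrow> \<exists>n. x \<in> U n \<and> U n \<subseteq> S"
    by (rule basis_sequence) (rule that)
  define I where "I = {(m, n). \<forall>x\<in>U m. \<forall>c\<in>U n. x + c \<in> S}"
  have "{z \<in> space \<Lambda>. ((+) (fst z) ` snd z) \<inter> S \<noteq> {}} =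
    (\<Union>(m, n)\<in>I. U m \<times> {C. compact C \<and> C \<inter> U n \<noteq> {}})" (is "?L = ?R")
  proof (intro set_eqI iffI)
    fix z assume "z \<in> ?L"
    then obtain x C c where z: "z = (x, C)" "compact C" "c \<in> C" "x + c \<in> S"
      by (cases z) (auto simp: space_\<Lambda>)
    have "open ((\<lambda>p. fst p + snd p) -` S)" by (intro open_vimage S continuous_intros)
    moreover have "(x, c) \<in> (\<lambda>p. fst p + snd p) -` S" using z by simp
    ultimately obtain V W where VW: "open V" "open W" "(x, c) \<in> V \<times> W" "V \<times> W \<subseteq> (\<lambda>p. fst p + snd p) -` S"
      by (rule open_prod_elim)
    obtain m where "x \<in> U m" "U m \<subseteq> V" using U(2)[OF VW(1), of x] VW(3) by auto
    moreover obtain n where "c \<in> U n" "U n \<subseteq> W" using U(2)[OF VW(2), of c] VW(3) by auto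
    ultimately have mn: "x \<in> U m" "U m \<subseteq> V" "c \<in> U n" "U n \<subseteq> W" by auto
    then have "(m, n) \<in> I" using VW(4) by (fastforce simp: I_def)
    then show "z \<in> ?R" using z mn by blast
  next
    fix z assume "z \<in> ?R"
    then obtain m n x C c where z: "z = (x, C)" "compact C" "(m, n) \<in> I" "x \<in> U m" "c \<in> C" "c \<in> U n"
      by (force split: prod.splits)
    then have "x + c \<in> S" by (auto simp: I_def)
    then have "x + c \<in> (+) x ` C \<inter> S" using z by auto
    then show "z \<in> ?L" using z by (auto simp: space_\<Lambda>)
  qed
  moreover have "U m \<times> {C. compact C \<and> C \<inter> U n \<noteq> {}} \<in> sets \<Lambda>" for m n
    unfolding \<Lambda>_def using U(1) compact_borel_hit[OF U(1)] by (intro pair_measureI) (auto simp: sets_\<nu>)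
  then have "?R \<in> sets \<Lambda>" by (intro sets.countable_UN') auto
  ultimately show ?thesis by simp
qed

text \<open>Two compact sets meet iff for every n they hit a common basic open set whose points are
  within 1 / (n + 1) of each other, because disjoint compact sets are a positive distance apart.
  This is a countable combination of the events in \<open>hit_open_sets\<close>.\<close>

lemma Hit_sets: "{p \<in> space (\<Lambda> \<Otimes>\<^sub>M \<Lambda>). Hit (fst p) (snd p)} \<in> sets (\<Lambda> \<Otimes>\<^sub>M \<Lambda>)"
proof -
  obtain U :: "nat \<Rightarrow> (real ^ 'n) set" where U: "\<And>n. open (U n)"
    "\<And>S x. open S \<Longrightarrow> x \<in> S \<Longrightarrow> \<exists>n. x \<in> U n \<and> U n \<subseteq> S"
    by (rule basis_sequence) (rule that)
  define A where "A = (\<lambda>k. {z \<in> space \<Lambda>. ((+) (fst z) ` snd z) \<inter> U k \<noteq> {}})"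
  define K where "K = (\<lambda>n :: nat. {k. \<forall>a\<in>U k. \<forall>b\<in>U k. dist a b < 1 / real (Suc n)})"
  have "{p \<in> space (\<Lambda> \<Otimes>\<^sub>M \<Lambda>). Hit (fst p) (snd p)} = (\<Inter>n. \<Union>k\<in>K n. A k \<times> A k)"
  proof (intro set_eqI iffI)
    fix p assume "p \<in> {p \<in> space (\<Lambda> \<Otimes>\<^sub>M \<Lambda>). Hit (fst p) (snd p)}"
    then have p: "fst p \<in> space \<Lambda>" "snd p \<in> space \<Lambda>" "Hit (fst p) (snd p)" by (auto simp: space_pair_measure)
    then obtain q where q: "q \<in> (+) (fst (fst p)) ` snd (fst p)" "q \<in> (+) (fst (snd p)) ` snd (snd p)"
      by (auto simp: Hit_def)
    show "p \<in> (\<Inter>n. \<Union>k\<in>K n. A k \<times> A k)"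
    proof (intro INT_I)
      fix n
      obtain k where k: "q \<in> U k" "U k \<subseteq> ball q (1 / real (Suc n) / 2)"
        using U(2)[OF open_ball, of q q "1 / real (Suc n) / 2"] by auto
      have "k \<in> K n" unfolding K_def
      proof (intro CollectI ballI)
        fix a b assume "a \<in> U k" "b \<in> U k"
        then have "dist q a < 1 / real (Suc n) / 2" "dist q b < 1 / real (Suc n) / 2" using k by auto
        then show "dist a b < 1 / real (Suc n)" by (rule dist_triangle_half_r)
      qed
      moreover have "p \<in> A k \<times> A k" using p q k by (cases p) (auto simp: A_def)
      ultimately show "p \<in> (\<Union>k\<in>K n. A k \<times> A k)" by blast
    qed
  next
    fix p assume p: "p \<in> (\<Inter>n. \<Union>k\<in>K n. A k \<times> A k)"
    then have sp: "fst p \<in> space \<Lambda>" "snd p \<in> space \<Lambda>" by (auto simp: A_def)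
    let ?X = "(+) (fst (fst p)) ` snd (fst p)" and ?Y = "(+) (fst (snd p)) ` snd (snd p)"
    have comp: "compact ?X" "compact ?Y"
      using sp by (auto simp: space_\<Lambda> mem_Times_iff intro!: compact_continuous_image continuous_intros)
    have "?X \<inter> ?Y \<noteq> {}"
    proof
      assume "?X \<inter> ?Y = {}"
      then obtain d where d: "d > 0" "\<And>x y. x \<in> ?X \<Longrightarrow> y \<in> ?Y \<Longrightarrow> d \<le> dist x y"
        using separate_compact_closed[OF comp(1) compact_imp_closed[OF comp(2)]] by blast
      obtain n where n: "1 / real (Suc n) < d" using nat_approx_posE[OF d(1)] by blast
      from p have "p \<in> (\<Union>k\<in>K n. A k \<times> A k)" by blast
      then obtain k where k: "k \<in> K n" "fst p \<in> A k" "snd p \<in> A k" by auto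
      then obtain a b where "a \<in> ?X" "a \<in> U k" "b \<in> ?Y" "b \<in> U k" unfolding A_def by blast
      then show False using k(1) d(2)[of a b] n by (force simp: K_def)
    qed
    then show "p \<in> {p \<in> space (\<Lambda> \<Otimes>\<^sub>M \<Lambda>). Hit (fst p) (snd p)}"
      using sp by (cases p) (auto simp: Hit_def space_pair_measure)
  qed
  moreover have "A k \<in> sets \<Lambda>" for k unfolding A_def by (rule hit_open_sets[OF U(1)])
  then have "(\<Inter>n. \<Union>k\<in>K n. A k \<times> A k) \<in> sets (\<Lambda> \<Otimes>\<^sub>M \<Lambda>)"
    by (intro sets.countable_INT' sets.countable_UN' pair_measureI) auto
  ultimately show ?thesis by simp
qed

text \<open>Even indices separate germs by basic open sets. Odd indices separate grains, since a
  closed set is determined by the basic open sets that it hits.\<close>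

lemma separating_sequence:
  "\<exists>E :: nat \<Rightarrow> ((real ^ 'n) \<times> (real ^ 'n) set) set. (\<forall>n. E n \<in> sets \<Lambda>) \<and>
    (\<forall>z\<in>space \<Lambda>. \<forall>z'\<in>space \<Lambda>. (\<forall>n. z \<in> E n \<longleftrightarrow> z' \<in> E n) \<longrightarrow> z = z')"
proof -
  obtain U :: "nat \<Rightarrow> (real ^ 'n) set" where U: "\<And>n. open (U n)"
    "\<And>S x. open S \<Longrightarrow> x \<in> S \<Longrightarrow> \<exists>n. x \<in> U n \<and> U n \<subseteq> S"
    by (rule basis_sequence) (rule that)
  define E where "E = (\<lambda>n. if even n then U (n div 2) \<times> {C. compact C} else UNIV \<times> {C. compact C \<and> C \<inter> U (n div 2) \<noteq> {}})"
  have E: "E (2 * n) = U n \<times> {C. compact C}" "E (2 * n + 1) = UNIV \<times> {C. compact C \<and> C \<inter> U n \<noteq> {}}" for n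
    by (auto simp: E_def)
  show ?thesis
  proof (intro exI[of _ E] conjI)
    show "\<forall>n. E n \<in> sets \<Lambda>"
      unfolding \<Lambda>_def E_def using U(1) compact_borel_hit[OF U(1)] sets.top[of \<nu>]
      by (auto simp: sets_\<nu> space_\<nu> intro!: pair_measureI)
    show "\<forall>z\<in>space \<Lambda>. \<forall>z'\<in>space \<Lambda>. (\<forall>n. z \<in> E n \<longleftrightarrow> z' \<in> E n) \<longrightarrow> z = z'"
    proof (intro ballI impI)
    fix z z' assume z: "z \<in> space \<Lambda>" "z' \<in> space \<Lambda>" and eq': "\<forall>n. z \<in> E n \<longleftrightarrow> z' \<in> E n"
    note eq = eq'[rule_format]
    obtain x C y D where zz: "z = (x, C)" "z' = (y, D)" by (cases z, cases z')
    have comp: "compact C" "compact D" using z by (auto simp: zz space_\<Lambda>)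
    have "x = y"
    proof (rule ccontr)
      assume "x \<noteq> y"
      then obtain n where "x \<in> U n" "U n \<subseteq> - {y}" using U(2)[of "- {y}" x] by auto
      then show False using eq[of "2 * n"] comp by (auto simp: E zz)
    qed
    have hit: "C \<inter> U n \<noteq> {} \<longleftrightarrow> D \<inter> U n \<noteq> {}" for n
      using eq[of "2 * n + 1"] comp unfolding E zz by auto
    have sub: "X \<subseteq> X'" if X: "compact X'" "\<And>n. X \<inter> U n \<noteq> {} \<Longrightarrow> X' \<inter> U n \<noteq> {}" for X X'
    proof
      fix c assume "c \<in> X"
      show "c \<in> X'"
      proof (rule ccontr)
        assume "c \<notin> X'"
        then obtain n where "c \<in> U n" "U n \<subseteq> - X'"
          using U(2)[of "- X'" c] compact_imp_closed[OF X(1)] by auto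
        then show False using X(2)[of n] \<open>c \<in> X\<close> by auto
      qed
    qed
    have "C = D" using sub[of D C] sub[of C D] comp hit by (intro equalityI) auto
    with \<open>x = y\<close> show "z = z'" by (simp add: zz)
    qed
  qed
qed

text \<open>Only germs are separated: \<nu> may have atoms, so the diffuseness of the intensity
  rests on Lebesgue measure.\<close>

lemma spatial_sequence:
  obtains B :: "nat \<Rightarrow> ((real ^ 'n) \<times> (real ^ 'n) set) set" where "\<And>n. B n \<in> sets \<Lambda>"
    and "\<And>z z'. z \<in> space \<Lambda> \<Longrightarrow> z' \<in> space \<Lambda> \<Longrightarrow> fst z \<noteq> fst z' \<Longrightarrow> \<exists>n. (z \<in> B n) \<noteq> (z' \<in> B n)"
proof -
  obtain U :: "nat \<Rightarrow> (real ^ 'n) set" where U: "\<And>n. open (U n)"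
    "\<And>S x. open S \<Longrightarrow> x \<in> S \<Longrightarrow> \<exists>n. x \<in> U n \<and> U n \<subseteq> S"
    by (rule basis_sequence) (rule that)
  show ?thesis
  proof (rule that)
    show "U n \<times> {C. compact C} \<in> sets \<Lambda>" for n
      unfolding \<Lambda>_def using U(1) sets.top[of \<nu>] by (auto simp: space_\<nu> intro!: pair_measureI)
    fix z z' assume z: "z \<in> space \<Lambda>" "z' \<in> space \<Lambda>" and "fst z \<noteq> fst z'"
    then obtain n where "fst z \<in> U n" "U n \<subseteq> - {fst z'}" using U(2)[of "- {fst z'}" "fst z"] by auto
    then show "\<exists>n. (z \<in> U n \<times> {C. compact C}) \<noteq> (z' \<in> U n \<times> {C. compact C})"
      using z by (intro exI[of _ n]) (auto simp: space_\<Lambda> mem_Times_iff)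
  qed
qed

end

section \<open>Integer-valued finite measures as sums of point masses\<close>

locale counting_measure = finite_measure X for X :: "'z measure" +
  fixes E :: "nat \<Rightarrow> 'z set"
  assumes E_sets: "\<And>n. E n \<in> sets X"
    and E_sep: "\<And>z z'. z \<in> space X \<Longrightarrow> z' \<in> space X \<Longrightarrow> (\<And>n. z \<in> E n \<longleftrightarrow> z' \<in> E n) \<Longrightarrow> z = z'"
    and integer: "\<And>A. A \<in> sets X \<Longrightarrow> \<exists>k::nat. emeasure X A = of_nat k"
begin

definition atoms :: "'z set" where "atoms = {z \<in> space X. emeasure X {z} > 0}"

lemma ge_1: "A \<in> sets X \<Longrightarrow> emeasure X A > 0 \<Longrightarrow> emeasure X A \<ge> 1"
proof -
  assume A: "A \<in> sets X" "emeasure X A > 0"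
  obtain k :: nat where k: "emeasure X A = of_nat k" using integer[OF A(1)] by blast
  then have "1 \<le> k" using A(2) by (cases k) auto
  then have "of_nat 1 \<le> (of_nat k :: ennreal)" by (rule of_nat_mono)
  then show "emeasure X A \<ge> 1" by (simp add: k)
qed

text \<open>Bisect along the sequence E, always keeping a part of positive mass. Integer values
  force mass at least 1 at every stage, so by continuity from above the intersection has mass at
  least 1, and since E separates points it is a singleton.\<close>

lemma atom_exists:
  assumes S: "S \<in> sets X" "emeasure X S > 0"
  obtains z where "z \<in> S" "{z} \<in> sets X" "emeasure X {z} > 0"
proof -
  define T where "T = rec_nat S (\<lambda>n A. if emeasure X (A \<inter> E n) > 0 then A \<inter> E n else A - E n)"
  have T0: "T 0 = S" and TS: "T (Suc n) = (if emeasure X (T n \<inter> E n) > 0 then T n \<inter> E n else T n - E n)" for n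
    by (simp_all add: T_def)
  have sets: "T n \<in> sets X" for n by (induction n) (auto simp: T0 TS S E_sets)
  have pos: "emeasure X (T n) > 0" for n
  proof (induction n)
    case (Suc n)
    have "emeasure X (T n) = emeasure X (T n \<inter> E n) + emeasure X (T n - E n)"
      using sets E_sets by (subst plus_emeasure) (auto intro!: arg_cong[of _ _ "emeasure X"])
    then show ?case using Suc by (auto simp: TS zero_less_iff_neq_zero)
  qed (simp add: T0 S)
  have "emeasure X (\<Inter>n. T n) \<ge> 1"
  proof (rule LIMSEQ_le_const)
    show "(\<lambda>n. emeasure X (T n)) \<longlonglongrightarrow> emeasure X (\<Inter>n. T n)"
      by (rule Lim_emeasure_decseq) (auto simp: sets decseq_Suc_iff TS)
  qed (use ge_1[OF sets pos] in auto)
  then have ne: "(\<Inter>n. T n) \<noteq> {}" and p: "emeasure X (\<Inter>n. T n) > 0"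
    by (auto simp: less_le_trans[OF zero_less_one])
  obtain z where z: "z \<in> (\<Inter>n. T n)" using ne by blast
  have "z' = z" if z': "z' \<in> (\<Inter>n. T n)" for z'
  proof (rule E_sep)
    show "z' \<in> space X" "z \<in> space X" using z z' sets.sets_into_space[OF sets[of 0]] by auto
    show "z' \<in> E n \<longleftrightarrow> z \<in> E n" for n
    proof -
      have "z \<in> T (Suc n)" "z' \<in> T (Suc n)" using z z' by blast+
      then show ?thesis by (cases "emeasure X (T n \<inter> E n) > 0") (auto simp: TS)
    qed
  qed
  then have eq: "(\<Inter>n. T n) = {z}" using z by blast
  show ?thesis
  proof (rule that)
    show "z \<in> S" using z T0 by blast
    show "{z} \<in> sets X" unfolding eq[symmetric] using sets by auto
    show "emeasure X {z} > 0" using p unfolding eq .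
  qed
qed

lemma singleton_sets:
  assumes z: "z \<in> space X" shows "{z} \<in> sets X"
proof -
  have "{z} = (\<Inter>n. if z \<in> E n then E n else space X - E n) \<inter> space X"
    using z E_sep[of _ z] by (auto split: if_splits)
  also have "\<dots> \<in> sets X" using E_sets by (intro sets.Int sets.countable_INT) auto
  finally show ?thesis .
qed

lemma finite_atoms: "finite atoms"
proof -
  obtain k :: nat where k: "emeasure X (space X) = of_nat k" using integer by auto
  have "card G \<le> k" if G: "G \<subseteq> atoms" "finite G" for G
  proof -
    have sg: "{z} \<in> sets X" if "z \<in> G" for z using that G by (intro singleton_sets) (auto simp: atoms_def)
    have "of_nat (card G) = (\<Sum>z\<in>G. 1 :: ennreal)" by simp
    also have "\<dots> \<le> (\<Sum>z\<in>G. emeasure X {z})"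
      by (intro sum_mono ge_1 sg) (use G in \<open>auto simp: atoms_def\<close>)
    also have "\<dots> = emeasure X G"
      by (rule emeasure_eq_sum_singleton[symmetric, OF G(2)]) (rule sg)
    also have "\<dots> \<le> of_nat k" unfolding k[symmetric] by (rule emeasure_space)
    finally show ?thesis by simp
  qed
  then show ?thesis using finite_if_finite_subsets_card_bdd[of atoms k] by blast
qed

lemma sets_atoms: "atoms \<in> sets X"
proof -
  have "atoms = (\<Union>z\<in>atoms. {z})" by auto
  also have "\<dots> \<in> sets X"
    by (intro sets.finite_UN finite_atoms singleton_sets) (auto simp: atoms_def)
  finally show ?thesis .
qed

lemma AE_atoms: "AE z in X. z \<in> atoms"
proof (rule AE_I')
  show "space X - atoms \<in> null_sets X"
  proof (rule null_setsI)
    show "emeasure X (space X - atoms) = 0"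
    proof (rule ccontr)
      assume "emeasure X (space X - atoms) \<noteq> 0"
      then obtain z where "z \<in> space X - atoms" "emeasure X {z} > 0"
        using atom_exists[of "space X - atoms"] sets_atoms by (auto simp: zero_less_iff_neq_zero)
      then show False by (simp add: atoms_def)
    qed
  qed (use sets_atoms in auto)
qed auto

lemma integral_eq_sum_atoms:
  fixes g :: "'z \<times> 'z \<Rightarrow> real"
  assumes g: "g \<in> borel_measurable (X \<Otimes>\<^sub>M X)"
  shows "(\<integral>z. g z \<partial>(X \<Otimes>\<^sub>M X)) = (\<Sum>p\<in>atoms \<times> atoms. g p * (measure X {fst p} * measure X {snd p}))"
proof -
  have sg: "{p} \<in> sets (X \<Otimes>\<^sub>M X)" if "p \<in> atoms \<times> atoms" for p
    using pair_measureI[OF singleton_sets singleton_sets, of "fst p" "snd p"] that by (auto simp: atoms_def)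
  have ms: "measure (X \<Otimes>\<^sub>M X) {p} = measure X {fst p} * measure X {snd p}" if "p \<in> atoms \<times> atoms" for p
  proof -
    have "emeasure (X \<Otimes>\<^sub>M X) ({fst p} \<times> {snd p}) = emeasure X {fst p} * emeasure X {snd p}"
      by (intro emeasure_pair_measure_Times singleton_sets) (use that in \<open>auto simp: atoms_def\<close>)
    then show ?thesis by (simp add: measure_def enn2real_mult)
  qed
  have "AE p in X \<Otimes>\<^sub>M X. p \<in> atoms \<times> atoms"
  proof (rule pair_sigma_finite.AE_pair_measure)
    show "pair_sigma_finite X X" ..
    have "{p \<in> space (X \<Otimes>\<^sub>M X). p \<in> atoms \<times> atoms} = atoms \<times> atoms"
      using sets.sets_into_space[OF sets_atoms] by (auto simp: space_pair_measure)
    then show "{p \<in> space (X \<Otimes>\<^sub>M X). p \<in> atoms \<times> atoms} \<in> sets (X \<Otimes>\<^sub>M X)"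
      using sets_atoms by simp
    show "AE x in X. AE y in X. (x, y) \<in> atoms \<times> atoms"
      using AE_atoms by eventually_elim (use AE_atoms in auto)
  qed
  then have "AE p in X \<Otimes>\<^sub>M X. g p = (\<Sum>a\<in>atoms \<times> atoms. g a * indicator {a} p)"
  proof eventually_elim
    case (elim p)
    have "(\<Sum>a\<in>atoms \<times> atoms. g a * indicator {a} p) = (\<Sum>a\<in>atoms \<times> atoms. if a = p then g a else 0)"
      by (intro sum.cong) (auto simp: indicator_def)
    then show ?case using elim finite_atoms by simp
  qed
  then have "(\<integral>z. g z \<partial>(X \<Otimes>\<^sub>M X)) = (\<integral>p. (\<Sum>a\<in>atoms \<times> atoms. g a * indicator {a} p) \<partial>(X \<Otimes>\<^sub>M X))"
    by (intro integral_cong_AE g borel_measurable_sum borel_measurable_times borel_measurable_indicator sg) auto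
  also have "\<dots> = (\<Sum>p\<in>atoms \<times> atoms. g p * (measure X {fst p} * measure X {snd p}))"
  proof (subst Bochner_Integration.integral_sum)
    show "integrable (X \<Otimes>\<^sub>M X) (\<lambda>p. g a * indicator {a} p)" if "a \<in> atoms \<times> atoms" for a
      using sg[OF that] finite_measure.emeasure_finite[OF finite_pair] by (intro integrable_mult_right) (auto simp: less_top[symmetric])
  qed (intro sum.cong refl, simp add: ms sg)
  finally show ?thesis .
qed

end

section \<open>The marked Poisson process in a window\<close>

lemma window_eq_cbox:
  "window l = cbox (\<chi> i. - (l powr (1 / CARD('n)))) (\<chi> i. l powr (1 / CARD('n)) :: real ^ 'n)"
  by (auto simp: window_def mem_box_cart)

lemma window_sets [measurable]: "(window l :: (real ^ 'n) set) \<in> sets borel"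
  unfolding window_eq_cbox by simp

lemma emeasure_window:
  assumes "l > 0"
  shows "emeasure lborel (window l :: (real ^ 'n) set) = ennreal (2 ^ CARD('n) * l)"
proof -
  let ?a = "l powr (1 / CARD('n))"
  have ne: "cbox (\<chi> i. - ?a) (\<chi> i. ?a :: real ^ 'n) \<noteq> {}"
    by (simp add: interval_ne_empty_cart(1))
  have p: "?a ^ CARD('n) = l"
    using assms by (simp add: powr_realpow[symmetric] powr_powr)
  have "measure lborel (window l :: (real ^ 'n) set) = (\<Prod>i\<in>(UNIV :: 'n set). 2 * ?a)"
    unfolding window_eq_cbox content_cbox_cart[OF ne] by simp
  also have "\<dots> = 2 ^ CARD('n) * l" by (simp add: power_mult_distrib p)
  finally have "measure lborel (window l :: (real ^ 'n) set) = 2 ^ CARD('n) * l" .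
  moreover have "emeasure lborel (window l :: (real ^ 'n) set) < \<infinity>"
    unfolding window_eq_cbox by (rule emeasure_lborel_cbox_finite)
  ultimately show ?thesis using emeasure_eq_ennreal_measure[of lborel "window l :: (real ^ 'n) set"] by simp
qed

locale boolean_model = grain_law \<nu> for \<nu> :: "(real ^ 'n) set measure" +
  fixes P :: "'w measure" and \<eta> :: "'w \<Rightarrow> ((real ^ 'n) \<times> (real ^ 'n) set) measure"
  assumes poisson: "poisson_measure P (lborel \<Otimes>\<^sub>M \<nu>) \<eta>"
begin

sublocale P: prob_space P
  using poisson by (simp add: poisson_measure_def)

abbreviation cyl :: "real \<Rightarrow> ((real ^ 'n) \<times> (real ^ 'n) set) set" where
  "cyl l \<equiv> window l \<times> space \<nu>"

definition \<mu>W :: "real \<Rightarrow> ((real ^ 'n) \<times> (real ^ 'n) set) measure" where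
  "\<mu>W l = density \<Lambda> (indicator (cyl l))"

text \<open>Emptied on the null event of infinitely many points, so as to be finite for every \<open>\<omega>\<close>.\<close>

definition \<xi>W :: "real \<Rightarrow> 'w \<Rightarrow> ((real ^ 'n) \<times> (real ^ 'n) set) measure" where
  "\<xi>W l \<omega> = density (\<eta> \<omega>) (indicator (if emeasure (\<eta> \<omega>) (cyl l) < \<infinity> then cyl l else {}))"

lemmas poissonD = poisson[folded \<Lambda>_def, unfolded poisson_measure_def]

lemma sets_\<eta>: "\<omega> \<in> space P \<Longrightarrow> sets (\<eta> \<omega>) = sets \<Lambda>"
  using poissonD by blast

lemma cyl_sets: "cyl l \<in> sets \<Lambda>"
  unfolding \<Lambda>_def by (intro pair_measureI) auto

lemma sets_\<mu>W: "sets (\<mu>W l) = sets \<Lambda>" and space_\<mu>W: "space (\<mu>W l) = space \<Lambda>"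
  by (simp_all add: \<mu>W_def)

lemma emeasure_\<mu>W: "A \<in> sets \<Lambda> \<Longrightarrow> emeasure (\<mu>W l) A = emeasure \<Lambda> (A \<inter> cyl l)"
  unfolding \<mu>W_def using emeasure_restricted[OF cyl_sets, of A l] by (simp add: Int_commute)

lemma emeasure_cyl: "l > 0 \<Longrightarrow> emeasure \<Lambda> (cyl l) = ennreal (2 ^ CARD('n) * l)"
  unfolding \<Lambda>_def by (subst emeasure_pair_measure_Times) (auto simp: emeasure_window emeasure_space_1)

lemma finite_\<mu>W: "l > 0 \<Longrightarrow> finite_measure (\<mu>W l)"
proof
  assume l: "l > 0"
  have "emeasure (\<mu>W l) (space \<Lambda>) = emeasure \<Lambda> (space \<Lambda> \<inter> cyl l)"
    by (rule emeasure_\<mu>W) auto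
  also have "\<dots> \<le> emeasure \<Lambda> (cyl l)" by (rule emeasure_mono) (use cyl_sets in auto)
  also have "\<dots> < \<infinity>" by (simp add: emeasure_cyl[OF l])
  finally show "emeasure (\<mu>W l) (space (\<mu>W l)) \<noteq> \<infinity>" by (simp add: space_\<mu>W)
qed

lemma sets_\<xi>W: "\<omega> \<in> space P \<Longrightarrow> sets (\<xi>W l \<omega>) = sets \<Lambda>"
  by (simp add: \<xi>W_def sets_\<eta>)

lemma emeasure_\<xi>W:
  assumes \<omega>: "\<omega> \<in> space P" and A: "A \<in> sets \<Lambda>"
  shows "emeasure (\<xi>W l \<omega>) A = (if emeasure (\<eta> \<omega>) (cyl l) < \<infinity> then emeasure (\<eta> \<omega>) (A \<inter> cyl l) else 0)"
proof -
  have "emeasure (density (\<eta> \<omega>) (indicator S)) A = emeasure (\<eta> \<omega>) (A \<inter> S)" if "S \<in> sets \<Lambda>" for S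
    using emeasure_restricted[of S "\<eta> \<omega>" A] that A sets_\<eta>[OF \<omega>] by (simp add: Int_commute)
  from this[of "cyl l"] this[of "{}"] show ?thesis unfolding \<xi>W_def using cyl_sets by simp
qed

lemma measurable_emeasure_\<eta>: "A \<in> sets \<Lambda> \<Longrightarrow> (\<lambda>\<omega>. emeasure (\<eta> \<omega>) A) \<in> borel_measurable P"
  using poissonD by blast

lemma law_\<eta>: "A \<in> sets \<Lambda> \<Longrightarrow> emeasure \<Lambda> A < \<infinity> \<Longrightarrow>
    P.prob {\<omega> \<in> space P. emeasure (\<eta> \<omega>) A = of_nat k} = measure \<Lambda> A ^ k / fact k * exp (- measure \<Lambda> A)"
  using poissonD by blast

text \<open>Infinite counts are allowed by \<open>poisson_measure\<close>. The probabilities of the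
  finite values add up to exp m * exp (- m) = 1.\<close>

lemma AE_finite_\<eta>:
  assumes l: "l > 0" shows "AE \<omega> in P. emeasure (\<eta> \<omega>) (cyl l) < \<infinity>"
proof -
  define m where "m = measure \<Lambda> (cyl l)"
  define S where "S = (\<lambda>k :: nat. {\<omega> \<in> space P. emeasure (\<eta> \<omega>) (cyl l) = of_nat k})"
  have [measurable]: "(\<lambda>\<omega>. emeasure (\<eta> \<omega>) (cyl l)) \<in> borel_measurable P"
    by (rule measurable_emeasure_\<eta>[OF cyl_sets])
  have S: "range S \<subseteq> sets P" unfolding S_def by auto
  have "(\<lambda>k. P.prob (S k)) sums P.prob (\<Union>k. S k)"
    by (rule P.finite_measure_UNION[OF S]) (auto simp: disjoint_family_on_def S_def)
  moreover have "P.prob (S k) = m ^ k /\<^sub>R fact k * exp (- m)" for k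
    unfolding S_def m_def using law_\<eta>[OF cyl_sets] emeasure_cyl[OF l] by (simp add: divide_inverse_commute)
  moreover have "(\<lambda>k. m ^ k /\<^sub>R fact k * exp (- m)) sums (exp m * exp (- m))"
    by (intro sums_mult2 exp_converges)
  ultimately have "P.prob (\<Union>k. S k) = 1" by (simp add: sums_iff exp_minus)
  moreover have "(\<Union>k. S k) \<in> P.events" using S by auto
  ultimately have "AE \<omega> in P. \<omega> \<in> (\<Union>k. S k)" by (simp add: P.prob_eq_1)
  then show ?thesis by eventually_elim (auto simp: S_def of_nat_less_top)
qed

lemma joint_law_\<eta>:
  fixes J :: "nat set"
  assumes J: "finite J" and A: "\<And>j. j \<in> J \<Longrightarrow> A j \<in> sets \<Lambda>" "\<And>j. j \<in> J \<Longrightarrow> emeasure \<Lambda> (A j) < \<infinity>"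
    and disj: "disjoint_family_on A J"
  shows "P.prob {\<omega> \<in> space P. \<forall>j\<in>J. emeasure (\<eta> \<omega>) (A j) = of_nat (k j)} =
    (\<Prod>j\<in>J. measure \<Lambda> (A j) ^ k j / fact (k j) * exp (- measure \<Lambda> (A j)))"
proof (cases "J = {}")
  case False
  \<comment> \<open>Padding with empty sets turns the finite family into a sequence, the form in
    which independence is given.\<close>
  define A' where "A' = (\<lambda>j. if j \<in> J then A j else {})"
  have A': "range A' \<subseteq> sets \<Lambda>" using A by (auto simp: A'_def)
  have "disjoint_family A'" using disj by (auto simp: disjoint_family_on_def A'_def)
  then have ind: "P.indep_vars (\<lambda>_. borel) (\<lambda>j \<omega>. emeasure (\<eta> \<omega>) (A' j)) UNIV"
    using poissonD A' by blast
  have "{\<omega> \<in> space P. \<forall>j\<in>J. emeasure (\<eta> \<omega>) (A j) = of_nat (k j)} =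
      (\<Inter>j\<in>J. (\<lambda>\<omega>. emeasure (\<eta> \<omega>) (A' j)) -` {of_nat (k j)} \<inter> space P)"
    using False by (auto simp: A'_def)
  also have "P.prob \<dots> = (\<Prod>j\<in>J. P.prob ((\<lambda>\<omega>. emeasure (\<eta> \<omega>) (A' j)) -` {of_nat (k j)} \<inter> space P))"
    by (rule P.indep_varsD[OF ind]) (use False J in auto)
  also have "\<dots> = (\<Prod>j\<in>J. measure \<Lambda> (A j) ^ k j / fact (k j) * exp (- measure \<Lambda> (A j)))"
  proof (rule prod.cong)
    fix j assume j: "j \<in> J"
    have "(\<lambda>\<omega>. emeasure (\<eta> \<omega>) (A' j)) -` {of_nat (k j)} \<inter> space P = {\<omega> \<in> space P. emeasure (\<eta> \<omega>) (A j) = of_nat (k j)}"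
      using j by (auto simp: A'_def)
    then show "P.prob ((\<lambda>\<omega>. emeasure (\<eta> \<omega>) (A' j)) -` {of_nat (k j)} \<inter> space P) =
        measure \<Lambda> (A j) ^ k j / fact (k j) * exp (- measure \<Lambda> (A j))"
      using law_\<eta>[OF A(1)[OF j] A(2)[OF j]] by simp
  qed simp
  finally show ?thesis .
qed (simp add: P.prob_space)

lemma poisson_process_\<xi>W:
  assumes l: "l > 0" shows "poisson_process P (\<mu>W l) (\<xi>W l)"
proof (rule poisson_process.intro)
  show "prob_space P" by (rule P.prob_space_axioms)
  show "finite_measure (\<mu>W l)" by (rule finite_\<mu>W[OF l])
  show "sets (\<xi>W l \<omega>) = sets (\<mu>W l)" if "\<omega> \<in> space P" for \<omega>
    by (simp add: sets_\<xi>W[OF that] sets_\<mu>W)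
  show "\<exists>k::nat. emeasure (\<xi>W l \<omega>) A = of_nat k" if \<omega>: "\<omega> \<in> space P" and A: "A \<in> sets (\<mu>W l)" for \<omega> A
  proof (cases "emeasure (\<eta> \<omega>) (cyl l) < \<infinity>")
    case True
    have A': "A \<in> sets \<Lambda>" "A \<inter> cyl l \<in> sets \<Lambda>" using A cyl_sets by (auto simp: sets_\<mu>W)
    have "emeasure (\<eta> \<omega>) (A \<inter> cyl l) \<le> emeasure (\<eta> \<omega>) (cyl l)"
      using cyl_sets sets_\<eta>[OF \<omega>] by (intro emeasure_mono) auto
    then have "emeasure (\<eta> \<omega>) (A \<inter> cyl l) \<noteq> \<infinity>" using True by (auto simp: top_unique)
    moreover have "emeasure (\<eta> \<omega>) (A \<inter> cyl l) \<in> range of_nat \<union> {\<infinity>}"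
      using poissonD A'(2) \<omega> by blast
    ultimately show ?thesis using True emeasure_\<xi>W[OF \<omega> A'(1)] by auto
  next
    case False
    then show ?thesis using emeasure_\<xi>W[OF \<omega>, of A] A by (auto simp: sets_\<mu>W intro: exI[of _ 0])
  qed
  note [measurable] = measurable_emeasure_\<eta>[OF cyl_sets]
  show meas: "(\<lambda>\<omega>. emeasure (\<xi>W l \<omega>) A) \<in> borel_measurable P" if A: "A \<in> sets (\<mu>W l)" for A
  proof -
    have A': "A \<in> sets \<Lambda>" "A \<inter> cyl l \<in> sets \<Lambda>" using A cyl_sets by (auto simp: sets_\<mu>W)
    note [measurable] = measurable_emeasure_\<eta>[OF A'(2)]
    show ?thesis by (subst measurable_cong[OF emeasure_\<xi>W[OF _ A'(1)]], assumption) measurable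
  qed
  fix J :: "nat set" and A k
  assume J: "finite J" and A: "\<And>j. j \<in> J \<Longrightarrow> A j \<in> sets (\<mu>W l)" and disj: "disjoint_family_on A J"
  have A': "A j \<inter> cyl l \<in> sets \<Lambda>" "A j \<in> sets \<Lambda>" if "j \<in> J" for j using A[OF that] cyl_sets by (auto simp: sets_\<mu>W)
  have "P.prob {\<omega> \<in> space P. \<forall>j\<in>J. emeasure (\<xi>W l \<omega>) (A j) = of_nat (k j)} =
      P.prob {\<omega> \<in> space P. \<forall>j\<in>J. emeasure (\<eta> \<omega>) (A j \<inter> cyl l) = of_nat (k j)}"
  proof (rule measure_eq_AE)
    show "AE \<omega> in P. \<omega> \<in> {\<omega> \<in> space P. \<forall>j\<in>J. emeasure (\<xi>W l \<omega>) (A j) = of_nat (k j)} \<longleftrightarrow>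
        \<omega> \<in> {\<omega> \<in> space P. \<forall>j\<in>J. emeasure (\<eta> \<omega>) (A j \<inter> cyl l) = of_nat (k j)}"
      using AE_finite_\<eta>[OF l] by eventually_elim (auto simp: emeasure_\<xi>W A')
    show "{\<omega> \<in> space P. \<forall>j\<in>J. emeasure (\<xi>W l \<omega>) (A j) = of_nat (k j)} \<in> P.events"
      by (rule sets.sets_Collect_finite_All[OF _ J]) (use meas[OF A] in measurable)
    show "{\<omega> \<in> space P. \<forall>j\<in>J. emeasure (\<eta> \<omega>) (A j \<inter> cyl l) = of_nat (k j)} \<in> P.events"
      by (rule sets.sets_Collect_finite_All[OF _ J]) (use measurable_emeasure_\<eta>[OF A'(1)] in measurable)
  qed
  also have "\<dots> = (\<Prod>j\<in>J. measure \<Lambda> (A j \<inter> cyl l) ^ k j / fact (k j) * exp (- measure \<Lambda> (A j \<inter> cyl l)))"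
  proof (rule joint_law_\<eta>[OF J A'(1)])
    show "emeasure \<Lambda> (A j \<inter> cyl l) < \<infinity>" for j
      using emeasure_mono[of "A j \<inter> cyl l" "cyl l" \<Lambda>] cyl_sets emeasure_cyl[OF l] by (auto simp: less_top[symmetric] top_unique)
    show "disjoint_family_on (\<lambda>j. A j \<inter> cyl l) J" using disj by (auto simp: disjoint_family_on_def)
  qed
  also have "\<dots> = (\<Prod>j\<in>J. measure (\<mu>W l) (A j) ^ k j / fact (k j) * exp (- measure (\<mu>W l) (A j)))"
    by (intro prod.cong refl) (simp add: measure_def emeasure_\<mu>W A')
  finally show "P.prob {\<omega> \<in> space P. \<forall>j\<in>J. emeasure (\<xi>W l \<omega>) (A j) = of_nat (k j)} =
    (\<Prod>j\<in>J. measure (\<mu>W l) (A j) ^ k j / fact (k j) * exp (- measure (\<mu>W l) (A j)))" .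
qed

section \<open>Simplicity of the process and the grain sum\<close>

lemma AE_distinct_positions:
  assumes l: "l > 0" shows "AE p in \<mu>W l \<Otimes>\<^sub>M \<mu>W l. fst (fst p) \<noteq> fst (snd p)"
proof -
  interpret m: finite_measure "\<mu>W l" by (rule finite_\<mu>W[OF l])
  have m: "fst \<in> measurable \<Lambda> borel" unfolding \<Lambda>_def by measurable
  then have m': "fst \<in> measurable (\<mu>W l) borel" by (simp add: \<mu>W_def)
  show ?thesis
  proof (rule pair_sigma_finite.AE_pair_measure)
    show "pair_sigma_finite (\<mu>W l) (\<mu>W l)" ..
    show "{p \<in> space (\<mu>W l \<Otimes>\<^sub>M \<mu>W l). fst (fst p) \<noteq> fst (snd p)} \<in> sets (\<mu>W l \<Otimes>\<^sub>M \<mu>W l)"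
      using m' by measurable
    show "AE z in \<mu>W l. AE z' in \<mu>W l. fst (fst (z, z')) \<noteq> fst (snd (z, z'))"
    proof (rule AE_I2)
      fix z :: "(real ^ 'n) \<times> (real ^ 'n) set"
      have s: "{fst z} \<times> space \<nu> \<in> sets \<Lambda>" unfolding \<Lambda>_def by (intro pair_measureI) auto
      have "emeasure \<Lambda> ({fst z} \<times> space \<nu>) = 0"
        unfolding \<Lambda>_def by (subst emeasure_pair_measure_Times) auto
      moreover have "emeasure (\<mu>W l) ({fst z} \<times> space \<nu>) \<le> emeasure \<Lambda> ({fst z} \<times> space \<nu>)"
        unfolding emeasure_\<mu>W[OF s] using s by (intro emeasure_mono) auto
      ultimately have "{fst z} \<times> space \<nu> \<in> null_sets (\<mu>W l)"
        using s by (intro null_setsI) (auto simp: sets_\<mu>W)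
      then show "AE z' in \<mu>W l. fst (fst (z, z')) \<noteq> fst (snd (z, z'))"
        by (rule AE_I') (auto simp: space_\<mu>W space_\<Lambda> space_\<nu>)
    qed
  qed
qed

text \<open>Equal germs are excluded inside the kernel, which makes it vanish on the diagonal. The
  difference runs from the first germ to the second, so that moving the first germ to the origin
  leaves \<phi> at the second; the opposite order in \<open>grain_sum\<close> is absorbed by
  evenness of \<phi>.\<close>

definition pair_kernel :: "(real ^ 'n \<Rightarrow> real) \<Rightarrow> ((real ^ 'n) \<times> (real ^ 'n) set) \<times> ((real ^ 'n) \<times> (real ^ 'n) set) \<Rightarrow> real" where
  "pair_kernel \<phi> p = \<phi> (fst (snd p) - fst (fst p)) * of_bool (fst (fst p) \<noteq> fst (snd p) \<and> Hit (fst p) (snd p))"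

lemma pair_kernel_measurable:
  assumes [measurable]: "\<phi> \<in> borel_measurable borel"
  shows "pair_kernel \<phi> \<in> borel_measurable (\<Lambda> \<Otimes>\<^sub>M \<Lambda>)"
proof -
  have [measurable]: "fst \<in> measurable \<Lambda> borel" unfolding \<Lambda>_def by measurable
  have [measurable]: "Measurable.pred (\<Lambda> \<Otimes>\<^sub>M \<Lambda>) (\<lambda>p. Hit (fst p) (snd p))"
    using Hit_sets by (simp add: pred_def)
  show ?thesis unfolding pair_kernel_def[abs_def] by measurable
qed

text \<open>Let Dg be the set of pairs with equal germs. For atoms of integer mass, the squared
  point measure gives Dg at least the total count, with equality iff all masses are 1 and no two
  atoms share a germ. By the second moment formula both quantities have the same finite mean,
  because Dg is null for the squared intensity and its diagonal part carries the whole mass. Hence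
  equality holds almost surely.\<close>

lemma simple_points:
  assumes l: "l > 0"
  shows "AE \<omega> in P. inj_on fst (counting_measure.atoms (\<xi>W l \<omega>)) \<and>
    (\<forall>z\<in>counting_measure.atoms (\<xi>W l \<omega>). measure (\<xi>W l \<omega>) {z} = 1)"
proof -
  interpret pp: poisson_process P "\<mu>W l" "\<xi>W l" by (rule poisson_process_\<xi>W[OF l])
  obtain E :: "nat \<Rightarrow> ((real ^ 'n) \<times> (real ^ 'n) set) set" where E: "\<forall>n. E n \<in> sets \<Lambda>"
    "\<forall>z\<in>space \<Lambda>. \<forall>z'\<in>space \<Lambda>. (\<forall>n. z \<in> E n \<longleftrightarrow> z' \<in> E n) \<longrightarrow> z = z'"
    using separating_sequence by blast
  define Dg where "Dg = {p \<in> space pp.\<mu>2. fst (fst p) = fst (snd p)}"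
  have "fst \<in> measurable \<Lambda> borel" unfolding \<Lambda>_def by measurable
  then have m: "fst \<in> measurable (\<mu>W l) borel" by (simp add: \<mu>W_def)
  have Dg: "Dg \<in> sets pp.\<mu>2"
    unfolding Dg_def
    by (rule measurable_equality_set[OF measurable_compose[OF measurable_fst m] measurable_compose[OF measurable_snd m]])
  have full: "space (\<mu>W l) \<in> sets (\<mu>W l)" by simp
  have cm: "counting_measure (\<xi>W l \<omega>) E" if \<omega>: "\<omega> \<in> space P" for \<omega>
  proof -
    interpret fm: finite_measure "\<xi>W l \<omega>" by (rule pp.finite_\<xi>[OF \<omega>])
    show ?thesis
      by unfold_locales (use E pp.count_\<xi>[OF \<omega>] pp.sets_\<xi>[OF \<omega>] pp.space_\<xi>[OF \<omega>] in \<open>auto simp: sets_\<mu>W space_\<mu>W\<close>)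
  qed
  have key: "measure (\<xi>W l \<omega>) (space (\<mu>W l)) \<le> measure (pp.\<xi>2 \<omega>) Dg \<and>
      (measure (pp.\<xi>2 \<omega>) Dg = measure (\<xi>W l \<omega>) (space (\<mu>W l)) \<longrightarrow> inj_on fst (counting_measure.atoms (\<xi>W l \<omega>)) \<and>
      (\<forall>z\<in>counting_measure.atoms (\<xi>W l \<omega>). measure (\<xi>W l \<omega>) {z} = 1))" if \<omega>: "\<omega> \<in> space P" for \<omega>
  proof -
    interpret cm: counting_measure "\<xi>W l \<omega>" E by (rule cm[OF \<omega>])
    let ?A = "cm.atoms" and ?m = "\<lambda>z. measure (\<xi>W l \<omega>) {z}"
    have m1: "?m z \<ge> 1" if "z \<in> ?A" for z
    proof -
      have "emeasure (\<xi>W l \<omega>) {z} \<ge> 1"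
        using that cm.singleton_sets[of z] cm.ge_1[of "{z}"] by (auto simp: cm.atoms_def)
      then show ?thesis by (simp add: cm.emeasure_eq_measure)
    qed
    have tot: "measure (\<xi>W l \<omega>) (space (\<mu>W l)) = (\<Sum>z\<in>?A. ?m z)"
    proof -
      have "measure (\<xi>W l \<omega>) (space (\<mu>W l)) = measure (\<xi>W l \<omega>) ?A"
      proof (rule cm.finite_measure_eq_AE)
        show "AE z in \<xi>W l \<omega>. z \<in> space (\<mu>W l) \<longleftrightarrow> z \<in> ?A"
          using cm.AE_atoms by eventually_elim (auto simp: cm.atoms_def pp.space_\<xi>[OF \<omega>])
        show "space (\<mu>W l) \<in> sets (\<xi>W l \<omega>)" using full pp.sets_\<xi>[OF \<omega>] by simp
      qed (rule cm.sets_atoms)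
      also have "\<dots> = (\<Sum>z\<in>?A. ?m z)"
        by (rule cm.finite_measure_eq_sum_singleton[OF cm.finite_atoms]) (auto simp: cm.atoms_def intro!: cm.singleton_sets)
      finally show ?thesis .
    qed
    have "(\<integral>p. indicator Dg p \<partial>pp.\<xi>2 \<omega>) = (\<Sum>p\<in>?A \<times> ?A. indicator Dg p * (?m (fst p) * ?m (snd p)))"
      by (rule cm.integral_eq_sum_atoms, rule borel_measurable_indicator) (use Dg pp.sets_\<xi>2[OF \<omega>] in simp)
    also have "(\<integral>p. indicator Dg p \<partial>pp.\<xi>2 \<omega>) = measure (pp.\<xi>2 \<omega>) Dg"
      using Dg pp.sets_\<xi>2[OF \<omega>] by simp
    finally have D1: "measure (pp.\<xi>2 \<omega>) Dg = (\<Sum>p\<in>?A \<times> ?A. indicator Dg p * (?m (fst p) * ?m (snd p)))" .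
    define \<Delta> where "\<Delta> = (\<lambda>z. (z, z)) ` ?A"
    have \<Delta>: "\<Delta> \<subseteq> ?A \<times> ?A" by (auto simp: \<Delta>_def)
    have inD: "(a, b) \<in> Dg \<longleftrightarrow> fst a = fst b" if "a \<in> ?A" "b \<in> ?A" for a b
      using that pp.space_\<xi>[OF \<omega>] by (auto simp: Dg_def cm.atoms_def space_pair_measure)
    let ?rest = "\<Sum>p\<in>?A \<times> ?A - \<Delta>. indicator Dg p * (?m (fst p) * ?m (snd p))"
    have "(\<Sum>p\<in>\<Delta>. indicator Dg p * (?m (fst p) * ?m (snd p))) = (\<Sum>z\<in>?A. (?m z)\<^sup>2)"
      unfolding \<Delta>_def by (subst sum.reindex) (auto simp: inj_on_def inD power2_eq_square intro!: sum.cong)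
    then have D2: "measure (pp.\<xi>2 \<omega>) Dg = ?rest + (\<Sum>z\<in>?A. (?m z)\<^sup>2)"
      unfolding D1 using sum.subset_diff[OF \<Delta>, of "\<lambda>p. indicator Dg p * (?m (fst p) * ?m (snd p))"] cm.finite_atoms by simp
    have rest: "?rest \<ge> 0" by (intro sum_nonneg) auto
    \<comment> \<open>The excess splits into the pairs of different atoms with a common germ and the
      terms m^2 - m for masses m, all nonnegative.\<close>
    have D3: "measure (pp.\<xi>2 \<omega>) Dg - measure (\<xi>W l \<omega>) (space (\<mu>W l)) = ?rest + (\<Sum>z\<in>?A. (?m z)\<^sup>2 - ?m z)"
      unfolding D2 tot by (simp add: sum_subtractf)
    have sq: "(?m z)\<^sup>2 - ?m z \<ge> 0" if "z \<in> ?A" for z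
      using mult_left_mono[OF m1[OF that], of "?m z"] by (simp add: power2_eq_square)
    have sqs: "(\<Sum>z\<in>?A. (?m z)\<^sup>2 - ?m z) \<ge> 0" by (intro sum_nonneg sq)
    show ?thesis
    proof (intro conjI impI)
      show "measure (\<xi>W l \<omega>) (space (\<mu>W l)) \<le> measure (pp.\<xi>2 \<omega>) Dg" using D3 rest sqs by linarith
      assume "measure (pp.\<xi>2 \<omega>) Dg = measure (\<xi>W l \<omega>) (space (\<mu>W l))"
      then have r0: "?rest = 0" and s0: "(\<Sum>z\<in>?A. (?m z)\<^sup>2 - ?m z) = 0" using D3 rest sqs by linarith+
      show "\<forall>z\<in>?A. ?m z = 1"
      proof
        fix z assume z: "z \<in> ?A"
        then have "(?m z)\<^sup>2 - ?m z = 0"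
          using s0 sum_nonneg_eq_0_iff[where f = "\<lambda>z. (?m z)\<^sup>2 - ?m z", OF cm.finite_atoms sq] by simp
        then have "?m z * (?m z - 1) = 0" by (simp add: power2_eq_square algebra_simps)
        then show "?m z = 1" using m1[OF z] by auto
      qed
      show "inj_on fst ?A"
      proof (rule inj_onI, rule ccontr)
        fix a b assume ab: "a \<in> ?A" "b \<in> ?A" "fst a = fst b" "a \<noteq> b"
        have fin: "finite (?A \<times> ?A - \<Delta>)" using cm.finite_atoms by simp
        have nn: "0 \<le> indicator Dg p * (?m (fst p) * ?m (snd p))" for p by simp
        have "indicator Dg (a, b) * (?m (fst (a, b)) * ?m (snd (a, b))) = 0"
          using r0 sum_nonneg_eq_0_iff[where f = "\<lambda>p. indicator Dg p * (?m (fst p) * ?m (snd p))", OF fin nn] ab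
          by (auto simp: \<Delta>_def)
        then show False using ab inD[OF ab(1,2)] m1[OF ab(1)] m1[OF ab(2)] by auto
      qed
    qed
  qed
  have i1: "(\<integral>\<^sup>+ \<omega>. emeasure (pp.\<xi>2 \<omega>) Dg \<partial>P) = emeasure (\<mu>W l) (space (\<mu>W l))"
  proof -
    have "emeasure pp.\<mu>2 Dg = 0"
      unfolding Dg_def by (rule emeasure_eq_0_AE) (use AE_distinct_positions[OF l] in auto)
    moreover have "(\<integral>\<^sup>+ z. indicator Dg (z, z) \<partial>\<mu>W l) = (\<integral>\<^sup>+ z. 1 \<partial>\<mu>W l)"
      by (intro nn_integral_cong) (auto simp: Dg_def space_pair_measure)
    ultimately show ?thesis using pp.second_moment_sets[OF Dg] by simp
  qed
  have i2: "(\<integral>\<^sup>+ \<omega>. emeasure (\<xi>W l \<omega>) (space (\<mu>W l)) \<partial>P) = emeasure (\<mu>W l) (space (\<mu>W l))"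
    by (rule pp.nn_integral_num[OF full])
  note [measurable] = pp.second_moment_sets[OF Dg, THEN conjunct1] pp.meas_\<xi>[OF full]
  have le: "emeasure (\<xi>W l \<omega>) (space (\<mu>W l)) \<le> emeasure (pp.\<xi>2 \<omega>) Dg" if \<omega>: "\<omega> \<in> space P" for \<omega>
    using key[OF \<omega>] finite_measure.emeasure_eq_measure[OF pp.finite_\<xi>[OF \<omega>]]
      finite_measure.emeasure_eq_measure[OF pp.finite_\<xi>2[OF \<omega>]] by simp
  have "(\<integral>\<^sup>+ \<omega>. emeasure (pp.\<xi>2 \<omega>) Dg - emeasure (\<xi>W l \<omega>) (space (\<mu>W l)) \<partial>P) = 0"
    by (subst nn_integral_diff) (use le i1 i2 pp.\<mu>.emeasure_finite in \<open>auto intro!: AE_I2\<close>)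
  then have "AE \<omega> in P. emeasure (pp.\<xi>2 \<omega>) Dg - emeasure (\<xi>W l \<omega>) (space (\<mu>W l)) = 0"
    by (subst (asm) nn_integral_0_iff_AE) auto
  then show ?thesis using AE_space
  proof eventually_elim
    case (elim \<omega>)
    have "measure (pp.\<xi>2 \<omega>) Dg = measure (\<xi>W l \<omega>) (space (\<mu>W l))"
      using elim(1) key[OF elim(2)] finite_measure.emeasure_eq_measure[OF pp.finite_\<xi>[OF elim(2)]]
        finite_measure.emeasure_eq_measure[OF pp.finite_\<xi>2[OF elim(2)]]
      by (simp add: ennreal_minus)
    then show ?case using key[OF elim(2)] by blast
  qed
qed

text \<open>On the almost sure event of \<open>simple_points\<close>, \<open>fst\<close> is a
  bijection from atoms to germs. So the definite description in \<open>grain\<close> picks the mark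
  of the atom, and the sum over germs is a sum over atoms of mass 1.\<close>

theorem grain_sum_eq:
  assumes l: "l > 0" and \<phi> [measurable]: "\<phi> \<in> borel_measurable borel" and even: "\<And>x. \<phi> (- x) = \<phi> x"
  shows "AE \<omega> in P. grain_sum \<phi> (\<eta> \<omega>) l = (\<integral>p. pair_kernel \<phi> p \<partial>(\<xi>W l \<omega> \<Otimes>\<^sub>M \<xi>W l \<omega>))"
  using simple_points[OF l] AE_finite_\<eta>[OF l] AE_space
proof eventually_elim
  case (elim \<omega>)
  interpret pp: poisson_process P "\<mu>W l" "\<xi>W l" by (rule poisson_process_\<xi>W[OF l])
  obtain E :: "nat \<Rightarrow> ((real ^ 'n) \<times> (real ^ 'n) set) set" where E: "\<forall>n. E n \<in> sets \<Lambda>"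
    "\<forall>z\<in>space \<Lambda>. \<forall>z'\<in>space \<Lambda>. (\<forall>n. z \<in> E n \<longleftrightarrow> z' \<in> E n) \<longrightarrow> z = z'"
    using separating_sequence by blast
  interpret fm: finite_measure "\<xi>W l \<omega>" by (rule pp.finite_\<xi>[OF elim(3)])
  interpret cm: counting_measure "\<xi>W l \<omega>" E
    by unfold_locales (use E pp.count_\<xi>[OF elim(3)] pp.sets_\<xi>[OF elim(3)] pp.space_\<xi>[OF elim(3)] in \<open>auto simp: sets_\<mu>W space_\<mu>W\<close>)
  let ?A = "cm.atoms"
  have inj: "inj_on fst ?A" and one: "\<And>z. z \<in> ?A \<Longrightarrow> measure (\<xi>W l \<omega>) {z} = 1" using elim(1) by auto
  have sp: "space (\<xi>W l \<omega>) = space \<Lambda>" using pp.space_\<xi>[OF elim(3)] by (simp add: space_\<mu>W)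
  have atom: "(x, C) \<in> ?A \<longleftrightarrow> x \<in> window l \<and> compact C \<and> charges (\<eta> \<omega>) (x, C)" for x C
  proof (cases "compact C")
    case True
    then have z: "(x, C) \<in> space \<Lambda>" by (simp add: space_\<Lambda>)
    then have s: "{(x, C)} \<in> sets \<Lambda>" using cm.singleton_sets[of "(x, C)"] sp sets_\<xi>W[OF elim(3)] by auto
    have "{(x, C)} \<inter> cyl l = (if x \<in> window l then {(x, C)} else {})" using True by (auto simp: space_\<nu>)
    then show ?thesis using True z elim(2) emeasure_\<xi>W[OF elim(3) s, of l]
      by (auto simp: cm.atoms_def sp charges_def)
  next
    case False
    then show ?thesis by (auto simp: cm.atoms_def sp space_\<Lambda>)
  qed
  have germs: "germs (\<eta> \<omega>) l = fst ` ?A"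
    unfolding germs_def using atom by (force simp: image_iff)
  have grain: "grain (\<eta> \<omega>) (fst z) = snd z" if z: "z \<in> ?A" for z
    unfolding grain_def
  proof (rule the_equality)
    show "compact (snd z) \<and> charges (\<eta> \<omega>) (fst z, snd z)" using z atom[of "fst z" "snd z"] by simp
    fix C assume "compact C \<and> charges (\<eta> \<omega>) (fst z, C)"
    then have "(fst z, C) \<in> ?A" using z atom[of "fst z" "snd z"] atom[of "fst z" C] by simp
    then have "(fst z, C) = z" using inj_onD[OF inj, of "(fst z, C)" z] z by simp
    then show "C = snd z" by (metis snd_conv)
  qed
  let ?S = "{p \<in> ?A \<times> ?A. fst (fst p) \<noteq> fst (snd p)}"
  let ?f = "\<lambda>p :: ((real ^ 'n) \<times> (real ^ 'n) set) \<times> ((real ^ 'n) \<times> (real ^ 'n) set). (fst (fst p), fst (snd p))"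
  have im: "{(x, y). x \<in> germs (\<eta> \<omega>) l \<and> y \<in> germs (\<eta> \<omega>) l \<and> x \<noteq> y} = ?f ` ?S"
    unfolding germs by (force simp: image_iff)
  have injf: "inj_on ?f ?S"
    using inj by (auto simp: inj_on_def)
  have "grain_sum \<phi> (\<eta> \<omega>) l = (\<Sum>p\<in>?S. \<phi> (fst (fst p) - fst (snd p)) *
      of_bool (((+) (fst (fst p)) ` grain (\<eta> \<omega>) (fst (fst p))) \<inter> ((+) (fst (snd p)) ` grain (\<eta> \<omega>) (fst (snd p))) \<noteq> {}))"
    unfolding grain_sum_def im by (subst sum.reindex[OF injf]) simp
  also have "\<dots> = (\<Sum>p\<in>?S. pair_kernel \<phi> p)"
  proof (rule sum.cong)
    fix p assume p: "p \<in> ?S"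
    have "\<phi> (fst (fst p) - fst (snd p)) = \<phi> (fst (snd p) - fst (fst p))"
      using even[of "fst (fst p) - fst (snd p)"] by simp
    then show "\<phi> (fst (fst p) - fst (snd p)) *
      of_bool (((+) (fst (fst p)) ` grain (\<eta> \<omega>) (fst (fst p))) \<inter> ((+) (fst (snd p)) ` grain (\<eta> \<omega>) (fst (snd p))) \<noteq> {})
      = pair_kernel \<phi> p"
      using p unfolding pair_kernel_def Hit_def by (simp add: grain mem_Times_iff)
  qed simp
  also have "\<dots> = (\<Sum>p\<in>?A \<times> ?A. pair_kernel \<phi> p)"
    by (rule sum.mono_neutral_left) (use cm.finite_atoms in \<open>auto simp: pair_kernel_def\<close>)
  also have "\<dots> = (\<Sum>p\<in>?A \<times> ?A. pair_kernel \<phi> p * (measure (\<xi>W l \<omega>) {fst p} * measure (\<xi>W l \<omega>) {snd p}))"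
    by (intro sum.cong refl) (auto simp: one)
  also have "\<dots> = (\<integral>p. pair_kernel \<phi> p \<partial>(\<xi>W l \<omega> \<Otimes>\<^sub>M \<xi>W l \<omega>))"
  proof (rule cm.integral_eq_sum_atoms[symmetric])
    have "sets (\<xi>W l \<omega> \<Otimes>\<^sub>M \<xi>W l \<omega>) = sets (\<Lambda> \<Otimes>\<^sub>M \<Lambda>)"
      by (intro sets_pair_measure_cong sets_\<xi>W elim(3))
    then show "pair_kernel \<phi> \<in> borel_measurable (\<xi>W l \<omega> \<Otimes>\<^sub>M \<xi>W l \<omega>)"
      using pair_kernel_measurable[OF \<phi>] measurable_cong_sets by blast
  qed
  finally show ?case .
qed

end

section \<open>Variance asymptotics and the rate of convergence\<close>

context grain_law
begin

sublocale \<Lambda>: sigma_finite_measure \<Lambda>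
proof -
  interpret pair_sigma_finite lborel \<nu> ..
  show "sigma_finite_measure \<Lambda>" unfolding \<Lambda>_def by (rule sigma_finite_measure_axioms)
qed

sublocale \<Lambda>2: pair_sigma_finite \<Lambda> \<Lambda> ..

lemma fst_measurable [measurable]: "fst \<in> measurable \<Lambda> borel"
  and snd_measurable [measurable]: "snd \<in> measurable \<Lambda> \<nu>"
  unfolding \<Lambda>_def by measurable

lemma measurable_Pair_\<Lambda> [measurable]:
  "f \<in> measurable M borel \<Longrightarrow> g \<in> measurable M \<nu> \<Longrightarrow> (\<lambda>x. (f x, g x)) \<in> measurable M \<Lambda>"
  unfolding \<Lambda>_def by measurable

lemma nn_integral_\<Lambda>:
  assumes "f \<in> borel_measurable \<Lambda>"
  shows "(\<integral>\<^sup>+ z. f z \<partial>\<Lambda>) = (\<integral>\<^sup>+ x. \<integral>\<^sup>+ C. f (x, C) \<partial>\<nu> \<partial>lborel)"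
    and "(\<integral>\<^sup>+ z. f z \<partial>\<Lambda>) = (\<integral>\<^sup>+ C. \<integral>\<^sup>+ x. f (x, C) \<partial>lborel \<partial>\<nu>)"
proof -
  interpret L: pair_sigma_finite lborel \<nu> ..
  have m: "f \<in> borel_measurable (lborel \<Otimes>\<^sub>M \<nu>)" using assms by (simp add: \<Lambda>_def)
  show "(\<integral>\<^sup>+ z. f z \<partial>\<Lambda>) = (\<integral>\<^sup>+ x. \<integral>\<^sup>+ C. f (x, C) \<partial>\<nu> \<partial>lborel)"
    unfolding \<Lambda>_def using nn_integral_fst[OF m] by simp
  then show "(\<integral>\<^sup>+ z. f z \<partial>\<Lambda>) = (\<integral>\<^sup>+ C. \<integral>\<^sup>+ x. f (x, C) \<partial>lborel \<partial>\<nu>)"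
    using L.Fubini[OF m] by simp
qed

text \<open>Only the germ moves; the grain is a shape attached around the origin. The cases in use
  are translation (c = 1), reflection (c = -1) and rescaling of the window (t = 0).\<close>

definition affine :: "real ^ 'n \<Rightarrow> real \<Rightarrow> (real ^ 'n) \<times> (real ^ 'n) set \<Rightarrow> (real ^ 'n) \<times> (real ^ 'n) set" where
  "affine t c z = (t + c *\<^sub>R fst z, snd z)"

lemma affine_measurable [measurable]: "affine t c \<in> measurable \<Lambda> \<Lambda>"
  unfolding affine_def[abs_def] by measurable

lemma nn_integral_lborel_affine:
  assumes [measurable]: "f \<in> borel_measurable borel" and "c \<noteq> 0"
  shows "(\<integral>\<^sup>+ x. f x \<partial>(lborel :: (real ^ 'n) measure)) = ennreal (\<bar>c\<bar> ^ CARD('n)) * (\<integral>\<^sup>+ x. f (t + c *\<^sub>R x) \<partial>lborel)"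
  by (subst lborel_affine[OF \<open>c \<noteq> 0\<close>, of t])
     (simp add: nn_integral_density nn_integral_distr nn_integral_cmult)

lemma nn_integral_\<Lambda>_affine:
  assumes f [measurable]: "f \<in> borel_measurable \<Lambda>" and c: "c \<noteq> 0"
  shows "(\<integral>\<^sup>+ z. f z \<partial>\<Lambda>) = ennreal (\<bar>c\<bar> ^ CARD('n)) * (\<integral>\<^sup>+ z. f (affine t c z) \<partial>\<Lambda>)"
proof -
  have m [measurable]: "(\<lambda>x. f (x, C)) \<in> borel_measurable borel" if "C \<in> space \<nu>" for C
    using that by measurable
  have [measurable]: "f \<in> borel_measurable (lborel \<Otimes>\<^sub>M \<nu>)" using f by (simp add: \<Lambda>_def)
  have "(\<integral>\<^sup>+ z. f z \<partial>\<Lambda>) = (\<integral>\<^sup>+ C. \<integral>\<^sup>+ x. f (x, C) \<partial>lborel \<partial>\<nu>)" by (rule nn_integral_\<Lambda>(2)[OF f])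
  also have "\<dots> = (\<integral>\<^sup>+ C. ennreal (\<bar>c\<bar> ^ CARD('n)) * (\<integral>\<^sup>+ x. f (t + c *\<^sub>R x, C) \<partial>lborel) \<partial>\<nu>)"
    by (intro nn_integral_cong nn_integral_lborel_affine m c)
  also have "\<dots> = ennreal (\<bar>c\<bar> ^ CARD('n)) * (\<integral>\<^sup>+ C. (\<integral>\<^sup>+ x. f (t + c *\<^sub>R x, C) \<partial>lborel) \<partial>\<nu>)"
    by (intro nn_integral_cmult) measurable
  also have "(\<integral>\<^sup>+ C. (\<integral>\<^sup>+ x. f (t + c *\<^sub>R x, C) \<partial>lborel) \<partial>\<nu>) = (\<integral>\<^sup>+ z. f (affine t c z) \<partial>\<Lambda>)"
    by (subst nn_integral_\<Lambda>(2)) (auto simp: affine_def)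
  finally show ?thesis .
qed

text \<open>Stated for the measure itself, so that Bochner integrals transform without an
  integrability condition.\<close>

lemma \<Lambda>_affine:
  assumes c: "c \<noteq> 0"
  shows "\<Lambda> = density (distr \<Lambda> \<Lambda> (affine t c)) (\<lambda>_. ennreal (\<bar>c\<bar> ^ CARD('n)))"
proof (rule measure_eqI)
  fix A assume A: "A \<in> sets \<Lambda>"
  have "emeasure \<Lambda> A = (\<integral>\<^sup>+ z. indicator A z \<partial>\<Lambda>)" using A by simp
  also have "\<dots> = ennreal (\<bar>c\<bar> ^ CARD('n)) * (\<integral>\<^sup>+ z. indicator A (affine t c z) \<partial>\<Lambda>)"
    using A by (intro nn_integral_\<Lambda>_affine c borel_measurable_indicator)
  also have "\<dots> = emeasure (density (distr \<Lambda> \<Lambda> (affine t c)) (\<lambda>_. ennreal (\<bar>c\<bar> ^ CARD('n)))) A"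
  proof -
    have "(\<integral>\<^sup>+ z. indicator A (affine t c z) \<partial>\<Lambda>) = (\<integral>\<^sup>+ z. indicator A z \<partial>distr \<Lambda> \<Lambda> (affine t c))"
      using A by (intro nn_integral_distr[symmetric] affine_measurable borel_measurable_indicator) simp
    then show ?thesis using A by (subst emeasure_density) (auto simp: nn_integral_cmult)
  qed
  finally show "emeasure \<Lambda> A = emeasure (density (distr \<Lambda> \<Lambda> (affine t c)) (\<lambda>_. ennreal (\<bar>c\<bar> ^ CARD('n)))) A" .
qed simp

lemma integral_\<Lambda>_affine:
  fixes f :: "_ \<Rightarrow> real"
  assumes f [measurable]: "f \<in> borel_measurable \<Lambda>" and c: "c \<noteq> 0"
  shows "(\<integral>z. f z \<partial>\<Lambda>) = \<bar>c\<bar> ^ CARD('n) * (\<integral>z. f (affine t c z) \<partial>\<Lambda>)"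
proof -
  have "(\<integral>z. f z \<partial>\<Lambda>) = (\<integral>z. f z \<partial>density (distr \<Lambda> \<Lambda> (affine t c)) (\<lambda>_. ennreal (\<bar>c\<bar> ^ CARD('n))))"
    using \<Lambda>_affine[OF c, of t] by simp
  also have "\<dots> = (\<integral>z. \<bar>c\<bar> ^ CARD('n) *\<^sub>R f z \<partial>distr \<Lambda> \<Lambda> (affine t c))"
    by (subst integral_density) auto
  also have "\<dots> = (\<integral>z. \<bar>c\<bar> ^ CARD('n) *\<^sub>R f (affine t c z) \<partial>\<Lambda>)"
    by (subst integral_distr) auto
  finally show ?thesis by simp
qed

lemma Hit_pred [measurable]: "Measurable.pred (\<Lambda> \<Otimes>\<^sub>M \<Lambda>) (\<lambda>p. Hit (fst p) (snd p))"
  using Hit_sets by (simp add: pred_def)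

lemma Hit_measurable_comp [measurable (raw)]:
  "f \<in> measurable M \<Lambda> \<Longrightarrow> g \<in> measurable M \<Lambda> \<Longrightarrow> Measurable.pred M (\<lambda>x. Hit (f x) (g x))"
  using measurable_compose[of "\<lambda>x. (f x, g x)" M "\<Lambda> \<Otimes>\<^sub>M \<Lambda>", OF _ Hit_pred] by simp

lemma Hit_commute: "Hit z z' \<longleftrightarrow> Hit z' z"
  by (auto simp: Hit_def)

lemma Hit_translate: "Hit (x, C) (x + u, C') \<longleftrightarrow> Hit (0, C) (u, C')"
  by (force simp: Hit_def image_iff add.assoc)

lemma hit_prob_eq:
  "ennreal (hit_prob \<nu> u) = (\<integral>\<^sup>+ C. \<integral>\<^sup>+ C'. of_bool (Hit (0, C) (u, C')) \<partial>\<nu> \<partial>\<nu>)"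
proof -
  interpret pp: pair_prob_space \<nu> \<nu> ..
  define S where "S = {p \<in> space (\<nu> \<Otimes>\<^sub>M \<nu>). Hit (0, fst p) (u, snd p)}"
  have "Measurable.pred (\<nu> \<Otimes>\<^sub>M \<nu>) (\<lambda>p. Hit (0, fst p) (u, snd p))"
    by measurable
  then have S: "S \<in> sets (\<nu> \<Otimes>\<^sub>M \<nu>)" by (simp add: S_def pred_def)
  have "{(C1, C2) \<in> space (\<nu> \<Otimes>\<^sub>M \<nu>). C1 \<inter> ((+) u ` C2) \<noteq> {}} = S"
    by (auto simp: S_def Hit_def)
  then have "ennreal (hit_prob \<nu> u) = emeasure (\<nu> \<Otimes>\<^sub>M \<nu>) S"
    by (simp add: hit_prob_def pp.emeasure_eq_measure)
  also have "\<dots> = (\<integral>\<^sup>+ p. indicator S p \<partial>(\<nu> \<Otimes>\<^sub>M \<nu>))" using S by simp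
  also have "\<dots> = (\<integral>\<^sup>+ C. \<integral>\<^sup>+ C'. indicator S (C, C') \<partial>\<nu> \<partial>\<nu>)"
    by (rule nn_integral_fst[symmetric]) (use S in measurable)
  also have "\<dots> = (\<integral>\<^sup>+ C. \<integral>\<^sup>+ C'. of_bool (Hit (0, C) (u, C')) \<partial>\<nu> \<partial>\<nu>)"
    by (intro nn_integral_cong) (auto simp: S_def space_pair_measure indicator_def)
  finally show ?thesis .
qed

lemma hit_prob_nonneg: "hit_prob \<nu> u \<ge> 0"
  by (simp add: hit_prob_def)

lemma hit_prob_measurable [measurable]: "hit_prob \<nu> \<in> borel_measurable borel"
proof -
  have "(\<lambda>u. \<integral>\<^sup>+ C. \<integral>\<^sup>+ C'. of_bool (Hit (0, C) (u, C')) \<partial>\<nu> \<partial>\<nu>) \<in> borel_measurable (borel :: (real ^ 'n) measure)"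
    by measurable
  then have "(\<lambda>u. ennreal (hit_prob \<nu> u)) \<in> borel_measurable borel" by (simp add: hit_prob_eq)
  then have "(\<lambda>u. enn2real (ennreal (hit_prob \<nu> u))) \<in> borel_measurable borel" by measurable
  then show ?thesis by (simp add: hit_prob_nonneg)
qed

text \<open>By Fubini's theorem the two independent grains are integrated first, at a fixed
  difference u of the germs, which produces the hitting probability at u.\<close>

lemma nn_integral_Hit:
  assumes [measurable]: "g \<in> borel_measurable borel"
  shows "(\<integral>\<^sup>+ C. \<integral>\<^sup>+ w. g (fst w) * of_bool (Hit (0, C) w) \<partial>\<Lambda> \<partial>\<nu>) = (\<integral>\<^sup>+ u. g u * ennreal (hit_prob \<nu> u) \<partial>lborel)"
proof -
  interpret L: pair_sigma_finite lborel \<nu> ..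
  have "(\<integral>\<^sup>+ C. \<integral>\<^sup>+ w. g (fst w) * of_bool (Hit (0, C) w) \<partial>\<Lambda> \<partial>\<nu>) =
      (\<integral>\<^sup>+ C. \<integral>\<^sup>+ u. \<integral>\<^sup>+ C'. g u * of_bool (Hit (0, C) (u, C')) \<partial>\<nu> \<partial>lborel \<partial>\<nu>)"
  proof (rule nn_integral_cong)
    fix C assume C [measurable]: "C \<in> space \<nu>"
    have "(\<lambda>w. (0, C)) \<in> measurable \<Lambda> \<Lambda>" using C by (intro measurable_const) (simp add: space_\<Lambda> space_\<nu>)
    from Hit_measurable_comp[OF this measurable_ident]
    have [measurable]: "Measurable.pred \<Lambda> (\<lambda>w. Hit (0, C) w)" by simp
    have "(\<lambda>w. g (fst w) * of_bool (Hit (0, C) w)) \<in> borel_measurable \<Lambda>" by measurable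
    from nn_integral_\<Lambda>(1)[OF this]
    show "(\<integral>\<^sup>+ w. g (fst w) * of_bool (Hit (0, C) w) \<partial>\<Lambda>) =
        (\<integral>\<^sup>+ u. \<integral>\<^sup>+ C'. g u * of_bool (Hit (0, C) (u, C')) \<partial>\<nu> \<partial>lborel)"
      unfolding fst_conv .
  qed
  also have "\<dots> = (\<integral>\<^sup>+ u. \<integral>\<^sup>+ C. \<integral>\<^sup>+ C'. g u * of_bool (Hit (0, C) (u, C')) \<partial>\<nu> \<partial>\<nu> \<partial>lborel)"
    by (rule L.Fubini') measurable
  also have "\<dots> = (\<integral>\<^sup>+ u. g u * ennreal (hit_prob \<nu> u) \<partial>lborel)"
  proof (rule nn_integral_cong)
    fix u :: "real ^ 'n"
    have "(\<integral>\<^sup>+ C. \<integral>\<^sup>+ C'. g u * of_bool (Hit (0, C) (u, C')) \<partial>\<nu> \<partial>\<nu>) =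
        (\<integral>\<^sup>+ C. g u * (\<integral>\<^sup>+ C'. of_bool (Hit (0, C) (u, C')) \<partial>\<nu>) \<partial>\<nu>)"
      by (intro nn_integral_cong nn_integral_cmult) measurable
    also have "\<dots> = g u * ennreal (hit_prob \<nu> u)"
      unfolding hit_prob_eq by (intro nn_integral_cmult) measurable
    finally show "(\<integral>\<^sup>+ C. \<integral>\<^sup>+ C'. g u * of_bool (Hit (0, C) (u, C')) \<partial>\<nu> \<partial>\<nu>) = g u * ennreal (hit_prob \<nu> u)" .
  qed
  finally show ?thesis .
qed

end

section \<open>The windowed grain sum as a pair statistic\<close>

locale grain_statistic = boolean_model \<nu> P \<eta>
  for \<nu> :: "(real ^ 'n) set measure" and P :: "'w measure" and \<eta> +
  fixes \<phi> \<kappa> :: "real ^ 'n \<Rightarrow> real" and k :: real and G :: "real \<Rightarrow> 'w \<Rightarrow> real"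
  assumes \<phi>_meas [measurable]: "\<phi> \<in> borel_measurable borel" and \<phi>_even: "\<And>x. \<phi> (- x) = \<phi> x"
    and \<kappa>_meas [measurable]: "\<kappa> \<in> borel_measurable borel" and \<kappa>_pos: "\<And>x. \<kappa> x > 0" and \<kappa>_le: "\<And>x. \<kappa> x \<le> k"
    and \<kappa>_density: "(\<integral>\<^sup>+ x. ennreal (\<kappa> x) \<partial>lborel) = 1"
    and moment2: "(\<integral>\<^sup>+ x. ennreal ((\<phi> x)\<^sup>2 / \<kappa> x) * ennreal (hit_prob \<nu> x) \<partial>lborel) < \<infinity>"
    and moment4: "(\<integral>\<^sup>+ x. ennreal (\<phi> x ^ 4 / \<kappa> x ^ 3) * ennreal (hit_prob \<nu> x) \<partial>lborel) < \<infinity>"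
    and G_meas: "\<And>l. l > 0 \<Longrightarrow> G l \<in> borel_measurable P"
    and G_eq: "\<And>l. l > 0 \<Longrightarrow> AE \<omega> in P. G l \<omega> = grain_sum \<phi> (\<eta> \<omega>) l"
begin

abbreviation H where "H \<equiv> pair_kernel \<phi>"

definition \<kappa>' :: "((real ^ 'n) \<times> (real ^ 'n) set) \<times> ((real ^ 'n) \<times> (real ^ 'n) set) \<Rightarrow> real" where
  "\<kappa>' p = \<kappa> (fst (snd p) - fst (fst p))"

text \<open>The kernel as seen from a first point placed at the origin with grain C.\<close>

definition \<psi> :: "(real ^ 'n) set \<Rightarrow> (real ^ 'n) \<times> (real ^ 'n) set \<Rightarrow> real" where
  "\<psi> C w = H ((0, C), w)"

definition A4 :: real where
  "A4 = enn2real (\<integral>\<^sup>+ x. ennreal (\<phi> x ^ 4 / \<kappa> x ^ 3) * ennreal (hit_prob \<nu> x) \<partial>lborel)"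

lemma H_measurable [measurable]: "H \<in> borel_measurable (\<Lambda> \<Otimes>\<^sub>M \<Lambda>)"
  by (rule pair_kernel_measurable) measurable

lemma \<kappa>'_measurable [measurable]: "\<kappa>' \<in> borel_measurable (\<Lambda> \<Otimes>\<^sub>M \<Lambda>)"
  unfolding \<kappa>'_def[abs_def] by measurable

lemma H_sym: "H (x, y) = H (y, x)"
  using \<phi>_even[of "fst x - fst y"] by (auto simp: pair_kernel_def Hit_commute)

lemma H_affine: "H (z, affine (fst z) 1 w) = \<psi> (snd z) w"
  using Hit_translate[of "fst z" "snd z" "fst w" "snd w"]
  by (simp add: pair_kernel_def \<psi>_def affine_def)

lemma nn_integral_\<mu>W:
  assumes "f \<in> borel_measurable \<Lambda>"
  shows "(\<integral>\<^sup>+ z. f z \<partial>\<mu>W l) = (\<integral>\<^sup>+ z. indicator (window l) (fst z) * f z \<partial>\<Lambda>)"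
proof -
  have "(\<integral>\<^sup>+ z. f z \<partial>\<mu>W l) = (\<integral>\<^sup>+ z. indicator (cyl l) z * f z \<partial>\<Lambda>)"
    unfolding \<mu>W_def using assms cyl_sets by (intro nn_integral_density) auto
  also have "\<dots> = (\<integral>\<^sup>+ z. indicator (window l) (fst z) * f z \<partial>\<Lambda>)"
    by (intro nn_integral_cong) (auto simp: indicator_def space_\<Lambda> space_\<nu>)
  finally show ?thesis .
qed

lemma nn_integral_\<mu>W_le:
  assumes "f \<in> borel_measurable \<Lambda>" shows "(\<integral>\<^sup>+ z. f z \<partial>\<mu>W l) \<le> (\<integral>\<^sup>+ z. f z \<partial>\<Lambda>)"
  unfolding nn_integral_\<mu>W[OF assms] by (intro nn_integral_mono) (auto simp: indicator_def)

lemma nn_integral_window: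
  assumes [measurable]: "h \<in> borel_measurable \<nu>" and l: "l > 0"
  shows "(\<integral>\<^sup>+ z. indicator (window l) (fst z) * h (snd z) \<partial>\<Lambda>) = ennreal (2 ^ CARD('n) * l) * (\<integral>\<^sup>+ C. h C \<partial>\<nu>)"
proof -
  have "(\<integral>\<^sup>+ z. indicator (window l) (fst z) * h (snd z) \<partial>\<Lambda>) =
      (\<integral>\<^sup>+ x. \<integral>\<^sup>+ C. indicator (window l) x * h C \<partial>\<nu> \<partial>(lborel :: (real ^ 'n) measure))"
    by (subst nn_integral_\<Lambda>(1)) auto
  also have "\<dots> = (\<integral>\<^sup>+ x. indicator (window l :: (real ^ 'n) set) x * (\<integral>\<^sup>+ C. h C \<partial>\<nu>) \<partial>lborel)"
    by (intro nn_integral_cong nn_integral_cmult) measurable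
  also have "\<dots> = ennreal (2 ^ CARD('n) * l) * (\<integral>\<^sup>+ C. h C \<partial>\<nu>)"
    by (subst nn_integral_multc) (auto simp: emeasure_window[OF l])
  finally show ?thesis .
qed

lemma nn_integral_Hit_measurable [measurable]:
  assumes [measurable]: "g \<in> borel_measurable borel"
  shows "(\<lambda>C. \<integral>\<^sup>+ w. g (fst w) * of_bool (Hit (0, C) w) \<partial>\<Lambda>) \<in> borel_measurable \<nu>"
proof -
  have [measurable]: "(\<lambda>p. (0, fst p)) \<in> measurable (\<nu> \<Otimes>\<^sub>M \<Lambda>) \<Lambda>" "snd \<in> measurable (\<nu> \<Otimes>\<^sub>M \<Lambda>) \<Lambda>"
    by measurable
  show ?thesis by measurable
qed

text \<open>Enlarge the inner window to the whole space and translate the first germ to the origin.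
  The inner integral then no longer depends on that germ, so the outer one contributes the volume of
  the window, 2^d l in dimension d.\<close>

lemma nn_integral_pair_le:
  assumes g [measurable]: "g \<in> borel_measurable borel" and l: "l > 0"
  shows "(\<integral>\<^sup>+ p. g (fst (snd p) - fst (fst p)) * of_bool (Hit (fst p) (snd p)) \<partial>(\<mu>W l \<Otimes>\<^sub>M \<mu>W l)) \<le>
    ennreal (2 ^ CARD('n) * l) * (\<integral>\<^sup>+ u. g u * ennreal (hit_prob \<nu> u) \<partial>lborel)"
    (is "(\<integral>\<^sup>+ p. ?f p \<partial>_) \<le> _")
proof -
  interpret m: finite_measure "\<mu>W l" by (rule finite_\<mu>W[OF l])
  have f [measurable]: "?f \<in> borel_measurable (\<Lambda> \<Otimes>\<^sub>M \<Lambda>)" by measurable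
  have "sets (\<mu>W l \<Otimes>\<^sub>M \<mu>W l) = sets (\<Lambda> \<Otimes>\<^sub>M \<Lambda>)" by (intro sets_pair_measure_cong sets_\<mu>W)
  then have f': "?f \<in> borel_measurable (\<mu>W l \<Otimes>\<^sub>M \<mu>W l)" using f measurable_cong_sets by blast
  have "(\<integral>\<^sup>+ p. ?f p \<partial>(\<mu>W l \<Otimes>\<^sub>M \<mu>W l)) = (\<integral>\<^sup>+ z. \<integral>\<^sup>+ z'. ?f (z, z') \<partial>\<mu>W l \<partial>\<mu>W l)"
    by (rule m.nn_integral_fst[OF f', symmetric])
  also have "\<dots> \<le> (\<integral>\<^sup>+ z. (\<integral>\<^sup>+ w. g (fst w) * of_bool (Hit (0, snd z) w) \<partial>\<Lambda>) \<partial>\<mu>W l)"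
  proof (rule nn_integral_mono)
    fix z assume "z \<in> space (\<mu>W l)"
    then have z: "z \<in> space \<Lambda>" by (simp add: space_\<mu>W)
    have fz: "(\<lambda>z'. ?f (z, z')) \<in> borel_measurable \<Lambda>" using f z by measurable
    have "(\<integral>\<^sup>+ z'. ?f (z, z') \<partial>\<mu>W l) \<le> (\<integral>\<^sup>+ z'. ?f (z, z') \<partial>\<Lambda>)" by (rule nn_integral_\<mu>W_le[OF fz])
    also have "\<dots> = (\<integral>\<^sup>+ w. ?f (z, affine (fst z) 1 w) \<partial>\<Lambda>)"
      using nn_integral_\<Lambda>_affine[OF fz, of 1 "fst z"] by simp
    also have "\<dots> = (\<integral>\<^sup>+ w. g (fst w) * of_bool (Hit (0, snd z) w) \<partial>\<Lambda>)"
      using Hit_translate[of "fst z" "snd z"] by (simp add: affine_def)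
    finally show "(\<integral>\<^sup>+ z'. ?f (z, z') \<partial>\<mu>W l) \<le> (\<integral>\<^sup>+ w. g (fst w) * of_bool (Hit (0, snd z) w) \<partial>\<Lambda>)" .
  qed
  also have "\<dots> = (\<integral>\<^sup>+ z. indicator (window l) (fst z) * (\<integral>\<^sup>+ w. g (fst w) * of_bool (Hit (0, snd z) w) \<partial>\<Lambda>) \<partial>\<Lambda>)"
    by (rule nn_integral_\<mu>W) measurable
  also have "\<dots> = ennreal (2 ^ CARD('n) * l) * (\<integral>\<^sup>+ C. \<integral>\<^sup>+ w. g (fst w) * of_bool (Hit (0, C) w) \<partial>\<Lambda> \<partial>\<nu>)"
    by (rule nn_integral_window[OF nn_integral_Hit_measurable[OF g] l])
  also have "\<dots> = ennreal (2 ^ CARD('n) * l) * (\<integral>\<^sup>+ u. g u * ennreal (hit_prob \<nu> u) \<partial>lborel)"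
    by (simp add: nn_integral_Hit[OF g])
  finally show ?thesis .
qed

lemma nn_integral_\<kappa>_fst: "(\<integral>\<^sup>+ w. ennreal (\<kappa> (fst w)) \<partial>\<Lambda>) = 1"
  by (subst nn_integral_\<Lambda>(1)) (auto simp: emeasure_space_1 \<kappa>_density)

text \<open>Since \<kappa> is not assumed even, c = 1 serves the rows and c = -1 the
  columns.\<close>

lemma integral_\<kappa>_le:
  assumes c: "\<bar>c\<bar> = 1"
  shows "(\<integral>z. \<kappa> (c *\<^sub>R (fst z - t)) \<partial>\<mu>W l) \<le> 1"
proof -
  have m [measurable]: "(\<lambda>z. \<kappa> (c *\<^sub>R (fst z - t))) \<in> borel_measurable \<Lambda>" by measurable
  have "c *\<^sub>R c *\<^sub>R x = x" for x :: "real ^ 'n" using c by (auto simp: abs_if split: if_splits)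
  then have "(\<integral>\<^sup>+ z. ennreal (\<kappa> (c *\<^sub>R (fst z - t))) \<partial>\<Lambda>) = 1"
    using nn_integral_\<Lambda>_affine[of "\<lambda>z. ennreal (\<kappa> (c *\<^sub>R (fst z - t)))" c t] c nn_integral_\<kappa>_fst
    by (auto simp: affine_def)
  then have "(\<integral>\<^sup>+ z. ennreal (\<kappa> (c *\<^sub>R (fst z - t))) \<partial>\<mu>W l) \<le> 1"
    using nn_integral_\<mu>W_le[of "\<lambda>z. ennreal (\<kappa> (c *\<^sub>R (fst z - t)))" l] by simp
  moreover have "(\<integral>z. \<kappa> (c *\<^sub>R (fst z - t)) \<partial>\<mu>W l) = enn2real (\<integral>\<^sup>+ z. ennreal (\<kappa> (c *\<^sub>R (fst z - t))) \<partial>\<mu>W l)"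
    by (rule integral_eq_nn_integral) (use less_imp_le[OF \<kappa>_pos] in \<open>auto simp: \<mu>W_def\<close>)
  ultimately show ?thesis using enn2real_mono[of _ 1] by fastforce
qed

lemma nn_integral_H4:
  assumes l: "l > 0"
  shows "(\<integral>\<^sup>+ p. ennreal (H p ^ 4 / \<kappa>' p ^ 3) \<partial>(\<mu>W l \<Otimes>\<^sub>M \<mu>W l)) \<le> ennreal (2 ^ CARD('n) * l * A4)"
proof -
  have "ennreal (H p ^ 4 / \<kappa>' p ^ 3) \<le> ennreal ((\<lambda>x. \<phi> x ^ 4 / \<kappa> x ^ 3) (fst (snd p) - fst (fst p))) * of_bool (Hit (fst p) (snd p))" for p
    using \<kappa>_pos by (auto simp: pair_kernel_def \<kappa>'_def less_imp_le)
  then have "(\<integral>\<^sup>+ p. ennreal (H p ^ 4 / \<kappa>' p ^ 3) \<partial>(\<mu>W l \<Otimes>\<^sub>M \<mu>W l)) \<le>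
      (\<integral>\<^sup>+ p. ennreal ((\<lambda>x. \<phi> x ^ 4 / \<kappa> x ^ 3) (fst (snd p) - fst (fst p))) * of_bool (Hit (fst p) (snd p)) \<partial>(\<mu>W l \<Otimes>\<^sub>M \<mu>W l))"
    by (intro nn_integral_mono)
  also have "\<dots> \<le> ennreal (2 ^ CARD('n) * l) * (\<integral>\<^sup>+ u. ennreal (\<phi> u ^ 4 / \<kappa> u ^ 3) * ennreal (hit_prob \<nu> u) \<partial>lborel)"
    by (rule nn_integral_pair_le[OF _ l]) measurable
  also have "\<dots> = ennreal (2 ^ CARD('n) * l) * ennreal A4"
    using moment4 by (simp add: A4_def)
  also have "\<dots> = ennreal (2 ^ CARD('n) * l * A4)"
    using l by (intro ennreal_mult[symmetric]) (auto simp: A4_def)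
  finally show ?thesis .
qed

lemma A4_nonneg: "A4 \<ge> 0" by (simp add: A4_def)

lemma pair_sets: "sets (\<mu>W l \<Otimes>\<^sub>M \<mu>W l) = sets (\<Lambda> \<Otimes>\<^sub>M \<Lambda>)"
  by (intro sets_pair_measure_cong sets_\<mu>W)

lemma integrable_H4:
  assumes l: "l > 0"
  shows "integrable (\<mu>W l \<Otimes>\<^sub>M \<mu>W l) (\<lambda>p. H p ^ 4 / \<kappa>' p ^ 3)"
    and "(\<integral>p. H p ^ 4 / \<kappa>' p ^ 3 \<partial>(\<mu>W l \<Otimes>\<^sub>M \<mu>W l)) \<le> 2 ^ CARD('n) * l * A4"
proof -
  have "(\<lambda>p. H p ^ 4 / \<kappa>' p ^ 3) \<in> borel_measurable (\<Lambda> \<Otimes>\<^sub>M \<Lambda>)" by measurable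
  then have m: "(\<lambda>p. H p ^ 4 / \<kappa>' p ^ 3) \<in> borel_measurable (\<mu>W l \<Otimes>\<^sub>M \<mu>W l)"
    using measurable_cong_sets[OF pair_sets refl] by blast
  have nn: "H p ^ 4 / \<kappa>' p ^ 3 \<ge> 0" for p using \<kappa>_pos by (simp add: \<kappa>'_def less_imp_le)
  show int: "integrable (\<mu>W l \<Otimes>\<^sub>M \<mu>W l) (\<lambda>p. H p ^ 4 / \<kappa>' p ^ 3)"
    using m le_less_trans[OF nn_integral_H4[OF l]] nn by (intro integrableI_nonneg) auto
  show "(\<integral>p. H p ^ 4 / \<kappa>' p ^ 3 \<partial>(\<mu>W l \<Otimes>\<^sub>M \<mu>W l)) \<le> 2 ^ CARD('n) * l * A4"
    using nn_integral_H4[OF l] nn_integral_eq_integral[OF int] nn l A4_nonneg by simp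
qed

lemma k_pos: "k > 0"
  using \<kappa>_pos[of 0] \<kappa>_le[of 0] by simp

lemma pair_statistic_exists:
  assumes l: "l > 0"
  obtains B where "pair_statistic P (\<mu>W l) (\<xi>W l) B H \<kappa>' k (G l)"
proof -
  obtain B :: "nat \<Rightarrow> ((real ^ 'n) \<times> (real ^ 'n) set) set" where B: "\<And>n. B n \<in> sets \<Lambda>"
    "\<And>z z'. z \<in> space \<Lambda> \<Longrightarrow> z' \<in> space \<Lambda> \<Longrightarrow> fst z \<noteq> fst z' \<Longrightarrow> \<exists>n. (z \<in> B n) \<noteq> (z' \<in> B n)"
    by (rule spatial_sequence) (rule that)
  have m: "f \<in> borel_measurable (\<mu>W l \<Otimes>\<^sub>M \<mu>W l)" if "f \<in> borel_measurable (\<Lambda> \<Otimes>\<^sub>M \<Lambda>)" for f :: "_ \<Rightarrow> real"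
    using that measurable_cong_sets[OF pair_sets refl] by blast
  have "pair_statistic P (\<mu>W l) (\<xi>W l) B H \<kappa>' k (G l)"
  proof (intro pair_statistic.intro diffuse_measure.intro)
    show "poisson_process P (\<mu>W l) (\<xi>W l)" by (rule poisson_process_\<xi>W[OF l])
    show "finite_measure (\<mu>W l)" by (rule finite_\<mu>W[OF l])
    show "diffuse_measure_axioms (\<mu>W l) B"
    proof
      show "B n \<in> sets (\<mu>W l)" for n using B(1) by (simp add: sets_\<mu>W)
      show "AE z in \<mu>W l \<Otimes>\<^sub>M \<mu>W l. \<exists>n. (fst z \<in> B n) \<noteq> (snd z \<in> B n)"
        using AE_distinct_positions[OF l] AE_space
      proof eventually_elim
        case (elim z)
        then show ?case using B(2)[of "fst z" "snd z"] by (auto simp: space_pair_measure space_\<mu>W)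
      qed
    qed
    show "pair_statistic_axioms P (\<mu>W l) (\<xi>W l) H \<kappa>' k (G l)"
    proof
      show "H \<in> borel_measurable (\<mu>W l \<Otimes>\<^sub>M \<mu>W l)" "\<kappa>' \<in> borel_measurable (\<mu>W l \<Otimes>\<^sub>M \<mu>W l)"
        by (rule m[OF H_measurable], rule m[OF \<kappa>'_measurable])
      show "H (x, y) = H (y, x)" for x y by (rule H_sym)
      show "H (x, x) = 0" for x by (simp add: pair_kernel_def)
      show "\<kappa>' z > 0" "\<kappa>' z \<le> k" for z by (simp_all add: \<kappa>'_def \<kappa>_pos \<kappa>_le)
      show "(\<integral>y. \<kappa>' (x, y) \<partial>\<mu>W l) \<le> 1" for x using integral_\<kappa>_le[where c = 1 and t = "fst x" and l = l] by (simp add: \<kappa>'_def)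
      show "(\<integral>x. \<kappa>' (x, y) \<partial>\<mu>W l) \<le> 1" for y using integral_\<kappa>_le[where c = "-1" and t = "fst y" and l = l] by (simp add: \<kappa>'_def)
      show "integrable (\<mu>W l \<Otimes>\<^sub>M \<mu>W l) (\<lambda>p. H p ^ 4 / \<kappa>' p ^ 3)" by (rule integrable_H4(1)[OF l])
      show "G l \<in> borel_measurable P" by (rule G_meas[OF l])
      show "AE \<omega> in P. G l \<omega> = (\<integral>z. H z \<partial>(\<xi>W l \<omega> \<Otimes>\<^sub>M \<xi>W l \<omega>))"
        using G_eq[OF l] grain_sum_eq[OF l \<phi>_meas \<phi>_even] by eventually_elim simp
    qed
  qed
  then show ?thesis by (rule that)
qed

end

section \<open>The variance as an integral over the unit window\<close>

context grain_statistic
begin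

text \<open>The first germ is x and w is the second point relative to it, so the window truncates x
  + fst w.\<close>

definition Row :: "((real ^ 'n) set \<Rightarrow> (real ^ 'n) \<times> (real ^ 'n) set \<Rightarrow> real) \<Rightarrow> real \<Rightarrow> real ^ 'n \<Rightarrow> (real ^ 'n) set \<Rightarrow> real" where
  "Row f l x C = (\<integral>w. indicator (window l) (x + fst w) * f C w \<partial>\<Lambda>)"

definition S :: "real \<Rightarrow> real ^ 'n \<Rightarrow> (real ^ 'n) set \<Rightarrow> real" where
  "S l x C = 4 * (Row \<psi> l x C)\<^sup>2 + 2 * Row (\<lambda>C w. (\<psi> C w)\<^sup>2) l x C"

definition S_lim :: "(real ^ 'n) set \<Rightarrow> real" where
  "S_lim C = 4 * (\<integral>w. \<psi> C w \<partial>\<Lambda>)\<^sup>2 + 2 * (\<integral>w. (\<psi> C w)\<^sup>2 \<partial>\<Lambda>)"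

text \<open>The weighted second moment that controls rows through Cauchy-Schwarz uniformly in the
  window. Its \<nu>-integral is finite by the moment condition with p = 2.\<close>

definition b :: "(real ^ 'n) set \<Rightarrow> ennreal" where
  "b C = (\<integral>\<^sup>+ w. ennreal ((\<psi> C w)\<^sup>2 / \<kappa> (fst w)) \<partial>\<Lambda>)"

lemma \<psi>_measurable [measurable (raw)]:
  assumes [measurable]: "f \<in> measurable M \<nu>" "g \<in> measurable M \<Lambda>"
  shows "(\<lambda>x. \<psi> (f x) (g x)) \<in> borel_measurable M"
  unfolding \<psi>_def by measurable

lemma Row_measurable [measurable]:
  "(\<lambda>z. Row \<psi> l (t *\<^sub>R fst z) (snd z)) \<in> borel_measurable \<Lambda>"
  "(\<lambda>z. Row (\<lambda>C w. (\<psi> C w)\<^sup>2) l (t *\<^sub>R fst z) (snd z)) \<in> borel_measurable \<Lambda>"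
  unfolding Row_def by measurable

lemma S_measurable [measurable]: "(\<lambda>z. S l (t *\<^sub>R fst z) (snd z)) \<in> borel_measurable \<Lambda>"
  unfolding S_def by measurable

lemma S_lim_measurable [measurable]: "S_lim \<in> borel_measurable \<nu>"
  unfolding S_lim_def[abs_def] by measurable

lemma b_measurable [measurable]: "b \<in> borel_measurable \<nu>"
  unfolding b_def[abs_def] by measurable

lemma integral_\<mu>W:
  fixes f :: "_ \<Rightarrow> real"
  assumes [measurable]: "f \<in> borel_measurable \<Lambda>"
  shows "(\<integral>z. f z \<partial>\<mu>W l) = (\<integral>z. indicator (window l) (fst z) * f z \<partial>\<Lambda>)"
proof -
  have [measurable]: "(\<lambda>z. indicator (cyl l) z :: real) \<in> borel_measurable \<Lambda>"
    using cyl_sets by (rule borel_measurable_indicator)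
  have "(\<integral>z. f z \<partial>\<mu>W l) = (\<integral>z. f z \<partial>density \<Lambda> (\<lambda>z. ennreal (indicator (cyl l) z)))"
    unfolding \<mu>W_def by (simp add: ennreal_indicator)
  also have "\<dots> = (\<integral>z. indicator (cyl l) z *\<^sub>R f z \<partial>\<Lambda>)"
    by (rule integral_density) auto
  also have "\<dots> = (\<integral>z. indicator (window l) (fst z) * f z \<partial>\<Lambda>)"
    by (intro Bochner_Integration.integral_cong) (auto simp: indicator_def space_\<Lambda> space_\<nu>)
  finally show ?thesis .
qed

lemma row_eq:
  fixes h :: "real \<Rightarrow> real"
  assumes z: "z \<in> space \<Lambda>" and [measurable]: "h \<in> borel_measurable borel"
  shows "(\<integral>z'. h (H (z, z')) \<partial>\<mu>W l) = Row (\<lambda>C w. h (\<psi> C w)) l (fst z) (snd z)"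
proof -
  have "(\<lambda>z'. (z, z')) \<in> measurable \<Lambda> (\<Lambda> \<Otimes>\<^sub>M \<Lambda>)" using z by measurable
  from measurable_compose[OF this H_measurable]
  have [measurable]: "(\<lambda>z'. H (z, z')) \<in> borel_measurable \<Lambda>" .
  have "(\<integral>z'. h (H (z, z')) \<partial>\<mu>W l) = (\<integral>z'. indicator (window l) (fst z') * h (H (z, z')) \<partial>\<Lambda>)"
    by (rule integral_\<mu>W) measurable
  also have "\<dots> = \<bar>1\<bar> ^ CARD('n) * (\<integral>w. indicator (window l) (fst (affine (fst z) 1 w)) * h (H (z, affine (fst z) 1 w)) \<partial>\<Lambda>)"
    by (rule integral_\<Lambda>_affine) auto
  also have "\<dots> = Row (\<lambda>C w. h (\<psi> C w)) l (fst z) (snd z)"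
    unfolding H_affine Row_def by (simp add: affine_def)
  finally show ?thesis .
qed

lemma filterlim_real_powr_at_top: "filterlim (\<lambda>l. l powr (1 / CARD('n))) at_top (at_top :: real filter)"
proof -
  have "filterlim (\<lambda>l :: real. exp (1 / CARD('n) * ln l)) at_top at_top"
    by (rule filterlim_compose[OF exp_at_top], rule filterlim_tendsto_pos_mult_at_top[OF tendsto_const _ ln_at_top]) simp
  moreover have "\<forall>\<^sub>F l :: real in at_top. exp (1 / CARD('n) * ln l) = l powr (1 / CARD('n))"
    using eventually_gt_at_top[of 0] by eventually_elim (simp add: powr_def)
  ultimately show ?thesis by (rule filterlim_cong[OF refl refl, THEN iffD1, rotated])
qed

lemma scale_window:
  fixes s :: "real ^ 'n"
  assumes l: "l > 0"
  shows "l powr (1 / CARD('n)) *\<^sub>R s \<in> window l \<longleftrightarrow> s \<in> window 1"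
proof -
  let ?r = "l powr (1 / CARD('n))"
  have r: "?r > 0" using l by simp
  have "(- ?r \<le> ?r * y) = (- 1 \<le> y)" "(?r * y \<le> ?r) = (y \<le> 1)" for y
    using mult_le_cancel_left_pos[OF r, of "- 1" y] mult_le_cancel_left_pos[OF r, of y 1] by simp_all
  then show ?thesis unfolding window_def by simp
qed

text \<open>The substitution x = r s with r = l^(1/d), d the dimension, maps the window to the unit
  one, and its Jacobian r^d = l is the order of the variance.\<close>

lemma pair_variance_eq:
  assumes l: "l > 0"
  shows "finite_measure.pair_variance (\<mu>W l) H =
    l * (\<integral>z. indicator (window 1) (fst z) * S l (l powr (1 / CARD('n)) *\<^sub>R fst z) (snd z) \<partial>\<Lambda>)"
proof -
  obtain B where "pair_statistic P (\<mu>W l) (\<xi>W l) B H \<kappa>' k (G l)" by (rule pair_statistic_exists[OF l])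
  then interpret ps: pair_statistic P "\<mu>W l" "\<xi>W l" B H \<kappa>' k "G l" .
  have p: "pair_sigma_finite (\<mu>W l) (\<mu>W l)" ..
  let ?r = "l powr (1 / CARD('n))"
  have rl: "?r ^ CARD('n) = l" using l by (simp add: powr_realpow[symmetric] powr_powr)
  have r: "?r \<noteq> 0" using l by simp
  have sqH: "sq_integrable (\<mu>W l \<Otimes>\<^sub>M \<mu>W l) H" by (rule ps.sq_integrable_H)
  then have H2: "integrable (\<mu>W l \<Otimes>\<^sub>M \<mu>W l) (\<lambda>p. (H p)\<^sup>2)" by (simp add: sq_integrable_def)
  have i1: "integrable (\<mu>W l) (\<lambda>z. (ps.\<mu>.row_integral H z)\<^sup>2)"
    using ps.\<mu>.row_integral_sq(1)[OF sqH] by (simp add: sq_integrable_def)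
  have i2: "integrable (\<mu>W l) (\<lambda>z. \<integral>z'. (H (z, z'))\<^sup>2 \<partial>\<mu>W l)" by (rule pair_sigma_finite.integrable_fst'[OF p H2])
  have "ps.\<mu>.pair_variance H = 4 * (\<integral>z. (ps.\<mu>.row_integral H z)\<^sup>2 \<partial>\<mu>W l) + 2 * (\<integral>z. \<integral>z'. (H (z, z'))\<^sup>2 \<partial>\<mu>W l \<partial>\<mu>W l)"
    unfolding ps.\<mu>.pair_variance_def by (subst pair_sigma_finite.integral_fst'[OF p H2]) simp
  also have "\<dots> = (\<integral>z. 4 * (ps.\<mu>.row_integral H z)\<^sup>2 + 2 * (\<integral>z'. (H (z, z'))\<^sup>2 \<partial>\<mu>W l) \<partial>\<mu>W l)"
    using i1 i2 by simp
  also have "\<dots> = (\<integral>z. S l (1 *\<^sub>R fst z) (snd z) \<partial>\<mu>W l)"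
  proof (rule Bochner_Integration.integral_cong[OF refl])
    fix z assume "z \<in> space (\<mu>W l)"
    then have z: "z \<in> space \<Lambda>" by (simp add: space_\<mu>W)
    show "4 * (ps.\<mu>.row_integral H z)\<^sup>2 + 2 * (\<integral>z'. (H (z, z'))\<^sup>2 \<partial>\<mu>W l) = S l (1 *\<^sub>R fst z) (snd z)"
      using row_eq[OF z, of "\<lambda>x. x" l] row_eq[OF z, of "\<lambda>x. x\<^sup>2" l] by (simp add: S_def ps.\<mu>.row_integral_def)
  qed
  also have "\<dots> = (\<integral>z. indicator (window l) (fst z) * S l (1 *\<^sub>R fst z) (snd z) \<partial>\<Lambda>)"
    by (rule integral_\<mu>W) measurable
  also have "\<dots> = \<bar>?r\<bar> ^ CARD('n) * (\<integral>z. indicator (window l) (fst (affine 0 ?r z)) * S l (1 *\<^sub>R fst (affine 0 ?r z)) (snd (affine 0 ?r z)) \<partial>\<Lambda>)"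
    by (rule integral_\<Lambda>_affine[OF _ r]) measurable
  also have "\<dots> = l * (\<integral>z. indicator (window 1) (fst z) * S l (?r *\<^sub>R fst z) (snd z) \<partial>\<Lambda>)"
    using scale_window[OF l] rl by (simp add: affine_def indicator_def)
  finally show ?thesis .
qed

lemma \<psi>_le: "ennreal ((\<psi> C w)\<^sup>2 / \<kappa> (fst w)) \<le> ennreal ((\<phi> (fst w))\<^sup>2 / \<kappa> (fst w)) * of_bool (Hit (0, C) w)"
  by (auto simp: \<psi>_def pair_kernel_def)

lemma nn_integral_b_finite: "(\<integral>\<^sup>+ z. indicator (window 1) (fst z) * b (snd z) \<partial>\<Lambda>) < \<infinity>"
proof -
  have "(\<integral>\<^sup>+ C. b C \<partial>\<nu>) \<le> (\<integral>\<^sup>+ C. \<integral>\<^sup>+ w. ennreal ((\<phi> (fst w))\<^sup>2 / \<kappa> (fst w)) * of_bool (Hit (0, C) w) \<partial>\<Lambda> \<partial>\<nu>)"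
    unfolding b_def by (intro nn_integral_mono \<psi>_le)
  also have "\<dots> = (\<integral>\<^sup>+ u. ennreal ((\<phi> u)\<^sup>2 / \<kappa> u) * ennreal (hit_prob \<nu> u) \<partial>lborel)"
    by (rule nn_integral_Hit) measurable
  also have "\<dots> < \<infinity>" by (rule moment2)
  finally show ?thesis
    by (subst nn_integral_window) (auto simp: ennreal_mult_less_top)
qed

lemma integrable_\<kappa>_fst: "integrable \<Lambda> (\<lambda>w. \<kappa> (fst w))" and integral_\<kappa>_fst: "(\<integral>w. \<kappa> (fst w) \<partial>\<Lambda>) = 1"
proof -
  show i: "integrable \<Lambda> (\<lambda>w. \<kappa> (fst w))"
    using nn_integral_\<kappa>_fst less_imp_le[OF \<kappa>_pos] by (intro integrableI_nonneg) auto
  show "(\<integral>w. \<kappa> (fst w) \<partial>\<Lambda>) = 1"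
    using nn_integral_eq_integral[OF i] nn_integral_\<kappa>_fst less_imp_le[OF \<kappa>_pos] by auto
qed

context
  fixes C assumes C: "C \<in> space \<nu>" and bC: "b C < \<infinity>"
begin

lemma \<psi>C_measurable [measurable]: "\<psi> C \<in> borel_measurable \<Lambda>"
  using \<psi>_measurable[of "\<lambda>_. C" \<Lambda> "\<lambda>w. w"] C by simp

lemma weighted_integrable: "integrable \<Lambda> (\<lambda>w. (\<psi> C w)\<^sup>2 / \<kappa> (fst w))"
  using bC less_imp_le[OF \<kappa>_pos] by (intro integrableI_nonneg) (auto simp: b_def)

lemma weighted_integral: "(\<integral>w. (\<psi> C w)\<^sup>2 / \<kappa> (fst w) \<partial>\<Lambda>) = enn2real (b C)"
  using less_imp_le[OF \<kappa>_pos] unfolding b_def by (intro integral_eq_nn_integral) auto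

lemma sq_le_weighted: "(\<psi> C w)\<^sup>2 \<le> k * ((\<psi> C w)\<^sup>2 / \<kappa> (fst w))"
  using mult_right_mono[OF \<kappa>_le[of "fst w"], of "(\<psi> C w)\<^sup>2"] \<kappa>_pos[of "fst w"] by (simp add: field_simps)

lemma integrable_\<psi>_sq: "integrable \<Lambda> (\<lambda>w. (\<psi> C w)\<^sup>2)"
  by (rule Bochner_Integration.integrable_bound[OF integrable_mult_right[OF weighted_integrable, of k]])
     (use order_trans[OF sq_le_weighted abs_ge_self] in \<open>simp_all add: abs_mult\<close>)

lemma integrable_\<psi>: "integrable \<Lambda> (\<psi> C)"
proof (rule Bochner_Integration.integrable_bound[OF Bochner_Integration.integrable_add[OF weighted_integrable integrable_\<kappa>_fst]])
  show "AE w in \<Lambda>. norm (\<psi> C w) \<le> norm ((\<psi> C w)\<^sup>2 / \<kappa> (fst w) + \<kappa> (fst w))"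
  proof (rule AE_I2)
    fix w
    let ?a = "\<bar>\<psi> C w\<bar>" and ?t = "\<kappa> (fst w)"
    have t: "?t > 0" by (rule \<kappa>_pos)
    have "?a * ?t \<le> ?a\<^sup>2 + ?t\<^sup>2"
      using sum_squares_bound[of ?a ?t] mult_nonneg_nonneg[OF abs_ge_zero[of "\<psi> C w"] less_imp_le[OF t]] by linarith
    then have "?a \<le> ?a\<^sup>2 / ?t + ?t" using t by (simp add: field_simps power2_eq_square)
    then show "norm (\<psi> C w) \<le> norm ((\<psi> C w)\<^sup>2 / ?t + ?t)" using t by (simp add: abs_of_nonneg)
  qed
qed simp

text \<open>Cauchy-Schwarz for the factors \<psi> / sqrt \<kappa> and sqrt \<kappa>, with total
  \<kappa>-mass 1, bounds the squared row by b, and \<kappa> \<le> k bounds the row of squares by k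
  b. Neither bound depends on l or x, as dominated convergence requires.\<close>

lemma S_bound: "\<bar>S l x C\<bar> \<le> (4 + 2 * k) * enn2real (b C)"
proof -
  let ?i = "\<lambda>w. indicator (window l) (x + fst w) :: real"
  have i: "(?i w)\<^sup>2 = ?i w" "0 \<le> ?i w" "?i w \<le> 1" for w by (auto simp: indicator_def)
  have bb: "integrable \<Lambda> (\<lambda>w. (?i w * \<psi> C w / sqrt (\<kappa> (fst w)))\<^sup>2)"
    and bl: "(\<integral>w. (?i w * \<psi> C w / sqrt (\<kappa> (fst w)))\<^sup>2 \<partial>\<Lambda>) \<le> enn2real (b C)"
  proof -
    have le: "(?i w * \<psi> C w / sqrt (\<kappa> (fst w)))\<^sup>2 \<le> (\<psi> C w)\<^sup>2 / \<kappa> (fst w)" for w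
      using \<kappa>_pos[of "fst w"] by (auto simp: indicator_def power_divide)
    show bb: "integrable \<Lambda> (\<lambda>w. (?i w * \<psi> C w / sqrt (\<kappa> (fst w)))\<^sup>2)"
      by (rule Bochner_Integration.integrable_bound[OF weighted_integrable])
         (use order_trans[OF le abs_ge_self] in simp_all)
    show "(\<integral>w. (?i w * \<psi> C w / sqrt (\<kappa> (fst w)))\<^sup>2 \<partial>\<Lambda>) \<le> enn2real (b C)"
      unfolding weighted_integral[symmetric] by (intro integral_mono bb weighted_integrable le)
  qed
  have sq1: "sq_integrable \<Lambda> (\<lambda>w. ?i w * \<psi> C w / sqrt (\<kappa> (fst w)))" using bb by (auto simp: sq_integrable_def)
  have sq2: "sq_integrable \<Lambda> (\<lambda>w. sqrt (\<kappa> (fst w)))"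
    using integrable_\<kappa>_fst less_imp_le[OF \<kappa>_pos] by (auto simp: sq_integrable_def)
  have "?i w * \<psi> C w / sqrt (\<kappa> (fst w)) * sqrt (\<kappa> (fst w)) = ?i w * \<psi> C w" for w
    using \<kappa>_pos[of "fst w"] by simp
  then have "(Row \<psi> l x C)\<^sup>2 \<le> (\<integral>w. (?i w * \<psi> C w / sqrt (\<kappa> (fst w)))\<^sup>2 \<partial>\<Lambda>)"
    using integral_cauchy_schwarz[OF sq1 sq2] integral_\<kappa>_fst less_imp_le[OF \<kappa>_pos] by (simp add: Row_def)
  then have R1: "(Row \<psi> l x C)\<^sup>2 \<le> enn2real (b C)" using bl by simp
  have le: "?i w * (\<psi> C w)\<^sup>2 \<le> (\<psi> C w)\<^sup>2" for w by (auto simp: indicator_def)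
  have "Row (\<lambda>C w. (\<psi> C w)\<^sup>2) l x C \<le> (\<integral>w. k * ((\<psi> C w)\<^sup>2 / \<kappa> (fst w)) \<partial>\<Lambda>)"
    unfolding Row_def
  proof (rule integral_mono)
    show "integrable \<Lambda> (\<lambda>w. ?i w * (\<psi> C w)\<^sup>2)"
      by (rule Bochner_Integration.integrable_bound[OF integrable_\<psi>_sq]) (auto simp: indicator_def)
    show "integrable \<Lambda> (\<lambda>w. k * ((\<psi> C w)\<^sup>2 / \<kappa> (fst w)))" using weighted_integrable by (rule integrable_mult_right)
    show "?i w * (\<psi> C w)\<^sup>2 \<le> k * ((\<psi> C w)\<^sup>2 / \<kappa> (fst w))" for w
      using le[of w] sq_le_weighted[of w] by linarith
  qed
  then have R2: "Row (\<lambda>C w. (\<psi> C w)\<^sup>2) l x C \<le> k * enn2real (b C)"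
    by (simp only: integral_mult_right_zero weighted_integral)
  have "Row (\<lambda>C w. (\<psi> C w)\<^sup>2) l x C \<ge> 0" unfolding Row_def by (intro integral_nonneg_AE AE_I2) auto
  then show ?thesis unfolding S_def using R1 R2 by (simp add: algebra_simps)
qed

text \<open>For s in the open unit cube and r the half side of the window, r s stays at distance (1
  - |s i|) r from the faces in direction i, which outgrows any fixed u.\<close>

lemma eventually_in_window:
  fixes s u :: "real ^ 'n"
  assumes s: "\<And>i. \<bar>s $ i\<bar> < 1"
  shows "\<forall>\<^sub>F l in at_top. l powr (1 / CARD('n)) *\<^sub>R s + u \<in> window l"
proof -
  have "\<forall>\<^sub>F l in at_top. \<bar>u $ i\<bar> \<le> (1 - \<bar>s $ i\<bar>) * l powr (1 / CARD('n))" for i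
  proof -
    have "filterlim (\<lambda>l. (1 - \<bar>s $ i\<bar>) * l powr (1 / CARD('n))) at_top at_top"
      by (rule filterlim_tendsto_pos_mult_at_top[OF tendsto_const])
         (use s[of i] filterlim_real_powr_at_top in auto)
    then show ?thesis by (simp add: filterlim_at_top)
  qed
  then have "\<forall>\<^sub>F l in at_top. \<forall>i. \<bar>u $ i\<bar> \<le> (1 - \<bar>s $ i\<bar>) * l powr (1 / CARD('n))"
    by (rule eventually_all_finite)
  then show ?thesis
  proof eventually_elim
    case (elim l)
    have "\<bar>l powr (1 / CARD('n)) * s $ i + u $ i\<bar> \<le> l powr (1 / CARD('n))" for i
    proof -
      have "\<bar>l powr (1 / CARD('n)) * s $ i + u $ i\<bar> \<le> l powr (1 / CARD('n)) * \<bar>s $ i\<bar> + \<bar>u $ i\<bar>"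
        using abs_triangle_ineq[of "l powr (1 / CARD('n)) * s $ i" "u $ i"] by (simp add: abs_mult)
      then show ?thesis using elim[rule_format, of i] by (simp add: algebra_simps)
    qed
    then show ?case by (auto simp: window_def abs_le_iff minus_le_iff)
  qed
qed

lemma Row_tendsto:
  assumes s: "\<And>i. \<bar>s $ i\<bar> < 1" and f: "integrable \<Lambda> (f C)"
  shows "((\<lambda>l. Row f l (l powr (1 / CARD('n)) *\<^sub>R s) C) \<longlongrightarrow> (\<integral>w. f C w \<partial>\<Lambda>)) at_top"
  unfolding Row_def
proof (rule integral_dominated_convergence_at_top[where w = "\<lambda>w. \<bar>f C w\<bar>"])
  show "AE w in \<Lambda>. ((\<lambda>l. indicator (window l) (l powr (1 / CARD('n)) *\<^sub>R s + fst w) * f C w) \<longlongrightarrow> f C w) at_top"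
  proof (rule AE_I2)
    fix w :: "(real ^ 'n) \<times> (real ^ 'n) set"
    show "((\<lambda>l. indicator (window l) (l powr (1 / CARD('n)) *\<^sub>R s + fst w) * f C w) \<longlongrightarrow> f C w) at_top"
      by (rule tendsto_eventually) (use eventually_in_window[OF s, of "fst w"] in eventually_elim, simp)
  qed
  have [measurable]: "f C \<in> borel_measurable \<Lambda>" using f by simp
  show "(\<lambda>w. indicator (window l) (l powr (1 / CARD('n)) *\<^sub>R s + fst w) * f C w) \<in> borel_measurable \<Lambda>" for l
    by measurable
qed (use f in \<open>auto simp: indicator_def\<close>)

lemma S_tendsto:
  assumes s: "\<And>i. \<bar>s $ i\<bar> < 1"
  shows "((\<lambda>l. S l (l powr (1 / CARD('n)) *\<^sub>R s) C) \<longlongrightarrow> S_lim C) at_top"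
  unfolding S_def S_lim_def
  by (intro tendsto_intros Row_tendsto s integrable_\<psi> integrable_\<psi>_sq)

end

end

section \<open>The limiting variance and the rate of convergence\<close>

lemma powr_minus_half: "l > 0 \<Longrightarrow> l powr (- 1 / 2) = 1 / sqrt l" for l :: real
proof -
  assume l: "l > 0"
  have "l powr (- 1 / 2) = l powr - (1 / 2)" by simp
  also have "\<dots> = inverse (l powr (1 / 2))" by (rule powr_minus)
  also have "l powr (1 / 2) = sqrt l" by (rule powr_half_sqrt) (use l in simp)
  finally show ?thesis by (simp only: inverse_eq_divide)
qed

text \<open>With M1 and M2 of order at most l and V of order at least l, the two terms are of order
  sqrt l / l and l / l^(3/2).\<close>

lemma rate_bound:
  fixes l v V M1 M2 a e s1 s2 :: real
  assumes l: "l > 0" and v: "v > 0" and V: "V \<ge> v * l"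
    and s: "s1 \<ge> 0" "s2 \<ge> 0" and M: "0 \<le> M1" "M1 \<le> a * l" "0 \<le> M2" "M2 \<le> e * l"
  shows "78 * sqrt (s1 * M1) / V + 728 * (s2 * M2) / sqrt V ^ 3
    \<le> (78 * sqrt (s1 * a) / v + 728 * (s2 * e) / sqrt v ^ 3) * l powr (- 1 / 2)"
proof -
  define r where "r = sqrt l"
  have r: "r > 0" and l_eq: "l = r * r" using l by (auto simp: r_def)
  have vl: "v * l > 0" using v l by simp
  have p: "l powr (- 1 / 2) = 1 / r" unfolding r_def by (rule powr_minus_half[OF l])
  have "sqrt (s1 * M1) \<le> sqrt (s1 * (a * l))" using s M by (intro real_sqrt_le_mono mult_left_mono) auto
  also have "\<dots> = sqrt (s1 * a) * r" by (simp add: r_def real_sqrt_mult mult.assoc)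
  finally have sq: "sqrt (s1 * M1) \<le> sqrt (s1 * a) * r" .
  have "0 \<le> sqrt (s1 * M1)" using s M by simp
  then have "78 * sqrt (s1 * M1) / V \<le> 78 * (sqrt (s1 * a) * r) / (v * l)"
    using sq by (intro frac_le V vl) linarith+
  also have "\<dots> = 78 * sqrt (s1 * a) / v * (1 / r)" using r v by (simp add: l_eq)
  finally have 1: "78 * sqrt (s1 * M1) / V \<le> 78 * sqrt (s1 * a) / v * (1 / r)" .
  have q: "sqrt v * r > 0" using v r by simp
  have "sqrt v * r = sqrt (v * l)" by (simp add: r_def real_sqrt_mult)
  also have "\<dots> \<le> sqrt V" using V by simp
  finally have "(sqrt v * r) ^ 3 \<le> sqrt V ^ 3" using q by (intro power_mono) auto
  moreover have "728 * (s2 * M2) \<le> 728 * (s2 * (e * l))" using s M by (intro mult_left_mono) auto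
  ultimately have "728 * (s2 * M2) / sqrt V ^ 3 \<le> 728 * (s2 * (e * l)) / (sqrt v * r) ^ 3"
    using q M s by (intro frac_le zero_less_power) auto
  also have "\<dots> = 728 * (s2 * e) / sqrt v ^ 3 * (1 / r)"
  proof -
    have "728 * (s2 * (e * (r * r))) / (w * r) ^ 3 = 728 * (s2 * e) / w ^ 3 * (1 / r)" if "w > 0" for w
      using r that by (simp add: power_mult_distrib power3_eq_cube)
    then show ?thesis using v unfolding l_eq by simp
  qed
  finally show ?thesis using 1 unfolding p by (simp add: algebra_simps)
qed

context grain_statistic
begin

lemma S_lim_nonneg: "S_lim C \<ge> 0"
  unfolding S_lim_def by simp

lemma S_lim_bound:
  assumes "C \<in> space \<nu>" "b C < \<infinity>" shows "\<bar>S_lim C\<bar> \<le> (4 + 2 * k) * enn2real (b C)"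
  by (rule tendsto_upperbound[OF tendsto_rabs[OF S_tendsto[OF assms, where s = 0]]])
     (auto intro!: always_eventually S_bound assms)

text \<open>At a face of the cube a half-space of relative positions stays outside the rescaled
  window for all l, so the limit of \<open>S\<close> there may differ from \<open>S_lim\<close>. The
  boundary of a box is null.\<close>

lemma AE_window_interior: "AE z in \<Lambda>. fst z \<in> window 1 \<longrightarrow> (\<forall>i. \<bar>fst z $ i\<bar> < 1)"
proof -
  define a where "a = (\<chi> i. - 1 :: real ^ 'n)"
  define b' where "b' = (\<chi> i. 1 :: real ^ 'n)"
  define D where "D = cbox a b' - box a b'"
  have D: "D \<in> sets borel" by (simp add: D_def)
  have "D \<in> null_sets lebesgue"
    unfolding D_def using negligible_frontier_interval negligible_iff_null_sets by blast
  then have "D \<in> null_sets lborel" using D by (simp add: null_sets_completion_iff)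
  then have "emeasure \<Lambda> (D \<times> space \<nu>) = 0"
    unfolding \<Lambda>_def using D by (subst emeasure_pair_measure_Times) auto
  moreover have "D \<times> space \<nu> \<in> sets \<Lambda>" unfolding \<Lambda>_def using D by (intro pair_measureI) auto
  ultimately have "D \<times> space \<nu> \<in> null_sets \<Lambda>" by (intro null_setsI) auto
  then show ?thesis
  proof (rule AE_I')
    show "{z \<in> space \<Lambda>. \<not> (fst z \<in> window 1 \<longrightarrow> (\<forall>i. \<bar>fst z $ i\<bar> < 1))} \<subseteq> D \<times> space \<nu>"
      by (auto simp: D_def a_def b'_def mem_box_cart window_def space_\<Lambda> space_\<nu> abs_less_iff)
  qed
qed

definition c_lim :: real where
  "c_lim = (\<integral>z. indicator (window 1) (fst z) * S_lim (snd z) \<partial>\<Lambda>)"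

text \<open>An infinite value of b is sent to 0 by \<open>enn2real\<close>; it can occur over the
  window only on a null set, by \<open>AE_window_b\<close>.\<close>

definition dominator :: "(real ^ 'n) \<times> (real ^ 'n) set \<Rightarrow> real" where
  "dominator z = (4 + 2 * k) * enn2real (indicator (window 1) (fst z) * b (snd z))"

lemma dominator_integrable: "integrable \<Lambda> dominator"
  unfolding dominator_def[abs_def]
proof (rule integrable_mult_right, rule integrableI_nonneg)
  have "(\<integral>\<^sup>+ z. ennreal (enn2real (indicator (window 1) (fst z) * b (snd z))) \<partial>\<Lambda>) \<le>
      (\<integral>\<^sup>+ z. indicator (window 1) (fst z) * b (snd z) \<partial>\<Lambda>)"
    by (intro nn_integral_mono) (auto simp: ennreal_enn2real_if)
  then show "(\<integral>\<^sup>+ z. ennreal (enn2real (indicator (window 1) (fst z) * b (snd z))) \<partial>\<Lambda>) < \<infinity>"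
    using nn_integral_b_finite by (rule le_less_trans)
qed auto

lemma AE_window_b: "AE z in \<Lambda>. fst z \<in> window 1 \<longrightarrow> b (snd z) < \<infinity>"
proof -
  have "AE z in \<Lambda>. indicator (window 1) (fst z) * b (snd z) \<noteq> \<infinity>"
    by (rule nn_integral_PInf_AE) (use nn_integral_b_finite in auto)
  then show ?thesis by eventually_elim (auto simp: indicator_def less_top)
qed

lemma AE_window_good: "AE z in \<Lambda>. fst z \<in> window 1 \<longrightarrow> snd z \<in> space \<nu> \<and> b (snd z) < \<infinity> \<and> (\<forall>i. \<bar>fst z $ i\<bar> < 1)"
  using AE_window_b AE_window_interior AE_space
  by eventually_elim (auto simp: space_\<Lambda> space_\<nu>)

lemma variance_ratio_tendsto:
  "((\<lambda>l. \<integral>z. indicator (window 1) (fst z) * S l (l powr (1 / CARD('n)) *\<^sub>R fst z) (snd z) \<partial>\<Lambda>) \<longlongrightarrow> c_lim) at_top"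
  unfolding c_lim_def
proof (rule integral_dominated_convergence_at_top[where w = dominator])
  show "integrable \<Lambda> dominator" by (rule dominator_integrable)
  show "\<forall>\<^sub>F l in at_top. AE z in \<Lambda>. norm (indicator (window 1) (fst z) * S l (l powr (1 / CARD('n)) *\<^sub>R fst z) (snd z)) \<le> dominator z"
  proof (rule always_eventually, rule allI)
    fix l
    show "AE z in \<Lambda>. norm (indicator (window 1) (fst z) * S l (l powr (1 / CARD('n)) *\<^sub>R fst z) (snd z)) \<le> dominator z"
      using AE_window_good by eventually_elim (auto simp: dominator_def indicator_def intro!: S_bound)
  qed
  show "AE z in \<Lambda>. ((\<lambda>l. indicator (window 1) (fst z) * S l (l powr (1 / CARD('n)) *\<^sub>R fst z) (snd z)) \<longlongrightarrow>
      indicator (window 1) (fst z) * S_lim (snd z)) at_top"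
    using AE_window_good
  proof eventually_elim
    case (elim z)
    then show ?case by (cases "fst z \<in> window 1") (auto intro!: S_tendsto)
  qed
qed measurable

text \<open>Rows may cancel because \<phi> can change sign, so positivity is drawn from the term
  with \<psi>^2. If that term vanishes, \<open>nn_integral_Hit\<close> shows that \<phi>^2 times the
  hitting probability is 0 almost everywhere.\<close>

lemma c_lim_pos:
  assumes nz: "\<not> (AE x in lborel. \<phi> x * hit_prob \<nu> x = 0)"
  shows "c_lim > 0"
proof (rule ccontr)
  assume "\<not> c_lim > 0"
  moreover have "c_lim \<ge> 0"
    unfolding c_lim_def by (intro integral_nonneg_AE AE_I2) (simp add: S_lim_nonneg)
  ultimately have c0: "c_lim = 0" by simp
  have "integrable \<Lambda> (\<lambda>z. indicator (window 1) (fst z) * S_lim (snd z))"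
  proof (rule Bochner_Integration.integrable_bound[OF dominator_integrable])
    show "AE z in \<Lambda>. norm (indicator (window 1) (fst z) * S_lim (snd z)) \<le> norm (dominator z)"
      using AE_window_good
    proof eventually_elim
      case (elim z)
      then show ?case using S_lim_bound[of "snd z"] by (auto simp: dominator_def indicator_def intro: order_trans[OF _ abs_ge_self])
    qed
  qed measurable
  then have "AE z in \<Lambda>. indicator (window 1) (fst z) * S_lim (snd z) = 0"
    using c0 unfolding c_lim_def by (subst (asm) integral_nonneg_eq_0_iff_AE) (auto simp: S_lim_nonneg)
  then have z0: "AE z in \<Lambda>. indicator (window 1) (fst z) * (\<integral>\<^sup>+ w. ennreal ((\<psi> (snd z) w)\<^sup>2) \<partial>\<Lambda>) = 0"
    using AE_window_good
  proof eventually_elim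
    case (elim z)
    show ?case
    proof (cases "fst z \<in> window 1")
      case True
      then have z: "snd z \<in> space \<nu>" "b (snd z) < \<infinity>" and S0: "S_lim (snd z) = 0" using elim by auto
      have "(\<integral>w. (\<psi> (snd z) w)\<^sup>2 \<partial>\<Lambda>) \<ge> 0" by (intro integral_nonneg_AE AE_I2) simp
      then have "(\<integral>w. (\<psi> (snd z) w)\<^sup>2 \<partial>\<Lambda>) = 0"
        using S0 zero_le_power2[of "\<integral>w. \<psi> (snd z) w \<partial>\<Lambda>"] unfolding S_lim_def by linarith
      then show ?thesis using nn_integral_eq_integral[OF integrable_\<psi>_sq[OF z]] by simp
    qed simp
  qed
  \<comment> \<open>The factor excluding u = 0 mirrors the exclusion of equal germs in
    \<open>pair_kernel\<close>; a single point is null for Lebesgue measure.\<close>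
  define g where "g = (\<lambda>u. ennreal ((\<phi> u)\<^sup>2) * of_bool (u \<noteq> 0))"
  have g [measurable]: "g \<in> borel_measurable borel" unfolding g_def by measurable
  have g_eq: "ennreal ((\<psi> C w)\<^sup>2) = g (fst w) * of_bool (Hit (0, C) w)" for C w
    by (auto simp: g_def \<psi>_def pair_kernel_def)
  have "(\<integral>\<^sup>+ z. indicator (window 1) (fst z) * (\<integral>\<^sup>+ w. g (fst w) * of_bool (Hit (0, snd z) w) \<partial>\<Lambda>) \<partial>\<Lambda>) = 0"
    using z0 unfolding g_eq by (subst nn_integral_0_iff_AE) auto
  then have "(\<integral>\<^sup>+ u. g u * ennreal (hit_prob \<nu> u) \<partial>lborel) = 0"
    using nn_integral_window[OF nn_integral_Hit_measurable[OF g], of 1] nn_integral_Hit[OF g] by simp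
  then have "AE u in lborel. g u * ennreal (hit_prob \<nu> u) = 0"
    by (subst (asm) nn_integral_0_iff_AE) auto
  moreover have "AE u in lborel. u \<noteq> (0 :: real ^ 'n)" by (rule AE_lborel_singleton)
  ultimately have "AE u in lborel. \<phi> u * hit_prob \<nu> u = 0"
  proof eventually_elim
    case (elim u)
    then have "\<phi> u = 0 \<or> hit_prob \<nu> u \<le> 0" by (auto simp: g_def ennreal_eq_0_iff)
    then show ?case using hit_prob_nonneg[of u] by auto
  qed
  with nz show False by simp
qed

lemma
  assumes l: "l > 0"
  shows sq_integrable_G: "sq_integrable P (G l)"
    and variance_G: "P.variance (G l) = l *
      (\<integral>z. indicator (window 1) (fst z) * S l (l powr (1 / CARD('n)) *\<^sub>R fst z) (snd z) \<partial>\<Lambda>)"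
    and wasserstein_G: "v > 0 \<Longrightarrow> P.variance (G l) \<ge> v * l \<Longrightarrow>
      wasserstein (distr P borel (\<lambda>\<omega>. (G l \<omega> - P.expectation (G l)) / sqrt (P.variance (G l)))) std_normal_distribution
      \<le> ennreal ((78 * sqrt ((161 + 16 * k\<^sup>2) * (2 ^ CARD('n) * A4)) / v +
          728 * ((18 + k + 3 * k\<^sup>2 + k ^ 3) * (2 ^ CARD('n) * (A4 + 1))) / sqrt v ^ 3) * l powr (- 1 / 2))"
proof -
  obtain B where "pair_statistic P (\<mu>W l) (\<xi>W l) B H \<kappa>' k (G l)" by (rule pair_statistic_exists[OF l])
  then interpret ps: pair_statistic P "\<mu>W l" "\<xi>W l" B H \<kappa>' k "G l" .
  show "sq_integrable P (G l)" by (rule ps.sq_integrable_G)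
  show "P.variance (G l) = l *
      (\<integral>z. indicator (window 1) (fst z) * S l (l powr (1 / CARD('n)) *\<^sub>R fst z) (snd z) \<partial>\<Lambda>)"
    using ps.variance_G pair_variance_eq[OF l] by simp
  assume v: "v > 0" and V: "P.variance (G l) \<ge> v * l"
  have pos: "P.variance (G l) > 0" using v l V by (smt (verit) mult_pos_pos)
  have "emeasure (\<mu>W l) (space (\<mu>W l)) = emeasure \<Lambda> (space \<Lambda> \<inter> cyl l)"
    using emeasure_\<mu>W[of "space \<Lambda>" l] by (simp add: space_\<mu>W)
  also have "space \<Lambda> \<inter> cyl l = cyl l" using sets.sets_into_space[OF cyl_sets] by auto
  finally have mass: "measure (\<mu>W l) (space (\<mu>W l)) = 2 ^ CARD('n) * l"
    using emeasure_cyl[OF l] l by (simp add: measure_def)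
  have M4: "0 \<le> ps.M4" "ps.M4 \<le> 2 ^ CARD('n) * A4 * l"
    using integrable_H4(2)[OF l] ps.M4_nonneg by (simp_all add: ps.M4_def mult.commute mult.left_commute)
  have "wasserstein (distr P borel (\<lambda>\<omega>. (G l \<omega> - P.expectation (G l)) / sqrt (P.variance (G l)))) std_normal_distribution
      \<le> ennreal (78 * sqrt ((161 + 16 * k\<^sup>2) * ps.M4) / P.variance (G l) +
        728 * ((18 + k + 3 * k\<^sup>2 + k ^ 3) * (ps.M4 + measure (\<mu>W l) (space (\<mu>W l)))) / sqrt (P.variance (G l)) ^ 3)"
    using ps.wasserstein_pair_statistic[OF pos] by (simp add: ps.stein_const1_def ps.stein_const2_def)
  also have "\<dots> \<le> ennreal ((78 * sqrt ((161 + 16 * k\<^sup>2) * (2 ^ CARD('n) * A4)) / v +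
          728 * ((18 + k + 3 * k\<^sup>2 + k ^ 3) * (2 ^ CARD('n) * (A4 + 1))) / sqrt v ^ 3) * l powr (- 1 / 2))"
  proof (intro ennreal_leI rate_bound l v V)
    show "ps.M4 + measure (\<mu>W l) (space (\<mu>W l)) \<le> 2 ^ CARD('n) * (A4 + 1) * l"
      using M4 by (simp add: mass algebra_simps)
  qed (use M4 k_pos in auto)
  finally show "wasserstein (distr P borel (\<lambda>\<omega>. (G l \<omega> - P.expectation (G l)) / sqrt (P.variance (G l)))) std_normal_distribution
      \<le> ennreal ((78 * sqrt ((161 + 16 * k\<^sup>2) * (2 ^ CARD('n) * A4)) / v +
          728 * ((18 + k + 3 * k\<^sup>2 + k ^ 3) * (2 ^ CARD('n) * (A4 + 1))) / sqrt v ^ 3) * l powr (- 1 / 2))" .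
qed

theorem normal_approximation:
  assumes nz: "\<not> (AE x in lborel. \<phi> x * hit_prob \<nu> x = 0)"
  shows "\<exists>c>0. \<exists>C>0. (\<lambda>l. P.variance (G l)) \<sim>[at_top] (\<lambda>l. c * l) \<and>
    (\<forall>l>0. P.variance (G l) > 0 \<longrightarrow>
      wasserstein (distr P borel (\<lambda>\<omega>. (G l \<omega> - P.expectation (G l)) / sqrt (P.variance (G l)))) std_normal_distribution
      \<le> ennreal (C * l powr (- 1 / 2)))"
proof -
  define q where "q = (\<lambda>l. \<integral>z. indicator (window 1) (fst z) * S l (l powr (1 / CARD('n)) *\<^sub>R fst z) (snd z) \<partial>\<Lambda>)"
  have q: "(q \<longlongrightarrow> c_lim) at_top" unfolding q_def by (rule variance_ratio_tendsto)
  have V: "P.variance (G l) = l * q l" if "l > 0" for l unfolding q_def by (rule variance_G[OF that])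
  have c: "c_lim > 0" by (rule c_lim_pos[OF nz])
  define v where "v = c_lim / 2"
  have v: "v > 0" "v < c_lim" using c by (auto simp: v_def)
  obtain l0 where l0: "\<And>l. l \<ge> l0 \<Longrightarrow> v < q l"
    using order_tendstoD(1)[OF q v(2)] by (auto simp: eventually_at_top_linorder)
  define K where "K = 78 * sqrt ((161 + 16 * k\<^sup>2) * (2 ^ CARD('n) * A4)) / v +
          728 * ((18 + k + 3 * k\<^sup>2 + k ^ 3) * (2 ^ CARD('n) * (A4 + 1))) / sqrt v ^ 3"
  have K: "K \<ge> 0" unfolding K_def using v k_pos A4_nonneg by (intro add_nonneg_nonneg divide_nonneg_nonneg mult_nonneg_nonneg) auto
  \<comment> \<open>K serves l \<ge> l0. The term \<open>2 * sqrt \<bar>l0\<bar>\<close> makes C *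
    l^(-1/2) at least the trivial bound 2 for l < l0, and the 1 makes C positive.\<close>
  define C where "C = K + 2 * sqrt \<bar>l0\<bar> + 1"
  have C: "C > 0" "K \<le> C" "2 * sqrt \<bar>l0\<bar> \<le> C"
    using K real_sqrt_ge_zero[OF abs_ge_zero[of l0]] unfolding C_def by linarith+
  have asym: "(\<lambda>l. P.variance (G l)) \<sim>[at_top] (\<lambda>l. c_lim * l)"
  proof (rule asymp_equivI')
    have "((\<lambda>l. q l / c_lim) \<longlongrightarrow> c_lim / c_lim) at_top" using q c by (intro tendsto_intros) auto
    moreover have "\<forall>\<^sub>F l in at_top. q l / c_lim = P.variance (G l) / (c_lim * l)"
      using eventually_gt_at_top[of 0] by eventually_elim (simp add: V)
    ultimately show "((\<lambda>l. P.variance (G l) / (c_lim * l)) \<longlongrightarrow> 1) at_top"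
      using c by (auto elim: Lim_transform_eventually)
  qed
  have bound: "wasserstein (distr P borel (\<lambda>\<omega>. (G l \<omega> - P.expectation (G l)) / sqrt (P.variance (G l)))) std_normal_distribution
      \<le> ennreal (C * l powr (- 1 / 2))" (is "?W \<le> _") if l: "l > 0" and pos: "P.variance (G l) > 0" for l
  proof (cases "l \<ge> l0")
    case True
    have "?W \<le> ennreal (K * l powr (- 1 / 2))"
      unfolding K_def by (rule wasserstein_G[OF l v(1)]) (use l0[OF True] l in \<open>simp add: V\<close>)
    also have "\<dots> \<le> ennreal (C * l powr (- 1 / 2))"
      by (intro ennreal_leI mult_right_mono C) simp
    finally show ?thesis .
  next
    case False
    have s: "sqrt l > 0" using l by simp
    have p: "l powr (- 1 / 2) = 1 / sqrt l" by (rule powr_minus_half[OF l])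
    have "2 * sqrt l \<le> 2 * sqrt \<bar>l0\<bar>" using False l by simp
    then have "2 * sqrt l \<le> C" using C(3) by linarith
    then have "2 \<le> C * l powr (- 1 / 2)" using s unfolding p by (simp add: field_simps)
    from ennreal_leI[OF this] have "2 \<le> ennreal (C * l powr (- 1 / 2))"
      by (simp only: ennreal_numeral)
    with wasserstein_std_normal_le_2[OF P.prob_space_axioms sq_integrable_G[OF l] pos]
    show ?thesis by (rule order_trans)
  qed
  show ?thesis using c C(1) asym bound by blast
qed

end

text \<open>Square integrability is part of the conclusion because a Bochner integral of a
  non-integrable function is 0 by convention; it makes the expectation and the variance in the
  remaining claims genuine.\<close>

theorem theorem8p1:
  fixes P :: "'w measure"
    and \<nu> :: "(real ^ 'n) set measure"
    and \<eta> :: "'w \<Rightarrow> ((real ^ 'n) \<times> (real ^ 'n) set) measure"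
    and \<phi> \<kappa> :: "real ^ 'n \<Rightarrow> real"
    and G :: "real \<Rightarrow> 'w \<Rightarrow> real"
  assumes "prob_space \<nu>" and "sets \<nu> = sets compact_borel"
    and "poisson_measure P (lborel \<Otimes>\<^sub>M \<nu>) \<eta>"
    and "\<phi> \<in> borel_measurable borel" and "\<And>x. \<phi> (- x) = \<phi> x"
    and "\<And>K. compact K \<Longrightarrow> set_integrable lborel K (\<lambda>x. (\<phi> x)\<^sup>2)"
    and "\<And>l. l > 0 \<Longrightarrow> G l \<in> borel_measurable P"
    and "\<And>l. l > 0 \<Longrightarrow> AE \<omega> in P. G l \<omega> = grain_sum \<phi> (\<eta> \<omega>) l"
    and "\<not> (AE x in lborel. \<phi> x * hit_prob \<nu> x = 0)"
    and "\<kappa> \<in> borel_measurable borel" and "bounded (range \<kappa>)" and "\<And>x. \<kappa> x > 0"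
    and "(\<integral>\<^sup>+ x. ennreal (\<kappa> x) \<partial>lborel) = 1"
    and "\<And>p::nat. p \<in> {2, 4} \<Longrightarrow>
           (\<integral>\<^sup>+ x. ennreal (\<phi> x ^ p * hit_prob \<nu> x * \<kappa> x powr (1 - real p)) \<partial>lborel) < \<infinity>"
  shows "(\<forall>l>0. integrable P (\<lambda>\<omega>. (G l \<omega>)\<^sup>2)) \<and>
    (\<exists>c>0. \<exists>C>0.
       (\<lambda>l. prob_space.variance P (G l)) \<sim>[at_top] (\<lambda>l. c * l) \<and>
       (\<forall>l>0. prob_space.variance P (G l) > 0 \<longrightarrow>
          wasserstein
            (distr P borel (\<lambda>\<omega>. (G l \<omega> - prob_space.expectation P (G l))
                                 / sqrt (prob_space.variance P (G l))))
            (density lborel (\<lambda>x. ennreal (std_normal_density x)))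
          \<le> ennreal (C * l powr (- 1 / 2))))"
proof -
  obtain k where k: "\<And>x. \<kappa> x \<le> k"
    using \<open>bounded (range \<kappa>)\<close> by (auto simp: bounded_iff abs_le_iff)
  have \<kappa>0: "\<kappa> x > 0" for x by fact
  \<comment> \<open>For p = n + 1 the weight \<kappa> powr (1 - p) is 1 / \<kappa>^n; the cases
    needed are n = 1 and n = 3.\<close>
  have powr_Suc: "\<kappa> x powr (1 - real (Suc n)) = 1 / \<kappa> x ^ n" for x n
  proof -
    have "\<kappa> x powr (1 - real (Suc n)) = \<kappa> x powr (- real n)" by simp
    also have "\<dots> = inverse (\<kappa> x ^ n)" unfolding powr_minus powr_realpow[OF \<kappa>0] ..
    finally show ?thesis by (simp only: inverse_eq_divide)
  qed
  have powr: "\<kappa> x powr (1 - real 2) = 1 / \<kappa> x" "\<kappa> x powr (1 - real 4) = 1 / \<kappa> x ^ 3" for x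
    using powr_Suc[of x 1] powr_Suc[of x 3] by simp_all
  have eq2: "ennreal (\<phi> x ^ 2 * hit_prob \<nu> x * \<kappa> x powr (1 - real 2)) = ennreal ((\<phi> x)\<^sup>2 / \<kappa> x) * ennreal (hit_prob \<nu> x)" for x
    using \<kappa>0[of x] unfolding powr by (subst ennreal_mult[symmetric]) (auto simp: hit_prob_def)
  have eq4: "ennreal (\<phi> x ^ 4 * hit_prob \<nu> x * \<kappa> x powr (1 - real 4)) = ennreal (\<phi> x ^ 4 / \<kappa> x ^ 3) * ennreal (hit_prob \<nu> x)" for x
    using \<kappa>0[of x] unfolding powr by (subst ennreal_mult[symmetric]) (auto simp: hit_prob_def)
  interpret grain_statistic \<nu> P \<eta> \<phi> \<kappa> k G
  proof (intro grain_statistic.intro boolean_model.intro grain_law.intro grain_law_axioms.intro)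
    show "boolean_model_axioms \<nu> P \<eta>" by standard fact
    show "grain_statistic_axioms \<nu> P \<eta> \<phi> \<kappa> k G"
    proof
      show "(\<integral>\<^sup>+ x. ennreal ((\<phi> x)\<^sup>2 / \<kappa> x) * ennreal (hit_prob \<nu> x) \<partial>lborel) < \<infinity>"
        using assms(14)[of 2] unfolding eq2 by simp
      show "(\<integral>\<^sup>+ x. ennreal (\<phi> x ^ 4 / \<kappa> x ^ 3) * ennreal (hit_prob \<nu> x) \<partial>lborel) < \<infinity>"
        using assms(14)[of 4] unfolding eq4 by simp
    qed (fact assms k)+
  qed (fact assms)+
  have "\<forall>l>0. integrable P (\<lambda>\<omega>. (G l \<omega>)\<^sup>2)"
    using sq_integrable_G by (simp add: sq_integrable_def)
  with normal_approximation[OF assms(9)] show ?thesis by blast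
qed


end
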